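(* Assume the standing setting described in the context. Suppose that $L:=\{i\in I:C(A_i)=\infty\}$ consists of a single index $\ell$, that $\ell\in I^-$, and that $A_i\cap A_\ell=\varnothing$ for all $i\ne\ell$. For an admissible vector $\boldsymbol a$ (see context), let $\tilde{\boldsymbol\lambda}=(\tilde\lambda^i)_{i\in I}$ be any solution of the $(\boldsymbol A,\boldsymbol a,g,\chi,I\setminus\{\ell\})$-problem. Then the Gauss variational problem (the $(\boldsymbol A,\boldsymbol a,g,\chi,I)$-problem) is solvable if and only if $$a_\ell\le\int g\,d\tilde\lambda^\ell,$$ or, equivalently, $$a_\ell\le\int g\,d\Bigl[P_{A_\ell}\Bigl(\chi+\sum_{i\ne\ell}\alpha_i\tilde\lambda^i\Bigr)\Bigr].$$ In other words, the set $\mathcal S_\kappa(\boldsymbol A,g,\chi)$ of all admissible $\boldsymbol a$ for which the Gauss variational problem is solvable consists exactly of those $\boldsymbol a$ satisfying these inequalities.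
   Context: Standing setting. $\mathrm X$ is a noncompact locally compact Hausdorff space; $\mathfrak M$ the real Radon measures on $\mathrm X$ with the vague topology; $S(\nu)$ the support. Kernel $\kappa:\mathrm X\times\mathrm X\to[0,\infty]$, lower semicontinuous, symmetric; $\kappa(\nu,\nu_1)=\int\kappa\,d(\nu\otimes\nu_1)$, $\kappa(x,\nu)=\int\kappa(x,y)d\nu(y)$; $\mathcal E$ = measures with $\kappa(\nu,\nu)$ well defined and finite. Assumed: (a) strictly positive definite ($\|\nu\|:=\kappa(\nu,\nu)^{1/2}$ is a norm on the pre-Hilbert space $\mathcal E$; "strong" refers to it); (b) consistent: every strong Cauchy net in $\mathcal E^+=\{\nu\in\mathcal E:\nu\ge0\}$ converges strongly to each of its vague cluster points; (c) $\kappa(x,y)$ finite and continuous for $x\ne y$; (d) for each $\varepsilon>0$ and compact $K$ there is compact $K'$ with $\kappa(x,y)<\varepsilon$ for $x\in K,y\notin K'$; (e) generalized maximum principle with constant $h\ge1$ (for compactly supported $\nu\ge0$ with $M=\sup_{S(\nu)}\kappa(\cdot,\nu)<\infty$, $\kappa(\cdot,\nu)\le hM$ everywhere). $\mathcal E^+_E$: elements of $\mathcal E^+$ concentrated on $E$. Interior capacity $C(E)=1/\inf\{\kappa(\nu,\nu):\nu\in\mathcal E^+_E,\nu(E)=1\}$; "n.e." = outside a set of interior capacity zero. For closed $F$ with $C(F)>0$ and $\nu\in\mathcal E$, $P_F\nu$ is the unique $\omega\in\mathcal E^+_F$ minimizing $\|\nu-\omega\|$ (orthogonal projection onto the convex cone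 $\mathcal E^+_F$). Condenser: disjoint countable index sets $I^+,I^-$, $I=I^+\cup I^-$; nonempty closed $A_i$, locally finite family, $A_i\cap A_j=\varnothing$ for $i\in I^+,j\in I^-$; $\alpha_i=\pm1$ for $i\in I^\pm$; $A^\pm=\bigcup_{I^\pm}A_i$, $A=\bigcup_IA_i$; $\sup_{A^+\times A^-}\kappa<\infty$. Vector measures $\boldsymbol\mu=(\mu^i)$, $\mu^i\ge0$ concentrated on $A_i$; $R\boldsymbol\mu=\sum\alpha_i\mu^i$; $\mathcal E^+(\boldsymbol A)$ those with finite energy $\sum_{i,j}\alpha_i\alpha_j\kappa(\mu^i,\mu^j)$. External field: bounded signed $\chi\in\mathcal E$ with $S(\chi^+)\cap A^-=\varnothing$, $S(\chi^-)\cap A^+=\varnothing$; $G_\chi(\boldsymbol\mu)=\|R\boldsymbol\mu\|^2+2\kappa(\chi,R\boldsymbol\mu)$. $g$ continuous on $A$ with $\inf_Ag>0$, and for each $i$ either $g|_{A_i}$ bounded or $g^{r_i}\le\kappa(\cdot,\nu_i)$ n.e. on $A_i$ for some $r_i>1$, $\nu_i\in\mathcal E$. An admissible vector is $\boldsymbol a=(a_i)_{i\in I}$ with $a_i>0$, $\sum_ia_i<\infty$ and $G_\chi(\boldsymbol A,\boldsymbol a,g)<\infty$. For $I^+\subseteq J\subseteq I$: $\mathcal E^+(\boldsymbol A,\boldsymbol a,g,J)=\{\boldsymbol\mu\in\mathcal E^+(\boldsymbol A):\int g\,d\mu^i=a_i\ \forall i\in J\}$, $G_\chi(\boldsymbol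 A,\boldsymbol a,g,J)$ = infimum of $G_\chi$ over it; the $(\boldsymbol A,\boldsymbol a,g,\chi,J)$-problem asks for a minimizer in this class; for $J=I$ it is the Gauss variational problem and $J$ is dropped from notation. *)

theory Defs
  imports "HOL-Analysis.Analysis"
begin

text \<open>Positive Radon measures, represented as Borel measures in the sense of
  the Riesz representation theorem: locally finite, outer regular on Borel sets,
  inner regular (by compact sets) on open sets.\<close>

definition radon :: "'a::topological_space measure \<Rightarrow> bool" where
  "radon \<nu> \<longleftrightarrow> sets \<nu> = sets borel
     \<and> (\<forall>K. compact K \<longrightarrow> emeasure \<nu> K < \<infinity>)
     \<and> (\<forall>B\<in>sets borel. emeasure \<nu> B = (INF U\<in>{U. open U \<and> B \<subseteq> U}. emeasure \<nu> U))
     \<and> (\<forall>U. open U \<longrightarrow> emeasure \<nu> U = (SUP K\<in>{K. compact K \<and> K \<subseteq> U}. emeasure \<nu> K))"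

definition supp :: "'a::topological_space measure \<Rightarrow> 'a set" where
  "supp \<nu> = UNIV - \<Union>{U. open U \<and> emeasure \<nu> U = 0}"

text \<open>A (positive) measure concentrated on a set E (E need not be Borel).\<close>
definition conc :: "'a::topological_space measure \<Rightarrow> 'a set \<Rightarrow> bool" where
  "conc \<nu> E \<longleftrightarrow> (\<exists>B\<in>sets borel. B \<subseteq> E \<and> emeasure \<nu> (UNIV - B) = 0)"

definition msingular :: "'a::topological_space measure \<Rightarrow> 'a measure \<Rightarrow> bool" where
  "msingular p n \<longleftrightarrow> (\<exists>B\<in>sets borel. emeasure p (UNIV - B) = 0 \<and> emeasure n B = 0)"

definition msum :: "'i set \<Rightarrow> ('i \<Rightarrow> 'a::topological_space measure) \<Rightarrow> 'a measure" where
  "msum I \<mu> = measure_of UNIV (sets borel) (\<lambda>B. \<Sum>\<^sub>\<infinity> i\<in>I. emeasure (\<mu> i) B)"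

definition madd :: "'a::topological_space measure \<Rightarrow> 'a measure \<Rightarrow> 'a measure" where
  "madd M N = measure_of UNIV (sets borel) (\<lambda>B. emeasure M B + emeasure N B)"

definition Cc :: "('a::topological_space \<Rightarrow> real) set" where
  "Cc = {\<phi>. continuous_on UNIV \<phi> \<and> compact (closure {x. \<phi> x \<noteq> 0})}"

type_synonym 'a kernel = "'a \<Rightarrow> 'a \<Rightarrow> ennreal"

definition pot :: "'a kernel \<Rightarrow> 'a::topological_space measure \<Rightarrow> 'a \<Rightarrow> ennreal" where
  "pot \<kappa> \<nu> x = (\<integral>\<^sup>+ y. \<kappa> x y \<partial>\<nu>)"

definition kint :: "'a kernel \<Rightarrow> 'a::topological_space measure \<Rightarrow> 'a measure \<Rightarrow> ennreal" where
  "kint \<kappa> \<mu> \<nu> = (\<integral>\<^sup>+ x. pot \<kappa> \<nu> x \<partial>\<mu>)"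

text \<open>Signed measures are represented by pairs \<open>(p, n)\<close> standing for \<open>p - n\<close>.
  For signed measures proper we use Jordan pairs (radon, mutually singular).\<close>
type_synonym 'a smeasure = "'a measure \<times> 'a measure"

definition finen :: "'a kernel \<Rightarrow> 'a::topological_space smeasure \<Rightarrow> bool" where
  "finen \<kappa> \<nu> \<longleftrightarrow> kint \<kappa> (fst \<nu>) (fst \<nu>) < \<infinity> \<and> kint \<kappa> (snd \<nu>) (snd \<nu>) < \<infinity>
      \<and> kint \<kappa> (fst \<nu>) (snd \<nu>) < \<infinity> \<and> kint \<kappa> (snd \<nu>) (fst \<nu>) < \<infinity>"

definition ip :: "'a kernel \<Rightarrow> 'a::topological_space smeasure \<Rightarrow> 'a smeasure \<Rightarrow> real" where
  "ip \<kappa> \<nu> \<nu>' = enn2real (kint \<kappa> (fst \<nu>) (fst \<nu>')) - enn2real (kint \<kappa> (fst \<nu>) (snd \<nu>'))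
      - enn2real (kint \<kappa> (snd \<nu>) (fst \<nu>')) + enn2real (kint \<kappa> (snd \<nu>) (snd \<nu>'))"

definition nrm :: "'a kernel \<Rightarrow> 'a::topological_space smeasure \<Rightarrow> real" where
  "nrm \<kappa> \<nu> = sqrt (ip \<kappa> \<nu> \<nu>)"

definition inE :: "'a kernel \<Rightarrow> 'a::topological_space smeasure \<Rightarrow> bool" where
  "inE \<kappa> \<nu> \<longleftrightarrow> radon (fst \<nu>) \<and> radon (snd \<nu>) \<and> msingular (fst \<nu>) (snd \<nu>) \<and> finen \<kappa> \<nu>"

definition inEp :: "'a kernel \<Rightarrow> 'a::topological_space measure \<Rightarrow> bool" where
  "inEp \<kappa> \<nu> \<longleftrightarrow> radon \<nu> \<and> kint \<kappa> \<nu> \<nu> < \<infinity>"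

definition cap :: "'a kernel \<Rightarrow> 'a::topological_space set \<Rightarrow> ennreal" where
  "cap \<kappa> E = inverse (INF \<nu>\<in>{\<nu>. inEp \<kappa> \<nu> \<and> conc \<nu> E \<and> emeasure \<nu> UNIV = 1}. kint \<kappa> \<nu> \<nu>)"

definition nearly_everywhere :: "'a kernel \<Rightarrow> 'a::topological_space set \<Rightarrow> ('a \<Rightarrow> bool) \<Rightarrow> bool" where
  "nearly_everywhere \<kappa> E P \<longleftrightarrow> (\<exists>N. cap \<kappa> N = 0 \<and> (\<forall>x\<in>E - N. P x))"

text \<open>Orthogonal projection \<open>P\<^sub>F \<nu>\<close> onto the cone \<open>\<E>\<^sup>+\<^sub>F\<close>:
  \<open>\<nu> - \<omega>\<close> is represented by the pair \<open>(\<nu>\<^sup>+, \<nu>\<^sup>- + \<omega>)\<close>.\<close>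
definition proj :: "'a kernel \<Rightarrow> 'a::topological_space set \<Rightarrow> 'a smeasure \<Rightarrow> 'a measure" where
  "proj \<kappa> F \<nu> = (THE \<omega>. inEp \<kappa> \<omega> \<and> conc \<omega> F \<and>
      (\<forall>\<omega>'. inEp \<kappa> \<omega>' \<and> conc \<omega>' F \<longrightarrow>
          nrm \<kappa> (fst \<nu>, madd (snd \<nu>) \<omega>) \<le> nrm \<kappa> (fst \<nu>, madd (snd \<nu>) \<omega>')))"

definition kernel_basic :: "'a::topological_space kernel \<Rightarrow> bool" where
  "kernel_basic \<kappa> \<longleftrightarrow> (\<forall>x y. \<kappa> x y = \<kappa> y x)
     \<and> (\<forall>c. open {z. c < \<kappa> (fst z) (snd z)})"

definition kernel_spd :: "'a::topological_space kernel \<Rightarrow> bool" where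
  "kernel_spd \<kappa> \<longleftrightarrow> (\<forall>\<nu>. inE \<kappa> \<nu> \<longrightarrow> 0 \<le> ip \<kappa> \<nu> \<nu>
       \<and> (ip \<kappa> \<nu> \<nu> = 0 \<longrightarrow> emeasure (fst \<nu>) UNIV = 0 \<and> emeasure (snd \<nu>) UNIV = 0))"

text \<open>Vague cluster points of a net, the net being encoded by its image filter.\<close>
definition vague_cluster :: "'a::topological_space measure filter \<Rightarrow> 'a measure \<Rightarrow> bool" where
  "vague_cluster G \<nu> \<longleftrightarrow> (\<forall>\<Phi> e. finite \<Phi> \<and> \<Phi> \<subseteq> Cc \<and> e > 0 \<longrightarrow>
      (\<exists>\<^sub>F \<mu> in G. \<forall>\<phi>\<in>\<Phi>. \<bar>integral\<^sup>L \<mu> \<phi> - integral\<^sup>L \<nu> \<phi>\<bar> < e))"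

definition kernel_consistent :: "'a::topological_space kernel \<Rightarrow> bool" where
  "kernel_consistent \<kappa> \<longleftrightarrow> (\<forall>G::'a measure filter.
      (\<forall>\<^sub>F \<mu> in G. inEp \<kappa> \<mu>) \<and>
      (\<forall>e>0. \<forall>\<^sub>F z in G \<times>\<^sub>F G. nrm \<kappa> (fst z, snd z) < e) \<longrightarrow>
      (\<forall>\<nu>. radon \<nu> \<and> vague_cluster G \<nu> \<longrightarrow>
          inEp \<kappa> \<nu> \<and> (\<forall>e>0. \<forall>\<^sub>F \<mu> in G. nrm \<kappa> (\<mu>, \<nu>) < e)))"

definition kernel_offdiag :: "'a::topological_space kernel \<Rightarrow> bool" where
  "kernel_offdiag \<kappa> \<longleftrightarrow> (\<forall>x y. x \<noteq> y \<longrightarrow> \<kappa> x y < \<infinity>)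
     \<and> continuous_on {z. fst z \<noteq> snd z} (\<lambda>z. \<kappa> (fst z) (snd z))"

definition kernel_vanishing :: "'a::topological_space kernel \<Rightarrow> bool" where
  "kernel_vanishing \<kappa> \<longleftrightarrow> (\<forall>e::real. e > 0 \<longrightarrow> (\<forall>K. compact K \<longrightarrow>
      (\<exists>K'. compact K' \<and> (\<forall>x\<in>K. \<forall>y. y \<notin> K' \<longrightarrow> \<kappa> x y < ennreal e))))"

definition kernel_gmp :: "'a::topological_space kernel \<Rightarrow> real \<Rightarrow> bool" where
  "kernel_gmp \<kappa> h \<longleftrightarrow> (\<forall>\<nu>. radon \<nu> \<and> compact (supp \<nu>)
      \<and> (SUP x\<in>supp \<nu>. pot \<kappa> \<nu> x) < \<infinity> \<longrightarrow>
      (\<forall>x. pot \<kappa> \<nu> x \<le> ennreal h * (SUP x\<in>supp \<nu>. pot \<kappa> \<nu> x)))"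

definition condenser :: "'a::topological_space kernel \<Rightarrow> 'i set \<Rightarrow> 'i set \<Rightarrow> ('i \<Rightarrow> 'a set) \<Rightarrow> bool" where
  "condenser \<kappa> Ip In A \<longleftrightarrow> countable Ip \<and> countable In \<and> Ip \<inter> In = {}
     \<and> (\<forall>i\<in>Ip \<union> In. A i \<noteq> {} \<and> closed (A i))
     \<and> (\<forall>x. \<exists>U. open U \<and> x \<in> U \<and> finite {i\<in>Ip \<union> In. A i \<inter> U \<noteq> {}})
     \<and> (\<forall>i\<in>Ip. \<forall>j\<in>In. A i \<inter> A j = {})
     \<and> (\<exists>M::real. \<forall>x\<in>(\<Union>i\<in>Ip. A i). \<forall>y\<in>(\<Union>j\<in>In. A j). \<kappa> x y \<le> ennreal M)"

text \<open>\<open>R\<mu> = \<Sum>\<^sub>i \<alpha>\<^sub>i \<mu>\<^sup>i\<close>, as the pair (positive part, negative part).\<close>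
definition Rm :: "'i set \<Rightarrow> 'i set \<Rightarrow> ('i \<Rightarrow> 'a::topological_space measure) \<Rightarrow> 'a smeasure" where
  "Rm Ip In \<mu> = (msum Ip \<mu>, msum In \<mu>)"

definition EA :: "'a::topological_space kernel \<Rightarrow> 'i set \<Rightarrow> 'i set \<Rightarrow> ('i \<Rightarrow> 'a set)
     \<Rightarrow> ('i \<Rightarrow> 'a measure) \<Rightarrow> bool" where
  "EA \<kappa> Ip In A \<mu> \<longleftrightarrow> (\<forall>i\<in>Ip \<union> In. radon (\<mu> i) \<and> conc (\<mu> i) (A i)) \<and> inE \<kappa> (Rm Ip In \<mu>)"

definition ext_field :: "'a::topological_space kernel \<Rightarrow> 'i set \<Rightarrow> 'i set \<Rightarrow> ('i \<Rightarrow> 'a set)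
     \<Rightarrow> 'a smeasure \<Rightarrow> bool" where
  "ext_field \<kappa> Ip In A ch \<longleftrightarrow> inE \<kappa> ch
     \<and> emeasure (fst ch) UNIV < \<infinity> \<and> emeasure (snd ch) UNIV < \<infinity>
     \<and> supp (fst ch) \<inter> (\<Union>j\<in>In. A j) = {} \<and> supp (snd ch) \<inter> (\<Union>i\<in>Ip. A i) = {}"

definition Gchi :: "'a::topological_space kernel \<Rightarrow> 'i set \<Rightarrow> 'i set \<Rightarrow> 'a smeasure
     \<Rightarrow> ('i \<Rightarrow> 'a measure) \<Rightarrow> real" where
  "Gchi \<kappa> Ip In ch \<mu> = (nrm \<kappa> (Rm Ip In \<mu>))\<^sup>2 + 2 * ip \<kappa> ch (Rm Ip In \<mu>)"

definition g_ok :: "'a::topological_space kernel \<Rightarrow> 'i set \<Rightarrow> ('i \<Rightarrow> 'a set) \<Rightarrow> ('a \<Rightarrow> real) \<Rightarrow> bool" where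
  "g_ok \<kappa> I A g \<longleftrightarrow> continuous_on (\<Union>i\<in>I. A i) g
     \<and> (\<exists>c>0. \<forall>x\<in>(\<Union>i\<in>I. A i). c \<le> g x)
     \<and> (\<forall>i\<in>I. (\<exists>B. \<forall>x\<in>A i. g x \<le> B)
           \<or> (\<exists>r>1. \<exists>\<nu>. inE \<kappa> \<nu> \<and> nearly_everywhere \<kappa> (A i)
                (\<lambda>x. pot \<kappa> (snd \<nu>) x < \<infinity> \<and>
                     ennreal (g x powr r) + pot \<kappa> (snd \<nu>) x \<le> pot \<kappa> (fst \<nu>) x)))"

definition EAag :: "'a::topological_space kernel \<Rightarrow> 'i set \<Rightarrow> 'i set \<Rightarrow> ('i \<Rightarrow> 'a set)
     \<Rightarrow> ('i \<Rightarrow> real) \<Rightarrow> ('a \<Rightarrow> real) \<Rightarrow> 'i set \<Rightarrow> ('i \<Rightarrow> 'a measure) \<Rightarrow> bool" where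
  "EAag \<kappa> Ip In A a g J \<mu> \<longleftrightarrow> EA \<kappa> Ip In A \<mu>
     \<and> (\<forall>i\<in>J. (\<integral>\<^sup>+ x. ennreal (g x) * indicator (A i) x \<partial>(\<mu> i)) = ennreal (a i))"

definition Ginf :: "'a::topological_space kernel \<Rightarrow> 'i set \<Rightarrow> 'i set \<Rightarrow> ('i \<Rightarrow> 'a set)
     \<Rightarrow> ('i \<Rightarrow> real) \<Rightarrow> ('a \<Rightarrow> real) \<Rightarrow> 'a smeasure \<Rightarrow> 'i set \<Rightarrow> ereal" where
  "Ginf \<kappa> Ip In A a g ch J = (INF \<mu>\<in>{\<mu>. EAag \<kappa> Ip In A a g J \<mu>}. ereal (Gchi \<kappa> Ip In ch \<mu>))"

definition solves :: "'a::topological_space kernel \<Rightarrow> 'i set \<Rightarrow> 'i set \<Rightarrow> ('i \<Rightarrow> 'a set)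
     \<Rightarrow> ('i \<Rightarrow> real) \<Rightarrow> ('a \<Rightarrow> real) \<Rightarrow> 'a smeasure \<Rightarrow> 'i set \<Rightarrow> ('i \<Rightarrow> 'a measure) \<Rightarrow> bool" where
  "solves \<kappa> Ip In A a g ch J lam \<longleftrightarrow> EAag \<kappa> Ip In A a g J lam
     \<and> ereal (Gchi \<kappa> Ip In ch lam) = Ginf \<kappa> Ip In A a g ch J"

definition admissible :: "'a::topological_space kernel \<Rightarrow> 'i set \<Rightarrow> 'i set \<Rightarrow> ('i \<Rightarrow> 'a set)
     \<Rightarrow> ('a \<Rightarrow> real) \<Rightarrow> 'a smeasure \<Rightarrow> ('i \<Rightarrow> real) \<Rightarrow> bool" where
  "admissible \<kappa> Ip In A g ch a \<longleftrightarrow> (\<forall>i\<in>Ip \<union> In. a i > 0) \<and> a summable_on (Ip \<union> In)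
     \<and> Ginf \<kappa> Ip In A a g ch (Ip \<union> In) < \<infinity>"

end

theory Submission
  imports Defs
begin

text \<open>
  Write \<open>G(\<mu>) = \<parallel>R\<mu> + \<chi>\<parallel>\<^sup>2 - \<parallel>\<chi>\<parallel>\<^sup>2\<close>; this is strictly convex in \<open>R\<mu>\<close>, so all minimizers over a given
  class have the same \<open>R\<mu>\<close>, and hence the same component on \<open>A\<^sub>l\<close>, because \<open>A\<^sub>l\<close> is disjoint from the
  other plates. Since \<open>A\<^sub>l\<close> has infinite capacity, weight can be added on it at arbitrarily small cost in
  energy; therefore the infima under \<open>\<integral>g d\<mu>\<^sup>l = a\<^sub>l\<close> and under \<open>\<integral>g d\<mu>\<^sup>l \<le> a\<^sub>l\<close> coincide. The relaxed problem
  has a minimizer \<open>\<mu>\<close>: a vague cluster point of a minimizing sequence is also a strong limit by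
  consistency, and plates of finite capacity lose no weight at infinity. If \<open>\<integral>g d\<mu>\<^sup>l < a\<^sub>l\<close>, the constraint is
  inactive, so by convexity \<open>\<mu>\<close> solves the problem without a constraint on \<open>A\<^sub>l\<close>, and then
  \<open>\<mu>\<^sup>l = \<lambda>\<^sup>l\<close> has weight below \<open>a\<^sub>l\<close>. Finally, fixing the other components, minimality of \<open>\<lambda>\<close> says
  exactly that \<open>\<lambda>\<^sup>l\<close> is the projection in the second inequality.
\<close>

subsection \<open>Integrals of lower semicontinuous functions\<close>

text \<open>The space is not assumed second countable, so Radon measures need not be
  \<sigma>-finite: Tonelli, Radon-Nikodym and inner regularity on Borel sets cannot be invoked
  directly, and vague cluster points require filters in place of sequences. Two devices compensate.
  Integrals of lower semicontinuous functions commute with arbitrary directed suprema, which gives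
  the symmetry of the mutual energy. And measures of finite energy are carried by \<sigma>-compact
  clopen sets, because \<kappa> is positive on the diagonal and small far away from compact sets;
  there the usual tools hold again. A second obstacle is that positive definiteness is assumed only
  for mutually singular pairs with finite mutual energies, whereas \<open>R \<mu> + \<chi>\<close>
  and differences of vectors are in general not of this kind. It is extended to all pairs of
  measures of finite energy: the mutual energy is first bounded on disjoint compact pieces, and
  common parts cancel. A third one is that competitors in the problem without a constraint on
  \<open>A l\<close> may have infinite weight there; they are cut down to compact sets before
  convexity is used.\<close>

text \<open>A dyadic layer sum of height at most \<open>n\<close>. Only strict inequalities
  \<open>k / 2 ^ n < y\<close> enter, so after composition with a lower semicontinuous function it
  involves open superlevel sets alone.\<close>

definition dyadic_layers :: "nat \<Rightarrow> ennreal \<Rightarrow> ennreal" where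
  "dyadic_layers n y = (\<Sum>k\<in>{1..n * 2 ^ n}. ennreal (1 / 2 ^ n) * indicator {ennreal (real k / 2 ^ n)<..} y)"

lemma dyadic_layers_eq_card:
  "dyadic_layers n y = ennreal (real (card {k\<in>{1..n * 2 ^ n}. ennreal (real k / 2 ^ n) < y}) / 2 ^ n)"
proof -
  have "dyadic_layers n y = (\<Sum>k\<in>{k\<in>{1..n * 2 ^ n}. ennreal (real k / 2 ^ n) < y}. ennreal (1 / 2 ^ n))"
    unfolding dyadic_layers_def
    by (intro sum.mono_neutral_cong_right) (auto simp: indicator_def)
  also have "\<dots> = ennreal (real (card {k\<in>{1..n * 2 ^ n}. ennreal (real k / 2 ^ n) < y}) / 2 ^ n)"
    by (simp add: ennreal_of_nat_eq_real_of_nat ennreal_mult[symmetric])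
  finally show ?thesis .
qed

lemma dyadic_layers_le: "dyadic_layers n y \<le> y"
proof -
  define S where "S = {k\<in>{1..n * 2 ^ n}. ennreal (real k / 2 ^ n) < y}"
  have fin: "finite S" by (auto simp: S_def)
  have *: "dyadic_layers n y = ennreal (real (card S) / 2 ^ n)"
    by (simp add: dyadic_layers_eq_card S_def)
  show ?thesis
  proof (cases "S = {}")
    case False
    then have M: "Max S \<in> S" using fin by simp
    have "S \<subseteq> {1..Max S}" using fin by (auto simp: S_def)
    then have "card S \<le> Max S" using card_mono[of "{1..Max S}" S] by simp
    then have "dyadic_layers n y \<le> ennreal (real (Max S) / 2 ^ n)"
      unfolding * by (intro ennreal_leI divide_right_mono) auto
    also have "\<dots> \<le> y" using M by (auto simp: S_def)
    finally show ?thesis .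
  qed (simp add: *)
qed

lemma min_le_dyadic_layers: "min y (ennreal (real n)) \<le> dyadic_layers n y + ennreal (1 / 2 ^ n)"
proof (rule ccontr)
  define S where "S = {k\<in>{1..n * 2 ^ n}. ennreal (real k / 2 ^ n) < y}"
  have fin: "finite S" by (auto simp: S_def)
  have *: "dyadic_layers n y + ennreal (1 / 2 ^ n) = ennreal (real (Suc (card S)) / 2 ^ n)"
    unfolding dyadic_layers_eq_card S_def[symmetric]
    by (subst ennreal_plus[symmetric]) (auto simp: add_divide_distrib)
  assume "\<not> ?thesis"
  then have 1: "ennreal (real (Suc (card S)) / 2 ^ n) < y"
    and 2: "ennreal (real (Suc (card S)) / 2 ^ n) < ennreal (real n)"
    unfolding * by (auto simp: not_le)
  from 2 have "real (Suc (card S)) / 2 ^ n < real n" by (simp add: ennreal_less_iff)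
  then have "real (Suc (card S)) < real (n * 2 ^ n)" by (simp add: field_simps)
  then have 3: "Suc (card S) \<le> n * 2 ^ n" using of_nat_less_iff less_imp_le by blast
  \<comment> \<open>If the bound failed, \<open>y\<close> would exceed \<open>k / 2 ^ n\<close> for
    every \<open>k \<le> card S + 1\<close>, and \<open>S\<close> would contain more elements than
    it has.\<close>
  have "{1..Suc (card S)} \<subseteq> S"
  proof
    fix k assume k: "k \<in> {1..Suc (card S)}"
    then have "real k / 2 ^ n \<le> real (Suc (card S)) / 2 ^ n"
      by (intro divide_right_mono) auto
    then have "ennreal (real k / 2 ^ n) < y"
      using 1 by (meson ennreal_leI le_less_trans)
    then show "k \<in> S" using k 3 by (auto simp: S_def)
  qed
  from card_mono[OF fin this] show False by simp
qed

text \<open>A lower bound for the liminf suffices: the upper bound is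
  \<open>dyadic_layers_le\<close>, and Fatou's lemma passes to the integrals.\<close>

lemma le_liminf_dyadic_layers: "y \<le> liminf (\<lambda>n. dyadic_layers n y)"
proof (subst le_Liminf_iff, intro allI impI)
  fix c assume "c < y"
  then obtain c' where c': "c < c'" "c' < y" using dense by blast
  then have fin: "c < top" "c' < top" using le_less_trans top_greatest by (auto simp: less_top[symmetric])
  obtain r where r: "c = ennreal r" "0 \<le> r" using fin by (cases c) auto
  obtain r' where r': "c' = ennreal r'" "0 \<le> r'" using fin by (cases c') auto
  have rr: "r < r'" using c' r r' by (simp add: ennreal_less_iff)
  have "(\<lambda>n. 1 / 2 ^ n :: real) \<longlonglongrightarrow> 0"
    using LIMSEQ_realpow_zero[of "1/2::real"] by (simp add: power_divide)
  then have e1: "\<forall>\<^sub>F n in sequentially. 1 / 2 ^ n < r' - r"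
    by (rule order_tendstoD) (use rr in simp)
  have e2: "\<forall>\<^sub>F n in sequentially. r' \<le> real n"
    using real_arch_simple[of r'] by (meson eventually_sequentiallyI of_nat_le_iff order_trans)
  show "\<forall>\<^sub>F n in sequentially. c < dyadic_layers n y"
    using e1 e2
  proof eventually_elim
    case (elim n)
    have "c + ennreal (1 / 2 ^ n) < c'"
      unfolding r(1) r'(1) using elim r(2) rr
      by (subst ennreal_plus[symmetric]) (auto simp del: ennreal_plus intro!: ennreal_lessI)
    also have "c' \<le> min y (ennreal (real n))"
      using c' elim r' by (auto intro: ennreal_leI)
    also have "\<dots> \<le> dyadic_layers n y + ennreal (1 / 2 ^ n)"
      by (rule min_le_dyadic_layers)
    finally show ?case
      by (meson add_right_mono leD leI)
  qed
qed

lemma dyadic_layers_measurable[measurable]: "dyadic_layers n \<in> borel_measurable borel"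
  unfolding dyadic_layers_def by measurable

lemma sum_SUP_directed_ennreal:
  fixes w :: "'i \<Rightarrow> 'k \<Rightarrow> ennreal"
  assumes "finite F" and D: "D \<noteq> {}"
    and dir: "\<And>i j. i \<in> D \<Longrightarrow> j \<in> D \<Longrightarrow> \<exists>k\<in>D. \<forall>x\<in>F. w i x \<le> w k x \<and> w j x \<le> w k x"
  shows "(\<Sum>x\<in>F. SUP i\<in>D. w i x) = (SUP i\<in>D. \<Sum>x\<in>F. w i x)"
  using assms(1) dir
proof (induction F)
  case empty
  then show ?case using D by simp
next
  case (insert a F)
  have dF: "\<exists>k\<in>D. \<forall>x\<in>F. w i x \<le> w k x \<and> w j x \<le> w k x" if "i \<in> D" "j \<in> D" for i j
    using insert.prems[OF that] by blast
  have "(SUP i\<in>D. w i a + (\<Sum>x\<in>F. w i x)) = (SUP i\<in>D. w i a) + (SUP i\<in>D. \<Sum>x\<in>F. w i x)"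
  proof (rule SUP_add_directed_ennreal)
    fix i j assume "i \<in> D" "j \<in> D"
    then obtain k where k: "k \<in> D" "\<forall>x\<in>insert a F. w i x \<le> w k x \<and> w j x \<le> w k x"
      using insert.prems by blast
    then show "\<exists>k\<in>D. w i a + (\<Sum>x\<in>F. w j x) \<le> w k a + (\<Sum>x\<in>F. w k x)"
      by (intro bexI[of _ k] add_mono sum_mono) auto
  qed
  then show ?case using insert.hyps insert.IH[OF dF] by simp
qed

text \<open>Dyadic layers turn an integral into a finite combination of measures of superlevel sets,
  and a finite sum commutes with a directed supremum. The index set may be uncountable, where
  monotone convergence does not apply.\<close>

lemma nn_integral_le_SUP_superlevel:
  fixes f :: "'a \<Rightarrow> ennreal" and h :: "'i \<Rightarrow> 'a \<Rightarrow> ennreal"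
  assumes [measurable]: "f \<in> borel_measurable M" and hm: "\<And>i. i \<in> D \<Longrightarrow> h i \<in> borel_measurable M"
    and D: "D \<noteq> {}"
    and dir: "\<And>i j. i \<in> D \<Longrightarrow> j \<in> D \<Longrightarrow> \<exists>k\<in>D. h i \<le> h k \<and> h j \<le> h k"
    and lev: "\<And>c. c < top \<Longrightarrow> emeasure M {x\<in>space M. c < f x} \<le> (SUP i\<in>D. emeasure M {x\<in>space M. c < h i x})"
  shows "(\<integral>\<^sup>+ x. f x \<partial>M) \<le> (SUP i\<in>D. \<integral>\<^sup>+ x. h i x \<partial>M)"
proof -
  have lay: "(\<integral>\<^sup>+ x. dyadic_layers n (u x) \<partial>M) =
      (\<Sum>k\<in>{1..n * 2 ^ n}. ennreal (1 / 2 ^ n) * emeasure M {x\<in>space M. ennreal (real k / 2 ^ n) < u x})"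
    if [measurable]: "u \<in> borel_measurable M" for u n
  proof -
    have "(\<integral>\<^sup>+ x. dyadic_layers n (u x) \<partial>M) = (\<integral>\<^sup>+ x. (\<Sum>k\<in>{1..n * 2 ^ n}. ennreal (1 / 2 ^ n) *
        indicator {x\<in>space M. ennreal (real k / 2 ^ n) < u x} x) \<partial>M)"
      unfolding dyadic_layers_def by (intro nn_integral_cong sum.cong) (auto simp: indicator_def)
    also have "\<dots> = (\<Sum>k\<in>{1..n * 2 ^ n}. ennreal (1 / 2 ^ n) * emeasure M {x\<in>space M. ennreal (real k / 2 ^ n) < u x})"
      by (subst nn_integral_sum) (auto intro!: sum.cong nn_integral_cmult_indicator)
    finally show ?thesis .
  qed
  have bound: "(\<integral>\<^sup>+ x. dyadic_layers n (f x) \<partial>M) \<le> (SUP i\<in>D. \<integral>\<^sup>+ x. h i x \<partial>M)" for n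
  proof -
    let ?F = "{1..n * 2 ^ n}"
    let ?w = "\<lambda>i k. ennreal (1 / 2 ^ n) * emeasure M {x\<in>space M. ennreal (real k / 2 ^ n) < h i x}"
    have "(\<integral>\<^sup>+ x. dyadic_layers n (f x) \<partial>M) \<le> (\<Sum>k\<in>?F. SUP i\<in>D. ?w i k)"
      unfolding lay[OF assms(1)]
      by (intro sum_mono) (auto simp: SUP_mult_left_ennreal[symmetric] intro!: mult_left_mono lev)
    also have "\<dots> = (SUP i\<in>D. \<Sum>k\<in>?F. ?w i k)"
    proof (rule sum_SUP_directed_ennreal)
      fix i j assume ij: "i \<in> D" "j \<in> D"
      then obtain k where k: "k \<in> D" "h i \<le> h k" "h j \<le> h k" using dir by blast
      have *: "?w i' x \<le> ?w k x" if "h i' \<le> h k" for i' x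
        using that hm[OF k(1)]
        by (intro mult_left_mono emeasure_mono) (auto simp: le_fun_def intro: less_le_trans)
      show "\<exists>k\<in>D. \<forall>x\<in>?F. ?w i x \<le> ?w k x \<and> ?w j x \<le> ?w k x"
        using k * by blast
    qed (use D in auto)
    also have "\<dots> = (SUP i\<in>D. \<integral>\<^sup>+ x. dyadic_layers n (h i x) \<partial>M)"
      by (intro SUP_cong refl) (simp only: lay hm)
    also have "\<dots> \<le> (SUP i\<in>D. \<integral>\<^sup>+ x. h i x \<partial>M)"
      by (intro SUP_mono) (auto intro!: nn_integral_mono dyadic_layers_le)
    finally show ?thesis .
  qed
  have "(\<integral>\<^sup>+ x. f x \<partial>M) \<le> (\<integral>\<^sup>+ x. liminf (\<lambda>n. dyadic_layers n (f x)) \<partial>M)"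
    by (intro nn_integral_mono le_liminf_dyadic_layers)
  also have "\<dots> \<le> liminf (\<lambda>n. \<integral>\<^sup>+ x. dyadic_layers n (f x) \<partial>M)"
    by (intro nn_integral_liminf) measurable
  also have "\<dots> \<le> liminf (\<lambda>n. SUP i\<in>D. \<integral>\<^sup>+ x. h i x \<partial>M)"
    by (intro Liminf_mono always_eventually allI bound)
  also have "\<dots> = (SUP i\<in>D. \<integral>\<^sup>+ x. h i x \<partial>M)"
    by (simp add: Liminf_const)
  finally show ?thesis .
qed

section \<open>Lower semicontinuous functions against Radon measures\<close>

definition lsc :: "('a::topological_space \<Rightarrow> ennreal) \<Rightarrow> bool" where
  "lsc f \<longleftrightarrow> (\<forall>c. open {x. c < f x})"

lemma lsc_borel: "lsc f \<Longrightarrow> f \<in> borel_measurable borel"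
  unfolding lsc_def by (intro borel_measurableI_greater) auto

lemma lsc_SUP:
  assumes "\<And>i. i \<in> D \<Longrightarrow> lsc (f i)" shows "lsc (\<lambda>x. SUP i\<in>D. f i x)"
  unfolding lsc_def
proof
  fix c
  have "{x. c < (SUP i\<in>D. f i x)} = (\<Union>i\<in>D. {x. c < f i x})" by (auto simp: less_SUP_iff)
  then show "open {x. c < (SUP i\<in>D. f i x)}" using assms by (auto simp: lsc_def)
qed

lemma radon_sets: "radon \<nu> \<Longrightarrow> sets \<nu> = sets borel"
  by (simp add: radon_def)

lemma radon_space: "radon \<nu> \<Longrightarrow> space \<nu> = UNIV"
  using sets_eq_imp_space_eq[OF radon_sets] by simp

lemma radon_meas: "radon \<nu> \<Longrightarrow> f \<in> borel_measurable borel \<Longrightarrow> f \<in> borel_measurable \<nu>"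
  using measurable_cong_sets[OF radon_sets] by blast

lemma radon_compact: "radon \<nu> \<Longrightarrow> compact K \<Longrightarrow> emeasure \<nu> K < \<infinity>"
  by (simp add: radon_def)

lemma radon_outer: "radon \<nu> \<Longrightarrow> B \<in> sets borel \<Longrightarrow>
    emeasure \<nu> B = (INF U\<in>{U. open U \<and> B \<subseteq> U}. emeasure \<nu> U)"
  unfolding radon_def by blast

lemma radon_inner: "radon \<nu> \<Longrightarrow> open U \<Longrightarrow>
    emeasure \<nu> U = (SUP K\<in>{K. compact K \<and> K \<subseteq> U}. emeasure \<nu> K)"
  unfolding radon_def by blast

text \<open>Inner regularity reduces the union to its compact subsets, and each of these lies in a
  single member of the directed family.\<close>

lemma radon_emeasure_UN_directed:
  fixes U :: "'i \<Rightarrow> 'a::t2_space set"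
  assumes r: "radon \<nu>" and D: "D \<noteq> {}" and op: "\<And>i. i \<in> D \<Longrightarrow> open (U i)"
    and dir: "\<And>i j. i \<in> D \<Longrightarrow> j \<in> D \<Longrightarrow> \<exists>k\<in>D. U i \<subseteq> U k \<and> U j \<subseteq> U k"
  shows "emeasure \<nu> (\<Union>i\<in>D. U i) \<le> (SUP i\<in>D. emeasure \<nu> (U i))"
proof -
  have "emeasure \<nu> K \<le> (SUP i\<in>D. emeasure \<nu> (U i))" if K: "compact K" "K \<subseteq> (\<Union>i\<in>D. U i)" for K
  proof -
    obtain C where C: "C \<subseteq> D" "finite C" "K \<subseteq> (\<Union>i\<in>C. U i)"
      using compactE_image[OF K(1) op K(2)] by blast
    have "\<exists>k\<in>D. (\<Union>i\<in>C. U i) \<subseteq> U k"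
      using C(2,1)
    proof (induction C)
      case empty then show ?case using D by auto
    next
      case (insert x C)
      then obtain k where "k \<in> D" "(\<Union>i\<in>C. U i) \<subseteq> U k" by auto
      moreover obtain k' where "k' \<in> D" "U x \<subseteq> U k'" "U k \<subseteq> U k'" using dir[of x k] insert.prems \<open>k \<in> D\<close> by auto
      ultimately show ?case by (intro bexI[of _ k']) auto
    qed
    then obtain k where k: "k \<in> D" "K \<subseteq> U k" using C by auto
    have "emeasure \<nu> K \<le> emeasure \<nu> (U k)"
      using k op[OF k(1)] radon_sets[OF r] by (intro emeasure_mono) auto
    then show ?thesis using k by (meson SUP_upper2)
  qed
  then show ?thesis
    using op by (subst radon_inner[OF r]) (auto intro!: SUP_least)
qed

text \<open>Monotone convergence for directed families of any cardinality: superlevel sets of lower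
  semicontinuous functions are open, and Radon measures are continuous along directed unions of open
  sets.\<close>

lemma nn_integral_SUP_lsc_directed:
  fixes f :: "'i \<Rightarrow> 'a::t2_space \<Rightarrow> ennreal"
  assumes r: "radon \<nu>" and D: "D \<noteq> {}" and l: "\<And>i. i \<in> D \<Longrightarrow> lsc (f i)"
    and dir: "\<And>i j. i \<in> D \<Longrightarrow> j \<in> D \<Longrightarrow> \<exists>k\<in>D. f i \<le> f k \<and> f j \<le> f k"
  shows "(\<integral>\<^sup>+ x. (SUP i\<in>D. f i x) \<partial>\<nu>) = (SUP i\<in>D. \<integral>\<^sup>+ x. f i x \<partial>\<nu>)"
proof (rule antisym)
  show "(\<integral>\<^sup>+ x. (SUP i\<in>D. f i x) \<partial>\<nu>) \<le> (SUP i\<in>D. \<integral>\<^sup>+ x. f i x \<partial>\<nu>)"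
  proof (rule nn_integral_le_SUP_superlevel)
    fix c :: ennreal
    have "{x\<in>space \<nu>. c < (SUP i\<in>D. f i x)} = (\<Union>i\<in>D. {x. c < f i x})"
      by (auto simp: less_SUP_iff radon_space[OF r])
    moreover have "emeasure \<nu> (\<Union>i\<in>D. {x. c < f i x}) \<le> (SUP i\<in>D. emeasure \<nu> {x. c < f i x})"
    proof (rule radon_emeasure_UN_directed[OF r D])
      fix i j assume "i \<in> D" "j \<in> D"
      then obtain k where k: "k \<in> D" "f i \<le> f k" "f j \<le> f k" using dir by blast
      then show "\<exists>k\<in>D. {x. c < f i x} \<subseteq> {x. c < f k x} \<and> {x. c < f j x} \<subseteq> {x. c < f k x}"
        by (intro bexI[of _ k]) (auto simp: le_fun_def intro: less_le_trans)
    qed (use l in \<open>auto simp: lsc_def\<close>)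
    ultimately show "emeasure \<nu> {x\<in>space \<nu>. c < (SUP i\<in>D. f i x)} \<le> (SUP i\<in>D. emeasure \<nu> {x\<in>space \<nu>. c < f i x})"
      by (simp add: radon_space[OF r])
  next
    show "(\<lambda>x. SUP i\<in>D. f i x) \<in> borel_measurable \<nu>"
      by (intro radon_meas[OF r] lsc_borel lsc_SUP l)
  next
    show "f i \<in> borel_measurable \<nu>" if "i \<in> D" for i
      by (intro radon_meas[OF r] lsc_borel l that)
  qed (fact D dir)+
  show "(SUP i\<in>D. \<integral>\<^sup>+ x. f i x \<partial>\<nu>) \<le> (\<integral>\<^sup>+ x. (SUP i\<in>D. f i x) \<partial>\<nu>)"
    by (intro SUP_least nn_integral_mono SUP_upper)
qed

text \<open>The truncations \<open>indicator K x * f x\<close> are in general not lower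
  semicontinuous, so the previous lemma does not cover them; the levels are compared directly, using
  inner regularity on the open set \<open>{x. c < f x}\<close>.\<close>

lemma nn_integral_lsc_compact_exhaustion:
  fixes f :: "'a::t2_space \<Rightarrow> ennreal"
  assumes r: "radon \<nu>" and l: "lsc f"
  shows "(\<integral>\<^sup>+ x. f x \<partial>\<nu>) = (SUP K\<in>{K. compact K}. \<integral>\<^sup>+ x. indicator K x * f x \<partial>\<nu>)"
proof (rule antisym)
  have KB: "K \<in> sets borel" if "compact K" for K :: "'a set" using that by (simp add: borel_closed compact_imp_closed)
  show "(\<integral>\<^sup>+ x. f x \<partial>\<nu>) \<le> (SUP K\<in>{K. compact K}. \<integral>\<^sup>+ x. indicator K x * f x \<partial>\<nu>)"
  proof (rule nn_integral_le_SUP_superlevel)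
    fix c :: ennreal
    have "open {x. c < f x}" using l by (simp add: lsc_def)
    then have "emeasure \<nu> {x. c < f x} = (SUP K\<in>{K. compact K \<and> K \<subseteq> {x. c < f x}}. emeasure \<nu> K)"
      by (rule radon_inner[OF r])
    also have "\<dots> \<le> (SUP K\<in>{K. compact K}. emeasure \<nu> {x. c < indicator K x * f x})"
    proof (rule SUP_mono)
      fix K assume K: "K \<in> {K. compact K \<and> K \<subseteq> {x. c < f x}}"
      have "(\<lambda>x. indicator K x * f x) \<in> borel_measurable borel"
        using K KB lsc_borel[OF l] by (intro borel_measurable_times_ennreal borel_measurable_indicator) auto
      then have "{x. c < indicator K x * f x} \<in> sets borel"
        using measurable_sets_borel[of _ borel "{c<..}"] by (auto simp: vimage_def)
      then have "emeasure \<nu> K \<le> emeasure \<nu> {x. c < indicator K x * f x}"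
        using K by (intro emeasure_mono) (auto simp: radon_sets[OF r] indicator_def)
      then show "\<exists>K'\<in>{K. compact K}. emeasure \<nu> K \<le> emeasure \<nu> {x. c < indicator K' x * f x}"
        using K by blast
    qed
    finally show "emeasure \<nu> {x\<in>space \<nu>. c < f x} \<le> (SUP K\<in>{K. compact K}. emeasure \<nu> {x\<in>space \<nu>. c < indicator K x * f x})"
      by (simp add: radon_space[OF r])
  next
    fix K L :: "'a set" assume "K \<in> {K. compact K}" "L \<in> {K. compact K}"
    then show "\<exists>M\<in>{K. compact K}. (\<lambda>x. indicator K x * f x) \<le> (\<lambda>x. indicator M x * f x) \<and>
        (\<lambda>x. indicator L x * f x) \<le> (\<lambda>x. indicator M x * f x)"
      by (intro bexI[of _ "K \<union> L"]) (auto simp: le_fun_def indicator_def compact_Un)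
  next
    show "f \<in> borel_measurable \<nu>"
      by (intro radon_meas[OF r] lsc_borel l)
    show "(\<lambda>x. indicator K x * f x) \<in> borel_measurable \<nu>" if "K \<in> {K. compact K}" for K
      using that KB lsc_borel[OF l]
      by (intro radon_meas[OF r] borel_measurable_times_ennreal borel_measurable_indicator) auto
    show "{K::'a set. compact K} \<noteq> {}" by auto
  qed
  show "(SUP K\<in>{K. compact K}. \<integral>\<^sup>+ x. indicator K x * f x \<partial>\<nu>) \<le> (\<integral>\<^sup>+ x. f x \<partial>\<nu>)"
    by (intro SUP_least nn_integral_mono) (auto simp: indicator_def)
qed

subsection \<open>Sums, multiples and restrictions of Radon measures\<close>

lemma borel_measurable_cong_sets:
  "sets M = sets borel \<Longrightarrow> f \<in> borel_measurable borel \<Longrightarrow> f \<in> borel_measurable M"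
  using measurable_cong_sets by blast

lemma sets_madd[simp]: "sets (madd M N) = sets borel"
  unfolding madd_def using sets.sigma_sets_eq[of borel] by (simp add: sets_measure_of_conv)

lemma sets_msum[simp]: "sets (msum I \<mu>) = sets borel"
  unfolding msum_def using sets.sigma_sets_eq[of borel] by (simp add: sets_measure_of_conv)

lemma infsum_ennreal_SUP:
  fixes f :: "'i \<Rightarrow> ennreal" shows "infsum f I = (SUP F\<in>{F. finite F \<and> F \<subseteq> I}. sum f F)"
  by (rule nonneg_infsum_complete) simp

lemma emeasure_madd:
  fixes M N :: "'a::topological_space measure"
  assumes "sets M = sets borel" "sets N = sets borel"
  shows "emeasure (madd M N) B = emeasure M B + emeasure N B"
proof (cases "B \<in> sets borel")
  case True
  have "countably_additive (sets borel) (\<lambda>B. emeasure M B + emeasure N B)"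
  proof (rule countably_additiveI)
    fix A :: "nat \<Rightarrow> 'a set" assume "range A \<subseteq> sets borel" "disjoint_family A"
    then show "(\<Sum>i. emeasure M (A i) + emeasure N (A i)) = emeasure M (\<Union> (range A)) + emeasure N (\<Union> (range A))"
      using assms by (simp add: suminf_add[symmetric] suminf_emeasure)
  qed
  then show ?thesis
    unfolding madd_def using True sets.sigma_algebra_axioms[of borel]
    by (subst emeasure_measure_of_sigma) (auto simp: positive_def)
next
  case False
  then show ?thesis using assms by (simp add: emeasure_notin_sets)
qed

lemma emeasure_msum:
  fixes \<mu> :: "'i \<Rightarrow> 'a::topological_space measure"
  assumes "\<And>i. i \<in> I \<Longrightarrow> sets (\<mu> i) = sets borel"
  shows "emeasure (msum I \<mu>) B = (\<Sum>\<^sub>\<infinity>i\<in>I. emeasure (\<mu> i) B)"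
proof (cases "B \<in> sets borel")
  case True
  have "countably_additive (sets borel) (\<lambda>B. \<Sum>\<^sub>\<infinity>i\<in>I. emeasure (\<mu> i) B)"
  proof (rule countably_additiveI)
    fix A :: "nat \<Rightarrow> 'a set" assume A: "range A \<subseteq> sets borel" "disjoint_family A"
    have "(\<Sum>n. \<Sum>\<^sub>\<infinity>i\<in>I. emeasure (\<mu> i) (A n)) = (SUP F\<in>{F. finite F \<and> F \<subseteq> I}. \<Sum>n. \<Sum>i\<in>F. emeasure (\<mu> i) (A n))"
      unfolding infsum_ennreal_SUP
    proof (rule ennreal_suminf_SUP_eq_directed)
      fix F G assume "F \<in> {F. finite F \<and> F \<subseteq> I}" "G \<in> {F. finite F \<and> F \<subseteq> I}"
      then show "\<exists>H\<in>{F. finite F \<and> F \<subseteq> I}. \<forall>n\<in>N. (\<Sum>i\<in>F. emeasure (\<mu> i) (A n)) \<le> (\<Sum>i\<in>H. emeasure (\<mu> i) (A n)) \<and>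
          (\<Sum>i\<in>G. emeasure (\<mu> i) (A n)) \<le> (\<Sum>i\<in>H. emeasure (\<mu> i) (A n))" for N
        by (intro bexI[of _ "F \<union> G"]) (auto intro!: sum_mono2)
    qed
    also have "\<dots> = (SUP F\<in>{F. finite F \<and> F \<subseteq> I}. \<Sum>i\<in>F. emeasure (\<mu> i) (\<Union> (range A)))"
    proof (intro SUP_cong refl)
      fix F assume F: "F \<in> {F. finite F \<and> F \<subseteq> I}"
      have "(\<Sum>n. \<Sum>i\<in>F. emeasure (\<mu> i) (A n)) = (\<Sum>i\<in>F. \<Sum>n. emeasure (\<mu> i) (A n))"
        by (rule suminf_sum) simp
      also have "\<dots> = (\<Sum>i\<in>F. emeasure (\<mu> i) (\<Union> (range A)))"
        using F A assms by (intro sum.cong refl suminf_emeasure) auto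
      finally show "(\<Sum>n. \<Sum>i\<in>F. emeasure (\<mu> i) (A n)) = (\<Sum>i\<in>F. emeasure (\<mu> i) (\<Union> (range A)))" .
    qed
    finally show "(\<Sum>n. \<Sum>\<^sub>\<infinity>i\<in>I. emeasure (\<mu> i) (A n)) = (\<Sum>\<^sub>\<infinity>i\<in>I. emeasure (\<mu> i) (\<Union> (range A)))"
      unfolding infsum_ennreal_SUP .
  qed
  then show ?thesis
    unfolding msum_def using True sets.sigma_algebra_axioms[of borel]
    by (subst emeasure_measure_of_sigma) (auto simp: positive_def)
next
  case False
  then show ?thesis using assms by (simp add: emeasure_notin_sets cong: infsum_cong)
qed

lemma nn_integral_madd:
  assumes M: "sets M = sets borel" and N: "sets N = sets borel" and f: "f \<in> borel_measurable borel"
  shows "(\<integral>\<^sup>+ x. f x \<partial>madd M N) = (\<integral>\<^sup>+ x. f x \<partial>M) + (\<integral>\<^sup>+ x. f x \<partial>N)"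
  using f
proof (induction rule: borel_measurable_induct)
  case (cong f g)
  then show ?case by (simp cong: nn_integral_cong_simp)
next
  case (set B)
  then show ?case using M N by (simp add: emeasure_madd)
next
  case (mult u c)
  then have "u \<in> borel_measurable M" "u \<in> borel_measurable N" "u \<in> borel_measurable (madd M N)"
    using M N by (auto intro: borel_measurable_cong_sets)
  then show ?case using mult by (simp add: nn_integral_cmult distrib_left)
next
  case (add u v)
  have "w \<in> borel_measurable M" "w \<in> borel_measurable N" "w \<in> borel_measurable (madd M N)" if "w \<in> borel_measurable borel" for w
    using M N that by (auto intro: borel_measurable_cong_sets)
  note m = this[OF add.hyps(1)] this[OF add.hyps(3)]
  show ?case using add.IH by (simp add: nn_integral_add m ac_simps)
next
  case (seq U)
  have m: "U i \<in> borel_measurable M" "U i \<in> borel_measurable N" "U i \<in> borel_measurable (madd M N)" for i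
    using M N seq.hyps(1)[of i] by (auto intro: borel_measurable_cong_sets)
  have "(SUP i. (\<integral>\<^sup>+ x. U i x \<partial>M) + (\<integral>\<^sup>+ x. U i x \<partial>N)) = (SUP i. \<integral>\<^sup>+ x. U i x \<partial>M) + (SUP i. \<integral>\<^sup>+ x. U i x \<partial>N)"
  proof (rule ennreal_SUP_add)
    show "incseq (\<lambda>i. \<integral>\<^sup>+ x. U i x \<partial>M)" "incseq (\<lambda>i. \<integral>\<^sup>+ x. U i x \<partial>N)"
      using seq.hyps by (auto simp: mono_def le_fun_def intro!: nn_integral_mono)
  qed
  then show ?case
    using m seq by (simp add: nn_integral_monotone_convergence_SUP image_comp)
qed

lemma nn_integral_msum:
  assumes M: "\<And>i. i \<in> I \<Longrightarrow> sets (\<mu> i) = sets borel" and f: "f \<in> borel_measurable borel"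
  shows "(\<integral>\<^sup>+ x. f x \<partial>msum I \<mu>) = (\<Sum>\<^sub>\<infinity>i\<in>I. \<integral>\<^sup>+ x. f x \<partial>(\<mu> i))"
  using f
proof (induction rule: borel_measurable_induct)
  case (cong f g)
  then have "f = g" by auto
  then show ?case using cong by simp
next
  case (set B)
  then show ?case using M by (simp add: emeasure_msum cong: infsum_cong)
next
  case (mult u c)
  have m: "i \<in> I \<Longrightarrow> u \<in> borel_measurable (\<mu> i)" "u \<in> borel_measurable (msum I \<mu>)" for i
    using M mult.hyps by (auto intro: borel_measurable_cong_sets)
  have "(\<integral>\<^sup>+ x. c * u x \<partial>msum I \<mu>) = c * (\<Sum>\<^sub>\<infinity>i\<in>I. \<integral>\<^sup>+ x. u x \<partial>(\<mu> i))"
    using m mult by (simp add: nn_integral_cmult)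
  also have "\<dots> = (\<Sum>\<^sub>\<infinity>i\<in>I. c * (\<integral>\<^sup>+ x. u x \<partial>(\<mu> i)))"
    unfolding infsum_ennreal_SUP by (simp add: SUP_mult_left_ennreal sum_distrib_left)
  also have "\<dots> = (\<Sum>\<^sub>\<infinity>i\<in>I. \<integral>\<^sup>+ x. c * u x \<partial>(\<mu> i))"
    using m by (intro infsum_cong) (simp add: nn_integral_cmult)
  finally show ?case .
next
  case (add u v)
  have m: "i \<in> I \<Longrightarrow> w \<in> borel_measurable (\<mu> i)" "w \<in> borel_measurable (msum I \<mu>)"
    if "w \<in> borel_measurable borel" for w i
    using M that by (auto intro: borel_measurable_cong_sets)
  have "(\<integral>\<^sup>+ x. v x + u x \<partial>msum I \<mu>) = (\<Sum>\<^sub>\<infinity>i\<in>I. \<integral>\<^sup>+ x. v x \<partial>(\<mu> i)) + (\<Sum>\<^sub>\<infinity>i\<in>I. \<integral>\<^sup>+ x. u x \<partial>(\<mu> i))"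
    using add.IH by (simp add: nn_integral_add m(2)[OF add.hyps(1)] m(2)[OF add.hyps(3)])
  also have "\<dots> = (\<Sum>\<^sub>\<infinity>i\<in>I. (\<integral>\<^sup>+ x. v x \<partial>(\<mu> i)) + (\<integral>\<^sup>+ x. u x \<partial>(\<mu> i)))"
    by (intro infsum_add[symmetric] nonneg_summable_on_complete) auto
  also have "\<dots> = (\<Sum>\<^sub>\<infinity>i\<in>I. \<integral>\<^sup>+ x. v x + u x \<partial>(\<mu> i))"
    by (intro infsum_cong) (simp add: nn_integral_add m(1)[OF add.hyps(1)] m(1)[OF add.hyps(3)])
  finally show ?case .
next
  case (seq U)
  have m: "j \<in> I \<Longrightarrow> U i \<in> borel_measurable (\<mu> j)" "U i \<in> borel_measurable (msum I \<mu>)" for i j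
    using M seq.hyps(1)[of i] by (auto intro: borel_measurable_cong_sets)
  have "(\<integral>\<^sup>+ x. (SUP n. U n x) \<partial>msum I \<mu>) = (SUP n. SUP F\<in>{F. finite F \<and> F \<subseteq> I}. \<Sum>i\<in>F. \<integral>\<^sup>+ x. U n x \<partial>(\<mu> i))"
    using m seq by (simp add: nn_integral_monotone_convergence_SUP infsum_ennreal_SUP)
  also have "\<dots> = (SUP F\<in>{F. finite F \<and> F \<subseteq> I}. SUP n. \<Sum>i\<in>F. \<integral>\<^sup>+ x. U n x \<partial>(\<mu> i))"
    by (rule SUP_commute)
  also have "\<dots> = (SUP F\<in>{F. finite F \<and> F \<subseteq> I}. \<Sum>i\<in>F. SUP n. \<integral>\<^sup>+ x. U n x \<partial>(\<mu> i))"
  proof (intro SUP_cong refl sum_SUP_directed_ennreal[symmetric])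
    fix F i j
    show "\<exists>k\<in>UNIV. \<forall>x\<in>F. integral\<^sup>N (\<mu> x) (U i) \<le> integral\<^sup>N (\<mu> x) (U k) \<and>
           integral\<^sup>N (\<mu> x) (U j) \<le> integral\<^sup>N (\<mu> x) (U k)"
      using seq.hyps by (intro bexI[of _ "max i j"]) (auto simp: mono_def le_fun_def intro!: nn_integral_mono)
  qed auto
  also have "\<dots> = (\<Sum>\<^sub>\<infinity>i\<in>I. \<integral>\<^sup>+ x. (SUP n. U n x) \<partial>(\<mu> i))"
    unfolding infsum_ennreal_SUP using m seq.hyps
    by (intro SUP_cong refl sum.cong) (auto simp: nn_integral_monotone_convergence_SUP)
  finally show ?case by (simp add: image_comp)
qed

section \<open>Radon regularity of sums, multiples, restrictions and dominated measures\<close>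

abbreviation restr :: "'a::topological_space set \<Rightarrow> 'a measure \<Rightarrow> 'a measure" where
  "restr B \<nu> \<equiv> density \<nu> (indicator B)"

lemma emeasure_restr:
  assumes "sets \<nu> = sets borel" "B \<in> sets borel" "E \<in> sets borel"
  shows "emeasure (restr B \<nu>) E = emeasure \<nu> (B \<inter> E)"
  using assms by (simp add: emeasure_density indicator_inter_arith[symmetric])

lemma nn_integral_restr:
  assumes "sets \<nu> = sets borel" "B \<in> sets borel" "f \<in> borel_measurable borel"
  shows "(\<integral>\<^sup>+ x. f x \<partial>restr B \<nu>) = (\<integral>\<^sup>+ x. indicator B x * f x \<partial>\<nu>)"
  using assms by (subst nn_integral_density) (auto intro: borel_measurable_cong_sets)

lemma radonI:
  assumes "sets \<nu> = sets borel" "\<And>K. compact K \<Longrightarrow> emeasure \<nu> K < \<infinity>"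
    and outer: "\<And>B e. B \<in> sets borel \<Longrightarrow> emeasure \<nu> B < \<infinity> \<Longrightarrow> e > 0 \<Longrightarrow>
      \<exists>U. open U \<and> B \<subseteq> U \<and> emeasure \<nu> U \<le> emeasure \<nu> B + ennreal e"
    and inner: "\<And>U. open U \<Longrightarrow> emeasure \<nu> U \<le> (SUP K\<in>{K. compact K \<and> K \<subseteq> U}. emeasure \<nu> K)"
  shows "radon \<nu>"
  unfolding radon_def
proof (intro conjI ballI allI impI)
  fix B :: "'a set" assume B: "B \<in> sets borel"
  show "emeasure \<nu> B = (INF U\<in>{U. open U \<and> B \<subseteq> U}. emeasure \<nu> U)"
  proof (rule antisym)
    show "emeasure \<nu> B \<le> (INF U\<in>{U. open U \<and> B \<subseteq> U}. emeasure \<nu> U)"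
      using assms(1) by (intro INF_greatest emeasure_mono) auto
    show "(INF U\<in>{U. open U \<and> B \<subseteq> U}. emeasure \<nu> U) \<le> emeasure \<nu> B"
    proof (cases "emeasure \<nu> B < \<infinity>")
      case True
      show ?thesis
      proof (rule ennreal_le_epsilon)
        fix e :: real assume "0 < e"
        then obtain U where "open U \<and> B \<subseteq> U \<and> emeasure \<nu> U \<le> emeasure \<nu> B + ennreal e"
          using outer[OF B True] by blast
        then show "(INF U\<in>{U. open U \<and> B \<subseteq> U}. emeasure \<nu> U) \<le> emeasure \<nu> B + ennreal e"
          by (intro INF_lower2[of U]) auto
      qed
    qed (simp add: less_top[symmetric])
  qed
next
  fix U :: "'a set" assume U: "open U"
  show "emeasure \<nu> U = (SUP K\<in>{K. compact K \<and> K \<subseteq> U}. emeasure \<nu> K)"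
    using inner[OF U] U assms(1) by (intro antisym SUP_least emeasure_mono) auto
qed (use assms in auto)

lemma radon_outer_eps:
  assumes "radon \<nu>" "B \<in> sets borel" "emeasure \<nu> B < \<infinity>" "e > 0"
  obtains U where "open U" "B \<subseteq> U" "emeasure \<nu> U \<le> emeasure \<nu> B + ennreal e"
proof -
  have "emeasure \<nu> B < emeasure \<nu> B + ennreal e"
    using assms(3,4) ennreal_add_left_cancel_less[of "emeasure \<nu> B" 0 "ennreal e"] by auto
  then have "(INF U\<in>{U. open U \<and> B \<subseteq> U}. emeasure \<nu> U) < emeasure \<nu> B + ennreal e"
    using radon_outer[OF assms(1,2)] by simp
  then show ?thesis using that by (auto simp: INF_less_iff less_imp_le)
qed

lemma radon_madd:
  fixes \<mu> \<nu> :: "'a::t2_space measure"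
  assumes r: "radon \<mu>" "radon \<nu>" shows "radon (madd \<mu> \<nu>)"
proof (rule radonI)
  note em[simp] = emeasure_madd[OF radon_sets[OF r(1)] radon_sets[OF r(2)]]
  show "emeasure (madd \<mu> \<nu>) K < \<infinity>" if "compact K" for K
    using that r by (simp add: radon_compact[unfolded infinity_ennreal_def])
  fix B :: "'a set" and e :: real assume B: "B \<in> sets borel" "emeasure (madd \<mu> \<nu>) B < \<infinity>" "e > 0"
  then have "emeasure \<mu> B < \<infinity>" "emeasure \<nu> B < \<infinity>" by (auto simp: ennreal_add_eq_top less_top)
  then obtain U V where UV: "open U" "B \<subseteq> U" "emeasure \<mu> U \<le> emeasure \<mu> B + ennreal (e/2)"
    "open V" "B \<subseteq> V" "emeasure \<nu> V \<le> emeasure \<nu> B + ennreal (e/2)"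
    using radon_outer_eps[OF r(1) B(1), of "e/2"] radon_outer_eps[OF r(2) B(1), of "e/2"] B(3)
    by (metis half_gt_zero)
  have "emeasure \<mu> (U \<inter> V) + emeasure \<nu> (U \<inter> V) \<le> emeasure \<mu> U + emeasure \<nu> V"
    using UV r by (intro add_mono emeasure_mono) (auto simp: radon_sets)
  also have "\<dots> \<le> (emeasure \<mu> B + ennreal (e/2)) + (emeasure \<nu> B + ennreal (e/2))"
    using UV by (intro add_mono)
  also have "\<dots> = emeasure \<mu> B + emeasure \<nu> B + ennreal e"
    using B(3) ennreal_plus[of "e/2" "e/2"] by (simp add: ac_simps flip: ennreal_plus)
  finally show "\<exists>W. open W \<and> B \<subseteq> W \<and> emeasure (madd \<mu> \<nu>) W \<le> emeasure (madd \<mu> \<nu>) B + ennreal e"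
    using UV by (intro exI[of _ "U \<inter> V"]) auto
next
  note em[simp] = emeasure_madd[OF radon_sets[OF r(1)] radon_sets[OF r(2)]]
  fix U :: "'a set" assume U: "open U"
  let ?D = "{K. compact K \<and> K \<subseteq> U}"
  have "(SUP K\<in>?D. emeasure \<mu> K + emeasure \<nu> K) = (SUP K\<in>?D. emeasure \<mu> K) + (SUP K\<in>?D. emeasure \<nu> K)"
  proof (rule SUP_add_directed_ennreal)
    fix K L assume "K \<in> ?D" "L \<in> ?D"
    then show "\<exists>M\<in>?D. emeasure \<mu> K + emeasure \<nu> L \<le> emeasure \<mu> M + emeasure \<nu> M"
      using r by (intro bexI[of _ "K \<union> L"] add_mono emeasure_mono) (auto simp: radon_sets compact_Un compact_imp_closed)
  qed
  then show "emeasure (madd \<mu> \<nu>) U \<le> (SUP K\<in>?D. emeasure (madd \<mu> \<nu>) K)"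
    using radon_inner[OF r(1) U] radon_inner[OF r(2) U] by simp
qed simp

lemma radon_scale:
  fixes \<nu> :: "'a::t2_space measure"
  assumes r: "radon \<nu>" and t: "t \<ge> 0" shows "radon (scale_measure (ennreal t) \<nu>)"
proof (rule radonI)
  show "emeasure (scale_measure (ennreal t) \<nu>) K < \<infinity>" if "compact K" for K
    using radon_compact[OF r that] by (simp add: ennreal_mult_less_top)
  fix B :: "'a set" and e :: real assume B: "B \<in> sets borel" "emeasure (scale_measure (ennreal t) \<nu>) B < \<infinity>" "e > 0"
  show "\<exists>W. open W \<and> B \<subseteq> W \<and> emeasure (scale_measure (ennreal t) \<nu>) W \<le> emeasure (scale_measure (ennreal t) \<nu>) B + ennreal e"
  proof (cases "t = 0")
    case True then show ?thesis by (intro exI[of _ UNIV]) auto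
  next
    case False
    then have "emeasure \<nu> B < \<infinity>" using B t by (auto simp: ennreal_mult_less_top)
    then obtain U where U: "open U" "B \<subseteq> U" "emeasure \<nu> U \<le> emeasure \<nu> B + ennreal (e/t)"
      using radon_outer_eps[OF r B(1), of "e/t"] B(3) False t by (metis divide_pos_pos less_le)
    have "ennreal t * emeasure \<nu> U \<le> ennreal t * (emeasure \<nu> B + ennreal (e/t))"
      using U by (intro mult_left_mono) auto
    also have "\<dots> = ennreal t * emeasure \<nu> B + ennreal e"
      using False t by (simp add: distrib_left ennreal_mult'[symmetric])
    finally show ?thesis using U by auto
  qed
next
  fix U :: "'a set" assume U: "open U"
  show "emeasure (scale_measure (ennreal t) \<nu>) U \<le> (SUP K\<in>{K. compact K \<and> K \<subseteq> U}. emeasure (scale_measure (ennreal t) \<nu>) K)"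
    using radon_inner[OF r U] by (simp add: SUP_mult_left_ennreal)
qed (use radon_sets[OF r] in simp)

text \<open>The hypothesis of a clopen carrier avoids the Borel sets of infinite measure all of whose compact
  subsets are null, which occur for outer regular measures that are not \<open>\<sigma>\<close>-finite.\<close>

definition moderated :: "'a::topological_space measure \<Rightarrow> bool" where
  "moderated \<nu> \<longleftrightarrow> (\<exists>K::nat \<Rightarrow> 'a set. (\<forall>n. compact (K n)) \<and> open (\<Union>n. K n) \<and> closed (\<Union>n. K n)
      \<and> emeasure \<nu> (UNIV - (\<Union>n. K n)) = 0)"

text \<open>Outer regularity of the complement: if the open \<open>W\<close> contains
  \<open>K - B\<close> with little excess, then \<open>K - W\<close> is compact, lies in
  \<open>B\<close> and misses little of it.\<close>

lemma radon_inner_finite: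
  fixes \<nu> :: "'a::t2_space measure"
  assumes r: "radon \<nu>" and K: "compact K" and B: "B \<in> sets borel" "B \<subseteq> K" and e: "e > 0"
  obtains C where "compact C" "C \<subseteq> B" "emeasure \<nu> (B - C) \<le> ennreal e"
proof -
  have KB: "K \<in> sets borel" using K by (simp add: borel_closed compact_imp_closed)
  have fin: "emeasure \<nu> (K - B) < \<infinity>"
    using radon_compact[OF r K] emeasure_mono[of "K - B" K \<nu>] KB r by (auto simp: radon_sets intro: le_less_trans)
  obtain W where W: "open W" "K - B \<subseteq> W" "emeasure \<nu> W \<le> emeasure \<nu> (K - B) + ennreal e"
    using radon_outer_eps[OF r _ fin e] KB B by (metis sets.Diff)
  have "emeasure \<nu> (B - (K - W)) \<le> emeasure \<nu> (W - (K - B))"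
    using W B KB r by (intro emeasure_mono) (auto simp: radon_sets)
  also have "\<dots> = emeasure \<nu> W - emeasure \<nu> (K - B)"
    using W B KB fin r by (intro emeasure_Diff) (auto simp: radon_sets)
  also have "\<dots> \<le> ennreal e"
    using W(3) fin by (auto simp: ennreal_minus_le_iff less_top)
  finally show ?thesis
    using that[of "K - W"] W K by (auto simp: compact_diff)
qed

text \<open>Inner regularity holds inside each compact \<open>K n\<close>; countably many
  approximants with errors \<open>1 / (k + 1)\<close> exhaust \<open>B\<close> up to a null
  set.\<close>

lemma moderated_inner:
  fixes \<nu> :: "'a::t2_space measure"
  assumes r: "radon \<nu>" and m: "moderated \<nu>" and B: "B \<in> sets borel"
  obtains C :: "nat \<Rightarrow> 'a set" where "\<And>n. compact (C n)" "incseq C" "\<And>n. C n \<subseteq> B" "emeasure \<nu> (B - (\<Union>n. C n)) = 0"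
proof -
  obtain K :: "nat \<Rightarrow> 'a set" where K: "\<And>n. compact (K n)" "emeasure \<nu> (UNIV - (\<Union>n. K n)) = 0"
    using m by (auto simp: moderated_def)
  have KB: "K n \<in> sets borel" for n using K by (simp add: borel_closed compact_imp_closed)
  have "\<exists>C. compact C \<and> C \<subseteq> B \<inter> K n \<and> emeasure \<nu> (B \<inter> K n - C) \<le> ennreal (1 / (real k + 1))" for n k
    using radon_inner_finite[OF r K(1)[of n], of "B \<inter> K n" "1 / (real k + 1)"] KB[of n] B
    by (metis Int_lower2 divide_pos_pos of_nat_0_le_iff add_nonneg_pos sets.Int zero_less_one)
  then obtain C where C: "\<And>n k. compact (C n k)" "\<And>n k. C n k \<subseteq> B \<inter> K n"
      "\<And>n k. emeasure \<nu> (B \<inter> K n - C n k) \<le> ennreal (1 / (real k + 1))"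
    by metis
  have CB: "C n k \<in> sets borel" for n k using C by (simp add: borel_closed compact_imp_closed)
  define D where "D j = (\<Union>n\<le>j. \<Union>k\<le>j. C n k)" for j
  have Dc: "compact (D j)" for j unfolding D_def using C by (intro compact_UN) auto
  have Dinc: "incseq D" unfolding D_def by (auto simp: mono_def intro: order_trans)
  have DB: "D j \<subseteq> B" for j unfolding D_def using C by blast
  have DD: "(\<Union>j. D j) \<in> sets borel"
    using Dc by (intro sets.countable_UN) (auto simp: borel_closed compact_imp_closed)
  have CD: "C n k \<subseteq> (\<Union>j. D j)" for n k
    unfolding D_def using max.cobounded1[of n k] max.cobounded2[of k n] by blast
  have null: "emeasure \<nu> (B \<inter> K n - (\<Union>j. D j)) = 0" for n
  proof -
    have "emeasure \<nu> (B \<inter> K n - (\<Union>j. D j)) \<le> 0 + ennreal e" if "e > 0" for e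
    proof -
      obtain k where k: "1 / (real k + 1) < e"
        using nat_approx_posE[OF \<open>e > 0\<close>] by (metis Suc_eq_plus1 of_nat_Suc add.commute)
      have "emeasure \<nu> (B \<inter> K n - (\<Union>j. D j)) \<le> emeasure \<nu> (B \<inter> K n - C n k)"
        using CD[of n k] B KB[of n] CB[of n k] r by (intro emeasure_mono) (auto simp: radon_sets)
      also have "\<dots> \<le> ennreal e" using C(3)[of n k] k by (meson ennreal_leI less_imp_le order_trans)
      finally show ?thesis by simp
    qed
    then show ?thesis by (metis ennreal_le_epsilon le_zero_eq)
  qed
  have "emeasure \<nu> (B - (\<Union>j. D j)) \<le> emeasure \<nu> ((UNIV - (\<Union>n. K n)) \<union> (\<Union>n. B \<inter> K n - (\<Union>j. D j)))"
    using B KB DD r by (intro emeasure_mono) (auto simp: radon_sets)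
  also have "\<dots> \<le> emeasure \<nu> (UNIV - (\<Union>n. K n)) + emeasure \<nu> (\<Union>n. B \<inter> K n - (\<Union>j. D j))"
    using B KB DD r by (intro emeasure_subadditive) (auto simp: radon_sets)
  also have "emeasure \<nu> (\<Union>n. B \<inter> K n - (\<Union>j. D j)) = 0"
    using null B KB DD r by (intro emeasure_UN_eq_0) (auto simp: radon_sets)
  finally have "emeasure \<nu> (B - (\<Union>j. D j)) = 0" using K by simp
  then show ?thesis using that[of D] Dc Dinc DB by auto
qed

lemma moderated_mono:
  assumes "moderated \<nu>" "\<And>B. B \<in> sets borel \<Longrightarrow> emeasure p B \<le> emeasure \<nu> B"
  shows "moderated p"
proof -
  obtain K :: "nat \<Rightarrow> 'a set" where K: "\<And>n. compact (K n)" "open (\<Union>n. K n)" "closed (\<Union>n. K n)" "emeasure \<nu> (UNIV - (\<Union>n. K n)) = 0"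
    using assms(1) by (auto simp: moderated_def)
  have "UNIV - (\<Union>n. K n) \<in> sets borel" using K by auto
  then have "emeasure p (UNIV - (\<Union>n. K n)) = 0" using assms(2) K(4) by (metis le_zero_eq)
  then show ?thesis using K unfolding moderated_def by blast
qed

lemma moderated_madd:
  fixes \<mu> \<nu> :: "'a::t2_space measure"
  assumes s: "sets \<mu> = sets borel" "sets \<nu> = sets borel" and "moderated \<mu>" "moderated \<nu>"
  shows "moderated (madd \<mu> \<nu>)"
proof -
  obtain K :: "nat \<Rightarrow> 'a set" where K: "\<And>n. compact (K n)" "open (\<Union>n. K n)" "closed (\<Union>n. K n)" "emeasure \<mu> (UNIV - (\<Union>n. K n)) = 0"
    using assms by (auto simp: moderated_def)
  obtain L :: "nat \<Rightarrow> 'a set" where L: "\<And>n. compact (L n)" "open (\<Union>n. L n)" "closed (\<Union>n. L n)" "emeasure \<nu> (UNIV - (\<Union>n. L n)) = 0"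
    using assms by (auto simp: moderated_def)
  have un: "(\<Union>n. K n \<union> L n) = (\<Union>n. K n) \<union> (\<Union>n. L n)" by auto
  have "emeasure \<mu> (UNIV - (\<Union>n. K n \<union> L n)) \<le> emeasure \<mu> (UNIV - (\<Union>n. K n))"
    using K s by (intro emeasure_mono) auto
  moreover have "emeasure \<nu> (UNIV - (\<Union>n. K n \<union> L n)) \<le> emeasure \<nu> (UNIV - (\<Union>n. L n))"
    using L s by (intro emeasure_mono) auto
  ultimately have "emeasure (madd \<mu> \<nu>) (UNIV - (\<Union>n. K n \<union> L n)) = 0"
    using K L by (simp add: emeasure_madd s)
  then show ?thesis unfolding moderated_def
    using K L by (intro exI[of _ "\<lambda>n. K n \<union> L n"]) (auto simp: un compact_Un)
qed

text \<open>Errors measured by \<nu> bound errors measured by \<open>p\<close>. For outer regularity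
  they are distributed over the sets \<open>B \<inter> K n\<close> with sizes
  \<open>e / 2 ^ (n + 1)\<close>; inner regularity holds for \<nu> up to null sets, which are null
  for \<open>p\<close> too.\<close>

lemma radon_dominated:
  fixes p \<nu> :: "'a::t2_space measure"
  assumes r: "radon \<nu>" and m: "moderated \<nu>" and s: "sets p = sets borel"
    and le: "\<And>B. B \<in> sets borel \<Longrightarrow> emeasure p B \<le> emeasure \<nu> B"
  shows "radon p"
proof (rule radonI)
  show "emeasure p K < \<infinity>" if "compact K" for K
    using radon_compact[OF r that] le[of K] that by (auto simp: borel_closed compact_imp_closed intro: le_less_trans)
  fix B :: "'a set" and e :: real assume B: "B \<in> sets borel" "e > 0"
  obtain K :: "nat \<Rightarrow> 'a set" where K: "\<And>n. compact (K n)" "open (\<Union>n. K n)" "closed (\<Union>n. K n)" "emeasure \<nu> (UNIV - (\<Union>n. K n)) = 0"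
    using m by (auto simp: moderated_def)
  have KB: "K n \<in> sets borel" for n using K by (simp add: borel_closed compact_imp_closed)
  have fin: "emeasure \<nu> (B \<inter> K n) < \<infinity>" for n
    using radon_compact[OF r K(1)[of n]] emeasure_mono[of "B \<inter> K n" "K n" \<nu>] KB[of n] r
    by (auto simp: radon_sets intro: le_less_trans)
  have "\<exists>U. open U \<and> B \<inter> K n \<subseteq> U \<and> emeasure \<nu> U \<le> emeasure \<nu> (B \<inter> K n) + ennreal (e * (1/2) ^ Suc n)" for n
    using radon_outer_eps[OF r _ fin[of n], of "e * (1/2) ^ Suc n"] B KB[of n] by (metis sets.Int mult_pos_pos zero_less_power half_gt_zero zero_less_one)
  then obtain U where U: "\<And>n. open (U n)" "\<And>n. B \<inter> K n \<subseteq> U n"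
      "\<And>n. emeasure \<nu> (U n) \<le> emeasure \<nu> (B \<inter> K n) + ennreal (e * (1/2) ^ Suc n)" by metis
  \<comment> \<open>The complement of the carrier is null for \<open>p\<close>, and open because the
    carrier is closed; it covers the part of \<open>B\<close> lying outside.\<close>
  define V where "V = (\<Union>n. U n) \<union> (UNIV - (\<Union>n. K n))"
  have V: "open V" "B \<subseteq> V" using U(1) U(2) K(3) by (auto simp: V_def open_Diff)
  have dif: "emeasure p (U n - B \<inter> K n) \<le> ennreal (e * (1/2) ^ Suc n)" for n
  proof -
    have "emeasure p (U n - B \<inter> K n) \<le> emeasure \<nu> (U n - B \<inter> K n)"
      using U(1)[of n] B KB[of n] by (intro le) auto
    also have "\<dots> = emeasure \<nu> (U n) - emeasure \<nu> (B \<inter> K n)"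
      using U B KB[of n] fin[of n] r by (intro emeasure_Diff) (auto simp: radon_sets)
    also have "\<dots> \<le> ennreal (e * (1/2) ^ Suc n)"
      using U(3)[of n] fin[of n] by (auto simp: ennreal_minus_le_iff less_top)
    finally show ?thesis .
  qed
  have "emeasure p V \<le> emeasure p (B \<union> (UNIV - (\<Union>n. K n)) \<union> (\<Union>n. U n - B \<inter> K n))"
    using B U K KB s by (intro emeasure_mono) (auto simp: V_def)
  also have "\<dots> \<le> emeasure p B + emeasure p (UNIV - (\<Union>n. K n)) + emeasure p (\<Union>n. U n - B \<inter> K n)"
    using B U K KB s
    by (intro order_trans[OF emeasure_subadditive] add_right_mono emeasure_subadditive) auto
  also have "emeasure p (UNIV - (\<Union>n. K n)) = 0"
    using le[of "UNIV - (\<Union>n. K n)"] K by auto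
  also have "emeasure p (\<Union>n. U n - B \<inter> K n) \<le> (\<Sum>n. emeasure p (U n - B \<inter> K n))"
    using B U KB s by (intro emeasure_subadditive_countably) auto
  also have "\<dots> \<le> (\<Sum>n. ennreal (e * (1/2) ^ Suc n))"
    by (intro suminf_le dif) auto
  also have "\<dots> = ennreal e"
    using B sums_mult[OF power_half_series, of e] by (intro suminf_ennreal_eq) auto
  finally have "emeasure p V \<le> emeasure p B + ennreal e" by simp
  then show "\<exists>U. open U \<and> B \<subseteq> U \<and> emeasure p U \<le> emeasure p B + ennreal e" using V by blast
next
  fix U :: "'a set" assume U: "open U"
  then obtain C :: "nat \<Rightarrow> 'a set" where C: "\<And>n. compact (C n)" "incseq C" "\<And>n. C n \<subseteq> U" "emeasure \<nu> (U - (\<Union>n. C n)) = 0"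
    using moderated_inner[OF r m, of U] by (metis borel_open)
  have CB: "C n \<in> sets borel" for n using C by (simp add: borel_closed compact_imp_closed)
  have "emeasure p (U - (\<Union>n. C n)) = 0"
    using le[of "U - (\<Union>n. C n)"] C(4) U CB by auto
  then have "emeasure p U = emeasure p (\<Union>n. C n)"
    using C(3) U CB s emeasure_Un_null_set[of "\<Union>n. C n" p "U - (\<Union>n. C n)"]
    by (auto simp: null_sets_def Un_absorb1 UN_least)
  also have "\<dots> = (SUP n. emeasure p (C n))"
    using C CB s by (intro SUP_emeasure_incseq[symmetric]) (auto simp: image_subset_iff)
  also have "\<dots> \<le> (SUP K\<in>{K. compact K \<and> K \<subseteq> U}. emeasure p K)"
    using C by (intro SUP_mono) auto
  finally show "emeasure p U \<le> (SUP K\<in>{K. compact K \<and> K \<subseteq> U}. emeasure p K)" .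
qed (use s in simp)

lemma
  fixes \<nu> :: "'a::t2_space measure"
  assumes r: "radon \<nu>" and m: "moderated \<nu>" and B: "B \<in> sets borel"
  shows radon_restr: "radon (restr B \<nu>)" and moderated_restr: "moderated (restr B \<nu>)"
proof -
  have *: "emeasure (restr B \<nu>) E \<le> emeasure \<nu> E" if "E \<in> sets borel" for E
    using that B r by (subst emeasure_restr) (auto simp: radon_sets intro!: emeasure_mono)
  show "radon (restr B \<nu>)" by (rule radon_dominated[OF r m _ *]) (use r in \<open>auto simp: radon_sets\<close>)
  show "moderated (restr B \<nu>)" by (rule moderated_mono[OF m *])
qed

text \<open>The restricted measure ignores the open set \<open>- K\<close>, so
  \<open>U \<union> - K\<close> is a neighbourhood of \<open>B\<close> with the measure of
  \<open>U \<inter> K\<close>. Compactness takes the place of moderation here, which matters because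
  the proof that measures of finite energy are moderated relies on such restrictions.\<close>

lemma radon_restr_compact:
  fixes \<nu> :: "'a::t2_space measure"
  assumes r: "radon \<nu>" and K: "compact K"
  shows "radon (restr K \<nu>)"
proof (rule radonI)
  have KB: "K \<in> sets borel" using K by (simp add: borel_closed compact_imp_closed)
  note em = emeasure_restr[OF radon_sets[OF r] KB]
  show "emeasure (restr K \<nu>) L < \<infinity>" if "compact L" for L
  proof -
    have "emeasure (restr K \<nu>) L \<le> emeasure \<nu> K"
      using that KB r by (subst em) (auto simp: borel_closed compact_imp_closed radon_sets intro!: emeasure_mono)
    then show ?thesis using radon_compact[OF r K] by (rule le_less_trans)
  qed
  fix B :: "'a set" and e :: real assume B: "B \<in> sets borel" "emeasure (restr K \<nu>) B < \<infinity>" "e > 0"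
  then have "emeasure \<nu> (K \<inter> B) < \<infinity>" by (simp add: em)
  then obtain U where U: "open U" "K \<inter> B \<subseteq> U" "emeasure \<nu> U \<le> emeasure \<nu> (K \<inter> B) + ennreal e"
    using radon_outer_eps[OF r _ _ \<open>e > 0\<close>, of "K \<inter> B"] B KB by (metis sets.Int)
  have oU: "open (U \<union> - K)" using U K by (simp add: compact_imp_closed open_Un open_Compl)
  have "emeasure (restr K \<nu>) (U \<union> - K) = emeasure \<nu> (K \<inter> (U \<union> - K))"
    using oU by (intro em) auto
  also have "\<dots> \<le> emeasure \<nu> U" using U r by (intro emeasure_mono) (auto simp: radon_sets)
  also have "\<dots> \<le> emeasure (restr K \<nu>) B + ennreal e" using U B by (simp add: em)
  finally show "\<exists>U. open U \<and> B \<subseteq> U \<and> emeasure (restr K \<nu>) U \<le> emeasure (restr K \<nu>) B + ennreal e"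
    using oU U by (intro exI[of _ "U \<union> - K"]) auto
next
  have KB: "K \<in> sets borel" using K by (simp add: borel_closed compact_imp_closed)
  note em = emeasure_restr[OF radon_sets[OF r] KB]
  fix U :: "'a set" assume U: "open U"
  show "emeasure (restr K \<nu>) U \<le> (SUP K'\<in>{K. compact K \<and> K \<subseteq> U}. emeasure (restr K \<nu>) K')"
  proof (rule ennreal_le_epsilon)
    fix e :: real assume "0 < e"
    then obtain C where C: "compact C" "C \<subseteq> K \<inter> U" "emeasure \<nu> (K \<inter> U - C) \<le> ennreal e"
      using radon_inner_finite[OF r K, of "K \<inter> U" e] KB U by (metis Int_lower1 borel_open sets.Int)
    have CB: "C \<in> sets borel" using C by (simp add: borel_closed compact_imp_closed)
    have "emeasure (restr K \<nu>) U = emeasure \<nu> (C \<union> (K \<inter> U - C))"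
      using C U by (subst em) (auto intro!: arg_cong[where f="emeasure \<nu>"])
    also have "\<dots> \<le> emeasure \<nu> C + emeasure \<nu> (K \<inter> U - C)"
      using CB KB U r by (intro emeasure_subadditive) (auto simp: radon_sets)
    also have "\<dots> \<le> emeasure (restr K \<nu>) C + ennreal e"
      using C CB by (intro add_mono) (auto simp: em Int_absorb1)
    also have "\<dots> \<le> (SUP K'\<in>{K. compact K \<and> K \<subseteq> U}. emeasure (restr K \<nu>) K') + ennreal e"
      using C by (intro add_right_mono SUP_upper) auto
    finally show "emeasure (restr K \<nu>) U \<le> (SUP K'\<in>{K. compact K \<and> K \<subseteq> U}. emeasure (restr K \<nu>) K') + ennreal e" .
  qed
qed (use radon_sets[OF r] in simp)

lemma conc_null: "conc \<nu> A \<Longrightarrow> closed A \<Longrightarrow> sets \<nu> = sets borel \<Longrightarrow> emeasure \<nu> (UNIV - A) = 0"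
  unfolding conc_def using emeasure_mono by (metis Diff_mono borel_closed le_zero_eq order_refl sets.compl_sets space_borel)

lemma conc_closed_iff: "closed A \<Longrightarrow> sets \<nu> = sets borel \<Longrightarrow> conc \<nu> A \<longleftrightarrow> emeasure \<nu> (UNIV - A) = 0"
  using conc_null[of \<nu> A] unfolding conc_def by (metis borel_closed order_refl)

lemma emeasure_conc_Int:
  assumes "emeasure \<nu> (UNIV - A) = 0" "closed A" "sets \<nu> = sets borel" "B \<in> sets borel"
  shows "emeasure \<nu> (B \<inter> A) = emeasure \<nu> B"
proof -
  have "B = (B \<inter> A) \<union> (B - A)" by auto
  moreover have "emeasure \<nu> (B - A) = 0"
    using assms emeasure_mono[of "B - A" "UNIV - A" \<nu>] by auto
  ultimately show ?thesis
    using assms emeasure_Un_null_set[of "B \<inter> A" \<nu> "B - A"] by (auto simp: null_sets_def)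
qed

section \<open>Locally finite families of closed sets and sums of measures carried by them\<close>

definition loc_finite :: "'i set \<Rightarrow> ('i \<Rightarrow> 'a::topological_space set) \<Rightarrow> bool" where
  "loc_finite I A \<longleftrightarrow> (\<forall>x. \<exists>U. open U \<and> x \<in> U \<and> finite {i\<in>I. A i \<inter> U \<noteq> {}})"

lemma loc_finite_subset:
  assumes "loc_finite I A" "J \<subseteq> I" "\<And>i. i \<in> J \<Longrightarrow> B i \<subseteq> A i" shows "loc_finite J B"
  unfolding loc_finite_def
proof
  fix x
  obtain U where U: "open U" "x \<in> U" "finite {i\<in>I. A i \<inter> U \<noteq> {}}" using assms(1) by (auto simp: loc_finite_def)
  have "{i\<in>J. B i \<inter> U \<noteq> {}} \<subseteq> {i\<in>I. A i \<inter> U \<noteq> {}}" using assms(2,3) by blast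
  then show "\<exists>U. open U \<and> x \<in> U \<and> finite {i\<in>J. B i \<inter> U \<noteq> {}}" using U finite_subset by blast
qed

lemma loc_finite_closed_UN:
  assumes "loc_finite I A" "\<And>i. i \<in> I \<Longrightarrow> closed (A i)" shows "closed (\<Union>i\<in>I. A i)"
proof -
  have *: "\<exists>T. open T \<and> x \<in> T \<and> T \<subseteq> - (\<Union>i\<in>I. A i)" if x: "x \<in> - (\<Union>i\<in>I. A i)" for x
  proof -
    obtain U where U: "open U" "x \<in> U" "finite {i\<in>I. A i \<inter> U \<noteq> {}}" using assms(1) by (auto simp: loc_finite_def)
    let ?T = "U - (\<Union>i\<in>{i\<in>I. A i \<inter> U \<noteq> {}}. A i)"
    have "open ?T" using U assms(2) by (intro open_Diff closed_UN) auto
    moreover have "x \<in> ?T" "?T \<subseteq> - (\<Union>i\<in>I. A i)" using x U by auto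
    ultimately show ?thesis by blast
  qed
  have "open (- (\<Union>i\<in>I. A i))" by (subst open_subopen, intro ballI *)
  then show ?thesis by (simp add: closed_def)
qed

lemma loc_finite_compact:
  assumes "loc_finite I A" "compact K" shows "finite {i\<in>I. A i \<inter> K \<noteq> {}}"
proof -
  obtain U where U: "\<And>x. open (U x)" "\<And>x. x \<in> U x" "\<And>x. finite {i\<in>I. A i \<inter> U x \<noteq> {}}"
    using assms(1) unfolding loc_finite_def by metis
  obtain C where C: "C \<subseteq> K" "finite C" "K \<subseteq> (\<Union>x\<in>C. U x)"
    using compactE_image[OF assms(2), of K U] U by blast
  have "{i\<in>I. A i \<inter> K \<noteq> {}} \<subseteq> (\<Union>x\<in>C. {i\<in>I. A i \<inter> U x \<noteq> {}})" using C by blast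
  then show ?thesis by (rule finite_subset) (use C U in auto)
qed

lemma infsum_finite_support:
  fixes f :: "'i \<Rightarrow> ennreal"
  assumes "finite F" "F \<subseteq> I" "\<And>i. i \<in> I - F \<Longrightarrow> f i = 0"
  shows "infsum f I = sum f F"
proof -
  have "infsum f I = infsum f F" using assms by (intro infsum_cong_neutral) auto
  then show ?thesis using assms(1) by simp
qed

text \<open>Outer regularity is the delicate point: the neighbourhoods \<open>U i\<close> found for
  the single measures cannot be intersected, as infinite intersections need not be open. Removing
  the sets \<open>A i - U i\<close> from the space works, since their union is closed by local
  finiteness and \<open>\<mu> i\<close> sees only \<open>A i\<close>.\<close>

lemma radon_msum:
  fixes \<mu> :: "'i \<Rightarrow> 'a::t2_space measure"
  assumes cI: "countable I" and lf: "loc_finite I A" and cl: "\<And>i. i \<in> I \<Longrightarrow> closed (A i)"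
    and r: "\<And>i. i \<in> I \<Longrightarrow> radon (\<mu> i)" and cc: "\<And>i. i \<in> I \<Longrightarrow> conc (\<mu> i) (A i)"
  shows "radon (msum I \<mu>)"
proof (rule radonI)
  have s: "i \<in> I \<Longrightarrow> sets (\<mu> i) = sets borel" for i using r by (rule radon_sets)
  note em[simp] = emeasure_msum[of I \<mu>, OF s]
  have nul: "i \<in> I \<Longrightarrow> emeasure (\<mu> i) (UNIV - A i) = 0" for i using conc_null[OF cc cl s] by blast
  show "emeasure (msum I \<mu>) K < \<infinity>" if K: "compact K" for K
  proof -
    let ?F = "{i\<in>I. A i \<inter> K \<noteq> {}}"
    have "emeasure (\<mu> i) K = 0" if "i \<in> I - ?F" for i
    proof -
      have "emeasure (\<mu> i) K \<le> emeasure (\<mu> i) (UNIV - A i)"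
        using that cl s by (intro emeasure_mono) auto
      then show ?thesis using nul that by auto
    qed
    then have "emeasure (msum I \<mu>) K = (\<Sum>i\<in>?F. emeasure (\<mu> i) K)"
      by (subst em, simp, intro infsum_finite_support loc_finite_compact[OF lf K]) auto
    also have "\<dots> < \<infinity>" using r K loc_finite_compact[OF lf K] by (auto simp: radon_compact[unfolded infinity_ennreal_def])
    finally show ?thesis .
  qed
  fix B :: "'a set" and e :: real assume B: "B \<in> sets borel" "emeasure (msum I \<mu>) B < \<infinity>" "e > 0"
  \<comment> \<open>Error weights along an enumeration of the countable \<open>I\<close>, with total
    at most \<open>e\<close>.\<close>
  define w where "w i = e * (1/2) ^ Suc (to_nat_on I i)" for i
  have w: "w i > 0" for i using B by (simp add: w_def)
  have "emeasure (\<mu> i) B < \<infinity>" if "i \<in> I" for i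
  proof -
    have "emeasure (\<mu> i) B = (\<Sum>\<^sub>\<infinity>i\<in>{i}. emeasure (\<mu> i) B)" by simp
    also have "\<dots> \<le> (\<Sum>\<^sub>\<infinity>i\<in>I. emeasure (\<mu> i) B)"
      using that by (intro infsum_mono_neutral nonneg_summable_on_complete) auto
    finally show ?thesis using B by (auto intro: le_less_trans)
  qed
  then have "\<exists>U. open U \<and> B \<subseteq> U \<and> emeasure (\<mu> i) U \<le> emeasure (\<mu> i) B + ennreal (w i)" if "i \<in> I" for i
    using radon_outer_eps[OF r[OF that] B(1) _ w[of i]] that by metis
  then obtain U where U: "\<And>i. i \<in> I \<Longrightarrow> open (U i)" "\<And>i. i \<in> I \<Longrightarrow> B \<subseteq> U i"
     "\<And>i. i \<in> I \<Longrightarrow> emeasure (\<mu> i) (U i) \<le> emeasure (\<mu> i) B + ennreal (w i)" by metis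
  define V where "V = UNIV - (\<Union>i\<in>I. A i - U i)"
  have "closed (\<Union>i\<in>I. A i - U i)"
    using U cl by (intro loc_finite_closed_UN[OF loc_finite_subset[OF lf]] closed_Diff) auto
  then have V: "open V" "B \<subseteq> V" using U by (auto simp: V_def)
  have Vi: "emeasure (\<mu> i) V \<le> emeasure (\<mu> i) B + ennreal (w i)" if "i \<in> I" for i
  proof -
    have "emeasure (\<mu> i) V = emeasure (\<mu> i) (V \<inter> A i)"
      using V cl s nul that by (intro emeasure_conc_Int[symmetric]) auto
    also have "\<dots> \<le> emeasure (\<mu> i) (U i)"
      using that U s by (intro emeasure_mono) (auto simp: V_def)
    finally show ?thesis using U(3)[OF that] by auto
  qed
  have ws: "(\<Sum>\<^sub>\<infinity>i\<in>I. ennreal (w i)) \<le> ennreal e"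
    unfolding infsum_ennreal_SUP
  proof (rule SUP_least, clarify)
    fix F assume F: "finite F" "F \<subseteq> I"
    have inj: "inj_on (to_nat_on I) F" using cI F inj_on_to_nat_on inj_on_subset by blast
    have "(\<Sum>i\<in>F. w i) = (\<Sum>n\<in>to_nat_on I ` F. e * (1/2) ^ Suc n)"
      by (subst sum.reindex[OF inj]) (simp add: w_def)
    also have "\<dots> \<le> e"
    proof -
      have h: "(\<lambda>n. e * (1/2) ^ Suc n) sums e" using sums_mult[OF power_half_series, of e] by simp
      show ?thesis
        using sum_le_suminf[OF sums_summable[OF h], of "to_nat_on I ` F"] F B sums_unique[OF h] by simp
    qed
    finally show "(\<Sum>i\<in>F. ennreal (w i)) \<le> ennreal e"
      using w by (simp add: sum_ennreal less_imp_le ennreal_leI)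
  qed
  have "emeasure (msum I \<mu>) V \<le> (\<Sum>\<^sub>\<infinity>i\<in>I. emeasure (\<mu> i) B + ennreal (w i))"
    using Vi by (simp add: infsum_mono nonneg_summable_on_complete)
  also have "\<dots> = emeasure (msum I \<mu>) B + (\<Sum>\<^sub>\<infinity>i\<in>I. ennreal (w i))"
    by (simp add: infsum_add nonneg_summable_on_complete)
  also have "\<dots> \<le> emeasure (msum I \<mu>) B + ennreal e" by (intro add_left_mono ws)
  finally show "\<exists>U. open U \<and> B \<subseteq> U \<and> emeasure (msum I \<mu>) U \<le> emeasure (msum I \<mu>) B + ennreal e"
    using V by blast
next
  have s: "i \<in> I \<Longrightarrow> sets (\<mu> i) = sets borel" for i using r by (rule radon_sets)
  note em[simp] = emeasure_msum[of I \<mu>, OF s]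
  fix U :: "'a set" assume U: "open U"
  let ?D = "{K. compact K \<and> K \<subseteq> U}"
  have "emeasure (msum I \<mu>) U = (SUP F\<in>{F. finite F \<and> F \<subseteq> I}. \<Sum>i\<in>F. SUP K\<in>?D. emeasure (\<mu> i) K)"
    using radon_inner[OF r U] by (auto simp: infsum_ennreal_SUP intro!: SUP_cong sum.cong)
  also have "\<dots> = (SUP F\<in>{F. finite F \<and> F \<subseteq> I}. SUP K\<in>?D. \<Sum>i\<in>F. emeasure (\<mu> i) K)"
  proof (intro SUP_cong refl sum_SUP_directed_ennreal)
    fix F K L assume F: "F \<in> {F. finite F \<and> F \<subseteq> I}" and "K \<in> ?D" "L \<in> ?D"
    then show "\<exists>M\<in>?D. \<forall>i\<in>F. emeasure (\<mu> i) K \<le> emeasure (\<mu> i) M \<and> emeasure (\<mu> i) L \<le> emeasure (\<mu> i) M"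
      using s by (intro bexI[of _ "K \<union> L"] ballI conjI emeasure_mono) (auto simp: compact_Un borel_closed compact_imp_closed)
  qed auto
  also have "\<dots> = (SUP K\<in>?D. emeasure (msum I \<mu>) K)"
    by (subst SUP_commute) (simp add: infsum_ennreal_SUP)
  finally show "emeasure (msum I \<mu>) U \<le> (SUP K\<in>?D. emeasure (msum I \<mu>) K)" by simp
qed simp

subsection \<open>Potentials and mutual energies\<close>

text \<open>Radon measures need not be \<open>\<sigma>\<close>-finite and \<open>\<kappa>\<close> need not be measurable for the product
  \<open>\<sigma>\<close>-algebra, so Tonelli's theorem for \<open>\<kappa>\<close> is obtained by writing \<open>\<kappa>\<close> as the directed supremum of
  the finite maxima \<open>step_kernel D\<close> of multiples of indicators of open rectangles.\<close>

definition step_kernel :: "('a set \<times> 'a set \<times> ennreal) set \<Rightarrow> 'a \<Rightarrow> 'a \<Rightarrow> ennreal" where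
  "step_kernel D x y = (SUP t\<in>D. snd (snd t) * indicator (fst t) x * indicator (fst (snd t)) y)"

definition minorants :: "'a::topological_space kernel \<Rightarrow> ('a set \<times> 'a set \<times> ennreal) set set" where
  "minorants \<kappa> = {D. finite D \<and> (\<forall>t\<in>D. open (fst t) \<and> open (fst (snd t)) \<and>
      (\<forall>x\<in>fst t. \<forall>y\<in>fst (snd t). snd (snd t) \<le> \<kappa> x y))}"

lemma minorants_nonempty: "minorants \<kappa> \<noteq> {}"
  by (auto simp: minorants_def intro!: exI[of _ "{}"])

lemma minorants_Un: "D \<in> minorants \<kappa> \<Longrightarrow> E \<in> minorants \<kappa> \<Longrightarrow> D \<union> E \<in> minorants \<kappa>"
  by (auto simp: minorants_def)

lemma step_kernel_mono: "D \<subseteq> E \<Longrightarrow> step_kernel D x y \<le> step_kernel E x y"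
  unfolding step_kernel_def by (rule SUP_subset_mono) auto

lemma step_kernel_le: "D \<in> minorants \<kappa> \<Longrightarrow> step_kernel D x y \<le> \<kappa> x y"
  unfolding step_kernel_def by (rule SUP_least) (auto simp: minorants_def indicator_def)

lemma lsc_cmult_indicator: "open V \<Longrightarrow> lsc (\<lambda>y. c * indicator V y)"
  unfolding lsc_def
proof
  fix e assume "open V"
  moreover have "{y. e < c * indicator V y} = (if e < c then V else {})"
    by (auto simp: indicator_def)
  ultimately show "open {y. e < c * indicator V y}" by simp
qed

lemma lsc_step_kernel: "D \<in> minorants \<kappa> \<Longrightarrow> lsc (step_kernel D x)"
  unfolding step_kernel_def[abs_def] by (intro lsc_SUP lsc_cmult_indicator) (auto simp: minorants_def)

lemma lsc_step_kernel': "D \<in> minorants \<kappa> \<Longrightarrow> lsc (\<lambda>x. step_kernel D x y)"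
proof -
  assume D: "D \<in> minorants \<kappa>"
  have "lsc (\<lambda>x. SUP t\<in>D. (snd (snd t) * indicator (fst (snd t)) y) * indicator (fst t) x)"
    using D by (intro lsc_SUP lsc_cmult_indicator) (auto simp: minorants_def)
  then show ?thesis unfolding step_kernel_def by (simp add: ac_simps)
qed

text \<open>Membership in the finitely many rectangle sides splits the space into Borel atoms
  \<open>S P\<close> and \<open>T Q\<close>, and the step kernel is constant on each product of
  atoms. Both iterated integrals become the same finite double sum.\<close>

lemma nn_integral_step_kernel_commute:
  assumes D: "D \<in> minorants \<kappa>" and s: "sets \<mu> = sets borel" "sets \<nu> = sets borel"
  shows "(\<integral>\<^sup>+ x. \<integral>\<^sup>+ y. step_kernel D x y \<partial>\<nu> \<partial>\<mu>) = (\<integral>\<^sup>+ y. \<integral>\<^sup>+ x. step_kernel D x y \<partial>\<mu> \<partial>\<nu>)"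
proof -
  have fin: "finite D" using D by (simp add: minorants_def)
  define S where "S P = {x. \<forall>t\<in>D. x \<in> fst t \<longleftrightarrow> t \<in> P}" for P
  define T where "T P = {x. \<forall>t\<in>D. x \<in> fst (snd t) \<longleftrightarrow> t \<in> P}" for P
  define F where "F P Q = (SUP t\<in>P \<inter> Q. snd (snd t))" for P Q :: "('a set \<times> 'a set \<times> ennreal) set"
  have S: "S P \<in> sets borel" for P
  proof -
    have "S P = (\<Inter>t\<in>D. if t \<in> P then fst t else - fst t)" by (auto simp: S_def split: if_splits)
    moreover have "(\<Inter>t\<in>D. if t \<in> P then fst t else - fst t) \<in> sets borel"
    proof (cases "D = {}")
      case False
      have "(if t \<in> P then fst t else - fst t) \<in> sets borel" if "t \<in> D" for t
        using D that by (auto simp: minorants_def)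
      then show ?thesis by (intro sets.finite_INT fin False)
    qed simp
    ultimately show ?thesis by simp
  qed
  have T: "T P \<in> sets borel" for P
  proof -
    have "T P = (\<Inter>t\<in>D. if t \<in> P then fst (snd t) else - fst (snd t))" by (auto simp: T_def split: if_splits)
    moreover have "(\<Inter>t\<in>D. if t \<in> P then fst (snd t) else - fst (snd t)) \<in> sets borel"
    proof (cases "D = {}")
      case False
      have "(if t \<in> P then fst (snd t) else - fst (snd t)) \<in> sets borel" if "t \<in> D" for t
        using D that by (auto simp: minorants_def)
      then show ?thesis by (intro sets.finite_INT fin False)
    qed simp
    ultimately show ?thesis by simp
  qed
  have eq: "step_kernel D x y = (\<Sum>P\<in>Pow D. \<Sum>Q\<in>Pow D. F P Q * indicator (S P) x * indicator (T Q) y)" for x y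
  proof -
    let ?P = "{t\<in>D. x \<in> fst t}" and ?Q = "{t\<in>D. y \<in> fst (snd t)}"
    have ind: "indicator (S P) x = (if P = ?P then 1 else 0 :: ennreal)"
              "indicator (T P) y = (if P = ?Q then 1 else 0 :: ennreal)" if "P \<in> Pow D" for P
      using that by (auto simp: S_def T_def indicator_def)
    have "(\<Sum>P\<in>Pow D. \<Sum>Q\<in>Pow D. F P Q * indicator (S P) x * indicator (T Q) y)
        = (\<Sum>P\<in>Pow D. \<Sum>Q\<in>Pow D. if Q = ?Q then (if P = ?P then F P Q else 0) else 0)"
      by (intro sum.cong refl) (simp add: ind)
    also have "\<dots> = F ?P ?Q" using fin by simp
    also have "\<dots> = step_kernel D x y"
    proof (rule antisym)
      show "F ?P ?Q \<le> step_kernel D x y"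
        unfolding F_def step_kernel_def by (intro SUP_mono) force
      show "step_kernel D x y \<le> F ?P ?Q"
        unfolding F_def step_kernel_def by (intro SUP_least) (auto simp: indicator_def intro: SUP_upper)
    qed
    finally show ?thesis by simp
  qed
  have [measurable]: "S P \<in> sets \<mu>" "T P \<in> sets \<nu>" for P using S T s by auto
  have "(\<integral>\<^sup>+ x. \<integral>\<^sup>+ y. step_kernel D x y \<partial>\<nu> \<partial>\<mu>) = (\<Sum>P\<in>Pow D. \<Sum>Q\<in>Pow D. F P Q * emeasure \<mu> (S P) * emeasure \<nu> (T Q))"
    unfolding eq by (simp add: nn_integral_sum nn_integral_cmult nn_integral_multc)
  moreover have "(\<integral>\<^sup>+ y. \<integral>\<^sup>+ x. step_kernel D x y \<partial>\<mu> \<partial>\<nu>) = (\<Sum>P\<in>Pow D. \<Sum>Q\<in>Pow D. F P Q * emeasure \<mu> (S P) * emeasure \<nu> (T Q))"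
    unfolding eq by (simp add: nn_integral_sum nn_integral_cmult nn_integral_multc)
  ultimately show ?thesis by simp
qed

text \<open>On the intersection of all first sides containing \<open>x0\<close> the step kernel can
  only grow, for every \<open>y\<close> at once; hence so does the integral, without any limit
  theorem.\<close>

lemma lsc_nn_integral_step_kernel:
  assumes D: "D \<in> minorants \<kappa>"
  shows "lsc (\<lambda>x. \<integral>\<^sup>+ y. step_kernel D x y \<partial>\<nu>)"
  unfolding lsc_def
proof
  fix e
  let ?S = "{x. e < (\<integral>\<^sup>+ y. step_kernel D x y \<partial>\<nu>)}"
  have "\<exists>W. open W \<and> x0 \<in> W \<and> W \<subseteq> ?S" if x0: "x0 \<in> ?S" for x0
  proof -
    let ?W = "\<Inter>t\<in>{t\<in>D. x0 \<in> fst t}. fst t"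
    have "open ?W" using D by (intro open_INT) (auto simp: minorants_def)
    moreover have "x \<in> ?S" if "x \<in> ?W" for x
    proof -
      have "step_kernel D x0 y \<le> step_kernel D x y" for y
      proof -
        have "snd (snd t) * indicator (fst t) x0 * indicator (fst (snd t)) y
            \<le> snd (snd t) * indicator (fst t) x * indicator (fst (snd t)) y" if "t \<in> D" for t
        proof -
          have "x0 \<in> fst t \<Longrightarrow> x \<in> fst t" using that \<open>x \<in> ?W\<close> by blast
          then show ?thesis by (intro mult_right_mono mult_left_mono) (auto simp: indicator_def)
        qed
        then show ?thesis unfolding step_kernel_def by (intro SUP_mono) blast
      qed
      then have "(\<integral>\<^sup>+ y. step_kernel D x0 y \<partial>\<nu>) \<le> (\<integral>\<^sup>+ y. step_kernel D x y \<partial>\<nu>)"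
        by (intro nn_integral_mono)
      then show ?thesis using x0 by auto
    qed
    ultimately show ?thesis by blast
  qed
  then show "open ?S" by (subst open_subopen) blast
qed

section \<open>Symmetry, bilinearity and compact exhaustion of the mutual energy\<close>

locale lsc_kernel =
  fixes \<kappa> :: "'a::t2_space kernel"
  assumes basic: "kernel_basic \<kappa>"
begin

lemma kernel_sym: "\<kappa> x y = \<kappa> y x"
  using basic unfolding kernel_basic_def by blast

lemma kernel_open: "open {z. c < \<kappa> (fst z) (snd z)}"
  using basic unfolding kernel_basic_def by blast

lemma kernel_eq_SUP: "\<kappa> x y = (SUP D\<in>minorants \<kappa>. step_kernel D x y)"
proof (rule antisym)
  show "\<kappa> x y \<le> (SUP D\<in>minorants \<kappa>. step_kernel D x y)"
  proof (rule dense_le)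
    fix c assume c: "c < \<kappa> x y"
    obtain U V where UV: "open U" "open V" "(x, y) \<in> U \<times> V" "U \<times> V \<subseteq> {z. c < \<kappa> (fst z) (snd z)}"
      using open_prod_elim[OF kernel_open, of "(x, y)" c] c by auto
    then have "{(U, V, c)} \<in> minorants \<kappa>" by (fastforce simp: minorants_def)
    moreover have "c \<le> step_kernel {(U, V, c)} x y" using UV by (simp add: step_kernel_def)
    ultimately show "c \<le> (SUP D\<in>minorants \<kappa>. step_kernel D x y)" by (meson SUP_upper2)
  qed
  show "(SUP D\<in>minorants \<kappa>. step_kernel D x y) \<le> \<kappa> x y"
    by (intro SUP_least step_kernel_le)
qed

lemma lsc_kernel: "lsc (\<kappa> x)"
proof -
  have "lsc (\<lambda>y. SUP D\<in>minorants \<kappa>. step_kernel D x y)" by (intro lsc_SUP lsc_step_kernel)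
  then show ?thesis by (simp add: kernel_eq_SUP[symmetric])
qed

lemma kernel_borel[measurable]: "\<kappa> x \<in> borel_measurable borel"
  by (intro lsc_borel lsc_kernel)

lemma pot_eq_SUP:
  assumes r: "radon \<nu>"
  shows "pot \<kappa> \<nu> x = (SUP D\<in>minorants \<kappa>. \<integral>\<^sup>+ y. step_kernel D x y \<partial>\<nu>)"
proof -
  have "pot \<kappa> \<nu> x = (\<integral>\<^sup>+ y. (SUP D\<in>minorants \<kappa>. step_kernel D x y) \<partial>\<nu>)"
    unfolding pot_def by (intro nn_integral_cong kernel_eq_SUP)
  also have "\<dots> = (SUP D\<in>minorants \<kappa>. \<integral>\<^sup>+ y. step_kernel D x y \<partial>\<nu>)"
  proof (rule nn_integral_SUP_lsc_directed[OF r minorants_nonempty lsc_step_kernel])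
    fix D E assume DE: "D \<in> minorants \<kappa>" "E \<in> minorants \<kappa>"
    show "\<exists>F\<in>minorants \<kappa>. step_kernel D x \<le> step_kernel F x \<and> step_kernel E x \<le> step_kernel F x"
      by (intro bexI[OF _ minorants_Un[OF DE]] conjI le_funI step_kernel_mono) auto
  qed
  finally show ?thesis .
qed

lemma lsc_pot: "radon \<nu> \<Longrightarrow> lsc (pot \<kappa> \<nu>)"
proof -
  assume r: "radon \<nu>"
  have "lsc (\<lambda>x. SUP D\<in>minorants \<kappa>. \<integral>\<^sup>+ y. step_kernel D x y \<partial>\<nu>)"
    by (intro lsc_SUP lsc_nn_integral_step_kernel)
  then show ?thesis by (simp add: pot_eq_SUP[OF r, symmetric])
qed

lemma pot_borel: "radon \<nu> \<Longrightarrow> pot \<kappa> \<nu> \<in> borel_measurable borel"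
  by (intro lsc_borel lsc_pot)

lemma kint_eq_SUP:
  assumes r: "radon \<mu>" "radon \<nu>"
  shows "kint \<kappa> \<mu> \<nu> = (SUP D\<in>minorants \<kappa>. \<integral>\<^sup>+ x. \<integral>\<^sup>+ y. step_kernel D x y \<partial>\<nu> \<partial>\<mu>)"
  unfolding kint_def pot_eq_SUP[OF r(2)]
proof (rule nn_integral_SUP_lsc_directed[OF r(1) minorants_nonempty lsc_nn_integral_step_kernel])
  fix D E assume DE: "D \<in> minorants \<kappa>" "E \<in> minorants \<kappa>"
  show "\<exists>F\<in>minorants \<kappa>. (\<lambda>x. \<integral>\<^sup>+ y. step_kernel D x y \<partial>\<nu>) \<le> (\<lambda>x. \<integral>\<^sup>+ y. step_kernel F x y \<partial>\<nu>) \<and>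
      (\<lambda>x. \<integral>\<^sup>+ y. step_kernel E x y \<partial>\<nu>) \<le> (\<lambda>x. \<integral>\<^sup>+ y. step_kernel F x y \<partial>\<nu>)"
    by (intro bexI[OF _ minorants_Un[OF DE]] conjI le_funI nn_integral_mono step_kernel_mono) auto
qed

text \<open>Both orders of integration are suprema over the same minorants, and for a single
  minorant the order does not matter by \<open>nn_integral_step_kernel_commute\<close>.\<close>

lemma kint_sym:
  assumes r: "radon \<mu>" "radon \<nu>"
  shows "kint \<kappa> \<mu> \<nu> = kint \<kappa> \<nu> \<mu>"
proof -
  let ?J = "\<lambda>D y. \<integral>\<^sup>+ x. step_kernel D x y \<partial>\<mu>"
  have lsc_J: "lsc (?J D)" if D: "D \<in> minorants \<kappa>" for D
  proof -
    \<comment> \<open>Exchanging the two sides of every rectangle gives a minorant again by symmetry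
      of \<kappa>, so lower semicontinuity in the other variable follows from the case already
      treated.\<close>
    let ?f = "\<lambda>t. (fst (snd t), fst t, snd (snd t)) :: 'a set \<times> 'a set \<times> ennreal"
    have "?f ` D \<in> minorants \<kappa>" using D by (fastforce simp: minorants_def kernel_sym)
    moreover have "step_kernel (?f ` D) y x = step_kernel D x y" for x y
      unfolding step_kernel_def by (simp add: image_comp o_def ac_simps)
    ultimately show ?thesis using lsc_nn_integral_step_kernel[of "?f ` D" \<kappa> \<mu>] by simp
  qed
  have "pot \<kappa> \<mu> y = (SUP D\<in>minorants \<kappa>. ?J D y)" for y
  proof -
    have "pot \<kappa> \<mu> y = (\<integral>\<^sup>+ x. (SUP D\<in>minorants \<kappa>. step_kernel D x y) \<partial>\<mu>)"
      unfolding pot_def by (intro nn_integral_cong) (subst kernel_sym, rule kernel_eq_SUP)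
    also have "\<dots> = (SUP D\<in>minorants \<kappa>. ?J D y)"
    proof (rule nn_integral_SUP_lsc_directed[OF r(1) minorants_nonempty lsc_step_kernel'])
      fix D E assume DE: "D \<in> minorants \<kappa>" "E \<in> minorants \<kappa>"
      show "\<exists>F\<in>minorants \<kappa>. (\<lambda>x. step_kernel D x y) \<le> (\<lambda>x. step_kernel F x y) \<and>
          (\<lambda>x. step_kernel E x y) \<le> (\<lambda>x. step_kernel F x y)"
        by (intro bexI[OF _ minorants_Un[OF DE]] conjI le_funI step_kernel_mono) auto
    qed
    finally show ?thesis .
  qed
  then have "kint \<kappa> \<nu> \<mu> = (\<integral>\<^sup>+ y. (SUP D\<in>minorants \<kappa>. ?J D y) \<partial>\<nu>)"
    unfolding kint_def by (intro nn_integral_cong)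
  also have "\<dots> = (SUP D\<in>minorants \<kappa>. \<integral>\<^sup>+ y. ?J D y \<partial>\<nu>)"
  proof (rule nn_integral_SUP_lsc_directed[OF r(2) minorants_nonempty lsc_J])
    fix D E assume DE: "D \<in> minorants \<kappa>" "E \<in> minorants \<kappa>"
    show "\<exists>F\<in>minorants \<kappa>. ?J D \<le> ?J F \<and> ?J E \<le> ?J F"
      by (intro bexI[OF _ minorants_Un[OF DE]] conjI le_funI nn_integral_mono step_kernel_mono) auto
  qed
  also have "\<dots> = kint \<kappa> \<mu> \<nu>"
    unfolding kint_eq_SUP[OF r]
    by (intro SUP_cong refl nn_integral_step_kernel_commute[symmetric]) (use r in \<open>auto simp: radon_sets\<close>)
  finally show ?thesis by simp
qed

lemma kint_madd_left:
  assumes "radon \<mu>" "radon \<mu>'" "radon \<nu>"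
  shows "kint \<kappa> (madd \<mu> \<mu>') \<nu> = kint \<kappa> \<mu> \<nu> + kint \<kappa> \<mu>' \<nu>"
  unfolding kint_def using assms by (intro nn_integral_madd pot_borel) (auto simp: radon_sets)

lemma kint_madd_right:
  assumes "radon \<mu>" "radon \<nu>" "radon \<nu>'"
  shows "kint \<kappa> \<mu> (madd \<nu> \<nu>') = kint \<kappa> \<mu> \<nu> + kint \<kappa> \<mu> \<nu>'"
  using assms 
  by (simp add: kint_sym[OF assms(1) radon_madd[OF assms(2,3)]] kint_madd_left
      kint_sym[OF assms(1,2)] kint_sym[OF assms(1,3)])

lemma kint_scale_left:
  assumes "radon \<mu>" "radon \<nu>"
  shows "kint \<kappa> (scale_measure (ennreal t) \<mu>) \<nu> = ennreal t * kint \<kappa> \<mu> \<nu>"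
  unfolding kint_def by (rule nn_integral_scale_measure[OF radon_meas[OF assms(1) pot_borel[OF assms(2)]]])

lemma kint_scale_right:
  assumes "radon \<mu>" "radon \<nu>" "t \<ge> 0"
  shows "kint \<kappa> \<mu> (scale_measure (ennreal t) \<nu>) = ennreal t * kint \<kappa> \<mu> \<nu>"
  using assms 
  by (simp add: kint_sym[OF assms(1) radon_scale[OF assms(2,3)]] kint_scale_left kint_sym[OF assms(1,2)])

lemma kint_restr_left:
  assumes "radon \<mu>" "radon \<nu>" "B \<in> sets borel"
  shows "kint \<kappa> (restr B \<mu>) \<nu> = (\<integral>\<^sup>+ x. indicator B x * pot \<kappa> \<nu> x \<partial>\<mu>)"
  unfolding kint_def using assms by (intro nn_integral_restr pot_borel) (auto simp: radon_sets)

lemma kint_restr_left_le: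
  assumes "radon \<mu>" "radon \<nu>" "B \<in> sets borel"
  shows "kint \<kappa> (restr B \<mu>) \<nu> \<le> kint \<kappa> \<mu> \<nu>"
  by (subst kint_restr_left[OF assms], unfold kint_def, intro nn_integral_mono) (auto simp: indicator_def)

lemma kint_restr_le:
  assumes "radon \<mu>" "radon \<nu>" "B \<in> sets borel" "C \<in> sets borel" "radon (restr B \<mu>)" "radon (restr C \<nu>)"
  shows "kint \<kappa> (restr B \<mu>) (restr C \<nu>) \<le> kint \<kappa> \<mu> \<nu>"
proof -
  have "kint \<kappa> (restr B \<mu>) (restr C \<nu>) \<le> kint \<kappa> \<mu> (restr C \<nu>)"
    using assms by (intro kint_restr_left_le)
  also have "\<dots> = kint \<kappa> (restr C \<nu>) \<mu>" using assms by (intro kint_sym)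
  also have "\<dots> \<le> kint \<kappa> \<nu> \<mu>" using assms by (intro kint_restr_left_le)
  also have "\<dots> = kint \<kappa> \<mu> \<nu>" using assms by (intro kint_sym)
  finally show ?thesis .
qed

lemma kint_compact_exhaustion_left:
  assumes "radon \<mu>" "radon \<nu>"
  shows "kint \<kappa> \<mu> \<nu> = (SUP K\<in>{K. compact K}. kint \<kappa> (restr K \<mu>) \<nu>)"
proof -
  have "kint \<kappa> \<mu> \<nu> = (SUP K\<in>{K. compact K}. \<integral>\<^sup>+ x. indicator K x * pot \<kappa> \<nu> x \<partial>\<mu>)"
    unfolding kint_def by (rule nn_integral_lsc_compact_exhaustion[OF assms(1) lsc_pot[OF assms(2)]])
  also have "\<dots> = (SUP K\<in>{K. compact K}. kint \<kappa> (restr K \<mu>) \<nu>)"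
    by (intro SUP_cong refl kint_restr_left[OF assms, symmetric]) (auto simp: borel_closed compact_imp_closed)
  finally show ?thesis .
qed

text \<open>Exhaust in one variable, then in the other; the mixed term for \<open>K\<close> and
  \<open>L\<close> is at most the term for \<open>K \<union> L\<close>.\<close>

lemma kint_compact_exhaustion:
  assumes r: "radon \<mu>"
  shows "kint \<kappa> \<mu> \<mu> = (SUP K\<in>{K. compact K}. kint \<kappa> (restr K \<mu>) (restr K \<mu>))"
proof (rule antisym)
  have rK: "radon (restr K \<mu>)" if "compact K" for K by (rule radon_restr_compact[OF r that])
  have KB: "K \<in> sets borel" if "compact K" for K :: "'a set" using that by (simp add: borel_closed compact_imp_closed)
  have "kint \<kappa> \<mu> \<mu> = (SUP K\<in>{K. compact K}. kint \<kappa> (restr K \<mu>) \<mu>)"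
    by (rule kint_compact_exhaustion_left[OF r r])
  also have "\<dots> = (SUP K\<in>{K. compact K}. SUP L\<in>{K. compact K}. kint \<kappa> (restr L \<mu>) (restr K \<mu>))"
  proof (intro SUP_cong refl)
    fix K :: "'a set" assume K: "K \<in> {K. compact K}"
    have "kint \<kappa> (restr K \<mu>) \<mu> = kint \<kappa> \<mu> (restr K \<mu>)" using K r rK by (intro kint_sym) auto
    also have "\<dots> = (SUP L\<in>{K. compact K}. kint \<kappa> (restr L \<mu>) (restr K \<mu>))"
      using K r rK by (intro kint_compact_exhaustion_left) auto
    finally show "kint \<kappa> (restr K \<mu>) \<mu> = (SUP L\<in>{K. compact K}. kint \<kappa> (restr L \<mu>) (restr K \<mu>))" .
  qed
  also have "\<dots> \<le> (SUP K\<in>{K. compact K}. kint \<kappa> (restr K \<mu>) (restr K \<mu>))"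
  proof (intro SUP_least)
    fix K L :: "'a set" assume K: "K \<in> {K. compact K}" and L: "L \<in> {K. compact K}"
    have cKL: "compact (K \<union> L)" using K L by (simp add: compact_Un)
    have eq: "restr M (restr (K \<union> L) \<mu>) = restr M \<mu>" if "compact M" "M \<subseteq> K \<union> L" for M
      using KB[OF that(1)] KB[OF cKL] r that(2)
      by (intro measure_eqI) (auto simp: emeasure_restr radon_sets intro!: arg_cong[where f="emeasure \<mu>"])
    have "kint \<kappa> (restr L (restr (K \<union> L) \<mu>)) (restr K (restr (K \<union> L) \<mu>)) \<le> kint \<kappa> (restr (K \<union> L) \<mu>) (restr (K \<union> L) \<mu>)"
      by (rule kint_restr_le) (use K L KB rK cKL eq in auto)
    then have "kint \<kappa> (restr L \<mu>) (restr K \<mu>) \<le> kint \<kappa> (restr (K \<union> L) \<mu>) (restr (K \<union> L) \<mu>)"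
      using K L by (simp add: eq)
    also have "\<dots> \<le> (SUP K\<in>{K. compact K}. kint \<kappa> (restr K \<mu>) (restr K \<mu>))"
      using cKL by (intro SUP_upper) auto
    finally show "kint \<kappa> (restr L \<mu>) (restr K \<mu>) \<le> (SUP K\<in>{K. compact K}. kint \<kappa> (restr K \<mu>) (restr K \<mu>))" .
  qed
  finally show "kint \<kappa> \<mu> \<mu> \<le> (SUP K\<in>{K. compact K}. kint \<kappa> (restr K \<mu>) (restr K \<mu>))" .
  show "(SUP K\<in>{K. compact K}. kint \<kappa> (restr K \<mu>) (restr K \<mu>)) \<le> kint \<kappa> \<mu> \<mu>"
    using r rK KB by (intro SUP_least kint_restr_le) auto
qed

end

lemma nn_integral_le_incseq:
  assumes "sets p = sets borel" "f \<in> borel_measurable borel" "incseq C" "\<And>j. C j \<in> sets borel"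
    and "emeasure p (UNIV - (\<Union>j. C j)) = 0"
    and "\<And>j::nat. (\<integral>\<^sup>+ x. indicator (C j) x * f x \<partial>p) \<le> b"
  shows "(\<integral>\<^sup>+ x. f x \<partial>p) \<le> b"
proof -
  have [measurable]: "f \<in> borel_measurable p" "\<And>j. C j \<in> sets p" using assms borel_measurable_cong_sets by auto
  have "AE x in p. x \<in> (\<Union>j. C j)"
    by (rule AE_I'[of "UNIV - (\<Union>j. C j)"]) (use assms(1,4,5) in \<open>auto simp: null_sets_def\<close>)
  then have "(\<integral>\<^sup>+ x. f x \<partial>p) = (\<integral>\<^sup>+ x. (SUP j. indicator (C j) x * f x) \<partial>p)"
  proof (intro nn_integral_cong_AE, eventually_elim)
    fix x assume "x \<in> (\<Union>j. C j)"
    then obtain j where "x \<in> C j" by auto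
    then show "f x = (SUP j. indicator (C j) x * f x)"
      by (intro antisym SUP_upper2[of j] SUP_least) (auto simp: indicator_def)
  qed
  also have "\<dots> = (SUP j. \<integral>\<^sup>+ x. indicator (C j) x * f x \<partial>p)"
    using assms(3) by (intro nn_integral_monotone_convergence_SUP) (auto simp: mono_def le_fun_def indicator_def subset_eq)
  also have "\<dots> \<le> b" by (intro SUP_least assms(6))
  finally show ?thesis .
qed

subsection \<open>Finite energy measures live on \<open>\<sigma>\<close>-compact clopen sets\<close>

definition dirac :: "'a::topological_space \<Rightarrow> 'a measure" where
  "dirac x = distr (count_space (UNIV :: unit set)) borel (\<lambda>_. x)"

lemma sets_dirac[simp]: "sets (dirac x) = sets borel"
  by (simp add: dirac_def)

lemma nn_integral_dirac: "f \<in> borel_measurable borel \<Longrightarrow> (\<integral>\<^sup>+ y. f y \<partial>dirac x) = f x"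
  unfolding dirac_def by (subst nn_integral_distr) (auto simp: nn_integral_count_space_finite)

lemma emeasure_dirac: "B \<in> sets borel \<Longrightarrow> emeasure (dirac x) B = indicator B x"
  using nn_integral_dirac[of "indicator B" x] by (simp add: nn_integral_indicator)

lemma radon_dirac: "radon (dirac (x::'a::t2_space))"
proof (rule radonI)
  have KB: "K \<in> sets borel" if "compact K" for K :: "'a set" using that by (simp add: borel_closed compact_imp_closed)
  show "emeasure (dirac x) K < \<infinity>" if "compact K" for K
    using KB[OF that] by (simp add: emeasure_dirac indicator_def)
  show "\<exists>U. open U \<and> B \<subseteq> U \<and> emeasure (dirac x) U \<le> emeasure (dirac x) B + ennreal e"
    if "B \<in> sets borel" for B e
  proof (cases "x \<in> B")
    case True
    then show ?thesis using that by (intro exI[of _ UNIV]) (auto simp: emeasure_dirac)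
  next
    case False
    then show ?thesis using that by (intro exI[of _ "- {x}"]) (auto simp: emeasure_dirac)
  qed
  show "emeasure (dirac x) U \<le> (SUP K\<in>{K. compact K \<and> K \<subseteq> U}. emeasure (dirac x) K)" if "open U" for U
  proof (cases "x \<in> U")
    case True
    then show ?thesis using that by (intro SUP_upper2[of "{x}"]) (auto simp: emeasure_dirac)
  next
    case False
    then show ?thesis using that by (simp add: emeasure_dirac)
  qed
qed simp

lemma radon_null: "radon (null_measure (borel :: 'a::t2_space measure))"
  by (rule radonI) (auto intro!: exI[of _ UNIV])

lemma kint_null_right[simp]: "kint \<kappa> \<mu> (null_measure borel) = 0"
  unfolding kint_def pot_def by (simp add: nn_integral_null_measure)

lemma kint_null_left[simp]: "kint \<kappa> (null_measure borel) \<mu> = 0"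
  unfolding kint_def by (simp add: nn_integral_null_measure)

locale energy_kernel = lsc_kernel +
  assumes spd: "kernel_spd \<kappa>" and offdiag: "kernel_offdiag \<kappa>" and vanishing: "kernel_vanishing \<kappa>"
begin

lemma zero_energy_imp_null:
  assumes "radon \<nu>" "kint \<kappa> \<nu> \<nu> = 0"
  shows "emeasure \<nu> UNIV = 0"
proof -
  have "inE \<kappa> (\<nu>, null_measure borel)"
    using assms radon_null by (auto simp: inE_def finen_def msingular_def intro!: bexI[of _ UNIV])
  moreover have "ip \<kappa> (\<nu>, null_measure borel) (\<nu>, null_measure borel) = 0"
    using assms by (simp add: ip_def)
  ultimately show ?thesis using spd unfolding kernel_spd_def by (metis fst_conv)
qed

text \<open>The point mass at \<open>x\<close> has energy \<open>\<kappa> x x\<close>, and strict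
  positive definiteness forbids energy zero for a nonzero measure.\<close>

lemma kernel_diag_pos: "0 < \<kappa> x x"
proof (rule ccontr)
  assume "\<not> 0 < \<kappa> x x"
  moreover have "kint \<kappa> (dirac x) (dirac x) = \<kappa> x x"
    unfolding kint_def using pot_borel[OF radon_dirac]
    by (simp add: nn_integral_dirac) (simp add: pot_def nn_integral_dirac kernel_borel)
  ultimately have "emeasure (dirac x) UNIV = 0"
    by (intro zero_energy_imp_null radon_dirac) simp
  then show False by (simp add: emeasure_dirac)
qed

text \<open>Around each \<open>x\<close> there is an open \<open>U x\<close> on whose square \<open>\<kappa>\<close> exceeds some \<open>c x > 0\<close>. Since \<open>\<kappa>\<close>
  vanishes at infinity, the \<open>U x\<close> with \<open>c x \<ge> 1/m\<close> that meet a given compact set lie in a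
  single compact set; iterating this yields a \<open>\<sigma>\<close>-compact set containing every \<open>U x\<close> it meets.\<close>

lemma sigma_compact_clopen:
  assumes K0: "\<And>n::nat. compact (K0 n)"
  obtains K :: "nat \<Rightarrow> 'a set" where "\<And>n. compact (K n)" "(\<Union>n. K0 n) \<subseteq> (\<Union>n. K n)"
    "open (\<Union>n. K n)" "closed (\<Union>n. K n)"
proof -
  have "\<exists>U c. open U \<and> x \<in> U \<and> c > 0 \<and> (\<forall>y\<in>U. \<forall>z\<in>U. ennreal c < \<kappa> y z)" for x
  proof -
    obtain c' where c': "0 < c'" "c' < \<kappa> x x" using dense kernel_diag_pos by blast
    then obtain c where c: "c' = ennreal c" by (cases c') auto
    obtain U V where UV: "open U" "open V" "(x, x) \<in> U \<times> V" "U \<times> V \<subseteq> {z. c' < \<kappa> (fst z) (snd z)}"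
      using open_prod_elim[OF kernel_open, of "(x, x)" c'] c' by auto
    then show ?thesis using c c' by (intro exI[of _ "U \<inter> V"] exI[of _ c]) auto
  qed
  then obtain U c where U: "\<And>x. open (U x)" "\<And>x. x \<in> U x" "\<And>x. c x > 0"
      "\<And>x y z. y \<in> U x \<Longrightarrow> z \<in> U x \<Longrightarrow> ennreal (c x) < \<kappa> y z" by metis
  have "\<exists>K'. compact K' \<and> (\<forall>x\<in>C. \<forall>y. y \<notin> K' \<longrightarrow> \<kappa> x y < ennreal (1 / (real m + 1)))" if "compact C" for C m
    using vanishing that unfolding kernel_vanishing_def by (metis add_nonneg_pos divide_pos_pos of_nat_0_le_iff zero_less_one)
  then obtain K' where K': "\<And>C m. compact C \<Longrightarrow> compact (K' C m)"
     "\<And>C m x y. compact C \<Longrightarrow> x \<in> C \<Longrightarrow> y \<notin> K' C m \<Longrightarrow> \<kappa> x y < ennreal (1 / (real m + 1))" by metis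
  \<comment> \<open>Stage \<open>j + 1\<close> adds to the \<open>i\<close>-th compact set of stage
    \<open>j\<close>, for each \<open>m\<close>, the compact set outside which \<kappa> is below
    \<open>1 / (m + 1)\<close>; the pairs \<open>(i, m)\<close> are coded by
    \<open>prod_decode\<close>.\<close>
  define S where "S = rec_nat K0 (\<lambda>_ F n. F (fst (prod_decode n)) \<union> K' (F (fst (prod_decode n))) (snd (prod_decode n)))"
  have S0: "S 0 = K0" and SS: "S (Suc j) n = S j (fst (prod_decode n)) \<union> K' (S j (fst (prod_decode n))) (snd (prod_decode n))" for j n
    by (auto simp: S_def)
  have Sc: "compact (S j n)" for j n
    by (induction j arbitrary: n) (auto simp: S0 SS K0 K' compact_Un)
  define K where "K n = S (fst (prod_decode n)) (snd (prod_decode n))" for n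
  have SK: "S j n \<subseteq> (\<Union>n. K n)" for j n
    unfolding K_def using UN_upper[of "prod_encode (j, n)" UNIV "\<lambda>n. S (fst (prod_decode n)) (snd (prod_decode n))"] by simp
  have meet: "U x \<subseteq> (\<Union>n. K n)" if yU: "y \<in> U x" and yK: "y \<in> (\<Union>n. K n)" for x y
  proof
    fix z assume z: "z \<in> U x"
    obtain n where "y \<in> K n" using yK by blast
    then obtain j i where y: "y \<in> S j i" by (auto simp: K_def)
    obtain m where m: "1 / (real m + 1) < c x"
      using nat_approx_posE[OF U(3)[of x]] by (metis Suc_eq_plus1 of_nat_Suc add.commute)
    have "z \<in> K' (S j i) m"
    proof (rule ccontr)
      assume "z \<notin> K' (S j i) m"
      then have "\<kappa> y z < ennreal (1 / (real m + 1))" using K'(2)[OF Sc y] by blast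
      also have "\<dots> \<le> ennreal (c x)" using m by (intro ennreal_leI) simp
      finally show False using U(4)[OF yU z] by simp
    qed
    then have "z \<in> S (Suc j) (prod_encode (i, m))" by (simp add: SS)
    then show "z \<in> (\<Union>n. K n)" using SK by blast
  qed
  have "open (\<Union>n. K n)"
  proof (subst open_subopen, intro ballI)
    fix x assume x: "x \<in> (\<Union>n. K n)"
    then show "\<exists>T. open T \<and> x \<in> T \<and> T \<subseteq> (\<Union>n. K n)"
      using meet[OF U(2)[of x] x] U(1,2)[of x] by blast
  qed
  moreover have "open (- (\<Union>n. K n))"
  proof (subst open_subopen, intro ballI)
    fix x assume x: "x \<in> - (\<Union>n. K n)"
    have "U x \<subseteq> - (\<Union>n. K n)"
    proof
      fix y assume y: "y \<in> U x"
      show "y \<in> - (\<Union>n. K n)"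
      proof
        assume "y \<in> (\<Union>n. K n)"
        then show False using meet[OF y] U(2)[of x] x by blast
      qed
    qed
    then show "\<exists>T. open T \<and> x \<in> T \<and> T \<subseteq> - (\<Union>n. K n)"
      using U(1,2)[of x] by blast
  qed
  moreover have "(\<Union>n. K0 n) \<subseteq> (\<Union>n. K n)" using SK[of 0] S0 by (simp add: UN_least)
  moreover have "compact (K n)" for n by (simp add: K_def Sc)
  ultimately show ?thesis using that[of K] unfolding closed_def by blast
qed

text \<open>Choose compact sets whose energies approach the total, and enlarge them to a clopen
  \<sigma>-compact set. A compact set disjoint from it adds its energy to theirs; the total being
  finite, this energy is zero, and so is the mass. Inner regularity on the open complement
  concludes.\<close>

lemma finite_energy_moderated:
  assumes "inEp \<kappa> \<mu>" shows "moderated \<mu>"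
proof -
  have r: "radon \<mu>" and fin: "kint \<kappa> \<mu> \<mu> < \<infinity>" using assms by (auto simp: inEp_def)
  have rK: "radon (restr K \<mu>)" if "compact K" for K by (rule radon_restr_compact[OF r that])
  have KB: "K \<in> sets borel" if "compact K" for K :: "'a set" using that by (simp add: borel_closed compact_imp_closed)
  let ?e = "\<lambda>K. kint \<kappa> (restr K \<mu>) (restr K \<mu>)"
  have "\<exists>f::nat \<Rightarrow> ennreal. range f \<subseteq> ?e ` {K. compact K} \<and> Sup (?e ` {K. compact K}) = (SUP i. f i)"
    using ennreal_Sup_countable_SUP[of "?e ` {K. compact K}"] compact_empty by blast
  then obtain f :: "nat \<Rightarrow> ennreal" where f: "range f \<subseteq> ?e ` {K. compact K}" "kint \<kappa> \<mu> \<mu> = (SUP i. f i)"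
    using kint_compact_exhaustion[OF r] by auto
  then have "\<forall>n. \<exists>K. compact K \<and> f n = ?e K" by (auto simp: image_subset_iff)
  then obtain K0 where K0: "\<And>n. compact (K0 n)" "\<And>n. f n = ?e (K0 n)" by metis
  obtain K :: "nat \<Rightarrow> 'a set" where K: "\<And>n. compact (K n)" "(\<Union>n. K0 n) \<subseteq> (\<Union>n. K n)" "open (\<Union>n. K n)" "closed (\<Union>n. K n)"
    using sigma_compact_clopen[of K0] K0 by metis
  have null: "emeasure \<mu> C = 0" if C: "compact C" "C \<subseteq> - (\<Union>n. K n)" for C
  proof -
    have "?e (K0 n) + ?e C \<le> kint \<kappa> \<mu> \<mu>" for n
    proof -
      have disj: "K0 n \<inter> C = {}" using C K(2) by blast
      have cc: "compact (K0 n \<union> C)" using K0 C by (simp add: compact_Un)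
      have eq: "restr (K0 n \<union> C) \<mu> = madd (restr (K0 n) \<mu>) (restr C \<mu>)"
      proof (rule measure_eqI)
        fix B assume "B \<in> sets (restr (K0 n \<union> C) \<mu>)"
        then have B: "B \<in> sets borel" using r by (simp add: radon_sets)
        have "emeasure \<mu> ((K0 n \<union> C) \<inter> B) = emeasure \<mu> (K0 n \<inter> B) + emeasure \<mu> (C \<inter> B)"
          using disj KB[OF K0(1)[of n]] KB[OF C(1)] B r
          by (subst plus_emeasure) (auto simp: radon_sets Int_Un_distrib2)
        then show "emeasure (restr (K0 n \<union> C) \<mu>) B = emeasure (madd (restr (K0 n) \<mu>) (restr C \<mu>)) B"
          using B KB[OF K0(1)[of n]] KB[OF C(1)] r by (simp add: emeasure_madd emeasure_restr radon_sets)
      qed (use r in \<open>simp add: radon_sets\<close>)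
      have "?e (K0 n) + ?e C \<le> ?e (K0 n \<union> C)"
        unfolding eq using rK[OF K0(1)[of n]] rK[OF C(1)]
        by (simp add: kint_madd_left kint_madd_right radon_madd add_mono add_increasing2 add_increasing)
      also have "\<dots> \<le> kint \<kappa> \<mu> \<mu>"
        using r rK[OF cc] KB[OF cc] by (intro kint_restr_le)
      finally show ?thesis .
    qed
    then have "(SUP n. f n + ?e C) \<le> kint \<kappa> \<mu> \<mu>" by (intro SUP_least) (simp add: K0)
    then have "kint \<kappa> \<mu> \<mu> + ?e C \<le> kint \<kappa> \<mu> \<mu> + 0" by (simp add: ennreal_SUP_add_left f)
    then have "?e C = 0" using fin by (subst (asm) ennreal_add_left_cancel_le) auto
    then have "emeasure (restr C \<mu>) UNIV = 0" by (intro zero_energy_imp_null rK C)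
    then show ?thesis using emeasure_restr[OF radon_sets[OF r] KB[OF C(1)], of UNIV] by simp
  qed
  have "emeasure \<mu> (UNIV - (\<Union>n. K n)) = 0"
  proof -
    have "open (UNIV - (\<Union>n. K n))" using K by auto
    then have "emeasure \<mu> (UNIV - (\<Union>n. K n)) = (SUP C\<in>{C. compact C \<and> C \<subseteq> UNIV - (\<Union>n. K n)}. emeasure \<mu> C)"
      by (rule radon_inner[OF r])
    also have "\<dots> = (SUP C\<in>{C. compact C \<and> C \<subseteq> UNIV - (\<Union>n. K n)}. 0)"
      by (intro SUP_cong refl null) auto
    also have "\<dots> = 0" by (intro SUP_eq_const) auto
    finally show ?thesis .
  qed
  then show ?thesis using K unfolding moderated_def by blast
qed

subsection \<open>Positive definiteness for arbitrary pairs\<close>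

text \<open>Both measures have densities with respect to their sum, which is \<sigma>-finite because
  it is moderated. The pieces are Radon since they are dominated by \<mu> or \<nu>.\<close>

lemma jordan_decomposition:
  fixes \<mu> \<nu> :: "'a measure"
  assumes "radon \<mu>" "radon \<nu>" "moderated \<mu>" "moderated \<nu>"
  obtains p n m where "radon p" "radon n" "radon m" "moderated p" "moderated n" "\<mu> = madd p m" "\<nu> = madd n m" "msingular p n"
proof -
  have s: "sets \<mu> = sets borel" "sets \<nu> = sets borel" using assms radon_sets by auto
  define \<tau> where "\<tau> = madd \<mu> \<nu>"
  have r\<tau>: "radon \<tau>" and m\<tau>: "moderated \<tau>" and s\<tau>[simp]: "sets \<tau> = sets borel"
    unfolding \<tau>_def using assms s by (auto intro: radon_madd moderated_madd)
  have em\<tau>: "emeasure \<tau> B = emeasure \<mu> B + emeasure \<nu> B" for B unfolding \<tau>_def using s by (rule emeasure_madd)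
  obtain K :: "nat \<Rightarrow> 'a set" where K: "\<And>n. compact (K n)" "closed (\<Union>n. K n)" "emeasure \<tau> (UNIV - (\<Union>n. K n)) = 0"
    using m\<tau> unfolding moderated_def by auto
  have KB: "K n \<in> sets borel" for n using K by (simp add: borel_closed compact_imp_closed)
  interpret sigma_finite_measure \<tau>
  proof (standard, intro exI[of _ "insert (UNIV - (\<Union>n. K n)) (range K)"] conjI)
    show "\<forall>a\<in>insert (UNIV - (\<Union>n. K n)) (range K). emeasure \<tau> a \<noteq> \<infinity>"
      using K radon_compact[OF r\<tau> K(1)] by (auto simp: less_top)
  qed (use K KB radon_space[OF r\<tau>] in auto)
  have ac: "absolutely_continuous \<tau> \<mu>" "absolutely_continuous \<tau> \<nu>"
    unfolding absolutely_continuous_def null_sets_def using s by (auto simp: em\<tau>)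
  obtain f where f: "f \<in> borel_measurable \<tau>" "density \<tau> f = \<mu>" using Radon_Nikodym[OF ac(1)] s by auto
  obtain g where g: "g \<in> borel_measurable \<tau>" "density \<tau> g = \<nu>" using Radon_Nikodym[OF ac(2)] s by auto
  note [measurable] = f(1) g(1)
  \<comment> \<open>The comparison guards the subtraction in \<open>ennreal\<close>: where both
    densities are infinite, everything goes to the common part \<open>m\<close>.\<close>
  define p where "p = density \<tau> (\<lambda>x. if g x < f x then f x - g x else 0)"
  define n where "n = density \<tau> (\<lambda>x. if f x < g x then g x - f x else 0)"
  define m where "m = density \<tau> (\<lambda>x. min (f x) (g x))"
  have sp[simp]: "sets p = sets borel" "sets n = sets borel" "sets m = sets borel"
    by (auto simp: p_def n_def m_def)
  have eq: "(if g x < f x then f x - g x else 0) + min (f x) (g x) = f x"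
    "(if f x < g x then g x - f x else 0) + min (f x) (g x) = g x" for x
    using diff_add_cancel_ennreal[of "g x" "f x"] diff_add_cancel_ennreal[of "f x" "g x"]
    by (auto simp: min_def not_less)
  have \<mu>: "\<mu> = madd p m"
  proof (rule measure_eqI)
    fix B assume "B \<in> sets \<mu>"
    then have B: "B \<in> sets \<tau>" using s by simp
    then show "emeasure \<mu> B = emeasure (madd p m) B"
      by (subst f(2)[symmetric], subst emeasure_madd)
         (simp_all add: p_def m_def emeasure_density_add eq)
  qed (use s in simp)
  have \<nu>: "\<nu> = madd n m"
  proof (rule measure_eqI)
    fix B assume "B \<in> sets \<nu>"
    then have B: "B \<in> sets \<tau>" using s by simp
    then show "emeasure \<nu> B = emeasure (madd n m) B"
      by (subst g(2)[symmetric], subst emeasure_madd)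
         (simp_all add: n_def m_def emeasure_density_add eq)
  qed (use s in simp)
  have le: "emeasure p B \<le> emeasure \<mu> B" "emeasure n B \<le> emeasure \<nu> B" "emeasure m B \<le> emeasure \<mu> B" for B
    by (simp_all add: \<mu> \<nu> emeasure_madd)
  have "radon p" "radon n" "radon m"
    using radon_dominated[OF assms(1,3) _ le(1)] radon_dominated[OF assms(2,4) _ le(2)]
      radon_dominated[OF assms(1,3) _ le(3)] by auto
  moreover have "moderated p" "moderated n"
    using moderated_mono[OF assms(3) le(1)] moderated_mono[OF assms(4) le(2)] by auto
  moreover have "msingular p n"
    unfolding msingular_def
  proof (intro bexI[of _ "{x\<in>space \<tau>. g x < f x}"] conjI)
    have B: "{x\<in>space \<tau>. g x < f x} \<in> sets \<tau>" by measurable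
    then have B': "UNIV - {x\<in>space \<tau>. g x < f x} \<in> sets \<tau>" by simp
    show "{x\<in>space \<tau>. g x < f x} \<in> sets borel" using B by simp
    show "emeasure p (UNIV - {x\<in>space \<tau>. g x < f x}) = 0"
      unfolding p_def using B' radon_space[OF r\<tau>]
      by (subst emeasure_density) (auto intro!: nn_integral_0_iff_AE[THEN iffD2] AE_I2 simp: indicator_def)
    show "emeasure n {x\<in>space \<tau>. g x < f x} = 0"
      unfolding n_def using B
      by (subst emeasure_density) (auto intro!: nn_integral_0_iff_AE[THEN iffD2] AE_I2 simp: indicator_def)
  qed
  ultimately show ?thesis using that \<mu> \<nu> by metis
qed

text \<open>Off the diagonal \<kappa> is continuous and finite, hence bounded on the compact product
  \<open>C \<times> D\<close>.\<close>

lemma kint_finite_disjoint_compact: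
  fixes p n :: "'a measure"
  assumes r: "radon p" "radon n" and C: "compact C" "compact D" "C \<inter> D = {}"
  shows "kint \<kappa> (restr C p) (restr D n) < \<infinity>"
proof -
  have CB: "C \<in> sets borel" "D \<in> sets borel" using C by (auto simp: borel_closed compact_imp_closed)
  have "\<exists>M<\<infinity>. \<forall>x\<in>C. \<forall>y\<in>D. \<kappa> x y \<le> M"
  proof (cases "C \<times> D = {}")
    case False
    have sub: "C \<times> D \<subseteq> {z. fst z \<noteq> snd z}" using C by auto
    have "continuous_on (C \<times> D) (\<lambda>z. \<kappa> (fst z) (snd z))"
      using offdiag sub unfolding kernel_offdiag_def by (meson continuous_on_subset)
    then obtain z where z: "z \<in> C \<times> D" "\<And>w. w \<in> C \<times> D \<Longrightarrow> \<kappa> (fst w) (snd w) \<le> \<kappa> (fst z) (snd z)"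
      using continuous_attains_sup[OF compact_Times[OF C(1,2)] False] by blast
    moreover have "\<kappa> (fst z) (snd z) < \<infinity>" using offdiag sub z unfolding kernel_offdiag_def by blast
    ultimately show ?thesis by (intro exI[of _ "\<kappa> (fst z) (snd z)"]) (metis mem_Times_iff fst_conv snd_conv)
  qed (auto intro!: exI[of _ 0])
  then obtain M where M: "M < \<infinity>" "\<And>x y. x \<in> C \<Longrightarrow> y \<in> D \<Longrightarrow> \<kappa> x y \<le> M" by blast
  have pb: "indicator C x * pot \<kappa> (restr D n) x \<le> (M * emeasure n D) * indicator C x" for x
  proof (cases "x \<in> C")
    case True
    have "pot \<kappa> (restr D n) x = (\<integral>\<^sup>+ y. indicator D y * \<kappa> x y \<partial>n)"
      unfolding pot_def using r CB by (intro nn_integral_restr) (auto simp: radon_sets)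
    also have "\<dots> \<le> (\<integral>\<^sup>+ y. M * indicator D y \<partial>n)"
      using M True by (intro nn_integral_mono) (auto simp: indicator_def)
    also have "\<dots> = M * emeasure n D" using r CB by (simp add: nn_integral_cmult_indicator radon_sets)
    finally show ?thesis using True by simp
  qed simp
  have "kint \<kappa> (restr C p) (restr D n) = (\<integral>\<^sup>+ x. indicator C x * pot \<kappa> (restr D n) x \<partial>p)"
    using r CB radon_restr_compact[OF r(2) C(2)] by (intro kint_restr_left)
  also have "\<dots> \<le> (\<integral>\<^sup>+ x. (M * emeasure n D) * indicator C x \<partial>p)" by (intro nn_integral_mono pb)
  also have "\<dots> = M * emeasure n D * emeasure p C" using r CB by (simp add: nn_integral_cmult_indicator radon_sets)
  also have "\<dots> < \<infinity>" using M radon_compact[OF r(1) C(1)] radon_compact[OF r(2) C(2)] by (simp add: ennreal_mult_less_top)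
  finally show ?thesis .
qed

lemma cross_le_of_inE:
  assumes "inE \<kappa> (p, n)"
  shows "2 * enn2real (kint \<kappa> p n) \<le> enn2real (kint \<kappa> p p) + enn2real (kint \<kappa> n n)"
proof -
  have "kint \<kappa> n p = kint \<kappa> p n" using assms by (intro kint_sym) (auto simp: inE_def)
  moreover have "0 \<le> ip \<kappa> (p, n) (p, n)" using spd assms unfolding kernel_spd_def by blast
  ultimately show ?thesis by (simp add: ip_def)
qed

text \<open>Positive definiteness cannot be applied to \<open>(p, n)\<close> itself, since it
  presupposes finite mutual energy. On disjoint compact pieces the mutual energy is finite, and
  positive definiteness bounds it by the sum of the energies. The bound does not depend on the
  pieces, which then exhaust both measures, one variable at a time.\<close>

lemma singular_cross_finite:
  assumes r: "radon p" "radon n" and m: "moderated p" "moderated n" and s: "msingular p n"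
    and fin: "kint \<kappa> p p < \<infinity>" "kint \<kappa> n n < \<infinity>"
  shows "kint \<kappa> p n < \<infinity>"
proof -
  obtain B where B: "B \<in> sets borel" "emeasure p (UNIV - B) = 0" "emeasure n B = 0"
    using s by (auto simp: msingular_def)
  obtain C :: "nat \<Rightarrow> 'a set" where C: "\<And>n. compact (C n)" "incseq C" "\<And>n. C n \<subseteq> B" "emeasure p (B - (\<Union>n. C n)) = 0"
    using moderated_inner[OF r(1) m(1) B(1)] by metis
  obtain D :: "nat \<Rightarrow> 'a set" where D: "\<And>n. compact (D n)" "incseq D" "\<And>n. D n \<subseteq> UNIV - B" "emeasure n (UNIV - B - (\<Union>n. D n)) = 0"
    using moderated_inner[OF r(2) m(2), of "UNIV - B"] B(1) by (metis sets.compl_sets space_borel)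
  have CB: "C k \<in> sets borel" "D k \<in> sets borel" for k using C D by (auto simp: borel_closed compact_imp_closed)
  have pC: "emeasure p (UNIV - (\<Union>n. C n)) = 0"
  proof -
    have "emeasure p (UNIV - (\<Union>n. C n)) \<le> emeasure p ((UNIV - B) \<union> (B - (\<Union>n. C n)))"
      using B CB r by (intro emeasure_mono) (auto simp: radon_sets)
    also have "\<dots> \<le> emeasure p (UNIV - B) + emeasure p (B - (\<Union>n. C n))"
      using B CB r by (intro emeasure_subadditive) (auto simp: radon_sets)
    finally show ?thesis using B C by simp
  qed
  have nD: "emeasure n (UNIV - (\<Union>n. D n)) = 0"
  proof -
    have "emeasure n (UNIV - (\<Union>n. D n)) \<le> emeasure n (B \<union> (UNIV - B - (\<Union>n. D n)))"
      using B CB r by (intro emeasure_mono) (auto simp: radon_sets)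
    also have "\<dots> \<le> emeasure n B + emeasure n (UNIV - B - (\<Union>n. D n))"
      using B CB r by (intro emeasure_subadditive) (auto simp: radon_sets)
    finally show ?thesis using B D by simp
  qed
  define b where "b = kint \<kappa> p p + kint \<kappa> n n"
  have rC: "radon (restr (C j) p)" and rD: "radon (restr (D j) n)" for j
    using radon_restr_compact[OF r(1) C(1)] radon_restr_compact[OF r(2) D(1)] by auto
  have bound: "kint \<kappa> (restr (C j) p) (restr (D k) n) \<le> b" for j k
  proof -
    let ?p = "restr (C j) p" and ?n = "restr (D k) n"
    have disj: "C j \<inter> D k = {}" using C D by blast
    have le: "kint \<kappa> ?p ?p \<le> kint \<kappa> p p" "kint \<kappa> ?n ?n \<le> kint \<kappa> n n"
      using r rC rD CB by (auto intro!: kint_restr_le)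
    have fin': "kint \<kappa> ?p ?p < \<infinity>" "kint \<kappa> ?n ?n < \<infinity>" using le fin by (auto intro: le_less_trans)
    have cr: "kint \<kappa> ?p ?n < \<infinity>" "kint \<kappa> ?n ?p < \<infinity>"
      using kint_finite_disjoint_compact[OF r C(1)[of j] D(1)[of k] disj] kint_sym[OF rC rD] by auto
    have "msingular ?p ?n"
      unfolding msingular_def using CB r disj
      by (intro bexI[of _ "C j"]) (auto simp: emeasure_restr radon_sets Int_commute)
    then have "inE \<kappa> (?p, ?n)" using fin' cr rC rD by (auto simp: inE_def finen_def)
    from cross_le_of_inE[OF this] have "enn2real (kint \<kappa> ?p ?n) \<le> enn2real (kint \<kappa> ?p ?p) + enn2real (kint \<kappa> ?n ?n)"
      using enn2real_nonneg[of "kint \<kappa> ?p ?n"] by linarith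
    then have "ennreal (enn2real (kint \<kappa> ?p ?n)) \<le> ennreal (enn2real (kint \<kappa> ?p ?p)) + ennreal (enn2real (kint \<kappa> ?n ?n))"
      by (simp flip: ennreal_plus add: ennreal_leI)
    then have "kint \<kappa> ?p ?n \<le> kint \<kappa> ?p ?p + kint \<kappa> ?n ?n" using fin' cr by simp
    also have "\<dots> \<le> b" unfolding b_def by (intro add_mono le)
    finally show ?thesis .
  qed
  have "kint \<kappa> p (restr (D k) n) \<le> b" for k
    unfolding kint_def[of \<kappa> p]
  proof (rule nn_integral_le_incseq[OF _ pot_borel C(2) _ pC])
    fix j show "(\<integral>\<^sup>+ x. indicator (C j) x * pot \<kappa> (restr (D k) n) x \<partial>p) \<le> b"
      using bound[of j k] kint_restr_left[OF r(1) rD CB(1)] by simp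
  qed (use r rD CB in \<open>auto simp: radon_sets\<close>)
  then have b2: "kint \<kappa> (restr (D k) n) p \<le> b" for k using kint_sym[OF r(1) rD] by simp
  have "kint \<kappa> n p \<le> b"
    unfolding kint_def[of \<kappa> n p]
  proof (rule nn_integral_le_incseq[OF _ pot_borel D(2) _ nD])
    fix j show "(\<integral>\<^sup>+ x. indicator (D j) x * pot \<kappa> p x \<partial>n) \<le> b"
      using b2[of j] kint_restr_left[OF r(2) r(1) CB(2)] by simp
  qed (use r CB in \<open>auto simp: radon_sets\<close>)
  then show ?thesis using kint_sym[OF r] fin by (auto simp: b_def intro: le_less_trans)
qed

text \<open>Both measures are split into a common part \<open>m\<close> and mutually singular
  remainders \<open>p\<close> and \<open>n\<close>. The common part cancels in the energy of the
  difference, so finiteness, the inequality and its case of equality reduce to the pair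
  \<open>(p, n)\<close>, for which positive definiteness is assumed.\<close>

lemma
  assumes \<mu>: "inEp \<kappa> \<mu>" and \<nu>: "inEp \<kappa> \<nu>"
  shows kint_finite: "kint \<kappa> \<mu> \<nu> < \<infinity>"
    and kint_cross_le: "2 * enn2real (kint \<kappa> \<mu> \<nu>) \<le> enn2real (kint \<kappa> \<mu> \<mu>) + enn2real (kint \<kappa> \<nu> \<nu>)"
    and kint_cross_eq: "2 * enn2real (kint \<kappa> \<mu> \<nu>) = enn2real (kint \<kappa> \<mu> \<mu>) + enn2real (kint \<kappa> \<nu> \<nu>) \<Longrightarrow> \<mu> = \<nu>"
proof -
  have r: "radon \<mu>" "radon \<nu>" and fin: "kint \<kappa> \<mu> \<mu> < \<infinity>" "kint \<kappa> \<nu> \<nu> < \<infinity>" using \<mu> \<nu> by (auto simp: inEp_def)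
  obtain p n m where d: "radon p" "radon n" "radon m" "moderated p" "moderated n" "\<mu> = madd p m" "\<nu> = madd n m" "msingular p n"
    using jordan_decomposition[OF r finite_energy_moderated[OF \<mu>] finite_energy_moderated[OF \<nu>]] by metis
  note sym = kint_sym[OF d(3) d(1)] kint_sym[OF d(3) d(2)] kint_sym[OF d(2) d(1)]
  have e\<mu>: "kint \<kappa> \<mu> \<mu> = kint \<kappa> p p + kint \<kappa> p m + (kint \<kappa> p m + kint \<kappa> m m)"
    unfolding d(6) using d by (simp add: kint_madd_left kint_madd_right radon_madd sym)
  have e\<nu>: "kint \<kappa> \<nu> \<nu> = kint \<kappa> n n + kint \<kappa> n m + (kint \<kappa> n m + kint \<kappa> m m)"
    unfolding d(7) using d by (simp add: kint_madd_left kint_madd_right radon_madd sym)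
  have ec: "kint \<kappa> \<mu> \<nu> = kint \<kappa> p n + kint \<kappa> p m + (kint \<kappa> n m + kint \<kappa> m m)"
    unfolding d(6,7) using d by (simp add: kint_madd_left kint_madd_right radon_madd sym)
  have f: "kint \<kappa> p p < top" "kint \<kappa> p m < top" "kint \<kappa> m m < top" "kint \<kappa> n n < top" "kint \<kappa> n m < top"
    using fin unfolding e\<mu> e\<nu> by auto
  have c: "kint \<kappa> p n < top" using singular_cross_finite[of p n] d f by auto
  show "kint \<kappa> \<mu> \<nu> < \<infinity>" unfolding ec using f c by simp
  have E: "inE \<kappa> (p, n)" using d f c sym by (auto simp: inE_def finen_def)
  have real: "enn2real (kint \<kappa> \<mu> \<mu>) = enn2real (kint \<kappa> p p) + 2 * enn2real (kint \<kappa> p m) + enn2real (kint \<kappa> m m)"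
     "enn2real (kint \<kappa> \<nu> \<nu>) = enn2real (kint \<kappa> n n) + 2 * enn2real (kint \<kappa> n m) + enn2real (kint \<kappa> m m)"
     "enn2real (kint \<kappa> \<mu> \<nu>) = enn2real (kint \<kappa> p n) + enn2real (kint \<kappa> p m) + enn2real (kint \<kappa> n m) + enn2real (kint \<kappa> m m)"
    unfolding e\<mu> e\<nu> ec using f c by (simp_all add: enn2real_plus)
  show "2 * enn2real (kint \<kappa> \<mu> \<nu>) \<le> enn2real (kint \<kappa> \<mu> \<mu>) + enn2real (kint \<kappa> \<nu> \<nu>)"
    using cross_le_of_inE[OF E] unfolding real by simp
  assume "2 * enn2real (kint \<kappa> \<mu> \<nu>) = enn2real (kint \<kappa> \<mu> \<mu>) + enn2real (kint \<kappa> \<nu> \<nu>)"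
  then have "ip \<kappa> (p, n) (p, n) = 0" unfolding real by (simp add: ip_def sym)
  then have z: "emeasure p UNIV = 0" "emeasure n UNIV = 0" using spd E unfolding kernel_spd_def by auto
  show "\<mu> = \<nu>"
  proof (rule measure_eqI)
    fix B assume "B \<in> sets \<mu>"
    have "emeasure p B = 0" "emeasure n B = 0"
      using z emeasure_mono[of B UNIV p] emeasure_mono[of B UNIV n] d by (auto simp: radon_sets)
    then show "emeasure \<mu> B = emeasure \<nu> B" using d by (simp add: emeasure_madd radon_sets)
  qed (use r in \<open>simp add: radon_sets\<close>)
qed

end

subsection \<open>The energy form on pairs of measures of finite energy\<close>

definition padd :: "'a::topological_space smeasure \<Rightarrow> 'a smeasure \<Rightarrow> 'a smeasure" where
  "padd z w = (madd (fst z) (fst w), madd (snd z) (snd w))"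

text \<open>Meaningful for \<open>t \<ge> 0\<close> only, because \<open>ennreal\<close> truncates
  negative numbers; negative multiples pass through \<open>pneg\<close>.\<close>

definition pscale :: "real \<Rightarrow> 'a::topological_space smeasure \<Rightarrow> 'a smeasure" where
  "pscale t z = (scale_measure (ennreal t) (fst z), scale_measure (ennreal t) (snd z))"

definition pneg :: "'a smeasure \<Rightarrow> 'a smeasure" where
  "pneg z = (snd z, fst z)"

context energy_kernel
begin

abbreviation energy :: "'a measure \<Rightarrow> 'a measure \<Rightarrow> real" where
  "energy \<mu> \<nu> \<equiv> enn2real (kint \<kappa> \<mu> \<nu>)"

text \<open>Mutual singularity is dropped, so that the class is closed under \<open>padd\<close>,
  which \<open>inE\<close> is not; the mutual energies are finite by
  \<open>kint_finite\<close>.\<close>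

definition E2 :: "'a smeasure \<Rightarrow> bool" where
  "E2 z \<longleftrightarrow> inEp \<kappa> (fst z) \<and> inEp \<kappa> (snd z)"

lemma inEp_radon: "inEp \<kappa> \<mu> \<Longrightarrow> radon \<mu>"
  by (simp add: inEp_def)

lemma inEp_sets: "inEp \<kappa> \<mu> \<Longrightarrow> sets \<mu> = sets borel"
  by (simp add: inEp_def radon_sets)

lemma energy_sym: "inEp \<kappa> \<mu> \<Longrightarrow> inEp \<kappa> \<nu> \<Longrightarrow> energy \<mu> \<nu> = energy \<nu> \<mu>"
  by (simp add: kint_sym[of \<mu> \<nu>] inEp_def)

lemma inEp_madd: "inEp \<kappa> \<mu> \<Longrightarrow> inEp \<kappa> \<nu> \<Longrightarrow> inEp \<kappa> (madd \<mu> \<nu>)"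
  using kint_finite[of \<mu> \<nu>] kint_finite[of \<nu> \<mu>]
  by (simp add: inEp_def radon_madd kint_madd_left kint_madd_right)

lemma inEp_scale: "inEp \<kappa> \<mu> \<Longrightarrow> t \<ge> 0 \<Longrightarrow> inEp \<kappa> (scale_measure (ennreal t) \<mu>)"
  by (simp add: inEp_def radon_scale kint_scale_left kint_scale_right ennreal_mult_less_top)

lemma inEp_restr:
  assumes "inEp \<kappa> \<mu>" "B \<in> sets borel" shows "inEp \<kappa> (restr B \<mu>)"
proof -
  have r: "radon (restr B \<mu>)" using assms finite_energy_moderated by (intro radon_restr) (auto simp: inEp_def)
  moreover have "kint \<kappa> (restr B \<mu>) (restr B \<mu>) \<le> kint \<kappa> \<mu> \<mu>"
    using assms r by (intro kint_restr_le) (auto simp: inEp_def)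
  ultimately show ?thesis using assms by (auto simp: inEp_def intro: le_less_trans)
qed

lemma energy_madd_left:
  "inEp \<kappa> \<mu> \<Longrightarrow> inEp \<kappa> \<mu>' \<Longrightarrow> inEp \<kappa> \<nu> \<Longrightarrow> energy (madd \<mu> \<mu>') \<nu> = energy \<mu> \<nu> + energy \<mu>' \<nu>"
  using kint_finite[of \<mu> \<nu>] kint_finite[of \<mu>' \<nu>]
  by (simp add: kint_madd_left inEp_radon enn2real_plus)

lemma energy_madd_right:
  "inEp \<kappa> \<mu> \<Longrightarrow> inEp \<kappa> \<nu> \<Longrightarrow> inEp \<kappa> \<nu>' \<Longrightarrow> energy \<mu> (madd \<nu> \<nu>') = energy \<mu> \<nu> + energy \<mu> \<nu>'"
  using kint_finite[of \<mu> \<nu>] kint_finite[of \<mu> \<nu>']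
  by (simp add: kint_madd_right inEp_radon enn2real_plus)

lemma energy_scale_left:
  "inEp \<kappa> \<mu> \<Longrightarrow> inEp \<kappa> \<nu> \<Longrightarrow> t \<ge> 0 \<Longrightarrow> energy (scale_measure (ennreal t) \<mu>) \<nu> = t * energy \<mu> \<nu>"
  by (simp add: kint_scale_left inEp_radon enn2real_mult)

lemma energy_scale_right:
  "inEp \<kappa> \<mu> \<Longrightarrow> inEp \<kappa> \<nu> \<Longrightarrow> t \<ge> 0 \<Longrightarrow> energy \<mu> (scale_measure (ennreal t) \<nu>) = t * energy \<mu> \<nu>"
  by (simp add: kint_scale_right inEp_radon enn2real_mult)

lemma E2_padd: "E2 z \<Longrightarrow> E2 w \<Longrightarrow> E2 (padd z w)"
  by (simp add: E2_def padd_def inEp_madd)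

lemma E2_pscale: "E2 z \<Longrightarrow> t \<ge> 0 \<Longrightarrow> E2 (pscale t z)"
  by (simp add: E2_def pscale_def inEp_scale)

lemma E2_pneg: "E2 z \<Longrightarrow> E2 (pneg z)"
  by (simp add: E2_def pneg_def)

lemma ip_sym: "E2 z \<Longrightarrow> E2 w \<Longrightarrow> ip \<kappa> z w = ip \<kappa> w z"
  unfolding ip_def E2_def using energy_sym by simp

lemma ip_padd_left: "E2 z \<Longrightarrow> E2 w \<Longrightarrow> E2 u \<Longrightarrow> ip \<kappa> (padd z w) u = ip \<kappa> z u + ip \<kappa> w u"
  unfolding ip_def E2_def padd_def by (simp add: energy_madd_left)

lemma ip_padd_right: "E2 z \<Longrightarrow> E2 w \<Longrightarrow> E2 u \<Longrightarrow> ip \<kappa> u (padd z w) = ip \<kappa> u z + ip \<kappa> u w"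
  unfolding ip_def E2_def padd_def by (simp add: energy_madd_right)

lemma ip_pscale_left: "E2 z \<Longrightarrow> E2 u \<Longrightarrow> t \<ge> 0 \<Longrightarrow> ip \<kappa> (pscale t z) u = t * ip \<kappa> z u"
  unfolding ip_def E2_def pscale_def by (simp add: energy_scale_left algebra_simps)

lemma ip_pscale_right: "E2 z \<Longrightarrow> E2 u \<Longrightarrow> t \<ge> 0 \<Longrightarrow> ip \<kappa> u (pscale t z) = t * ip \<kappa> u z"
  unfolding ip_def E2_def pscale_def by (simp add: energy_scale_right algebra_simps)

lemma ip_pneg_left: "ip \<kappa> (pneg z) u = - ip \<kappa> z u"
  unfolding ip_def pneg_def by simp

lemma ip_pneg_right: "ip \<kappa> u (pneg z) = - ip \<kappa> u z"
  unfolding ip_def pneg_def by simp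

lemmas ip_linear = ip_padd_left ip_padd_right ip_pscale_left ip_pscale_right ip_pneg_left ip_pneg_right
  E2_padd E2_pscale E2_pneg

lemma ip_nonneg: "E2 z \<Longrightarrow> 0 \<le> ip \<kappa> z z"
  using kint_cross_le[of "fst z" "snd z"] energy_sym[of "fst z" "snd z"] by (simp add: ip_def E2_def)

lemma ip_zero_imp_eq: "E2 z \<Longrightarrow> ip \<kappa> z z = 0 \<Longrightarrow> fst z = snd z"
  using kint_cross_eq[of "fst z" "snd z"] energy_sym[of "fst z" "snd z"] by (simp add: ip_def E2_def)

lemma nrm_nonneg: "E2 z \<Longrightarrow> 0 \<le> nrm \<kappa> z"
  by (simp add: nrm_def ip_nonneg)

lemma nrm_sq: "E2 z \<Longrightarrow> (nrm \<kappa> z)\<^sup>2 = ip \<kappa> z z"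
  by (simp add: nrm_def ip_nonneg)

lemma ip_cauchy_schwarz:
  assumes z: "E2 z" and w: "E2 w"
  shows "\<bar>ip \<kappa> z w\<bar> \<le> nrm \<kappa> z * nrm \<kappa> w"
proof -
  define a b c where "a = ip \<kappa> z z" and "b = ip \<kappa> z w" and "c = ip \<kappa> w w"
  have q: "0 \<le> a + 2 * t * b + t\<^sup>2 * c" for t
  proof (cases "t \<ge> 0")
    case True
    have "0 \<le> ip \<kappa> (padd z (pscale t w)) (padd z (pscale t w))" using z w True by (intro ip_nonneg) (simp add: ip_linear)
    then show ?thesis using z w True ip_sym[OF w z]
      by (simp add: ip_linear a_def b_def c_def power2_eq_square algebra_simps)
  next
    case False
    then have t: "- t \<ge> 0" by simp
    have "0 \<le> ip \<kappa> (padd z (pscale (- t) (pneg w))) (padd z (pscale (- t) (pneg w)))"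
      using z w t by (intro ip_nonneg) (simp add: ip_linear)
    then show ?thesis using z w t ip_sym[OF w z]
      by (simp add: ip_linear a_def b_def c_def power2_eq_square algebra_simps)
  qed
  have c0: "c \<ge> 0" and a0: "a \<ge> 0" using ip_nonneg z w by (auto simp: a_def c_def)
  have "b\<^sup>2 \<le> a * c"
  proof (cases "c = 0")
    case True
    \<comment> \<open>For \<open>c = 0\<close> the nonnegative function of \<open>t\<close> is
      affine; with \<open>b \<noteq> 0\<close> it would equal -1 at
      \<open>t = - (a + 1) / (2 * b)\<close>.\<close>
    have "b = 0"
    proof (rule ccontr)
      assume "b \<noteq> 0"
      then show False using q[of "- (a + 1) / (2 * b)"] a0 True by (simp add: field_simps)
    qed
    then show ?thesis using True by simp
  next
    case False
    then have "c > 0" using c0 by simp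
    have "0 \<le> a + 2 * (- b / c) * b + (- b / c)\<^sup>2 * c" by (rule q)
    also have "\<dots> = a - b\<^sup>2 / c" using \<open>c > 0\<close> by (simp add: field_simps power2_eq_square)
    finally show ?thesis using \<open>c > 0\<close> by (simp add: field_simps)
  qed
  then have "sqrt (b\<^sup>2) \<le> sqrt (a * c)" by (rule real_sqrt_le_mono)
  then show ?thesis by (simp add: nrm_def a_def b_def c_def real_sqrt_mult)
qed

lemma nrm_triangle:
  assumes z: "E2 z" and w: "E2 w"
  shows "nrm \<kappa> (padd z w) \<le> nrm \<kappa> z + nrm \<kappa> w"
proof (rule power2_le_imp_le)
  have "(nrm \<kappa> (padd z w))\<^sup>2 = ip \<kappa> z z + 2 * ip \<kappa> z w + ip \<kappa> w w"
    using z w ip_sym[OF w z] by (simp add: nrm_sq ip_linear)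
  also have "\<dots> \<le> (nrm \<kappa> z)\<^sup>2 + 2 * (nrm \<kappa> z * nrm \<kappa> w) + (nrm \<kappa> w)\<^sup>2"
    using z w ip_cauchy_schwarz[OF z w] by (simp add: nrm_sq)
  also have "\<dots> = (nrm \<kappa> z + nrm \<kappa> w)\<^sup>2" by (simp add: power2_eq_square algebra_simps)
  finally show "(nrm \<kappa> (padd z w))\<^sup>2 \<le> (nrm \<kappa> z + nrm \<kappa> w)\<^sup>2" .
qed (use nrm_nonneg z w in auto)

text \<open>The defect of convexity is kept exact: it is what forces two minimizers to have distance
  zero.\<close>

lemma ip_convex_combination:
  assumes z: "E2 z" and w: "E2 w" and t: "0 \<le> t" "t \<le> 1"
  shows "ip \<kappa> (padd (pscale (1 - t) z) (pscale t w)) (padd (pscale (1 - t) z) (pscale t w))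
     = (1 - t) * ip \<kappa> z z + t * ip \<kappa> w w - t * (1 - t) * ip \<kappa> (padd z (pneg w)) (padd z (pneg w))"
  using assms ip_sym[OF w z] by (simp add: ip_linear algebra_simps power2_eq_square)

end

subsection \<open>The Riesz representation theorem\<close>

lemma Cc_I:
  fixes f :: "'a::t2_space \<Rightarrow> real"
  assumes "continuous_on UNIV f" "compact K" "\<And>x. x \<notin> K \<Longrightarrow> f x = 0"
  shows "f \<in> Cc"
proof -
  have "closure {x. f x \<noteq> 0} \<subseteq> K"
    using assms by (intro closure_minimal) (auto simp: compact_imp_closed)
  then have "compact (closure {x. f x \<noteq> 0})"
    using compact_Int_closed[OF assms(2) closed_closure, of "{x. f x \<noteq> 0}"] by (simp add: Int_absorb1)
  then show ?thesis using assms by (simp add: Cc_def)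
qed

lemma Cc_E:
  assumes "f \<in> Cc"
  obtains K where "continuous_on UNIV f" "compact K" "\<And>x. x \<notin> K \<Longrightarrow> f x = 0"
  using assms closure_subset[of "{x. f x \<noteq> 0}"] unfolding Cc_def by blast

lemma Cc_comp2:
  fixes f g :: "'a::t2_space \<Rightarrow> real"
  assumes f: "f \<in> Cc" and g: "g \<in> Cc" and h: "continuous_on UNIV (\<lambda>x. h (f x) (g x))" and h0: "h 0 0 = 0"
  shows "(\<lambda>x. h (f x) (g x)) \<in> Cc"
proof -
  obtain K where K: "compact K" "\<And>x. x \<notin> K \<Longrightarrow> f x = 0" using Cc_E[OF f] by metis
  obtain L where L: "compact L" "\<And>x. x \<notin> L \<Longrightarrow> g x = 0" using Cc_E[OF g] by metis
  show ?thesis by (rule Cc_I[OF h compact_Un[OF K(1) L(1)]]) (use K L h0 in auto)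
qed

lemma Cc_cont: "f \<in> Cc \<Longrightarrow> continuous_on UNIV f"
  by (simp add: Cc_def)

lemma Cc_add: "f \<in> Cc \<Longrightarrow> g \<in> Cc \<Longrightarrow> (\<lambda>x::'a::t2_space. f x + g x) \<in> Cc"
  using Cc_cont[of f] Cc_cont[of g] by (intro Cc_comp2[of f g "(+)"]) (auto intro!: continuous_intros)

lemma Cc_diff: "f \<in> Cc \<Longrightarrow> g \<in> Cc \<Longrightarrow> (\<lambda>x::'a::t2_space. f x - g x) \<in> Cc"
  using Cc_cont[of f] Cc_cont[of g] by (intro Cc_comp2[of f g "(-)"]) (auto intro!: continuous_intros)

lemma Cc_cmult: "f \<in> Cc \<Longrightarrow> (\<lambda>x::'a::t2_space. c * f x) \<in> Cc"
  using Cc_cont[of f] by (intro Cc_comp2[of f f "\<lambda>a b. c * a"]) (auto intro!: continuous_intros)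

lemma Cc_zero: "(\<lambda>x::'a::t2_space. 0) \<in> Cc"
  by (rule Cc_I[of _ "{}"]) auto

lemma Cc_min_const: "f \<in> Cc \<Longrightarrow> 0 \<le> c \<Longrightarrow> (\<lambda>x::'a::t2_space. min (f x) c) \<in> Cc"
  using Cc_cont[of f] by (intro Cc_comp2[of f f "\<lambda>a b. min a c"]) (auto intro!: continuous_intros)

lemma Cc_max: "f \<in> Cc \<Longrightarrow> g \<in> Cc \<Longrightarrow> (\<lambda>x::'a::t2_space. max (f x) (g x)) \<in> Cc"
  using Cc_cont[of f] Cc_cont[of g] by (intro Cc_comp2[of f g max]) (auto intro!: continuous_intros)

lemma Cc_bounded:
  assumes "f \<in> Cc" obtains b where "b \<ge> 0" "\<And>x. \<bar>f x\<bar> \<le> b"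
proof -
  obtain K where K: "continuous_on UNIV f" "compact K" "\<And>x. x \<notin> K \<Longrightarrow> f x = 0" using Cc_E[OF assms] by metis
  have "compact (f ` K)" using K by (meson compact_continuous_image continuous_on_subset subset_UNIV)
  then obtain b where b: "\<And>y. y \<in> f ` K \<Longrightarrow> norm y \<le> b" using compact_imp_bounded bounded_iff by metis
  have "\<bar>f x\<bar> \<le> max b 0" for x using b[of "f x"] K(3)[of x] by (cases "x \<in> K") auto
  then show ?thesis using that[of "max b 0"] by auto
qed

lemma Cc_borel: "f \<in> Cc \<Longrightarrow> f \<in> borel_measurable borel"
  by (intro borel_measurable_continuous_onI Cc_cont)

lemma Cc_integrable:
  fixes \<nu> :: "'a::t2_space measure"
  assumes r: "radon \<nu>" and f: "f \<in> Cc" shows "integrable \<nu> f"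
proof -
  obtain K where K: "compact K" "\<And>x. x \<notin> K \<Longrightarrow> f x = 0" using Cc_E[OF f] by metis
  obtain b where b: "b \<ge> 0" "\<And>x. \<bar>f x\<bar> \<le> b" using Cc_bounded[OF f] by metis
  have KB: "K \<in> sets \<nu>" using K r by (simp add: borel_closed compact_imp_closed radon_sets)
  have "(\<integral>\<^sup>+ x. ennreal (norm (f x)) \<partial>\<nu>) \<le> (\<integral>\<^sup>+ x. ennreal b * indicator K x \<partial>\<nu>)"
    using b K by (intro nn_integral_mono) (auto simp: indicator_def intro!: ennreal_leI)
  also have "\<dots> = ennreal b * emeasure \<nu> K" using KB by (simp add: nn_integral_cmult_indicator)
  also have "\<dots> < \<infinity>" using radon_compact[OF r K(1)] by (simp add: ennreal_mult_less_top)
  finally show ?thesis by (intro integrableI_bounded radon_meas[OF r Cc_borel[OF f]])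
qed

text \<open>The separating function is taken for \<open>K\<close> and the complement of
  \<open>W\<close>, where \<open>W\<close> is an open neighbourhood of \<open>K\<close> inside a
  compact subset of \<open>U\<close>; this yields the compact support within
  \<open>U\<close>.\<close>

lemma urysohn_compact:
  fixes K U :: "'a::t2_space set"
  assumes lc: "locally_compact_space (euclidean :: 'a topology)" and K: "compact K" and U: "open U" "K \<subseteq> U"
  obtains f C where "f \<in> Cc" "\<And>x. 0 \<le> f x" "\<And>x. f x \<le> 1" "\<And>x. x \<in> K \<Longrightarrow> f x = 1"
    "compact C" "C \<subseteq> U" "\<And>x. x \<notin> C \<Longrightarrow> f x = 0"
proof -
  have H: "Hausdorff_space (euclidean :: 'a topology)"
    unfolding Hausdorff_space_def by (simp add: disjnt_def) (metis hausdorff)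
  have "neighbourhood_base_of (compactin euclidean) (euclidean :: 'a topology)"
    using locally_compact_space_neighbourhood_base H lc by blast
  then have nb: "\<exists>V C. open V \<and> compact C \<and> x \<in> V \<and> V \<subseteq> C \<and> C \<subseteq> U" if "x \<in> K" for x
    using U that by (auto simp: neighbourhood_base_of)
  then obtain V C where VC: "\<And>x. x \<in> K \<Longrightarrow> open (V x)" "\<And>x. x \<in> K \<Longrightarrow> compact (C x)" "\<And>x. x \<in> K \<Longrightarrow> x \<in> V x"
    "\<And>x. x \<in> K \<Longrightarrow> V x \<subseteq> C x" "\<And>x. x \<in> K \<Longrightarrow> C x \<subseteq> U" by metis
  have cov: "K \<subseteq> (\<Union>x\<in>K. V x)" using VC(3) by blast
  obtain D where D: "D \<subseteq> K" "finite D" "K \<subseteq> (\<Union>x\<in>D. V x)"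
    by (rule compactE_image[OF K VC(1) cov])
  define W where "W = (\<Union>x\<in>D. V x)"
  define L where "L = (\<Union>x\<in>D. C x)"
  have W: "open W" "K \<subseteq> W" using D VC by (auto simp: W_def)
  have WL: "W \<subseteq> L" unfolding W_def L_def using D(1) VC(4) by (intro UN_mono) auto
  have "compact L" unfolding L_def using D VC(2) by (intro compact_UN) auto
  moreover have "L \<subseteq> U" unfolding L_def using D(1) VC(5) by blast
  ultimately have L: "compact L" "L \<subseteq> U" by auto
  have cr: "completely_regular_space (euclidean :: 'a topology)"
    using locally_compact_regular_imp_completely_regular_space lc H by blast
  obtain f where f: "continuous_map euclidean (top_of_set {0..1::real}) f" "f ` (- W) \<subseteq> {0}" "f ` K \<subseteq> {1}"
    using Urysohn_completely_regular_compact_closed[of 0 1 euclidean K "- W"] cr K W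
    by (auto simp: disjnt_def)
  have fc: "continuous_on UNIV f" and f01: "\<And>x. f x \<in> {0..1}"
    using f(1) by (auto simp: continuous_map_in_subtopology)
  have f0: "f x = 0" if "x \<notin> L" for x using that WL f(2) by auto
  show ?thesis
    by (rule that[of f L]) (use Cc_I[OF fc L(1) f0] f01 f L f0 in auto)
qed

section \<open>The Radon measure of a positive linear functional on \<open>Cc\<close>\<close>

context
  fixes \<Lambda> :: "('a::t2_space \<Rightarrow> real) \<Rightarrow> real"
  assumes lc: "locally_compact_space (euclidean :: 'a topology)"
    and Ladd: "\<And>\<phi> \<psi>. \<phi> \<in> Cc \<Longrightarrow> \<psi> \<in> Cc \<Longrightarrow> \<Lambda> (\<lambda>x. \<phi> x + \<psi> x) = \<Lambda> \<phi> + \<Lambda> \<psi>"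
    and Lcmult: "\<And>\<phi> c. \<phi> \<in> Cc \<Longrightarrow> \<Lambda> (\<lambda>x. c * \<phi> x) = c * \<Lambda> \<phi>"
    and Lpos: "\<And>\<phi>. \<phi> \<in> Cc \<Longrightarrow> (\<And>x. 0 \<le> \<phi> x) \<Longrightarrow> 0 \<le> \<Lambda> \<phi>"
begin

private lemma Lmono:
  assumes "\<phi> \<in> Cc" "\<psi> \<in> Cc" "\<And>x. \<phi> x \<le> \<psi> x" shows "\<Lambda> \<phi> \<le> \<Lambda> \<psi>"
proof -
  have "\<Lambda> \<psi> = \<Lambda> (\<lambda>x. \<phi> x + (\<psi> x - \<phi> x))" by simp
  also have "\<dots> = \<Lambda> \<phi> + \<Lambda> (\<lambda>x. \<psi> x - \<phi> x)" using assms by (intro Ladd Cc_diff)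
  finally show ?thesis using Lpos[of "\<lambda>x. \<psi> x - \<phi> x"] assms by (simp add: Cc_diff)
qed

private definition test :: "'a set \<Rightarrow> ('a \<Rightarrow> real) set" where
  "test U = {\<phi>\<in>Cc. (\<forall>x. 0 \<le> \<phi> x \<and> \<phi> x \<le> 1) \<and> (\<exists>K. compact K \<and> K \<subseteq> U \<and> (\<forall>x. x \<notin> K \<longrightarrow> \<phi> x = 0))}"

private definition m0 :: "'a set \<Rightarrow> ennreal" where
  "m0 U = (SUP \<phi>\<in>test U. ennreal (\<Lambda> \<phi>))"

private definition mo :: "'a set \<Rightarrow> ennreal" where
  "mo E = (INF U\<in>{U. open U \<and> E \<subseteq> U}. m0 U)"

private lemma m0_mono: "U \<subseteq> V \<Longrightarrow> m0 U \<le> m0 V"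
  unfolding m0_def test_def by (intro SUP_subset_mono) auto

private lemma mo_open: "open U \<Longrightarrow> mo U = m0 U"
  unfolding mo_def by (intro antisym INF_lower INF_greatest m0_mono) auto

private lemma mo_mono: "E \<subseteq> F \<Longrightarrow> mo E \<le> mo F"
  unfolding mo_def by (intro INF_superset_mono) auto

private lemma m0_empty: "m0 {} = 0"
proof -
  have "\<Lambda> \<phi> = 0" if "\<phi> \<in> test {}" for \<phi>
  proof -
    have "\<phi> = (\<lambda>x. 0 * 0)" using that by (auto simp: test_def)
    then show ?thesis using Lcmult[OF Cc_zero, of 0] by simp
  qed
  then show ?thesis unfolding m0_def by (intro antisym SUP_least) auto
qed

private lemma m0_Un: assumes U: "open U" and V: "open V" shows "m0 (U \<union> V) \<le> m0 U + m0 V"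
  unfolding m0_def[of "U \<union> V"]
proof (rule SUP_least)
  fix \<phi> assume "\<phi> \<in> test (U \<union> V)"
  then obtain K where \<phi>: "\<phi> \<in> Cc" "\<And>x. 0 \<le> \<phi> x" "\<And>x. \<phi> x \<le> 1" "compact K" "K \<subseteq> U \<union> V" "\<And>x. x \<notin> K \<Longrightarrow> \<phi> x = 0"
    by (auto simp: test_def)
  have "compact (K - V)" "K - V \<subseteq> U" using \<phi> V by (auto intro: compact_diff)
  then obtain u C where u: "u \<in> Cc" "\<And>x. 0 \<le> u x" "\<And>x. u x \<le> 1" "\<And>x. x \<in> K - V \<Longrightarrow> u x = 1"
    "compact C" "C \<subseteq> U" "\<And>x. x \<notin> C \<Longrightarrow> u x = 0" using urysohn_compact[OF lc _ U] by metis
  \<comment> \<open>Doubling and truncating makes \<open>1 - \<psi>\<close> vanish wherever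
    \<open>u x \<ge> 1/2\<close>, so the second summand is supported in the compact part of
    \<open>K\<close> where \<open>u x \<le> 1/2\<close>, and this part lies in
    \<open>V\<close>.\<close>
  define \<psi> where "\<psi> x = min 1 (2 * u x)" for x
  have \<psi>c: "continuous_on UNIV \<psi>" unfolding \<psi>_def by (intro continuous_intros Cc_cont u)
  have \<psi>01: "0 \<le> \<psi> x" "\<psi> x \<le> 1" for x using u by (auto simp: \<psi>_def)
  let ?a = "\<lambda>x. \<phi> x * \<psi> x" and ?b = "\<lambda>x. \<phi> x * (1 - \<psi> x)"
  have aC: "?a x = 0" if "x \<notin> C" for x using u(7)[OF that] by (simp add: \<psi>_def)
  have a: "?a \<in> Cc" by (rule Cc_I[OF _ u(5) aC]) (intro continuous_intros Cc_cont \<phi> \<psi>c)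
  let ?K = "K \<inter> {x. u x \<le> 1/2}"
  have K': "compact ?K"
    by (intro compact_Int_closed \<phi> closed_Collect_le continuous_intros Cc_cont u)
  have K'V: "?K \<subseteq> V"
  proof
    fix x assume "x \<in> ?K" then show "x \<in> V" using u(4)[of x] by (cases "x \<in> V") auto
  qed
  have bK: "?b x = 0" if "x \<notin> ?K" for x using that \<phi>(6)[of x] by (cases "x \<in> K") (auto simp: \<psi>_def)
  have b: "?b \<in> Cc" by (rule Cc_I[OF _ K' bK]) (intro continuous_intros Cc_cont \<phi> \<psi>c)
  have "\<Lambda> \<phi> = \<Lambda> (\<lambda>x. ?a x + ?b x)" by (simp add: algebra_simps)
  also have "\<dots> = \<Lambda> ?a + \<Lambda> ?b" by (rule Ladd[OF a b])
  finally have "ennreal (\<Lambda> \<phi>) = ennreal (\<Lambda> ?a) + ennreal (\<Lambda> ?b)"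
    using Lpos[OF a] Lpos[OF b] \<phi> \<psi>01 by (simp add: ennreal_plus)
  moreover have "?a \<in> test U"
    unfolding test_def using a u(5,6) aC \<phi> \<psi>01 by (auto intro!: exI[of _ C] mult_le_one)
  moreover have "?b \<in> test V"
    unfolding test_def
  proof (intro CollectI conjI allI exI[of _ ?K] impI b K' K'V bK)
    fix x show "0 \<le> ?b x" "?b x \<le> 1" using \<phi> \<psi>01[of x] by (auto intro!: mult_le_one)
  qed
  ultimately show "ennreal (\<Lambda> \<phi>) \<le> m0 U + m0 V"
    unfolding m0_def by (simp only:) (intro add_mono SUP_upper)
qed

private lemma m0_UN_finite: "finite F \<Longrightarrow> (\<And>i. i \<in> F \<Longrightarrow> open (U i)) \<Longrightarrow> m0 (\<Union>i\<in>F. U i) \<le> (\<Sum>i\<in>F. m0 (U i))"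
proof (induction F rule: finite_induct)
  case empty then show ?case by (simp add: m0_empty)
next
  case (insert x F)
  have "m0 (\<Union>i\<in>insert x F. U i) \<le> m0 (U x) + m0 (\<Union>i\<in>F. U i)"
    using insert by (simp add: m0_Un open_UN)
  also have "\<dots> \<le> m0 (U x) + (\<Sum>i\<in>F. m0 (U i))" using insert by (intro add_left_mono) auto
  finally show ?case using insert by simp
qed

private lemma m0_UN: assumes U: "\<And>n::nat. open (U n)" shows "m0 (\<Union>n. U n) \<le> (\<Sum>n. m0 (U n))"
  unfolding m0_def[of "\<Union>n. U n"]
proof (rule SUP_least)
  fix \<phi> assume "\<phi> \<in> test (\<Union>n. U n)"
  then obtain K where \<phi>: "\<phi> \<in> Cc" "\<And>x. 0 \<le> \<phi> x" "\<And>x. \<phi> x \<le> 1" "compact K" "K \<subseteq> (\<Union>n. U n)" "\<And>x. x \<notin> K \<Longrightarrow> \<phi> x = 0"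
    by (auto simp: test_def)
  obtain F where F: "finite F" "K \<subseteq> (\<Union>n\<in>F. U n)" using compactE_image[OF \<phi>(4), of UNIV U] U \<phi>(5) by metis
  have "\<phi> \<in> test (\<Union>n\<in>F. U n)" unfolding test_def using \<phi> F by auto
  then have "ennreal (\<Lambda> \<phi>) \<le> m0 (\<Union>n\<in>F. U n)" unfolding m0_def by (rule SUP_upper)
  also have "\<dots> \<le> (\<Sum>n\<in>F. m0 (U n))" using m0_UN_finite[OF F(1)] U by blast
  also have "\<dots> \<le> (\<Sum>n. m0 (U n))" using F by (intro sum_le_suminf) auto
  finally show "ennreal (\<Lambda> \<phi>) \<le> (\<Sum>n. m0 (U n))" .
qed

private lemma outer: "outer_measure_space (Pow UNIV) mo"
  unfolding outer_measure_space_def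
proof (intro conjI)
  show "positive (Pow UNIV) mo" by (simp add: positive_def mo_open m0_empty)
  show "increasing (Pow UNIV) mo" by (simp add: increasing_def mo_mono)
  show "countably_subadditive (Pow UNIV) mo"
    unfolding countably_subadditive_def
  proof (intro allI impI)
    fix A :: "nat \<Rightarrow> 'a set"
    show "mo (\<Union> (range A)) \<le> (\<Sum>n. mo (A n))"
    proof (rule ennreal_le_epsilon)
      fix e :: real assume fin: "(\<Sum>n. mo (A n)) < top" and e: "0 < e"
      have "\<exists>U. open U \<and> A n \<subseteq> U \<and> m0 U \<le> mo (A n) + ennreal (e * (1/2) ^ Suc n)" for n
      proof -
        have "mo (A n) < top" using fin by (metis ennreal_suminf_lessD)
        then have "mo (A n) < mo (A n) + ennreal (e * (1/2) ^ Suc n)"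
          using e ennreal_add_left_cancel_less[of "mo (A n)" 0 "ennreal (e * (1/2) ^ Suc n)"] by auto
        then show ?thesis unfolding mo_def by (auto simp: INF_less_iff less_imp_le)
      qed
      then obtain U where U: "\<And>n. open (U n)" "\<And>n. A n \<subseteq> U n" "\<And>n. m0 (U n) \<le> mo (A n) + ennreal (e * (1/2) ^ Suc n)"
        by metis
      have "mo (\<Union> (range A)) \<le> m0 (\<Union>n. U n)" unfolding mo_def using U by (intro INF_lower) auto
      also have "\<dots> \<le> (\<Sum>n. m0 (U n))" using U by (intro m0_UN)
      also have "\<dots> \<le> (\<Sum>n. mo (A n) + ennreal (e * (1/2) ^ Suc n))" by (intro suminf_le U) auto
      also have "\<dots> = (\<Sum>n. mo (A n)) + (\<Sum>n. ennreal (e * (1/2) ^ Suc n))" by (rule suminf_add[symmetric]) auto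
      also have "(\<Sum>n. ennreal (e * (1/2) ^ Suc n)) = ennreal e"
        using e sums_mult[OF power_half_series, of e] by (intro suminf_ennreal_eq) auto
      finally show "mo (\<Union> (range A)) \<le> (\<Sum>n. mo (A n)) + ennreal e" .
    qed
  qed
qed

text \<open>A test function for \<open>V \<inter> U\<close> that vanishes off the compact
  \<open>K\<close>, plus one for \<open>V - K\<close>, is a test function for \<open>V\<close>.
  Since \<open>V - U \<subseteq> V - K\<close>, taking the two suprema gives the nontrivial
  inequality.\<close>

private lemma open_caratheodory:
  assumes U: "open U" shows "mo (U \<inter> E) + mo ((UNIV - U) \<inter> E) = mo E"
proof (rule antisym)
  have "mo (U \<inter> E) + mo ((UNIV - U) \<inter> E) \<le> m0 V" if V: "open V" "E \<subseteq> V" for V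
  proof -
    have *: "ennreal (\<Lambda> \<phi>) + mo (V - U) \<le> m0 V" if "\<phi> \<in> test (V \<inter> U)" for \<phi>
    proof -
      obtain K where \<phi>: "\<phi> \<in> Cc" "\<And>x. 0 \<le> \<phi> x" "\<And>x. \<phi> x \<le> 1" "compact K" "K \<subseteq> V \<inter> U" "\<And>x. x \<notin> K \<Longrightarrow> \<phi> x = 0"
        using \<open>\<phi> \<in> test (V \<inter> U)\<close> by (auto simp: test_def)
      have oVK: "open (V - K)" using V \<phi> by (simp add: open_Diff compact_imp_closed)
      have "ennreal (\<Lambda> \<phi>) + ennreal (\<Lambda> \<psi>) \<le> m0 V" if tst: "\<psi> \<in> test (V - K)" for \<psi>
      proof -
        obtain L where \<psi>: "\<psi> \<in> Cc" "\<And>x. 0 \<le> \<psi> x" "\<And>x. \<psi> x \<le> 1" "compact L" "L \<subseteq> V - K" "\<And>x. x \<notin> L \<Longrightarrow> \<psi> x = 0"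
          using tst by (auto simp: test_def)
        have "\<phi> x + \<psi> x \<le> 1" for x using \<phi>(3)[of x] \<psi>(3)[of x] \<phi>(6)[of x] \<psi>(5,6) by (cases "x \<in> K") fastforce+
        then have "(\<lambda>x. \<phi> x + \<psi> x) \<in> test V"
          unfolding test_def using \<phi> \<psi>
          by (intro CollectI conjI allI exI[of _ "K \<union> L"] impI Cc_add compact_Un) auto
        then have "ennreal (\<Lambda> (\<lambda>x. \<phi> x + \<psi> x)) \<le> m0 V" unfolding m0_def by (rule SUP_upper)
        then show ?thesis using Ladd[OF \<phi>(1) \<psi>(1)] Lpos[OF \<phi>(1,2)] Lpos[OF \<psi>(1,2)] by (simp add: ennreal_plus)
      qed
      moreover have "test (V - K) \<noteq> {}"
        using Cc_zero by (auto simp: test_def intro!: exI[of _ "\<lambda>x. 0"])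
      ultimately have "ennreal (\<Lambda> \<phi>) + m0 (V - K) \<le> m0 V"
        unfolding m0_def[of "V - K"] by (subst ennreal_SUP_add_right) (auto intro!: SUP_least)
      moreover have "mo (V - U) \<le> m0 (V - K)"
      proof -
        have "V - U \<subseteq> V - K" using \<phi>(5) by blast
        then show ?thesis using mo_mono[of "V - U" "V - K"] mo_open[OF oVK] by simp
      qed
      ultimately show ?thesis by (meson add_left_mono order_trans)
    qed
    have ne: "test (V \<inter> U) \<noteq> {}" using Cc_zero by (auto simp: test_def intro!: exI[of _ "\<lambda>x. 0"])
    have "m0 (V \<inter> U) + mo (V - U) \<le> m0 V"
      unfolding m0_def[of "V \<inter> U"] using ne * by (subst ennreal_SUP_add_left[symmetric]) (auto intro!: SUP_least)
    moreover have "mo (U \<inter> E) \<le> m0 (V \<inter> U)"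
    proof -
      have "U \<inter> E \<subseteq> V \<inter> U" using V by blast
      then show ?thesis using mo_mono[of "U \<inter> E" "V \<inter> U"] mo_open[OF open_Int[OF V(1) U]] by simp
    qed
    moreover have "mo ((UNIV - U) \<inter> E) \<le> mo (V - U)" using V by (intro mo_mono) auto
    ultimately show ?thesis by (meson add_mono order_trans)
  qed
  then show "mo (U \<inter> E) + mo ((UNIV - U) \<inter> E) \<le> mo E"
    unfolding mo_def[of E] by (intro INF_greatest) auto
  have "mo (U \<inter> E \<union> (UNIV - U) \<inter> E) \<le> mo (U \<inter> E) + mo ((UNIV - U) \<inter> E)"
  proof -
    interpret sigma_algebra UNIV "Pow (UNIV :: 'a set)" by (rule sigma_algebra_Pow)
    have "subadditive (Pow UNIV) mo"
      using outer by (intro countably_subadditive_subadditive) (auto simp: outer_measure_space_def)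
    then show ?thesis by (rule subadditiveD) auto
  qed
  moreover have "U \<inter> E \<union> (UNIV - U) \<inter> E = E" by auto
  ultimately show "mo E \<le> mo (U \<inter> E) + mo ((UNIV - U) \<inter> E)" by simp
qed

private definition riesz_measure :: "'a measure" where
  "riesz_measure = measure_of UNIV (sets borel) mo"

private lemma sets_riesz[simp]: "sets riesz_measure = sets borel"
  unfolding riesz_measure_def using sets.sigma_sets_eq[of borel] by (simp add: sets_measure_of_conv)

private lemma emeasure_riesz: assumes "B \<in> sets borel" shows "emeasure riesz_measure B = mo B"
proof -
  interpret sigma_algebra UNIV "Pow (UNIV :: 'a set)" by (rule sigma_algebra_Pow)
  let ?L = "lambda_system UNIV (Pow UNIV) mo"
  have ms: "measure_space UNIV ?L mo" using caratheodory_lemma[OF outer] .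
  then have sa: "sigma_algebra UNIV ?L" and ca: "countably_additive ?L mo" by (auto simp: measure_space_def)
  have "open U \<Longrightarrow> U \<in> ?L" for U by (simp add: lambda_system_def open_caratheodory)
  then have "sigma_sets UNIV {U. open U} \<subseteq> ?L"
    by (intro sigma_algebra.sigma_sets_subset[OF sa]) auto
  then have sub: "sets borel \<subseteq> ?L" by (simp add: borel_def)
  have "countably_additive (sets borel) mo"
    using ca sub unfolding countably_additive_def by (meson order_trans subsetD)
  then show ?thesis
    unfolding riesz_measure_def using assms sets.sigma_algebra_axioms[of borel]
    by (intro emeasure_measure_of_sigma) (auto simp: positive_def mo_open m0_empty)
qed

private lemma mo_le_L:
  assumes \<psi>: "\<psi> \<in> Cc" "\<And>x. 0 \<le> \<psi> x" and S: "\<And>x. x \<in> S \<Longrightarrow> 1 \<le> \<psi> x"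
  shows "mo S \<le> ennreal (\<Lambda> \<psi>)"
proof (rule ennreal_le_epsilon)
  fix e :: real assume e: "0 < e"
  define L where "L = \<Lambda> \<psi>"
  have L0: "L \<ge> 0" unfolding L_def by (rule Lpos[OF \<psi>])
  \<comment> \<open>Strictly between 0 and 1 even if \<open>L = 0\<close>, and such that
    \<open>L / t \<le> L + e\<close>; the set \<open>S\<close> then lies in the open set where
    \<open>t < \<psi> x\<close>.\<close>
  define t where "t = (L + e/2) / (L + e)"
  have t: "0 < t" "t < 1" using L0 e by (auto simp: t_def field_simps)
  let ?U = "{x. t < \<psi> x}"
  have U: "open ?U" by (intro open_Collect_less continuous_intros Cc_cont \<psi>)
  have "m0 ?U \<le> ennreal (L / t)"
    unfolding m0_def
  proof (rule SUP_least)
    fix \<phi> assume "\<phi> \<in> test ?U"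
    then obtain K where \<phi>: "\<phi> \<in> Cc" "\<And>x. 0 \<le> \<phi> x" "\<And>x. \<phi> x \<le> 1" "K \<subseteq> ?U" "\<And>x. x \<notin> K \<Longrightarrow> \<phi> x = 0"
      by (auto simp: test_def)
    have "\<phi> x \<le> (1/t) * \<psi> x" for x
    proof (cases "x \<in> K")
      case True
      then have "t < \<psi> x" using \<phi> by auto
      then have "1 \<le> (1/t) * \<psi> x" using t by (simp add: field_simps)
      then show ?thesis using \<phi>(3)[of x] by linarith
    next
      case False
      then show ?thesis using \<phi>(5)[of x] \<psi>(2)[of x] t by simp
    qed
    then have "\<Lambda> \<phi> \<le> (1/t) * \<Lambda> \<psi>" using Lmono[OF \<phi>(1) Cc_cmult[OF \<psi>(1)]] Lcmult[OF \<psi>(1)] by metis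
    then show "ennreal (\<Lambda> \<phi>) \<le> ennreal (L / t)" by (intro ennreal_leI) (simp add: L_def)
  qed
  moreover have "mo S \<le> m0 ?U" unfolding mo_def using U S t by (intro INF_lower) (force intro: less_le_trans)
  moreover have "L / t \<le> L + e"
  proof -
    have "L / t = L * (L + e) / (L + e/2)" using L0 e by (simp add: t_def)
    also have "\<dots> \<le> L + e" using L0 e by (simp add: divide_le_eq mult.commute mult_left_mono)
    finally show ?thesis .
  qed
  ultimately have "mo S \<le> ennreal (L + e)" by (meson ennreal_leI order_trans)
  then show "mo S \<le> ennreal (\<Lambda> \<psi>) + ennreal e" using L0 e by (simp add: L_def ennreal_plus)
qed

private lemma L_le_mo:
  assumes \<psi>: "\<psi> \<in> Cc" "\<And>x. 0 \<le> \<psi> x" "\<And>x. \<psi> x \<le> 1" and S: "compact S" "\<And>x. x \<notin> S \<Longrightarrow> \<psi> x = 0"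
  shows "ennreal (\<Lambda> \<psi>) \<le> mo S"
  unfolding mo_def m0_def
proof (intro INF_greatest SUP_upper)
  fix U assume "U \<in> {U. open U \<and> S \<subseteq> U}"
  then show "\<psi> \<in> test U" unfolding test_def using \<psi> S by auto
qed

private lemma radon_riesz: "radon riesz_measure"
proof (rule radonI)
  have KB: "K \<in> sets borel" if "compact K" for K :: "'a set" using that by (simp add: borel_closed compact_imp_closed)
  show "emeasure riesz_measure K < \<infinity>" if K: "compact K" for K
  proof -
    obtain f C where f: "f \<in> Cc" "\<And>x. 0 \<le> f x" "\<And>x. x \<in> K \<Longrightarrow> f x = 1"
      using urysohn_compact[OF lc K open_UNIV subset_UNIV] by metis
    have "mo K \<le> ennreal (\<Lambda> f)" using f by (intro mo_le_L) auto
    then show ?thesis using KB[OF K] by (auto simp: emeasure_riesz intro: le_less_trans)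
  qed
  show "\<exists>U. open U \<and> B \<subseteq> U \<and> emeasure riesz_measure U \<le> emeasure riesz_measure B + ennreal e"
    if B: "B \<in> sets borel" "emeasure riesz_measure B < \<infinity>" "e > 0" for B e
  proof -
    have "mo B < mo B + ennreal e"
      using B ennreal_add_left_cancel_less[of "mo B" 0 "ennreal e"] by (auto simp: emeasure_riesz)
    then have "\<exists>U. open U \<and> B \<subseteq> U \<and> m0 U \<le> mo B + ennreal e"
      unfolding mo_def by (auto simp: INF_less_iff less_imp_le)
    then show ?thesis using B by (auto simp: emeasure_riesz mo_open)
  qed
  show "emeasure riesz_measure U \<le> (SUP K\<in>{K. compact K \<and> K \<subseteq> U}. emeasure riesz_measure K)" if U: "open U" for U
  proof -
    have "ennreal (\<Lambda> \<phi>) \<le> (SUP K\<in>{K. compact K \<and> K \<subseteq> U}. emeasure riesz_measure K)" if tst: "\<phi> \<in> test U" for \<phi>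
    proof -
      obtain K where \<phi>: "\<phi> \<in> Cc" "\<And>x. 0 \<le> \<phi> x" "\<And>x. \<phi> x \<le> 1" "compact K" "K \<subseteq> U" "\<And>x. x \<notin> K \<Longrightarrow> \<phi> x = 0"
        using tst by (auto simp: test_def)
      have "ennreal (\<Lambda> \<phi>) \<le> mo K" using \<phi> by (intro L_le_mo) auto
      also have "\<dots> = emeasure riesz_measure K" using KB[OF \<phi>(4)] by (simp add: emeasure_riesz)
      also have "\<dots> \<le> (SUP K\<in>{K. compact K \<and> K \<subseteq> U}. emeasure riesz_measure K)" using \<phi> by (intro SUP_upper) auto
      finally show ?thesis .
    qed
    then show ?thesis using U by (simp add: emeasure_riesz mo_open m0_def SUP_least)
  qed
qed simp

text \<open>Cut \<phi> into \<open>N\<close> layers of height \<open>1 / N\<close>. On layer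
  \<open>k\<close> both the functional and the integral lie between \<open>m (Suc k) / N\<close> and
  \<open>m k / N\<close>, so the total difference telescopes to at most
  \<open>M / N\<close>.\<close>

private lemma integral_riesz_01:
  assumes \<phi>: "\<phi> \<in> Cc" "\<And>x. 0 \<le> \<phi> x" "\<And>x. \<phi> x \<le> 1"
  shows "integral\<^sup>L riesz_measure \<phi> = \<Lambda> \<phi>"
proof -
  let ?I = "integral\<^sup>L riesz_measure"
  have sp: "space riesz_measure = UNIV" by (rule radon_space[OF radon_riesz])
  obtain K where K: "compact K" "\<And>x. x \<notin> K \<Longrightarrow> \<phi> x = 0" using Cc_E[OF \<phi>(1)] by metis
  define M where "M = measure riesz_measure K"
  have bound: "\<bar>\<Lambda> \<phi> - ?I \<phi>\<bar> \<le> M / real N" if N: "N > 0" for N :: nat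
  proof -
    define S where "S k = K \<inter> {x. real k / real N \<le> \<phi> x}" for k
    define m where "m k = measure riesz_measure (S k)" for k
    define s where "s k x = min (\<phi> x) (real (Suc k) / real N) - min (\<phi> x) (real k / real N)" for k x
    have Sc: "compact (S k)" for k
      unfolding S_def by (intro compact_Int_closed K closed_Collect_le continuous_intros Cc_cont \<phi>)
    have SB: "S k \<in> sets borel" for k using Sc by (simp add: borel_closed compact_imp_closed)
    have Sf: "emeasure riesz_measure (S k) = ennreal (m k)" for k
      unfolding m_def using radon_compact[OF radon_riesz Sc[of k]] by (intro emeasure_eq_ennreal_measure) auto
    have sC: "s k \<in> Cc" for k unfolding s_def by (intro Cc_diff Cc_min_const \<phi>) auto
    have step: "real k / real N \<le> real (Suc k) / real N" for k by (intro divide_right_mono) auto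
    have gap: "real (Suc k) / real N - real k / real N = 1 / real N" for k by (simp add: diff_divide_distrib[symmetric])
    have s0: "0 \<le> s k x" "s k x \<le> 1 / real N" for k x
      using step[of k] gap[of k] unfolding s_def by (auto simp: min_def)
    have sone: "s k x = 1 / real N" if "x \<in> S (Suc k)" for k x
      using that step[of k] gap[of k] by (auto simp: s_def S_def min_def)
    have szero: "s k x = 0" if "x \<notin> S k" for k x
      using that K(2)[of x] step[of k] by (auto simp: s_def S_def min_def)
    have ssum: "(\<Sum>k<n. s k x) = min (\<phi> x) (real n / real N)" for n x
      using \<phi>(2)[of x] by (induction n) (auto simp: s_def)
    have \<phi>eq: "\<phi> = (\<lambda>x. \<Sum>k<N. s k x)" using \<phi>(3) N by (auto simp: ssum)
    have sumC: "(\<lambda>x. \<Sum>k<n. s k x) \<in> Cc" for n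
      by (induction n) (auto simp: Cc_zero intro!: Cc_add sC)
    have Lsum: "\<Lambda> (\<lambda>x. \<Sum>k<n. s k x) = (\<Sum>k<n. \<Lambda> (s k))" for n
    proof (induction n)
      case 0 then show ?case using Lcmult[OF Cc_zero, of 0] by simp
    next
      case (Suc n)
      then show ?case using Ladd[OF sumC[of n] sC[of n]] by simp
    qed
    have Isum: "?I (\<lambda>x. \<Sum>k<N. s k x) = (\<Sum>k<N. ?I (s k))"
      by (intro Bochner_Integration.integral_sum Cc_integrable radon_riesz sC)
    have nsC: "(\<lambda>x. real N * s k x) \<in> Cc" for k by (intro Cc_cmult sC)
    have L1: "m (Suc k) / real N \<le> \<Lambda> (s k)" for k
    proof -
      have "mo (S (Suc k)) \<le> ennreal (\<Lambda> (\<lambda>x. real N * s k x))"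
        using sone N s0 by (intro mo_le_L nsC) auto
      then have "m (Suc k) \<le> real N * \<Lambda> (s k)"
        using Sf[of "Suc k"] SB[of "Suc k"] Lpos[OF sC s0(1)] Lcmult[OF sC]
        by (simp add: emeasure_riesz ennreal_le_iff)
      then show ?thesis using N by (simp add: field_simps)
    qed
    have L2: "\<Lambda> (s k) \<le> m k / real N" for k
    proof -
      have "ennreal (\<Lambda> (\<lambda>x. real N * s k x)) \<le> mo (S k)"
        using s0 N szero by (intro L_le_mo nsC Sc) (auto simp: field_simps)
      then have "real N * \<Lambda> (s k) \<le> m k"
        using Sf[of k] SB[of k] Lcmult[OF sC, of "real N" k] by (simp add: emeasure_riesz ennreal_le_iff m_def)
      then show ?thesis using N by (simp add: field_simps)
    qed
    have int_ind: "integrable riesz_measure (\<lambda>x. indicator (S k) x / real N)" for k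
      using Sf[of k] SB[of k] by (intro integrable_divide_zero) (simp add: integrable_indicator_iff)
    have Iind: "?I (\<lambda>x. indicator (S k) x / real N) = m k / real N" for k
      using SB[of k] by (simp add: m_def sp)
    have I1: "m (Suc k) / real N \<le> ?I (s k)" for k
      unfolding Iind[symmetric] using s0 sone
      by (intro integral_mono int_ind Cc_integrable radon_riesz sC) (auto simp: indicator_def)
    have I2: "?I (s k) \<le> m k / real N" for k
      unfolding Iind[symmetric] using s0 szero
      by (intro integral_mono int_ind Cc_integrable radon_riesz sC) (auto simp: indicator_def)
    have "\<bar>\<Lambda> \<phi> - ?I \<phi>\<bar> = \<bar>\<Sum>k<N. \<Lambda> (s k) - ?I (s k)\<bar>"
      by (subst (1 2) \<phi>eq) (simp add: Lsum Isum sum_subtractf)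
    also have "\<dots> \<le> (\<Sum>k<N. \<bar>\<Lambda> (s k) - ?I (s k)\<bar>)" by (rule sum_abs)
    also have "\<dots> \<le> (\<Sum>k<N. m k / real N - m (Suc k) / real N)"
    proof (rule sum_mono)
      fix k show "\<bar>\<Lambda> (s k) - ?I (s k)\<bar> \<le> m k / real N - m (Suc k) / real N"
        using L1[of k] L2[of k] I1[of k] I2[of k] by linarith
    qed
    also have "\<dots> = m 0 / real N - m N / real N" by (rule sum_lessThan_telescope')
    also have "\<dots> \<le> M / real N"
      using \<phi>(2) by (simp add: m_def M_def S_def)
    finally show ?thesis .
  qed
  have "(\<lambda>n. M / real (Suc n)) \<longlonglongrightarrow> 0" using LIMSEQ_Suc[OF lim_const_over_n[of M]] by simp
  then have "\<bar>\<Lambda> \<phi> - ?I \<phi>\<bar> \<le> 0"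
    using bound[of "Suc n" for n] by (intro LIMSEQ_le_const[where X="\<lambda>n. M / real (Suc n)"]) blast+
  then show ?thesis by simp
qed

theorem riesz_representation: "\<exists>\<nu>. radon \<nu> \<and> (\<forall>\<phi>\<in>Cc. integral\<^sup>L \<nu> \<phi> = \<Lambda> \<phi>)"
proof (intro exI[of _ riesz_measure] conjI ballI radon_riesz)
  have pos: "integral\<^sup>L riesz_measure \<phi> = \<Lambda> \<phi>" if \<phi>: "\<phi> \<in> Cc" "\<And>x. 0 \<le> \<phi> x" for \<phi>
  proof -
    obtain b where b: "b \<ge> 0" "\<And>x. \<bar>\<phi> x\<bar> \<le> b" using Cc_bounded[OF \<phi>(1)] by metis
    let ?c = "b + 1"
    let ?\<psi> = "\<lambda>x. (1 / ?c) * \<phi> x"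
    have \<psi>: "?\<psi> \<in> Cc" using \<phi> by (intro Cc_cmult)
    have le: "\<phi> x \<le> b" for x using b(2)[of x] by (simp add: abs_le_iff)
    have "integral\<^sup>L riesz_measure ?\<psi> = \<Lambda> ?\<psi>"
      using b(1) \<phi>(2) le by (intro integral_riesz_01 \<psi>) (auto simp: divide_le_eq intro: order_trans[OF le])
    then have "(1 / ?c) * integral\<^sup>L riesz_measure \<phi> = (1 / ?c) * \<Lambda> \<phi>"
      using Lcmult[OF \<phi>(1), of "1 / ?c"] by simp
    then show ?thesis using b by (simp add: field_simps)
  qed
  fix \<phi> :: "'a \<Rightarrow> real" assume \<phi>: "\<phi> \<in> Cc"
  let ?p = "\<lambda>x. max (\<phi> x) 0" and ?n = "\<lambda>x. max (- 1 * \<phi> x) 0"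
  have p: "?p \<in> Cc" and n: "?n \<in> Cc" using \<phi> Cc_zero by (intro Cc_max Cc_cmult; simp)+
  have eq: "\<phi> = (\<lambda>x. ?p x + (- 1) * ?n x)" by (auto simp: max_def)
  have "\<Lambda> \<phi> = \<Lambda> ?p + \<Lambda> (\<lambda>x. (- 1) * ?n x)"
    by (subst eq) (intro Ladd p Cc_cmult n)
  also have "\<dots> = \<Lambda> ?p - \<Lambda> ?n" using Lcmult[OF n, of "-1"] by simp
  also have "\<dots> = integral\<^sup>L riesz_measure ?p - integral\<^sup>L riesz_measure ?n"
    using pos[OF p] pos[OF n] by simp
  also have "\<dots> = integral\<^sup>L riesz_measure (\<lambda>x. ?p x - ?n x)"
    by (intro Bochner_Integration.integral_diff[symmetric] Cc_integrable radon_riesz p n)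
  also have "(\<lambda>x. ?p x - ?n x) = \<phi>" by (auto simp: max_def)
  finally show "integral\<^sup>L riesz_measure \<phi> = \<Lambda> \<phi>" by simp
qed

end

subsection \<open>Vague limits\<close>

lemma nn_integral_lsc_eq_SUP_Cc:
  fixes f :: "'a::t2_space \<Rightarrow> ennreal"
  assumes lc: "locally_compact_space (euclidean :: 'a topology)" and r: "radon \<nu>" and f: "lsc f"
  shows "(\<integral>\<^sup>+ x. f x \<partial>\<nu>) = (SUP \<phi>\<in>{\<phi>\<in>Cc. \<forall>x. 0 \<le> \<phi> x \<and> ennreal (\<phi> x) \<le> f x}. \<integral>\<^sup>+ x. ennreal (\<phi> x) \<partial>\<nu>)"
    (is "_ = (SUP \<phi>\<in>?D. _)")
proof (rule antisym)
  show "(\<integral>\<^sup>+ x. f x \<partial>\<nu>) \<le> (SUP \<phi>\<in>?D. \<integral>\<^sup>+ x. ennreal (\<phi> x) \<partial>\<nu>)"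
  proof (rule nn_integral_le_SUP_superlevel)
    show "f \<in> borel_measurable \<nu>" by (rule radon_meas[OF r lsc_borel[OF f]])
    show "(\<lambda>x. ennreal (\<phi> x)) \<in> borel_measurable \<nu>" if "\<phi> \<in> ?D" for \<phi>
    proof -
      have "\<phi> \<in> borel_measurable \<nu>" using that by (intro radon_meas[OF r Cc_borel]) auto
      then show ?thesis by measurable
    qed
    show "?D \<noteq> {}" using Cc_zero by (auto intro!: exI[of _ "\<lambda>x. 0"])
    show "\<exists>\<eta>\<in>?D. (\<lambda>x. ennreal (\<phi> x)) \<le> (\<lambda>x. ennreal (\<eta> x)) \<and> (\<lambda>x. ennreal (\<psi> x)) \<le> (\<lambda>x. ennreal (\<eta> x))"
      if "\<phi> \<in> ?D" "\<psi> \<in> ?D" for \<phi> \<psi>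
    proof (rule bexI[of _ "\<lambda>x. max (\<phi> x) (\<psi> x)"])
      show "(\<lambda>x. max (\<phi> x) (\<psi> x)) \<in> ?D" using that by (intro CollectI conjI Cc_max) (auto simp: max_def)
    qed (auto simp: le_fun_def intro!: ennreal_leI)
    fix c :: ennreal assume c: "c < top"
    have "emeasure \<nu> K \<le> (SUP \<phi>\<in>?D. emeasure \<nu> {x. c < ennreal (\<phi> x)})" if K: "compact K" "K \<subseteq> {x. c < f x}" for K
    proof (cases "K = {}")
      case False
      \<comment> \<open>Compactness gives a level strictly above \<open>c\<close>, so that a
        multiple of a Urysohn function exceeds \<open>c\<close> on all of \<open>K\<close> while
        staying below \<open>f\<close>.\<close>
      have "\<exists>c'>c. c' < top \<and> K \<subseteq> {x. c' < f x}"
      proof -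
        have cov: "K \<subseteq> (\<Union>c'\<in>{c'. c < c' \<and> c' < top}. {x. c' < f x})"
        proof
          fix x assume "x \<in> K"
          then have "c < f x" using K by auto
          then obtain c' where "c < c'" "c' < f x" using dense by blast
          then show "x \<in> (\<Union>c'\<in>{c'. c < c' \<and> c' < top}. {x. c' < f x})"
            using less_le_trans[of c' "f x" top] by auto
        qed
        have op: "open {x. c' < f x}" for c' using f by (simp add: lsc_def)
        obtain F where F: "F \<subseteq> {c'. c < c' \<and> c' < top}" "finite F" "K \<subseteq> (\<Union>c'\<in>F. {x. c' < f x})"
          by (rule compactE_image[OF K(1) op cov])
        then have "F \<noteq> {}" using False by auto
        then have "Min F \<in> F" using F by simp
        moreover have "K \<subseteq> {x. Min F < f x}"
        proof
          fix x assume "x \<in> K"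
          then obtain c' where "c' \<in> F" "c' < f x" using F by auto
          then show "x \<in> {x. Min F < f x}" using Min_le[OF F(2)] by (auto intro: le_less_trans)
        qed
        ultimately show ?thesis using F by blast
      qed
      then obtain c' where c': "c < c'" "c' < top" "K \<subseteq> {x. c' < f x}" by blast
      then obtain q where q: "c' = ennreal q" "q \<ge> 0" by (cases c') auto
      have op: "open {x. c' < f x}" using f by (simp add: lsc_def)
      obtain u C where u: "u \<in> Cc" "\<And>x. 0 \<le> u x" "\<And>x. u x \<le> 1" "\<And>x. x \<in> K \<Longrightarrow> u x = 1"
        "compact C" "C \<subseteq> {x. c' < f x}" "\<And>x. x \<notin> C \<Longrightarrow> u x = 0"
        using urysohn_compact[OF lc K(1) op c'(3)] by metis
      let ?\<phi> = "\<lambda>x. q * u x"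
      have "?\<phi> \<in> ?D"
      proof (intro CollectI conjI allI Cc_cmult u)
        fix x show "0 \<le> q * u x" using q u by simp
        show "ennreal (q * u x) \<le> f x"
        proof (cases "x \<in> C")
          case True
          have "ennreal (q * u x) \<le> c'" unfolding q(1) using q(2) u(2,3)[of x] by (intro ennreal_leI) (simp add: mult_left_le)
          also have "\<dots> \<le> f x" using u(6) True by auto
          finally show ?thesis .
        qed (simp add: u)
      qed
      moreover have "emeasure \<nu> K \<le> emeasure \<nu> {x. c < ennreal (?\<phi> x)}"
      proof (rule emeasure_mono)
        show "K \<subseteq> {x. c < ennreal (?\<phi> x)}" using u(4) c' q by auto
        have "?\<phi> \<in> borel_measurable borel" using u by (intro Cc_borel Cc_cmult)
        then have "{x\<in>space borel. c < ennreal (?\<phi> x)} \<in> sets borel" by measurable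
        then show "{x. c < ennreal (?\<phi> x)} \<in> sets \<nu>" using r by (simp add: radon_sets)
      qed
      ultimately show ?thesis by (meson SUP_upper2)
    qed simp
    then have "emeasure \<nu> {x. c < f x} \<le> (SUP \<phi>\<in>?D. emeasure \<nu> {x. c < ennreal (\<phi> x)})"
      using f by (subst radon_inner[OF r]) (auto simp: lsc_def intro!: SUP_least)
    then show "emeasure \<nu> {x\<in>space \<nu>. c < f x} \<le> (SUP \<phi>\<in>?D. emeasure \<nu> {x\<in>space \<nu>. c < ennreal (\<phi> x)})"
      by (simp add: radon_space[OF r])
  qed
  show "(SUP \<phi>\<in>?D. \<integral>\<^sup>+ x. ennreal (\<phi> x) \<partial>\<nu>) \<le> (\<integral>\<^sup>+ x. f x \<partial>\<nu>)"
    by (intro SUP_least nn_integral_mono) auto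
qed

text \<open>Testing from below is enough: the integral of \<open>f\<close> is the supremum over the
  nonnegative members of \<open>Cc\<close> below \<open>f\<close>, and the integrals of each of
  these converge.\<close>

lemma vague_limit_lsc_le:
  fixes f :: "'a::t2_space \<Rightarrow> ennreal"
  assumes lc: "locally_compact_space (euclidean :: 'a topology)" and r: "radon \<nu>" and f: "lsc f"
    and G: "G \<noteq> bot" and M: "\<forall>\<^sub>F v in G. radon (M v) \<and> (\<integral>\<^sup>+ x. f x \<partial>M v) \<le> b"
    and lim: "\<And>\<phi>. \<phi> \<in> Cc \<Longrightarrow> ((\<lambda>v. integral\<^sup>L (M v) \<phi>) \<longlongrightarrow> integral\<^sup>L \<nu> \<phi>) G"
  shows "(\<integral>\<^sup>+ x. f x \<partial>\<nu>) \<le> b"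
  unfolding nn_integral_lsc_eq_SUP_Cc[OF lc r f]
proof (rule SUP_least, elim CollectE conjE)
  fix \<phi> :: "'a \<Rightarrow> real" assume \<phi>: "\<phi> \<in> Cc" "\<forall>x. 0 \<le> \<phi> x \<and> ennreal (\<phi> x) \<le> f x"
  have eq: "(\<integral>\<^sup>+ x. ennreal (\<phi> x) \<partial>\<mu>) = ennreal (integral\<^sup>L \<mu> \<phi>)" if "radon \<mu>" for \<mu>
    using \<phi> Cc_integrable[OF that] by (intro nn_integral_eq_integral) auto
  have t: "((\<lambda>v. ennreal (integral\<^sup>L (M v) \<phi>)) \<longlongrightarrow> ennreal (integral\<^sup>L \<nu> \<phi>)) G"
    by (intro tendsto_ennrealI lim \<phi>)
  have e: "\<forall>\<^sub>F v in G. ennreal (integral\<^sup>L (M v) \<phi>) \<le> b"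
    using M
  proof eventually_elim
    case (elim v)
    have "ennreal (integral\<^sup>L (M v) \<phi>) = (\<integral>\<^sup>+ x. ennreal (\<phi> x) \<partial>M v)" using elim by (simp add: eq)
    also have "\<dots> \<le> (\<integral>\<^sup>+ x. f x \<partial>M v)" using \<phi> by (intro nn_integral_mono) auto
    finally show ?case using elim by auto
  qed
  from tendsto_upperbound[OF t e G] show "(\<integral>\<^sup>+ x. ennreal (\<phi> x) \<partial>\<nu>) \<le> b" by (simp add: eq r)
qed

lemma vague_limit_null_open:
  fixes U :: "'a::t2_space set"
  assumes lc: "locally_compact_space (euclidean :: 'a topology)" and r: "radon \<nu>" and U: "open U"
    and G: "G \<noteq> bot" and M: "\<forall>\<^sub>F v in G. radon (M v) \<and> emeasure (M v) U = 0"
    and lim: "\<And>\<phi>. \<phi> \<in> Cc \<Longrightarrow> ((\<lambda>v. integral\<^sup>L (M v) \<phi>) \<longlongrightarrow> integral\<^sup>L \<nu> \<phi>) G"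
  shows "emeasure \<nu> U = 0"
proof -
  have "lsc (\<lambda>x. 1 * indicator U x)" by (rule lsc_cmult_indicator[OF U])
  then have l: "lsc (indicator U)" by simp
  have "(\<integral>\<^sup>+ x. indicator U x \<partial>\<nu>) \<le> 0"
    by (rule vague_limit_lsc_le[OF lc r l G _ lim])
       (use M in \<open>eventually_elim, use U in \<open>auto simp: radon_sets\<close>\<close>)
  then show ?thesis using U r by (simp add: radon_sets)
qed

section \<open>Vague compactness of families with bounded masses\<close>

text \<open>This replaces the choice of a convergent subnet: \<open>G\<close> is refined by the
  preimages of the neighbourhoods of a cluster point.\<close>

lemma compact_cluster_point:
  fixes K :: "'b::topological_space set"
  assumes K: "compact K" and G: "G \<noteq> bot" and ev: "\<forall>\<^sub>F v in G. f v \<in> K"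
  obtains x G' where "G' \<le> G" "G' \<noteq> bot" "(f \<longlongrightarrow> x) G'"
proof -
  have "filtermap f G \<noteq> bot" "\<forall>\<^sub>F y in filtermap f G. y \<in> K"
    using G ev by (auto simp: filtermap_bot_iff eventually_filtermap)
  then obtain x where x: "x \<in> K" "inf (nhds x) (filtermap f G) \<noteq> bot"
    using K compact_filter[of K] by blast
  define G' where "G' = inf G (filtercomap f (nhds x))"
  have "G' \<noteq> bot"
  proof
    assume "G' = bot"
    then have "eventually (\<lambda>_. False) G'" by simp
    then obtain P Q where PQ: "eventually P G" "eventually Q (filtercomap f (nhds x))" "\<And>v. P v \<Longrightarrow> Q v \<Longrightarrow> False"
      unfolding G'_def eventually_inf by blast
    then obtain R where R: "eventually R (nhds x)" "\<And>v. R (f v) \<Longrightarrow> Q v"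
      unfolding eventually_filtercomap by blast
    have "eventually (\<lambda>y. \<not> R y) (filtermap f G)"
      unfolding eventually_filtermap using PQ(1) by eventually_elim (use PQ R in blast)
    then have "eventually (\<lambda>_. False) (inf (nhds x) (filtermap f G))"
      unfolding eventually_inf using R by blast
    then show False using x by (simp add: trivial_limit_def)
  qed
  moreover have "(f \<longlongrightarrow> x) G'"
    unfolding G'_def by (rule filterlim_mono[OF filterlim_filtercomap]) auto
  ultimately show ?thesis using that[of G' x] by (simp add: G'_def)
qed

text \<open>Tychonoff's theorem is applied to the integrals for all components and all test
  functions at once, so that a single finer filter serves every \<open>i\<close>. The limits are
  positive and linear in the test function, and the Riesz theorem turns them into measures.\<close>

lemma vague_cluster_family:
  fixes M :: "'v \<Rightarrow> 'i \<Rightarrow> 'a::t2_space measure"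
  assumes lc: "locally_compact_space (euclidean :: 'a topology)" and G: "G \<noteq> bot"
    and M: "\<forall>\<^sub>F v in G. \<forall>i\<in>I. radon (M v i) \<and> emeasure (M v i) UNIV \<le> ennreal (c i)"
  obtains G' lam where "G' \<le> G" "G' \<noteq> bot" "\<And>i. i \<in> I \<Longrightarrow> radon (lam i)"
    "\<And>i \<phi>. i \<in> I \<Longrightarrow> \<phi> \<in> Cc \<Longrightarrow> ((\<lambda>v. integral\<^sup>L (M v i) \<phi>) \<longlongrightarrow> integral\<^sup>L (lam i) \<phi>) G'"
proof -
  have "\<exists>b. b \<ge> 0 \<and> (\<forall>x. \<bar>\<phi> x\<bar> \<le> b)" if "\<phi> \<in> Cc" for \<phi> :: "'a \<Rightarrow> real" using Cc_bounded[OF that] by metis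
  then obtain b where b: "\<And>\<phi>::'a \<Rightarrow> real. \<phi> \<in> Cc \<Longrightarrow> b \<phi> \<ge> 0" "\<And>\<phi> x. \<phi> \<in> Cc \<Longrightarrow> \<bar>\<phi> x\<bar> \<le> b \<phi>" by metis
  \<comment> \<open>The default 0 lets the coordinates range over a product of compact intervals
    indexed by the whole type.\<close>
  define f where "f v j = (if fst j \<in> I \<and> snd j \<in> Cc then integral\<^sup>L (M v (fst j)) (snd j) else 0)" for v j
  define B where "B j = (if snd j \<in> Cc then b (snd j) * max 0 (c (fst j)) else 0)" for j
  have B0: "B j \<ge> 0" for j unfolding B_def using b by auto
  let ?K = "PiE UNIV (\<lambda>j. {- B j..B j}) :: ('i \<times> ('a \<Rightarrow> real) \<Rightarrow> real) set"
  have "compactin (product_topology (\<lambda>_. euclidean) UNIV) ?K" by (simp add: compactin_PiE)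
  then have K: "compact ?K" by (simp add: euclidean_product_topology)
  have ev: "\<forall>\<^sub>F v in G. f v \<in> ?K"
    using M
  proof eventually_elim
    case (elim v)
    have "\<bar>f v j\<bar> \<le> B j" for j
    proof (cases "fst j \<in> I \<and> snd j \<in> Cc")
      case True
      let ?m = "M v (fst j)"
      have r: "radon ?m" and m: "emeasure ?m UNIV \<le> ennreal (c (fst j))" using True elim by auto
      have fm: "finite_measure ?m"
        using m radon_space[OF r] by (intro finite_measureI) (auto simp: top_unique)
      have "\<bar>integral\<^sup>L ?m (snd j)\<bar> \<le> integral\<^sup>L ?m (\<lambda>x. \<bar>snd j x\<bar>)" by (rule integral_abs_bound)
      also have "\<dots> \<le> integral\<^sup>L ?m (\<lambda>x. b (snd j))"
        using True b Cc_integrable[OF r] by (intro integral_mono integrable_abs finite_measure.integrable_const[OF fm]) auto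
      also have "\<dots> = b (snd j) * measure ?m UNIV"
        using radon_space[OF r] by (simp add: mult.commute)
      also have "\<dots> \<le> b (snd j) * max 0 (c (fst j))"
      proof (rule mult_left_mono)
        have "measure ?m UNIV = enn2real (emeasure ?m UNIV)" by (simp add: measure_def)
        also have "\<dots> \<le> enn2real (ennreal (c (fst j)))" using m by (intro enn2real_mono) auto
        also have "\<dots> \<le> max 0 (c (fst j))" by (simp add: enn2real_ennreal max_def ennreal_neg)
        finally show "measure ?m UNIV \<le> max 0 (c (fst j))" .
      qed (use b True in auto)
      finally show ?thesis using True by (simp add: f_def B_def)
    qed (use B0[of j] in \<open>auto simp: f_def\<close>)
    then show ?case by (auto simp: PiE_UNIV_domain abs_le_iff minus_le_iff)
  qed
  obtain x G' where G': "G' \<le> G" "G' \<noteq> bot" "(f \<longlongrightarrow> x) G'" using compact_cluster_point[OF K G ev] by metis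
  have limj: "((\<lambda>v. f v j) \<longlongrightarrow> x j) G'" for j
    by (rule continuous_on_tendsto_compose[OF continuous_on_product_coordinates[of j] G'(3)]) auto
  have lim: "((\<lambda>v. integral\<^sup>L (M v i) \<phi>) \<longlongrightarrow> x (i, \<phi>)) G'" if "i \<in> I" "\<phi> \<in> Cc" for i \<phi>
    using limj[of "(i, \<phi>)"] that by (simp add: f_def)
  have M': "\<forall>\<^sub>F v in G'. \<forall>i\<in>I. radon (M v i)"
    using filter_leD[OF G'(1) M] by eventually_elim auto
  have ex: "\<exists>\<nu>. radon \<nu> \<and> (\<forall>\<phi>\<in>Cc. integral\<^sup>L \<nu> \<phi> = x (i, \<phi>))" if i: "i \<in> I" for i
  proof (rule riesz_representation[OF lc, where \<Lambda>="\<lambda>\<phi>. x (i, \<phi>)"])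
    fix \<phi> \<psi> :: "'a \<Rightarrow> real" assume \<phi>: "\<phi> \<in> Cc" "\<psi> \<in> Cc"
    have "((\<lambda>v. integral\<^sup>L (M v i) \<phi> + integral\<^sup>L (M v i) \<psi>) \<longlongrightarrow> x (i, \<phi>) + x (i, \<psi>)) G'"
      by (intro tendsto_add lim i \<phi>)
    moreover have "\<forall>\<^sub>F v in G'. integral\<^sup>L (M v i) \<phi> + integral\<^sup>L (M v i) \<psi> = integral\<^sup>L (M v i) (\<lambda>x. \<phi> x + \<psi> x)"
      using M'
    proof eventually_elim
      case (elim v)
      then have r: "radon (M v i)" using i by auto
      show ?case by (intro Bochner_Integration.integral_add[symmetric] Cc_integrable r \<phi>)
    qed
    ultimately have "((\<lambda>v. integral\<^sup>L (M v i) (\<lambda>x. \<phi> x + \<psi> x)) \<longlongrightarrow> x (i, \<phi>) + x (i, \<psi>)) G'"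
      by (rule Lim_transform_eventually)
    then show "x (i, \<lambda>x. \<phi> x + \<psi> x) = x (i, \<phi>) + x (i, \<psi>)"
      by (rule tendsto_unique[OF G'(2) lim[OF i Cc_add[OF \<phi>]]])
  next
    fix \<phi> :: "'a \<Rightarrow> real" and c assume \<phi>: "\<phi> \<in> Cc"
    have "((\<lambda>v. c * integral\<^sup>L (M v i) \<phi>) \<longlongrightarrow> c * x (i, \<phi>)) G'" by (intro tendsto_mult tendsto_const lim i \<phi>)
    then have "((\<lambda>v. integral\<^sup>L (M v i) (\<lambda>x. c * \<phi> x)) \<longlongrightarrow> c * x (i, \<phi>)) G'" by simp
    then show "x (i, \<lambda>x. c * \<phi> x) = c * x (i, \<phi>)"
      by (rule tendsto_unique[OF G'(2) lim[OF i Cc_cmult[OF \<phi>]]])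
  next
    fix \<phi> :: "'a \<Rightarrow> real" assume \<phi>: "\<phi> \<in> Cc" "\<And>x. 0 \<le> \<phi> x"
    show "0 \<le> x (i, \<phi>)"
      by (rule tendsto_lowerbound[OF lim[OF i \<phi>(1)] _ G'(2)]) (auto intro!: always_eventually \<phi> integral_nonneg_AE)
  qed
  then obtain lam where lam: "\<And>i. i \<in> I \<Longrightarrow> radon (lam i)" "\<And>i \<phi>. i \<in> I \<Longrightarrow> \<phi> \<in> Cc \<Longrightarrow> integral\<^sup>L (lam i) \<phi> = x (i, \<phi>)"
    by metis
  show ?thesis by (rule that[OF G'(1,2) lam(1)]) (use lim lam(2) in auto)
qed

text \<open>A function continuous on the closed \<open>A\<close> only becomes lower semicontinuous
  on the whole space when extended by \<open>top\<close>; measures carried by \<open>A\<close> do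
  not see the extension.\<close>

lemma lsc_on_closed:
  assumes A: "closed A" and h: "continuous_on A h"
  shows "lsc (\<lambda>x. if x \<in> A then ennreal (h x) else top)"
  unfolding lsc_def
proof
  fix c :: ennreal
  show "open {x. c < (if x \<in> A then ennreal (h x) else top)}"
  proof (cases "c = top")
    case False
    have "continuous_on A (\<lambda>x. ennreal (h x))" by (intro continuous_on_ennreal h)
    then obtain T where T: "open T" "T \<inter> A = (\<lambda>x. ennreal (h x)) -` {c<..} \<inter> A"
      using continuous_on_open_invariant[of A "\<lambda>x. ennreal (h x)"] open_greaterThan by metis
    have "{x. c < (if x \<in> A then ennreal (h x) else top)} = - A \<union> T"
      using T False by (auto simp: less_top split: if_splits)
    then show ?thesis using T A by auto
  qed simp
qed

subsection \<open>Sets of finite capacity do not lose mass at infinity\<close>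

locale consistent_kernel = energy_kernel +
  assumes consistent: "kernel_consistent \<kappa>" and lc: "locally_compact_space (euclidean :: 'a topology)"
begin

definition unit_measures :: "'a set \<Rightarrow> 'a measure set" where
  "unit_measures E = {\<nu>. inEp \<kappa> \<nu> \<and> conc \<nu> E \<and> emeasure \<nu> UNIV = 1}"

text \<open>The parallelogram law on a convex set: if two energies are close to the infimum, the
  midpoint cannot lie much lower, so the two measures are strongly close.\<close>

lemma unit_measures_midpoint:
  assumes x: "x \<in> unit_measures E" and y: "y \<in> unit_measures E"
  shows "scale_measure (ennreal (1/2)) (madd x y) \<in> unit_measures E"
    and "4 * energy (scale_measure (ennreal (1/2)) (madd x y)) (scale_measure (ennreal (1/2)) (madd x y))
      = 2 * energy x x + 2 * energy y y - ip \<kappa> (x, y) (x, y)"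
proof -
  have E: "inEp \<kappa> x" "inEp \<kappa> y" using x y by (auto simp: unit_measures_def)
  have s: "sets x = sets borel" "sets y = sets borel" using E inEp_sets by auto
  have E': "inEp \<kappa> (madd x y)" using E by (rule inEp_madd)
  obtain B C where B: "B \<in> sets borel" "B \<subseteq> E" "emeasure x (UNIV - B) = 0"
    and C: "C \<in> sets borel" "C \<subseteq> E" "emeasure y (UNIV - C) = 0"
    using x y by (auto simp: unit_measures_def conc_def)
  have "emeasure x (UNIV - (B \<union> C)) \<le> emeasure x (UNIV - B)" "emeasure y (UNIV - (B \<union> C)) \<le> emeasure y (UNIV - C)"
    by (rule emeasure_mono; use B C s in auto)+
  then have "conc (scale_measure (ennreal (1/2)) (madd x y)) E"
    unfolding conc_def using B C by (intro bexI[of _ "B \<union> C"]) (auto simp: emeasure_madd s)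
  moreover have "emeasure (scale_measure (ennreal (1/2)) (madd x y)) UNIV = 1"
  proof -
    have "ennreal (1/2) * ennreal 2 = ennreal (1/2 * 2)" by (rule ennreal_mult[symmetric]) auto
    then have "ennreal (1/2) * (1 + 1) = 1" by (simp del: ennreal_half)
    then show ?thesis using x y by (simp add: emeasure_madd s unit_measures_def del: ennreal_half one_add_one)
  qed
  ultimately show "scale_measure (ennreal (1/2)) (madd x y) \<in> unit_measures E"
    using E' by (simp add: unit_measures_def inEp_scale del: ennreal_half)
  show "4 * energy (scale_measure (ennreal (1/2)) (madd x y)) (scale_measure (ennreal (1/2)) (madd x y))
      = 2 * energy x x + 2 * energy y y - ip \<kappa> (x, y) (x, y)"
    using E E' energy_sym[OF E]
    by (simp add: energy_scale_left energy_scale_right inEp_scale energy_madd_left energy_madd_right ip_def field_simps del: ennreal_half)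
qed

lemma unit_measures_mono: "E \<subseteq> F \<Longrightarrow> unit_measures E \<subseteq> unit_measures F"
  unfolding unit_measures_def conc_def by blast

text \<open>If the infima stayed bounded, near-minimizers would form a strong Cauchy filter with vague limit
  \<open>0\<close>, so by consistency their energies would tend to \<open>0\<close>, contradicting \<open>cap \<kappa> A \<noteq> \<infinity>\<close>.\<close>

lemma energy_at_infinity:
  assumes capf: "cap \<kappa> A \<noteq> \<infinity>"
  shows "(SUP K\<in>{K. compact K}. INF \<nu>\<in>unit_measures (A - K). kint \<kappa> \<nu> \<nu>) = top"
proof (rule ccontr)
  define w where "w K = (INF \<nu>\<in>unit_measures (A - K). kint \<kappa> \<nu> \<nu>)" for K
  assume "\<not> ?thesis"
  then have "(SUP K\<in>{K. compact K}. w K) \<noteq> top" unfolding w_def .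
  then obtain s where s: "(SUP K\<in>{K. compact K}. w K) = ennreal s" "s \<ge> 0"
    by (cases "SUP K\<in>{K. compact K}. w K") auto
  have ws: "w K \<le> ennreal s" if "compact K" for K unfolding s(1)[symmetric] using that by (intro SUP_upper) auto
  \<comment> \<open>The unit measures carried outside a compact set with energy below
    \<open>s\<close> plus a margin; such measures exist because every infimum \<open>w K\<close> is
    at most \<open>s\<close>.\<close>
  define S where "S z = {\<nu> \<in> unit_measures (A - fst z). kint \<kappa> \<nu> \<nu> < ennreal (s + snd z)}" for z :: "'a set \<times> real"
  define I where "I = {z::'a set \<times> real. compact (fst z) \<and> snd z > 0}"
  define F where "F = (INF z\<in>I. principal (S z))"
  have Ine: "({}, 1) \<in> I" by (simp add: I_def)
  have Sne: "S z \<noteq> {}" if "z \<in> I" for z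
  proof -
    have "w (fst z) < ennreal (s + snd z)"
      using ws[of "fst z"] that s(2) by (auto simp: I_def ennreal_less_iff intro!: le_less_trans[OF ws])
    then show ?thesis unfolding w_def INF_less_iff S_def by auto
  qed
  have dir: "\<exists>x\<in>I. principal (S x) \<le> inf (principal (S z)) (principal (S z'))" if "z \<in> I" "z' \<in> I" for z z'
  proof (intro bexI[of _ "(fst z \<union> fst z', min (snd z) (snd z'))"])
    let ?x = "(fst z \<union> fst z', min (snd z) (snd z'))"
    show "?x \<in> I" using that by (auto simp: I_def compact_Un)
    have le: "ennreal (s + snd ?x) \<le> ennreal (s + snd z)" "ennreal (s + snd ?x) \<le> ennreal (s + snd z')"
      by (auto intro!: ennreal_leI)
    have "unit_measures (A - fst ?x) \<subseteq> unit_measures (A - fst z) \<inter> unit_measures (A - fst z')"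
      using unit_measures_mono[of "A - fst ?x" "A - fst z"] unit_measures_mono[of "A - fst ?x" "A - fst z'"] by auto
    then have "S ?x \<subseteq> S z \<inter> S z'" unfolding S_def using le less_le_trans by blast
    then show "principal (S ?x) \<le> inf (principal (S z)) (principal (S z'))" by simp
  qed
  have evF: "eventually P F \<longleftrightarrow> (\<exists>z\<in>I. \<forall>\<nu>\<in>S z. P \<nu>)" for P
    unfolding F_def using Ine dir by (subst eventually_INF_base) (auto simp: eventually_principal)
  have Fne: "F \<noteq> bot"
    unfolding trivial_limit_def evF using Sne by blast
  have inE: "\<forall>\<^sub>F \<mu> in F. inEp \<kappa> \<mu>"
    unfolding evF using Ine by (intro bexI[of _ "({}, 1)"]) (auto simp: S_def unit_measures_def)
  have cauchy: "\<forall>\<^sub>F z in F \<times>\<^sub>F F. nrm \<kappa> (fst z, snd z) < e" if e: "e > 0" for e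
  proof -
    \<comment> \<open>By the parallelogram law two members of \<open>S (K, d)\<close> have squared
      distance below \<open>4 * (s + d) - 4 * (s - d) = 8 * d\<close>, which is
      \<open>e\<^sup>2 / 2\<close>.\<close>
    define d where "d = e\<^sup>2 / 16"
    have d: "d > 0" using e by (simp add: d_def)
    have "\<exists>K. compact K \<and> ennreal (s - d) \<le> w K"
    proof (cases "s - d > 0")
      case True
      then have "ennreal (s - d) < (SUP K\<in>{K. compact K}. w K)" unfolding s(1) using d s(2) by (intro ennreal_lessI) auto
      then show ?thesis by (auto simp: less_SUP_iff intro: less_imp_le)
    next
      case False
      then show ?thesis by (intro exI[of _ "{}"]) (simp add: ennreal_neg)
    qed
    then obtain K where K: "compact K" "ennreal (s - d) \<le> w K" by blast
    have z: "(K, d) \<in> I" using K d by (simp add: I_def)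
    have "nrm \<kappa> (x, y) < e" if x: "x \<in> S (K, d)" and y: "y \<in> S (K, d)" for x y
    proof -
      have xy: "x \<in> unit_measures (A - K)" "y \<in> unit_measures (A - K)" using x y by (auto simp: S_def)
      let ?m = "scale_measure (ennreal (1/2)) (madd x y)"
      have lt: "energy x x < s + d" "energy y y < s + d"
      proof -
        have "energy u u < s + d" if "u \<in> S (K, d)" for u
        proof -
          have "kint \<kappa> u u < ennreal (s + d)" using that by (simp add: S_def)
          moreover have "0 \<le> s + d" using s d by simp
          ultimately show ?thesis by (cases "kint \<kappa> u u") (auto simp: ennreal_less_iff)
        qed
        then show "energy x x < s + d" "energy y y < s + d" using x y by auto
      qed
      have mm: "?m \<in> unit_measures (A - K)" by (rule unit_measures_midpoint[OF xy])
      have "ennreal (s - d) \<le> kint \<kappa> ?m ?m" using K(2) mm unfolding w_def by (meson INF_lower order_trans)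
      moreover have "kint \<kappa> ?m ?m < top" using mm by (simp add: unit_measures_def inEp_def)
      ultimately have "s - d \<le> energy ?m ?m"
        by (cases "kint \<kappa> ?m ?m") (auto simp: ennreal_le_iff2)
      moreover define em where "em = energy ?m ?m"
      ultimately have "s - d \<le> em" "4 * em = 2 * energy x x + 2 * energy y y - ip \<kappa> (x, y) (x, y)"
        unfolding em_def using unit_measures_midpoint(2)[OF xy] by simp_all
      then have "ip \<kappa> (x, y) (x, y) < 8 * d"
        using lt by argo
      also have "\<dots> < e\<^sup>2" using e by (simp add: d_def)
      finally have "ip \<kappa> (x, y) (x, y) < e\<^sup>2" .
      then have "sqrt (ip \<kappa> (x, y) (x, y)) < sqrt (e\<^sup>2)" by (rule real_sqrt_less_mono)
      then show ?thesis using e by (simp add: nrm_def)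
    qed
    then show ?thesis
      unfolding eventually_prod_filter
      by (intro exI[of _ "\<lambda>\<nu>. \<nu> \<in> S (K, d)"] conjI) (use z in \<open>auto simp: evF\<close>)
  qed
  have vague: "vague_cluster F (null_measure borel)"
    unfolding vague_cluster_def
  proof (intro allI impI)
    fix \<Phi> :: "('a \<Rightarrow> real) set" and e :: real assume H: "finite \<Phi> \<and> \<Phi> \<subseteq> Cc \<and> e > 0"
    let ?K = "\<Union>\<phi>\<in>\<Phi>. closure {x. \<phi> x \<noteq> 0}"
    have cK: "compact ?K" using H by (intro compact_UN) (auto simp: Cc_def)
    have "integral\<^sup>L \<nu> \<phi> = 0" if \<nu>: "\<nu> \<in> S (?K, 1)" and \<phi>: "\<phi> \<in> \<Phi>" for \<nu> \<phi>
    proof -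
      obtain B where B: "B \<in> sets borel" "B \<subseteq> A - ?K" "emeasure \<nu> (UNIV - B) = 0"
        using \<nu> by (auto simp: S_def unit_measures_def conc_def)
      have s: "sets \<nu> = sets borel" and sp: "space \<nu> = UNIV"
        using \<nu> by (auto simp: S_def unit_measures_def inEp_def radon_sets radon_space)
      have "AE x in \<nu>. \<phi> x = 0"
      proof (rule AE_I'[of "UNIV - B"])
        show "UNIV - B \<in> null_sets \<nu>" using B s by (simp add: null_sets_def)
        show "{x\<in>space \<nu>. \<phi> x \<noteq> 0} \<subseteq> UNIV - B"
          using B(2) \<phi> closure_subset[of "{x. \<phi> x \<noteq> 0}"] by blast
      qed
      then show ?thesis by (rule integral_eq_zero_AE)
    qed
    then have "\<forall>\<^sub>F \<mu> in F. \<forall>\<phi>\<in>\<Phi>. \<bar>integral\<^sup>L \<mu> \<phi> - integral\<^sup>L (null_measure borel) \<phi>\<bar> < e"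
      unfolding evF using H cK by (intro bexI[of _ "(?K, 1)"]) (auto simp: I_def integral_null_measure)
    then show "\<exists>\<^sub>F \<mu> in F. \<forall>\<phi>\<in>\<Phi>. \<bar>integral\<^sup>L \<mu> \<phi> - integral\<^sup>L (null_measure borel) \<phi>\<bar> < e"
      by (rule eventually_frequently[OF Fne])
  qed
  have small: "\<forall>\<^sub>F \<mu> in F. nrm \<kappa> (\<mu>, null_measure borel) < e" if "e > 0" for e
  proof -
    have "(\<forall>\<^sub>F \<mu> in F. inEp \<kappa> \<mu>) \<and> (\<forall>e>0. \<forall>\<^sub>F z in F \<times>\<^sub>F F. nrm \<kappa> (fst z, snd z) < e)"
      using inE cauchy by blast
    then show ?thesis
      using consistent radon_null vague that unfolding kernel_consistent_def by blast
  qed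
  have "0 < w {}"
  proof (rule ccontr)
    assume "\<not> 0 < w {}"
    then have "(INF \<nu>\<in>{\<nu>. inEp \<kappa> \<nu> \<and> conc \<nu> A \<and> emeasure \<nu> UNIV = 1}. kint \<kappa> \<nu> \<nu>) = 0"
      by (simp add: w_def unit_measures_def)
    then show False using capf unfolding cap_def by simp
  qed
  then obtain q where q: "0 < q" "q \<le> w {}" "q < top" by (metis dense less_le_trans less_top top_greatest le_less)
  then obtain t where t: "q = ennreal t" "t > 0" by (cases q) auto
  obtain z where z: "z \<in> I" "\<forall>\<nu>\<in>S z. nrm \<kappa> (\<nu>, null_measure borel) < sqrt t"
    using small[of "sqrt t"] t unfolding evF by auto
  obtain \<nu> where \<nu>: "\<nu> \<in> S z" using Sne[OF z(1)] by blast
  have "nrm \<kappa> (\<nu>, null_measure borel) = sqrt (energy \<nu> \<nu>)" by (simp add: nrm_def ip_def)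
  then have "energy \<nu> \<nu> < t" using z(2) \<nu> by auto
  moreover have "\<nu> \<in> unit_measures (A - {})" using \<nu> unit_measures_mono[of "A - fst z" "A - {}"] by (auto simp: S_def)
  then have "w {} \<le> kint \<kappa> \<nu> \<nu>" and "kint \<kappa> \<nu> \<nu> < top"
    unfolding w_def by (auto intro!: INF_lower simp: unit_measures_def inEp_def)
  then have "ennreal t \<le> kint \<kappa> \<nu> \<nu>" "kint \<kappa> \<nu> \<nu> < top" using q t by (auto intro: order_trans)
  then have "t \<le> energy \<nu> \<nu>" by (cases "kint \<kappa> \<nu> \<nu>") (auto simp: ennreal_le_iff)
  ultimately show False by simp
qed

section \<open>Mass and weight outside compact sets, controlled by energy\<close>

lemma normalized_restr:
  assumes \<mu>: "inEp \<kappa> \<mu>" and B: "B \<in> sets borel" "B \<subseteq> E" and m: "emeasure \<mu> B = ennreal m" "m > 0"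
  shows "scale_measure (ennreal (1/m)) (restr B \<mu>) \<in> unit_measures E"
    and "kint \<kappa> (scale_measure (ennreal (1/m)) (restr B \<mu>)) (scale_measure (ennreal (1/m)) (restr B \<mu>))
      = ennreal ((1/m)\<^sup>2 * energy (restr B \<mu>) (restr B \<mu>))"
proof -
  have Er: "inEp \<kappa> (restr B \<mu>)" by (rule inEp_restr[OF \<mu> B(1)])
  have s: "sets \<mu> = sets borel" using \<mu> by (rule inEp_sets)
  have "emeasure (scale_measure (ennreal (1/m)) (restr B \<mu>)) UNIV = 1"
    using m by (simp add: emeasure_restr s B ennreal_mult'[symmetric])
  moreover have "conc (scale_measure (ennreal (1/m)) (restr B \<mu>)) E"
    unfolding conc_def using B by (intro bexI[of _ B]) (auto simp: emeasure_restr s)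
  ultimately show "scale_measure (ennreal (1/m)) (restr B \<mu>) \<in> unit_measures E"
    using Er m by (simp add: unit_measures_def inEp_scale)
  have f: "kint \<kappa> (restr B \<mu>) (restr B \<mu>) = ennreal (energy (restr B \<mu>) (restr B \<mu>))"
    using Er by (simp add: inEp_def)
  show "kint \<kappa> (scale_measure (ennreal (1/m)) (restr B \<mu>)) (scale_measure (ennreal (1/m)) (restr B \<mu>))
      = ennreal ((1/m)\<^sup>2 * energy (restr B \<mu>) (restr B \<mu>))"
    using Er m by (subst kint_scale_left kint_scale_right; (simp add: inEp_radon radon_scale)?)+
      (subst f, simp add: ennreal_mult'[symmetric] power2_eq_square mult.assoc)
qed

text \<open>Take \<open>K\<close> such that unit measures on \<open>A - K\<close> have energy above
  \<open>1 / e\<close>. A measure restricted to \<open>A - K\<close> and normalized is one of them,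
  and normalizing divides the energy by the square of the mass.\<close>

lemma capacity_tail:
  assumes capf: "cap \<kappa> A \<noteq> \<infinity>" and A: "closed A" and e: "e > 0"
  obtains K where "compact K"
    "\<And>\<mu>. inEp \<kappa> \<mu> \<Longrightarrow> emeasure \<mu> UNIV < \<infinity> \<Longrightarrow> (measure \<mu> (A - K))\<^sup>2 \<le> e * energy \<mu> \<mu>"
proof -
  have "ennreal (1 / e) < (SUP K\<in>{K. compact K}. INF \<nu>\<in>unit_measures (A - K). kint \<kappa> \<nu> \<nu>)"
    unfolding energy_at_infinity[OF capf] by simp
  then obtain K where K: "compact K" "ennreal (1 / e) < (INF \<nu>\<in>unit_measures (A - K). kint \<kappa> \<nu> \<nu>)"
    by (auto simp: less_SUP_iff)
  have "(measure \<mu> (A - K))\<^sup>2 \<le> e * energy \<mu> \<mu>" if \<mu>: "inEp \<kappa> \<mu>" "emeasure \<mu> UNIV < \<infinity>" for \<mu>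
  proof (cases "measure \<mu> (A - K) = 0")
    case True
    then show ?thesis using e by simp
  next
    case False
    define m where "m = measure \<mu> (A - K)"
    have m: "m > 0" using False by (simp add: m_def less_le)
    have B: "A - K \<in> sets borel" using A K by (auto simp: borel_closed compact_imp_closed)
    have s: "sets \<mu> = sets borel" using \<mu> by (auto simp: inEp_sets)
    have em: "emeasure \<mu> (A - K) = ennreal m"
    proof -
      have "emeasure \<mu> (A - K) \<le> emeasure \<mu> UNIV" using s by (intro emeasure_mono) auto
      then show ?thesis unfolding m_def using \<mu>(2) by (intro emeasure_eq_ennreal_measure) auto
    qed
    let ?r = "restr (A - K) \<mu>"
    let ?n = "scale_measure (ennreal (1/m)) ?r"
    have "ennreal (1 / e) < kint \<kappa> ?n ?n"
      using K(2) normalized_restr(1)[OF \<mu>(1) B subset_refl em m] by (meson INF_lower less_le_trans)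
    then have "1 / e < (1/m)\<^sup>2 * energy ?r ?r"
      unfolding normalized_restr(2)[OF \<mu>(1) B subset_refl em m] using e by (simp add: ennreal_less_iff)
    then have "m\<^sup>2 < e * energy ?r ?r" using e m by (simp add: field_simps power2_eq_square)
    also have "\<dots> \<le> e * energy \<mu> \<mu>"
    proof (rule mult_left_mono)
      have "kint \<kappa> ?r ?r \<le> kint \<kappa> \<mu> \<mu>"
        using \<mu> B inEp_restr[OF \<mu>(1) B] by (intro kint_restr_le) (auto simp: inEp_def)
      then show "energy ?r ?r \<le> energy \<mu> \<mu>" using \<mu> by (intro enn2real_mono) (auto simp: inEp_def)
    qed (use e in simp)
    finally show ?thesis by (simp add: m_def)
  qed
  then show ?thesis using that K by blast
qed

text \<open>Turns properties holding nearly everywhere into properties holding almost everywhere for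
  finite measures of finite energy.\<close>

lemma capacity_zero_null:
  assumes "cap \<kappa> N = 0" "inEp \<kappa> \<mu>" "emeasure \<mu> UNIV < \<infinity>" "B \<in> sets borel" "B \<subseteq> N"
  shows "emeasure \<mu> B = 0"
proof (rule ccontr)
  assume "emeasure \<mu> B \<noteq> 0"
  have s: "sets \<mu> = sets borel" using assms by (auto simp: inEp_sets)
  have "emeasure \<mu> B \<le> emeasure \<mu> UNIV" using s by (intro emeasure_mono) auto
  then have "emeasure \<mu> B < top" using assms(3) by auto
  then obtain m where m: "emeasure \<mu> B = ennreal m" "m > 0"
    using \<open>emeasure \<mu> B \<noteq> 0\<close> by (cases "emeasure \<mu> B") (auto simp: less_le)
  note n = normalized_restr[OF assms(2,4,5) m]
  have "(INF \<nu>\<in>unit_measures N. kint \<kappa> \<nu> \<nu>) < top"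
    using INF_lower[OF n(1), of "\<lambda>\<nu>. kint \<kappa> \<nu> \<nu>"] unfolding n(2) by (auto intro: le_less_trans)
  then show False using assms(1) by (simp add: cap_def unit_measures_def ennreal_inverse_eq_0_iff)
qed

text \<open>The tail is at most \<open>T * emeasure \<mu> (A - K) + e / 2\<close> with
  \<open>T\<close> independent of \<mu> and \<open>K\<close>, and \<open>capacity_tail\<close> makes
  the mass uniformly small. For unbounded \<open>g\<close> the condition with \<open>r > 1\<close>
  acts as uniform integrability: the part of \<open>g\<close> above \<open>T\<close> is controlled
  by the integral of \<open>g powr r\<close>, hence by a mutual energy.\<close>

lemma weighted_tail:
  assumes capf: "cap \<kappa> A \<noteq> \<infinity>" and A: "closed A" and e: "e > 0"
    and g: "continuous_on A g" "\<And>x. x \<in> A \<Longrightarrow> 0 < g x"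
    and gb: "(\<exists>B. \<forall>x\<in>A. g x \<le> B) \<or> (\<exists>r>1. \<exists>\<nu>. inE \<kappa> \<nu> \<and> nearly_everywhere \<kappa> A
                (\<lambda>x. pot \<kappa> (snd \<nu>) x < \<infinity> \<and>
                     ennreal (g x powr r) + pot \<kappa> (snd \<nu>) x \<le> pot \<kappa> (fst \<nu>) x))"
  obtains K where "compact K"
    "\<And>\<mu>. inEp \<kappa> \<mu> \<Longrightarrow> emeasure \<mu> UNIV < \<infinity> \<Longrightarrow> energy \<mu> \<mu> \<le> R \<Longrightarrow>
        (\<integral>\<^sup>+ x. ennreal (g x) * indicator (A - K) x \<partial>\<mu>) \<le> ennreal e"
proof -
  have "\<exists>T\<ge>0. \<forall>\<mu>. inEp \<kappa> \<mu> \<longrightarrow> emeasure \<mu> UNIV < \<infinity> \<longrightarrow> energy \<mu> \<mu> \<le> R \<longrightarrow>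
     (\<forall>K. compact K \<longrightarrow> (\<integral>\<^sup>+ x. ennreal (g x) * indicator (A - K) x \<partial>\<mu>) \<le> ennreal T * emeasure \<mu> (A - K) + ennreal (e/2))"
    using gb
  proof
    assume "\<exists>B. \<forall>x\<in>A. g x \<le> B"
    then obtain B where B: "\<And>x. x \<in> A \<Longrightarrow> g x \<le> B" by blast
    show ?thesis
    proof (intro exI[of _ "max B 0"] conjI allI impI)
      fix \<mu> and K :: "'a set" assume \<mu>: "inEp \<kappa> \<mu>" and K: "compact K"
      have BK: "A - K \<in> sets \<mu>" using A K \<mu> by (auto simp: borel_closed compact_imp_closed inEp_sets)
      have "(\<integral>\<^sup>+ x. ennreal (g x) * indicator (A - K) x \<partial>\<mu>) \<le> (\<integral>\<^sup>+ x. ennreal (max B 0) * indicator (A - K) x \<partial>\<mu>)"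
        using B by (intro nn_integral_mono) (auto simp: indicator_def intro!: ennreal_leI max.coboundedI1)
      also have "\<dots> = ennreal (max B 0) * emeasure \<mu> (A - K)" by (rule nn_integral_cmult_indicator[OF BK])
      finally show "(\<integral>\<^sup>+ x. ennreal (g x) * indicator (A - K) x \<partial>\<mu>) \<le> ennreal (max B 0) * emeasure \<mu> (A - K) + ennreal (e/2)"
        by (simp add: add_increasing2)
    qed simp
  next
    assume "\<exists>r>1. \<exists>\<nu>. inE \<kappa> \<nu> \<and> nearly_everywhere \<kappa> A
                (\<lambda>x. pot \<kappa> (snd \<nu>) x < \<infinity> \<and> ennreal (g x powr r) + pot \<kappa> (snd \<nu>) x \<le> pot \<kappa> (fst \<nu>) x)"
    then obtain r \<nu>0 N where r: "r > 1" and \<nu>0: "inE \<kappa> \<nu>0" and N: "cap \<kappa> N = 0"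
      "\<And>x. x \<in> A - N \<Longrightarrow> ennreal (g x powr r) + pot \<kappa> (snd \<nu>0) x \<le> pot \<kappa> (fst \<nu>0) x"
      by (auto simp: nearly_everywhere_def)
    \<comment> \<open>Dropping the negative part of \<open>\<nu>0\<close> only enlarges the
      potential, so its positive part alone dominates \<open>g powr r\<close> nearly
      everywhere.\<close>
    define \<nu> where "\<nu> = fst \<nu>0"
    have \<nu>: "inEp \<kappa> \<nu>" using \<nu>0 by (simp add: inE_def finen_def inEp_def \<nu>_def)
    have N': "ennreal (g x powr r) \<le> pot \<kappa> \<nu> x" if "x \<in> A - N" for x
      using N(2)[OF that] le_add_same_cancel1 unfolding \<nu>_def by (metis add_increasing2 le_iff_add order_trans zero_le)
    define D where "D = max R 0 + energy \<nu> \<nu>"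
    have D: "D \<ge> 0" by (simp add: D_def)
    \<comment> \<open>Chosen so that \<open>T powr (1 - r) * D\<close> is at most
      \<open>e / 2\<close>; the summand 1 keeps the base positive when \<open>D = 0\<close>.\<close>
    define T where "T = (2 * (D + 1) / e) powr (1 / (r - 1))"
    have T: "T > 0" using D e by (simp add: T_def)
    have Tr: "T powr (1 - r) = e / (2 * (D + 1))"
    proof -
      have "T powr (1 - r) = (2 * (D + 1) / e) powr (1 / (r - 1) * (1 - r))" by (simp add: T_def powr_powr)
      also have "1 / (r - 1) * (1 - r) = -1" using r by (simp add: field_simps)
      also have "(2 * (D + 1) / e) powr (-1) = e / (2 * (D + 1))" using D e by (simp add: powr_minus_divide)
      finally show ?thesis .
    qed
    have young: "g x \<le> T + T powr (1 - r) * g x powr r" if "x \<in> A" for x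
    proof (cases "g x \<le> T")
      case True
      then show ?thesis by (simp add: add_increasing2)
    next
      case False
      then have gT: "g x > T" "g x > 0" using T by auto
      have "g x = g x powr (1 - r) * g x powr r" using gT by (simp add: powr_add[symmetric])
      also have "\<dots> \<le> T powr (1 - r) * g x powr r"
        using gT T r by (intro mult_right_mono powr_mono2') auto
      finally show ?thesis using T by simp
    qed
    show ?thesis
    proof (intro exI[of _ T] conjI allI impI)
      fix \<mu> and K :: "'a set" assume \<mu>: "inEp \<kappa> \<mu>" "emeasure \<mu> UNIV < \<infinity>" "energy \<mu> \<mu> \<le> R" and K: "compact K"
      have s: "sets \<mu> = sets borel" and sp: "space \<mu> = UNIV" using \<mu> by (auto simp: inEp_def radon_sets radon_space)
      have AB: "A \<in> sets borel" using A by simp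
      have BK: "A - K \<in> sets \<mu>" using A K s by (auto simp: borel_closed compact_imp_closed)
      have gm: "(\<lambda>x. ennreal (g x powr r) * indicator A x) \<in> borel_measurable borel"
      proof -
        have "(\<lambda>x. indicator A x *\<^sub>R (g x powr r)) \<in> borel_measurable borel"
          using g by (intro borel_measurable_continuous_on_indicator AB continuous_intros) force+
        then have "(\<lambda>x. ennreal (indicator A x *\<^sub>R (g x powr r))) \<in> borel_measurable borel" by measurable
        moreover have "(\<lambda>x. ennreal (indicator A x *\<^sub>R (g x powr r))) = (\<lambda>x. ennreal (g x powr r) * indicator A x)"
          by (auto simp: indicator_def)
        ultimately show ?thesis by (simp only:)
      qed
      let ?B = "{x\<in>space borel. pot \<kappa> \<nu> x < ennreal (g x powr r) * indicator A x}"
      have B: "?B \<in> sets borel" using gm pot_borel[OF inEp_radon[OF \<nu>]] by measurable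
      have "?B \<subseteq> N" using N' by (auto simp: indicator_def not_le[symmetric] split: if_splits)
      then have "emeasure \<mu> ?B = 0" by (rule capacity_zero_null[OF N(1) \<mu>(1,2) B])
      then have ae: "AE x in \<mu>. ennreal (g x powr r) * indicator A x \<le> pot \<kappa> \<nu> x"
        using B s sp by (intro AE_I'[of ?B]) (auto simp: null_sets_def not_le)
      have "(\<integral>\<^sup>+ x. ennreal (g x powr r) * indicator A x \<partial>\<mu>) \<le> kint \<kappa> \<mu> \<nu>"
        unfolding kint_def by (rule nn_integral_mono_AE[OF ae])
      also have "\<dots> = ennreal (energy \<mu> \<nu>)" using kint_finite[OF \<mu>(1) \<nu>] by simp
      also have "\<dots> \<le> ennreal D"
      proof (rule ennreal_leI)
        have "2 * energy \<mu> \<nu> \<le> energy \<mu> \<mu> + energy \<nu> \<nu>" by (rule kint_cross_le[OF \<mu>(1) \<nu>])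
        then show "energy \<mu> \<nu> \<le> D" using \<mu>(3) enn2real_nonneg[of "kint \<kappa> \<mu> \<nu>"] unfolding D_def by linarith
      qed
      finally have I: "(\<integral>\<^sup>+ x. ennreal (g x powr r) * indicator A x \<partial>\<mu>) \<le> ennreal D" .
      have "(\<integral>\<^sup>+ x. ennreal (g x) * indicator (A - K) x \<partial>\<mu>)
          \<le> (\<integral>\<^sup>+ x. ennreal T * indicator (A - K) x + ennreal (T powr (1 - r)) * (ennreal (g x powr r) * indicator A x) \<partial>\<mu>)"
      proof (rule nn_integral_mono)
        fix x
        show "ennreal (g x) * indicator (A - K) x \<le> ennreal T * indicator (A - K) x + ennreal (T powr (1 - r)) * (ennreal (g x powr r) * indicator A x)"
        proof (cases "x \<in> A - K")
          case True
          have "ennreal (g x) \<le> ennreal (T + T powr (1 - r) * g x powr r)" using young True by (intro ennreal_leI) auto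
          then show ?thesis using True T by (simp add: ennreal_plus ennreal_mult)
        qed simp
      qed
      also have "\<dots> = ennreal T * emeasure \<mu> (A - K) + ennreal (T powr (1 - r)) * (\<integral>\<^sup>+ x. ennreal (g x powr r) * indicator A x \<partial>\<mu>)"
      proof -
        have gm': "(\<lambda>x. ennreal (g x powr r) * indicator A x) \<in> borel_measurable \<mu>" by (rule borel_measurable_cong_sets[OF s gm])
        show ?thesis using BK gm' by (simp add: nn_integral_add nn_integral_cmult nn_integral_cmult_indicator)
      qed
      also have "\<dots> \<le> ennreal T * emeasure \<mu> (A - K) + ennreal (T powr (1 - r)) * ennreal D"
        by (intro add_left_mono mult_left_mono I) auto
      also have "ennreal (T powr (1 - r)) * ennreal D \<le> ennreal (e/2)"
        unfolding Tr using D e by (simp add: ennreal_mult[symmetric] field_simps)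
      finally show "(\<integral>\<^sup>+ x. ennreal (g x) * indicator (A - K) x \<partial>\<mu>) \<le> ennreal T * emeasure \<mu> (A - K) + ennreal (e/2)"
        by (simp add: add_left_mono)
    qed (use T in simp)
  qed
  then obtain T where T: "T \<ge> 0" "\<And>\<mu> K. inEp \<kappa> \<mu> \<Longrightarrow> emeasure \<mu> UNIV < \<infinity> \<Longrightarrow> energy \<mu> \<mu> \<le> R \<Longrightarrow> compact K \<Longrightarrow>
     (\<integral>\<^sup>+ x. ennreal (g x) * indicator (A - K) x \<partial>\<mu>) \<le> ennreal T * emeasure \<mu> (A - K) + ennreal (e/2)"
    by blast
  \<comment> \<open>With this \<open>d\<close> the mass of \<open>A - K\<close> is at most
    \<open>e / (2 * (T + 1))\<close>, and \<open>T\<close> times it at most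
    \<open>e / 2\<close>.\<close>
  define d where "d = (e / (2 * (T + 1)))\<^sup>2 / (max R 0 + 1)"
  have d: "d > 0" using e T(1) by (simp add: d_def)
  obtain K where K: "compact K" "\<And>\<mu>. inEp \<kappa> \<mu> \<Longrightarrow> emeasure \<mu> UNIV < \<infinity> \<Longrightarrow> (measure \<mu> (A - K))\<^sup>2 \<le> d * energy \<mu> \<mu>"
    using capacity_tail[OF capf A d] by metis
  have "(\<integral>\<^sup>+ x. ennreal (g x) * indicator (A - K) x \<partial>\<mu>) \<le> ennreal e"
    if \<mu>: "inEp \<kappa> \<mu>" "emeasure \<mu> UNIV < \<infinity>" "energy \<mu> \<mu> \<le> R" for \<mu>
  proof -
    let ?m = "measure \<mu> (A - K)"
    have "?m\<^sup>2 \<le> d * energy \<mu> \<mu>" using K \<mu> by blast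
    also have "\<dots> \<le> d * (max R 0 + 1)" using \<mu> d by (intro mult_left_mono) auto
    also have "\<dots> = (e / (2 * (T + 1)))\<^sup>2" by (simp add: d_def)
    finally have "?m\<^sup>2 \<le> (e / (2 * (T + 1)))\<^sup>2" .
    then have m: "?m \<le> e / (2 * (T + 1))" by (rule power2_le_imp_le) (use e T(1) in simp)
    have "T * ?m \<le> (T + 1) * (e / (2 * (T + 1)))"
      by (rule mult_mono[OF _ m]) (use T(1) in auto)
    also have "\<dots> = e / 2" using T(1) by (simp add: field_simps)
    finally have Tm: "T * ?m \<le> e / 2" .
    have s: "sets \<mu> = sets borel" using \<mu> by (auto simp: inEp_sets)
    have "emeasure \<mu> (A - K) \<le> emeasure \<mu> UNIV" using s by (intro emeasure_mono) auto
    then have em: "emeasure \<mu> (A - K) = ennreal ?m" using \<mu>(2) by (intro emeasure_eq_ennreal_measure) auto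
    have "(\<integral>\<^sup>+ x. ennreal (g x) * indicator (A - K) x \<partial>\<mu>) \<le> ennreal T * ennreal ?m + ennreal (e/2)"
      using T(2)[OF \<mu> K(1)] unfolding em .
    also have "\<dots> = ennreal (T * ?m + e/2)" using T(1) e by (simp add: ennreal_mult'[symmetric] ennreal_plus)
    also have "\<dots> \<le> ennreal e" using Tm by (intro ennreal_leI) simp
    finally show ?thesis .
  qed
  then show ?thesis using that K(1) by blast
qed

end

section \<open>Weighted integrals under vague limits\<close>

lemma weighted_borel:
  assumes A: "closed A" and g: "continuous_on A (g :: 'a::topological_space \<Rightarrow> real)"
  shows "(\<lambda>x. ennreal (g x) * indicator A x) \<in> borel_measurable borel"
proof -
  have "(\<lambda>x. indicator A x *\<^sub>R g x) \<in> borel_measurable borel"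
    using A g by (intro borel_measurable_continuous_on_indicator) auto
  then have "(\<lambda>x. ennreal (indicator A x *\<^sub>R g x)) \<in> borel_measurable borel" by measurable
  moreover have "(\<lambda>x. ennreal (indicator A x *\<^sub>R g x)) = (\<lambda>x. ennreal (g x) * indicator A x)"
    by (auto simp: indicator_def)
  ultimately show ?thesis by (simp only:)
qed

lemma nn_integral_closed_top:
  assumes s: "sets \<mu> = sets borel" and A: "closed A" and z: "emeasure \<mu> (UNIV - A) = 0"
  shows "(\<integral>\<^sup>+ x. (if x \<in> A then ennreal (h x) else top) \<partial>\<mu>) = (\<integral>\<^sup>+ x. ennreal (h x) * indicator A x \<partial>\<mu>)"
proof (rule nn_integral_cong_AE)
  show "AE x in \<mu>. (if x \<in> A then ennreal (h x) else top) = ennreal (h x) * indicator A x"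
    by (rule AE_I'[of "UNIV - A"]) (use s A z in \<open>auto simp: null_sets_def\<close>)
qed

context consistent_kernel
begin

lemma weighted_limit_le:
  fixes \<nu> :: "'a measure"
  assumes r: "radon \<nu>" and A: "closed A" and g: "continuous_on A g"
    and G: "G \<noteq> bot"
    and M: "\<forall>\<^sub>F v in G. radon (M v) \<and> emeasure (M v) (UNIV - A) = 0 \<and> (\<integral>\<^sup>+ x. ennreal (g x) * indicator A x \<partial>M v) \<le> b"
    and lim: "\<And>\<phi>. \<phi> \<in> Cc \<Longrightarrow> ((\<lambda>v. integral\<^sup>L (M v) \<phi>) \<longlongrightarrow> integral\<^sup>L \<nu> \<phi>) G"
  shows "emeasure \<nu> (UNIV - A) = 0" "(\<integral>\<^sup>+ x. ennreal (g x) * indicator A x \<partial>\<nu>) \<le> b"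
proof -
  have M0: "\<forall>\<^sub>F v in G. radon (M v) \<and> emeasure (M v) (UNIV - A) = 0" using M by eventually_elim auto
  have op: "open (UNIV - A)" using A by auto
  show z: "emeasure \<nu> (UNIV - A) = 0"
    by (rule vague_limit_null_open[OF lc r op G M0 lim])
  have M1: "\<forall>\<^sub>F v in G. radon (M v) \<and> (\<integral>\<^sup>+ x. (if x \<in> A then ennreal (g x) else top) \<partial>M v) \<le> b"
    using M by eventually_elim (simp add: nn_integral_closed_top A radon_sets)
  have "(\<integral>\<^sup>+ x. (if x \<in> A then ennreal (g x) else top) \<partial>\<nu>) \<le> b"
    by (rule vague_limit_lsc_le[OF lc r lsc_on_closed[OF A g] G M1 lim])
  then show "(\<integral>\<^sup>+ x. ennreal (g x) * indicator A x \<partial>\<nu>) \<le> b"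
    by (simp add: nn_integral_closed_top A z radon_sets[OF r])
qed

text \<open>Lower semicontinuity bounds the integral of the limit from above only. It is therefore
  applied to \<open>\<phi> * (m - g)\<close>: together with \<open>\<phi> * g\<close> this adds up
  to \<open>m * \<phi>\<close>, whose integrals converge, so the upper bound for the one summand
  becomes a lower bound for the other. What lies outside \<open>K\<close> is uniformly small by
  \<open>weighted_tail\<close>.\<close>

lemma weighted_limit_ge:
  assumes r: "radon \<nu>" and A: "closed A" and g: "continuous_on A g" "\<And>x. x \<in> A \<Longrightarrow> 0 < g x"
    and capf: "cap \<kappa> A \<noteq> \<infinity>"
    and gb: "(\<exists>B. \<forall>x\<in>A. g x \<le> B) \<or> (\<exists>r>1. \<exists>\<nu>. inE \<kappa> \<nu> \<and> nearly_everywhere \<kappa> A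
                (\<lambda>x. pot \<kappa> (snd \<nu>) x < \<infinity> \<and>
                     ennreal (g x powr r) + pot \<kappa> (snd \<nu>) x \<le> pot \<kappa> (fst \<nu>) x))"
    and G: "G \<noteq> bot"
    and M: "\<forall>\<^sub>F v in G. inEp \<kappa> (M v) \<and> emeasure (M v) UNIV < \<infinity> \<and> energy (M v) (M v) \<le> R \<and>
       emeasure (M v) (UNIV - A) = 0 \<and> (\<integral>\<^sup>+ x. ennreal (g x) * indicator A x \<partial>M v) = ennreal b"
    and b: "b \<ge> 0"
    and lim: "\<And>\<phi>. \<phi> \<in> Cc \<Longrightarrow> ((\<lambda>v. integral\<^sup>L (M v) \<phi>) \<longlongrightarrow> integral\<^sup>L \<nu> \<phi>) G"
  shows "ennreal b \<le> (\<integral>\<^sup>+ x. ennreal (g x) * indicator A x \<partial>\<nu>)"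
proof (rule ennreal_le_epsilon)
  fix e :: real assume "0 < e"
  \<comment> \<open>One half of \<open>e\<close> is spent on the tail outside \<open>K\<close>, the
    other on vague convergence.\<close>
  define d where "d = e / 2"
  have d: "d > 0" using \<open>0 < e\<close> by (simp add: d_def)
  have "\<forall>\<^sub>F v in G. radon (M v) \<and> emeasure (M v) (UNIV - A) = 0 \<and> (\<integral>\<^sup>+ x. ennreal (g x) * indicator A x \<partial>M v) \<le> ennreal b"
    using M by eventually_elim (auto simp: inEp_def)
  note z = weighted_limit_le(1)[OF r A g(1) G this lim]
  obtain K where K: "compact K" "\<And>\<mu>. inEp \<kappa> \<mu> \<Longrightarrow> emeasure \<mu> UNIV < \<infinity> \<Longrightarrow> energy \<mu> \<mu> \<le> R \<Longrightarrow>
        (\<integral>\<^sup>+ x. ennreal (g x) * indicator (A - K) x \<partial>\<mu>) \<le> ennreal d"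
    using weighted_tail[OF capf A d g gb] by metis
  obtain \<phi> C where \<phi>: "\<phi> \<in> Cc" "\<And>x. 0 \<le> \<phi> x" "\<And>x. \<phi> x \<le> 1" "\<And>x. x \<in> K \<Longrightarrow> \<phi> x = 1"
    "compact C" "\<And>x. x \<notin> C \<Longrightarrow> \<phi> x = 0"
    using urysohn_compact[OF lc K(1) open_UNIV subset_UNIV] by metis
  have "compact (g ` (C \<inter> A))"
    using \<phi>(5) A g(1) by (intro compact_continuous_image compact_Int_closed) (auto intro: continuous_on_subset)
  then obtain m0 where m0: "\<And>x. x \<in> C \<inter> A \<Longrightarrow> g x \<le> m0"
    using compact_imp_bounded bounded_iff by (metis abs_le_D1 image_eqI real_norm_def)
  \<comment> \<open>The constant bounds \<open>g\<close> on \<open>C \<inter> A\<close>, so that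
    \<open>h\<close> is nonnegative on \<open>A\<close>; being at least 1 it can be divided
    by.\<close>
  define m where "m = max m0 1"
  have m: "m \<ge> 1" "\<And>x. x \<in> C \<Longrightarrow> x \<in> A \<Longrightarrow> g x \<le> m" using m0 by (auto simp: m_def intro: max.coboundedI1)
  define h where "h x = \<phi> x * (m - g x)" for x
  have hc: "continuous_on A h" unfolding h_def
    using continuous_on_subset[OF Cc_cont[OF \<phi>(1)] subset_UNIV] g(1) by (intro continuous_intros) auto
  have kc: "continuous_on A (\<lambda>x. \<phi> x * g x)"
    using continuous_on_subset[OF Cc_cont[OF \<phi>(1)] subset_UNIV] g(1) by (intro continuous_intros) auto
  have h0: "0 \<le> h x" if "x \<in> A" for x
    using m(2)[of x] \<phi>(2)[of x] \<phi>(6)[of x] that by (cases "x \<in> C") (auto simp: h_def)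
  have sum: "(\<integral>\<^sup>+ x. ennreal (h x) * indicator A x \<partial>\<mu>) + (\<integral>\<^sup>+ x. ennreal (\<phi> x * g x) * indicator A x \<partial>\<mu>) = ennreal (m * integral\<^sup>L \<mu> \<phi>)"
    if \<mu>: "radon \<mu>" "emeasure \<mu> (UNIV - A) = 0" for \<mu>
  proof -
    have "(\<integral>\<^sup>+ x. ennreal (h x) * indicator A x \<partial>\<mu>) + (\<integral>\<^sup>+ x. ennreal (\<phi> x * g x) * indicator A x \<partial>\<mu>)
        = (\<integral>\<^sup>+ x. ennreal (h x) * indicator A x + ennreal (\<phi> x * g x) * indicator A x \<partial>\<mu>)"
      by (intro nn_integral_add[symmetric] radon_meas[OF \<mu>(1) weighted_borel[OF A hc]] radon_meas[OF \<mu>(1) weighted_borel[OF A kc]])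
    also have "\<dots> = (\<integral>\<^sup>+ x. ennreal (m * \<phi> x) \<partial>\<mu>)"
    proof (rule nn_integral_cong_AE)
      have "ennreal (h x) + ennreal (\<phi> x * g x) = ennreal (m * \<phi> x)" if "x \<in> A" for x
        using h0[OF that] \<phi>(2)[of x] g(2)[OF that] by (subst ennreal_plus[symmetric]) (auto simp: h_def algebra_simps)
      then show "AE x in \<mu>. ennreal (h x) * indicator A x + ennreal (\<phi> x * g x) * indicator A x = ennreal (m * \<phi> x)"
        using \<mu> A by (intro AE_I'[of "UNIV - A"]) (auto simp: null_sets_def radon_sets)
    qed
    also have "\<dots> = ennreal (integral\<^sup>L \<mu> (\<lambda>x. m * \<phi> x))"
      using m \<phi>(1,2) by (intro nn_integral_eq_integral Cc_integrable[OF \<mu>(1)] Cc_cmult) auto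
    also have "\<dots> = ennreal (m * integral\<^sup>L \<mu> \<phi>)" by simp
    finally show ?thesis .
  qed
  have I0: "0 \<le> integral\<^sup>L \<mu> \<phi>" for \<mu> :: "'a measure" using \<phi> by (intro integral_nonneg_AE) auto
  define q where "q = integral\<^sup>L \<nu> \<phi>"
  have close: "\<forall>\<^sub>F v in G. integral\<^sup>L (M v) \<phi> < q + d / m"
    using order_tendstoD(2)[OF lim[OF \<phi>(1)], of "q + d / m"] d m by (simp add: q_def)
  have ev0: "\<forall>\<^sub>F v in G. 0 \<le> m * q + 2 * d - b \<and> radon (M v) \<and>
      (\<integral>\<^sup>+ x. (if x \<in> A then ennreal (h x) else top) \<partial>M v) \<le> ennreal (m * q + 2 * d - b)"
    using close M
  proof eventually_elim
    case (elim v)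
    then have v: "inEp \<kappa> (M v)" "emeasure (M v) UNIV < \<infinity>" "energy (M v) (M v) \<le> R" "emeasure (M v) (UNIV - A) = 0"
       "(\<integral>\<^sup>+ x. ennreal (g x) * indicator A x \<partial>M v) = ennreal b" by auto
    have rv: "radon (M v)" using v by (simp add: inEp_def)
    have KB: "K \<in> sets borel" using K by (simp add: borel_closed compact_imp_closed)
    let ?G = "\<integral>\<^sup>+ x. ennreal (\<phi> x * g x) * indicator A x \<partial>M v"
    let ?H = "\<integral>\<^sup>+ x. ennreal (h x) * indicator A x \<partial>M v"
    have gm: "(\<lambda>x. ennreal (g x) * indicator A x) \<in> borel_measurable (M v)" by (rule radon_meas[OF rv weighted_borel[OF A g(1)]])
    have "ennreal b = (\<integral>\<^sup>+ x. ennreal (g x) * indicator A x * indicator K x + ennreal (g x) * indicator (A - K) x \<partial>M v)"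
      unfolding v(5)[symmetric] by (intro nn_integral_cong) (auto simp: indicator_def)
    also have "\<dots> \<le> (\<integral>\<^sup>+ x. ennreal (\<phi> x * g x) * indicator A x + ennreal (g x) * indicator (A - K) x \<partial>M v)"
      using \<phi>(4) by (intro nn_integral_mono add_right_mono) (auto simp: indicator_def)
    also have "\<dots> = ?G + (\<integral>\<^sup>+ x. ennreal (g x) * indicator (A - K) x \<partial>M v)"
    proof (rule nn_integral_add)
      show "(\<lambda>x. ennreal (\<phi> x * g x) * indicator A x) \<in> borel_measurable (M v)" by (rule radon_meas[OF rv weighted_borel[OF A kc]])
      have "(\<lambda>x. (ennreal (g x) * indicator A x) * indicator (UNIV - K) x) \<in> borel_measurable (M v)"
        by (rule borel_measurable_times_ennreal[OF gm borel_measurable_indicator]) (use KB rv in \<open>auto simp: radon_sets\<close>)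
      moreover have "(\<lambda>x. (ennreal (g x) * indicator A x) * indicator (UNIV - K) x) = (\<lambda>x. ennreal (g x) * indicator (A - K) x)"
        by (auto simp: indicator_def)
      ultimately show "(\<lambda>x. ennreal (g x) * indicator (A - K) x) \<in> borel_measurable (M v)" by (simp only:)
    qed
    also have "\<dots> \<le> ?G + ennreal d" by (intro add_left_mono K(2) v)
    finally have bG: "ennreal b \<le> ?G + ennreal d" .
    have tot: "?H + ?G = ennreal (m * integral\<^sup>L (M v) \<phi>)" by (rule sum[OF rv v(4)])
    have "?H + ?G < top" unfolding tot by simp
    then have fin: "?H \<noteq> top" "?G \<noteq> top" by auto
    obtain H where H: "?H = ennreal H" "H \<ge> 0" using fin(1) by (cases ?H) auto
    obtain G' where G': "?G = ennreal G'" "G' \<ge> 0" using fin(2) by (cases ?G) auto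
    note HG = H G'
    have "H + G' = m * integral\<^sup>L (M v) \<phi>"
      using tot HG m I0[of "M v"] by (simp flip: ennreal_plus add: ennreal_inj)
    moreover have "b \<le> G' + d" using bG HG d by (simp flip: ennreal_plus add: ennreal_le_iff)
    moreover have "m * integral\<^sup>L (M v) \<phi> \<le> m * (q + d / m)" using elim m by (intro mult_left_mono) auto
    moreover have "m * (q + d / m) = m * q + d" using m by (simp add: field_simps)
    ultimately have "H \<le> m * q + 2 * d - b" by linarith
    then show ?case using HG rv v(4) A by (simp add: nn_integral_closed_top radon_sets ennreal_leI)
  qed
  have pos: "0 \<le> m * q + 2 * d - b" using eventually_happens'[OF G ev0] by auto
  have ev: "\<forall>\<^sub>F v in G. radon (M v) \<and> (\<integral>\<^sup>+ x. (if x \<in> A then ennreal (h x) else top) \<partial>M v) \<le> ennreal (m * q + 2 * d - b)"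
    using ev0 by eventually_elim auto
  have "(\<integral>\<^sup>+ x. (if x \<in> A then ennreal (h x) else top) \<partial>\<nu>) \<le> ennreal (m * q + 2 * d - b)"
    by (rule vague_limit_lsc_le[OF lc r lsc_on_closed[OF A hc] G ev lim])
  then have H: "(\<integral>\<^sup>+ x. ennreal (h x) * indicator A x \<partial>\<nu>) \<le> ennreal (m * q + 2 * d - b)"
    using r A z by (simp add: nn_integral_closed_top radon_sets)
  have "ennreal (m * q) \<le> ennreal (m * q + 2 * d - b) + (\<integral>\<^sup>+ x. ennreal (\<phi> x * g x) * indicator A x \<partial>\<nu>)"
    using add_right_mono[OF H, of "\<integral>\<^sup>+ x. ennreal (\<phi> x * g x) * indicator A x \<partial>\<nu>"] sum[OF r z] by (simp add: q_def)
  also have "(\<integral>\<^sup>+ x. ennreal (\<phi> x * g x) * indicator A x \<partial>\<nu>) \<le> (\<integral>\<^sup>+ x. ennreal (g x) * indicator A x \<partial>\<nu>)"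
    using \<phi> g(2) by (intro nn_integral_mono) (auto simp: indicator_def mult_left_le_one_le less_imp_le intro!: ennreal_leI)
  finally have fin: "ennreal (m * q) \<le> ennreal (m * q + 2 * d - b) + (\<integral>\<^sup>+ x. ennreal (g x) * indicator A x \<partial>\<nu>)"
    by (simp add: add_left_mono)
  show "ennreal b \<le> (\<integral>\<^sup>+ x. ennreal (g x) * indicator A x \<partial>\<nu>) + ennreal e"
  proof (cases "(\<integral>\<^sup>+ x. ennreal (g x) * indicator A x \<partial>\<nu>)")
    case (real J)
    have mq: "0 \<le> m * q" using m I0 by (simp add: q_def)
    have "m * q \<le> (m * q + 2 * d - b) + J"
      using fin real mq pos by (simp add: ennreal_le_iff flip: ennreal_plus)
    then have "b \<le> J + 2 * d" by linarith
    then have "ennreal b \<le> ennreal (J + e)" by (intro ennreal_leI) (simp add: d_def)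
    then show ?thesis using real \<open>0 < e\<close> by (simp add: ennreal_plus)
  qed simp
qed

end

subsection \<open>The Gauss problem on a condenser\<close>

lemma madd_commute: "madd M N = madd N M"
  by (simp add: madd_def add.commute)

lemma madd_assoc:
  assumes "sets M = sets borel" "sets N = sets borel" "sets L = sets borel"
  shows "madd (madd M N) L = madd M (madd N L)"
  using assms by (intro measure_eqI) (auto simp: emeasure_madd add.assoc)

lemma msum_cong: "(\<And>i. i \<in> S \<Longrightarrow> \<mu> i = \<nu> i) \<Longrightarrow> msum S \<mu> = msum S \<nu>"
  unfolding msum_def by (simp cong: infsum_cong)

lemma msum_remove:
  assumes i: "i \<in> S" and s: "\<And>j. j \<in> S \<Longrightarrow> sets (\<mu> j) = sets borel"
  shows "msum S \<mu> = madd (msum (S - {i}) \<mu>) (\<mu> i)"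
proof (rule measure_eqI)
  fix B
  have "(\<Sum>\<^sub>\<infinity>j\<in>insert i (S - {i}). emeasure (\<mu> j) B) = emeasure (\<mu> i) B + (\<Sum>\<^sub>\<infinity>j\<in>S - {i}. emeasure (\<mu> j) B)"
    by (intro infsum_insert nonneg_summable_on_complete) auto
  moreover have "emeasure (msum (S - {i}) \<mu>) B = (\<Sum>\<^sub>\<infinity>j\<in>S - {i}. emeasure (\<mu> j) B)"
    using s by (intro emeasure_msum) auto
  moreover have "emeasure (msum S \<mu>) B = (\<Sum>\<^sub>\<infinity>j\<in>S. emeasure (\<mu> j) B)" by (rule emeasure_msum[OF s])
  ultimately show "emeasure (msum S \<mu>) B = emeasure (madd (msum (S - {i}) \<mu>) (\<mu> i)) B"
    using i s by (simp add: emeasure_madd insert_absorb add.commute)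
qed simp

lemma msum_update:
  assumes i: "i \<in> S" and s: "\<And>j. j \<in> S \<Longrightarrow> sets (\<mu> j) = sets borel" "sets \<omega> = sets borel"
  shows "msum S (\<mu>(i := \<omega>)) = madd (msum (S - {i}) \<mu>) \<omega>"
proof -
  have "msum S (\<mu>(i := \<omega>)) = madd (msum (S - {i}) (\<mu>(i := \<omega>))) ((\<mu>(i := \<omega>)) i)"
    using i s by (intro msum_remove) auto
  also have "msum (S - {i}) (\<mu>(i := \<omega>)) = msum (S - {i}) \<mu>" by (rule msum_cong) auto
  finally show ?thesis by (simp add: fun_upd_def)
qed

definition vcomb :: "real \<Rightarrow> ('i \<Rightarrow> 'a::topological_space measure) \<Rightarrow> ('i \<Rightarrow> 'a measure) \<Rightarrow> 'i \<Rightarrow> 'a measure" where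
  "vcomb t \<mu> \<nu> i = madd (scale_measure (ennreal (1 - t)) (\<mu> i)) (scale_measure (ennreal t) (\<nu> i))"

lemma infsum_cmult_ennreal: "(\<Sum>\<^sub>\<infinity>i\<in>I. (c::ennreal) * f i) = c * (\<Sum>\<^sub>\<infinity>i\<in>I. f i)"
  unfolding infsum_ennreal_SUP by (simp add: SUP_mult_left_ennreal sum_distrib_left)

lemma msum_vcomb:
  assumes s: "\<And>j. j \<in> S \<Longrightarrow> sets (\<mu> j) = sets borel" "\<And>j. j \<in> S \<Longrightarrow> sets (\<nu> j) = sets borel"
  shows "msum S (vcomb t \<mu> \<nu>) = madd (scale_measure (ennreal (1 - t)) (msum S \<mu>)) (scale_measure (ennreal t) (msum S \<nu>))"
proof (rule measure_eqI)
  fix B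
  have "emeasure (msum S (vcomb t \<mu> \<nu>)) B = (\<Sum>\<^sub>\<infinity>i\<in>S. emeasure (vcomb t \<mu> \<nu> i) B)"
    by (rule emeasure_msum) (simp add: vcomb_def)
  also have "\<dots> = (\<Sum>\<^sub>\<infinity>i\<in>S. ennreal (1 - t) * emeasure (\<mu> i) B + ennreal t * emeasure (\<nu> i) B)"
    using s by (intro infsum_cong) (simp add: vcomb_def emeasure_madd)
  also have "\<dots> = ennreal (1 - t) * (\<Sum>\<^sub>\<infinity>i\<in>S. emeasure (\<mu> i) B) + ennreal t * (\<Sum>\<^sub>\<infinity>i\<in>S. emeasure (\<nu> i) B)"
    by (subst infsum_add) (auto intro: nonneg_summable_on_complete simp: infsum_cmult_ennreal)
  finally show "emeasure (msum S (vcomb t \<mu> \<nu>)) B = emeasure (madd (scale_measure (ennreal (1 - t)) (msum S \<mu>)) (scale_measure (ennreal t) (msum S \<nu>))) B"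
    using s by (simp add: emeasure_madd emeasure_msum)
qed simp

context energy_kernel
begin

lemma inEp_maddD:
  assumes "radon x" "radon y" "inEp \<kappa> (madd x y)"
  shows "inEp \<kappa> x" "inEp \<kappa> y" "kint \<kappa> y y \<le> kint \<kappa> (madd x y) (madd x y)"
    "kint \<kappa> x x + kint \<kappa> y y \<le> kint \<kappa> (madd x y) (madd x y)"
proof -
  have eq: "kint \<kappa> (madd x y) (madd x y) = kint \<kappa> x x + kint \<kappa> y x + (kint \<kappa> x y + kint \<kappa> y y)"
    using assms by (simp add: kint_madd_left kint_madd_right radon_madd)
  show le: "kint \<kappa> x x + kint \<kappa> y y \<le> kint \<kappa> (madd x y) (madd x y)"
    unfolding eq by (intro add_mono) (auto simp: add_increasing add_increasing2)
  have "kint \<kappa> (madd x y) (madd x y) < top" using assms(3) by (simp add: inEp_def)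
  then have "kint \<kappa> x x + kint \<kappa> y y < top" using le by (rule le_less_trans[rotated])
  then show "inEp \<kappa> x" "inEp \<kappa> y" using assms(1,2) by (auto simp: inEp_def)
  show "kint \<kappa> y y \<le> kint \<kappa> (madd x y) (madd x y)"
    using le by (rule order_trans[rotated]) (simp add: add_increasing)
qed

lemma ip_diff_snd:
  assumes "inEp \<kappa> p" "inEp \<kappa> n" "inEp \<kappa> \<nu>"
  shows "ip \<kappa> (padd (p, madd n \<nu>) (pneg (p, n))) (padd (p, madd n \<nu>) (pneg (p, n))) = energy \<nu> \<nu>"
    "ip \<kappa> (padd (p, n) (pneg (p, madd n \<nu>))) (padd (p, n) (pneg (p, madd n \<nu>))) = energy \<nu> \<nu>"
  using assms energy_sym
  by (simp_all add: padd_def pneg_def ip_def energy_madd_left energy_madd_right inEp_madd)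

end

locale condenser_problem = consistent_kernel \<kappa> for \<kappa> :: "'a::t2_space kernel" +
  fixes Ip In :: "'i set" and A :: "'i \<Rightarrow> 'a set" and ch :: "'a smeasure" and g :: "'a \<Rightarrow> real"
    and a :: "'i \<Rightarrow> real" and l :: 'i
  assumes cond: "condenser \<kappa> Ip In A" and chi: "ext_field \<kappa> Ip In A ch" and gok: "g_ok \<kappa> (Ip \<union> In) A g"
    and ell: "l \<in> In" and disj: "\<And>i. i \<in> Ip \<union> In \<Longrightarrow> i \<noteq> l \<Longrightarrow> A i \<inter> A l = {}"
    and cap_l: "cap \<kappa> (A l) = \<infinity>" and cap_fin: "\<And>i. i \<in> Ip \<union> In \<Longrightarrow> i \<noteq> l \<Longrightarrow> cap \<kappa> (A i) \<noteq> \<infinity>"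
    and a_pos: "\<And>i. i \<in> Ip \<union> In \<Longrightarrow> a i > 0" and a_sum: "a summable_on (Ip \<union> In)"
begin

section \<open>Vectors of measures on the plates and their weights\<close>

abbreviation I :: "'i set" where "I \<equiv> Ip \<union> In"

abbreviation wint :: "'i \<Rightarrow> 'a measure \<Rightarrow> ennreal" where
  "wint i \<mu> \<equiv> (\<integral>\<^sup>+ x. ennreal (g x) * indicator (A i) x \<partial>\<mu>)"

abbreviation vec :: "('i \<Rightarrow> 'a measure) \<Rightarrow> bool" where
  "vec \<equiv> EA \<kappa> Ip In A"

abbreviation R :: "('i \<Rightarrow> 'a measure) \<Rightarrow> 'a smeasure" where
  "R \<equiv> Rm Ip In"

abbreviation cls :: "'i set \<Rightarrow> ('i \<Rightarrow> 'a measure) \<Rightarrow> bool" where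
  "cls \<equiv> EAag \<kappa> Ip In A a g"

abbreviation minimizes :: "'i set \<Rightarrow> ('i \<Rightarrow> 'a measure) \<Rightarrow> bool" where
  "minimizes \<equiv> solves \<kappa> Ip In A a g ch"

lemma l_in: "l \<in> I" and l_notin: "l \<notin> Ip"
  using ell cond by (auto simp: condenser_def)

lemma countable_I: "countable Ip" "countable In" "countable I"
  using cond by (auto simp: condenser_def)

lemma closed_A: "i \<in> I \<Longrightarrow> closed (A i)"
  using cond by (auto simp: condenser_def)

lemma loc_finite_A: "loc_finite I A"
  using cond unfolding condenser_def loc_finite_def by blast

lemma loc_finite_A_sub: "S \<subseteq> I \<Longrightarrow> loc_finite S A"
  by (rule loc_finite_subset[OF loc_finite_A]) auto

lemma plates_disjoint: "i \<in> Ip \<Longrightarrow> j \<in> In \<Longrightarrow> A i \<inter> A j = {}"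
  using cond unfolding condenser_def by blast

lemma g_cont: "i \<in> I \<Longrightarrow> continuous_on (A i) g"
  using gok unfolding g_ok_def by (meson UN_upper continuous_on_subset)

definition c0 :: real where "c0 = (SOME c. c > 0 \<and> (\<forall>x\<in>(\<Union>i\<in>I. A i). c \<le> g x))"

lemma c0_pos: "c0 > 0" and c0_le: "i \<in> I \<Longrightarrow> x \<in> A i \<Longrightarrow> c0 \<le> g x"
proof -
  have "\<exists>c. c > 0 \<and> (\<forall>x\<in>(\<Union>i\<in>I. A i). c \<le> g x)" using gok unfolding g_ok_def by blast
  then have *: "c0 > 0 \<and> (\<forall>x\<in>(\<Union>i\<in>I. A i). c0 \<le> g x)" unfolding c0_def by (rule someI_ex)
  show "c0 > 0" using * by blast
  show "i \<in> I \<Longrightarrow> x \<in> A i \<Longrightarrow> c0 \<le> g x" using * by blast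
qed

lemma g_pos: "i \<in> I \<Longrightarrow> x \<in> A i \<Longrightarrow> 0 < g x"
  using c0_pos c0_le less_le_trans by blast

lemma wint_borel: "i \<in> I \<Longrightarrow> (\<lambda>x. ennreal (g x) * indicator (A i) x) \<in> borel_measurable borel"
  by (intro weighted_borel closed_A g_cont)

lemma mass_le_wint:
  assumes i: "i \<in> I" and s: "sets \<mu> = sets borel" and z: "emeasure \<mu> (UNIV - A i) = 0"
  shows "ennreal c0 * emeasure \<mu> UNIV \<le> wint i \<mu>"
proof -
  have AB: "A i \<in> sets \<mu>" using closed_A[OF i] s by simp
  have "emeasure \<mu> (UNIV \<inter> A i) = emeasure \<mu> UNIV" using closed_A[OF i] s z by (intro emeasure_conc_Int) auto
  then have "ennreal c0 * emeasure \<mu> UNIV = (\<integral>\<^sup>+ x. ennreal c0 * indicator (A i) x \<partial>\<mu>)"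
    by (simp add: nn_integral_cmult_indicator[OF AB])
  also have "\<dots> \<le> wint i \<mu>"
    using c0_le[OF i] by (intro nn_integral_mono) (auto simp: indicator_def intro!: ennreal_leI)
  finally show ?thesis .
qed

lemma mass_le:
  assumes "i \<in> I" "sets \<mu> = sets borel" "emeasure \<mu> (UNIV - A i) = 0" "wint i \<mu> \<le> ennreal b" "b \<ge> 0"
  shows "emeasure \<mu> UNIV \<le> ennreal (b / c0)"
proof -
  have *: "ennreal c0 * emeasure \<mu> UNIV \<le> ennreal b" using mass_le_wint[OF assms(1-3)] assms(4) by (rule order_trans)
  show ?thesis
  proof (cases "emeasure \<mu> UNIV")
    case (real m)
    then show ?thesis using * c0_pos assms(5)
      by (simp add: ennreal_mult'[symmetric] ennreal_le_iff field_simps)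
  next
    case top
    then show ?thesis using * c0_pos by (simp add: ennreal_mult_top top_unique)
  qed
qed

text \<open>The part of \<open>vec\<close> that says nothing about energy. Vague limits inherit it
  at once, while their finite energy is known only after consistency has been applied.\<close>

definition good :: "('i \<Rightarrow> 'a measure) \<Rightarrow> bool" where
  "good \<mu> \<longleftrightarrow> (\<forall>i\<in>I. radon (\<mu> i) \<and> emeasure (\<mu> i) (UNIV - A i) = 0)"

lemma good_sets: "good \<mu> \<Longrightarrow> i \<in> I \<Longrightarrow> sets (\<mu> i) = sets borel"
  by (auto simp: good_def radon_sets)

lemma good_iff: "(\<forall>i\<in>I. radon (\<mu> i) \<and> conc (\<mu> i) (A i)) \<longleftrightarrow> good \<mu>"
  unfolding good_def using conc_closed_iff[OF closed_A] by (metis radon_sets)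

lemma good_radon_msum:
  assumes "good \<mu>" "S \<subseteq> I" shows "radon (msum S \<mu>)"
proof (rule radon_msum)
  show "countable S" using countable_I(3) assms(2) countable_subset by blast
  show "loc_finite S A" by (rule loc_finite_A_sub[OF assms(2)])
  show "closed (A i)" if "i \<in> S" for i using closed_A that assms(2) by blast
  show "radon (\<mu> i)" if "i \<in> S" for i using assms that by (auto simp: good_def)
  show "conc (\<mu> i) (A i)" if "i \<in> S" for i using assms that good_iff by blast
qed

text \<open>Plates of equal sign may overlap, so \<open>R \<mu>\<close> does not determine \<mu> in
  general; the component on \<open>A l\<close> can be read off because no other plate meets
  \<open>A l\<close>.\<close>

lemma good_emeasure_l:
  assumes \<mu>: "good \<mu>" and S: "S \<subseteq> I" and B: "B \<in> sets borel"
  shows "emeasure (msum S \<mu>) (B \<inter> A l) = (if l \<in> S then emeasure (\<mu> l) B else 0)"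
proof -
  have s: "\<And>j. j \<in> S \<Longrightarrow> sets (\<mu> j) = sets borel" using good_sets \<mu> S by blast
  have em: "emeasure (msum S \<mu>) (B \<inter> A l) = (\<Sum>\<^sub>\<infinity>j\<in>S. emeasure (\<mu> j) (B \<inter> A l))" by (rule emeasure_msum[OF s])
  have z: "emeasure (\<mu> j) (B \<inter> A l) = 0" if "j \<in> S" "j \<noteq> l" for j
  proof -
    have "j \<in> I" using that S by blast
    then have "emeasure (\<mu> j) (B \<inter> A l) \<le> emeasure (\<mu> j) (UNIV - A j)"
      using disj[of j] that closed_A[of j] s[of j] by (intro emeasure_mono) auto
    then show ?thesis using \<mu> \<open>j \<in> I\<close> by (auto simp: good_def)
  qed
  show ?thesis
  proof (cases "l \<in> S")
    case True
    have "emeasure (msum S \<mu>) (B \<inter> A l) = (\<Sum>j\<in>{l}. emeasure (\<mu> j) (B \<inter> A l))"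
      unfolding em using True z by (intro infsum_finite_support) auto
    also have "\<dots> = emeasure (\<mu> l) B"
      using \<mu> l_in closed_A[OF l_in] B by (simp add: emeasure_conc_Int good_def radon_sets)
    finally show ?thesis using True by simp
  next
    case False
    have "emeasure (msum S \<mu>) (B \<inter> A l) = (\<Sum>\<^sub>\<infinity>j\<in>S. 0)"
      unfolding em using False z by (intro infsum_cong) metis
    then show ?thesis using False by simp
  qed
qed

lemma good_msingular:
  assumes \<mu>: "good \<mu>" shows "msingular (msum Ip \<mu>) (msum In \<mu>)"
proof -
  let ?B = "\<Union>i\<in>Ip. A i"
  have cB: "closed ?B" using closed_A by (intro loc_finite_closed_UN[OF loc_finite_A_sub]) auto
  have s: "\<And>j. j \<in> Ip \<Longrightarrow> sets (\<mu> j) = sets borel" "\<And>j. j \<in> In \<Longrightarrow> sets (\<mu> j) = sets borel" using good_sets \<mu> by auto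
  have "emeasure (\<mu> i) (UNIV - ?B) = 0" if "i \<in> Ip" for i
  proof -
    have "emeasure (\<mu> i) (UNIV - ?B) \<le> emeasure (\<mu> i) (UNIV - A i)"
      using that closed_A s by (intro emeasure_mono) auto
    then show ?thesis using \<mu> that by (auto simp: good_def)
  qed
  then have 1: "emeasure (msum Ip \<mu>) (UNIV - ?B) = 0"
    by (subst emeasure_msum[OF s(1)]) (auto cong: infsum_cong)
  have "emeasure (\<mu> j) ?B = 0" if "j \<in> In" for j
  proof -
    have "emeasure (\<mu> j) ?B \<le> emeasure (\<mu> j) (UNIV - A j)"
    proof (rule emeasure_mono)
      show "?B \<subseteq> UNIV - A j" using plates_disjoint[OF _ that] by blast
      show "UNIV - A j \<in> sets (\<mu> j)" using that closed_A[of j] s by auto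
    qed
    then show ?thesis using \<mu> that by (auto simp: good_def)
  qed
  then have 2: "emeasure (msum In \<mu>) ?B = 0"
    by (subst emeasure_msum[OF s(2)]) (auto cong: infsum_cong)
  show ?thesis unfolding msingular_def using 1 2 cB by (intro bexI[of _ ?B]) auto
qed

text \<open>Mutual energies of measures of finite energy are finite, and the positive and negative
  sums live on disjoint sets; so only the energies of the two sums have to be checked.\<close>

lemma EA_iff: "vec \<mu> \<longleftrightarrow> good \<mu> \<and> inEp \<kappa> (msum Ip \<mu>) \<and> inEp \<kappa> (msum In \<mu>)"
proof
  assume "vec \<mu>"
  then show "good \<mu> \<and> inEp \<kappa> (msum Ip \<mu>) \<and> inEp \<kappa> (msum In \<mu>)"
    unfolding EA_def good_iff by (auto simp: Rm_def inE_def finen_def inEp_def)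
next
  assume *: "good \<mu> \<and> inEp \<kappa> (msum Ip \<mu>) \<and> inEp \<kappa> (msum In \<mu>)"
  then show "vec \<mu>"
    unfolding EA_def good_iff using kint_finite[of "msum Ip \<mu>" "msum In \<mu>"] kint_finite[of "msum In \<mu>" "msum Ip \<mu>"] good_msingular
    by (auto simp: Rm_def inE_def finen_def inEp_def)
qed

lemma E2_Rm: "vec \<mu> \<Longrightarrow> E2 (R \<mu>)"
  by (simp add: EA_iff E2_def Rm_def)

lemma E2_ch: "E2 ch"
  using chi by (simp add: ext_field_def inE_def finen_def E2_def inEp_def)

section \<open>The quadratic functional: convexity and continuity\<close>

definition Q :: "'a smeasure \<Rightarrow> real" where
  "Q z = ip \<kappa> z z + 2 * ip \<kappa> ch z"

lemma Gchi_eq: "vec \<mu> \<Longrightarrow> Gchi \<kappa> Ip In ch \<mu> = Q (R \<mu>)"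
  by (simp add: Gchi_def Q_def nrm_sq E2_Rm)

lemma Q_eq: "E2 z \<Longrightarrow> Q z = (nrm \<kappa> (padd z ch))\<^sup>2 - ip \<kappa> ch ch"
  using E2_ch ip_sym[of z ch] by (simp add: Q_def nrm_sq ip_linear)

lemma Q_lower: "E2 z \<Longrightarrow> - ip \<kappa> ch ch \<le> Q z"
  using Q_eq[of z] by simp

lemma Q_convex:
  assumes z: "E2 z" and w: "E2 w" and t: "0 \<le> t" "t \<le> 1"
  shows "Q (padd (pscale (1 - t) z) (pscale t w)) = (1 - t) * Q z + t * Q w
     - t * (1 - t) * ip \<kappa> (padd z (pneg w)) (padd z (pneg w))"
  unfolding Q_def ip_convex_combination[OF assms] using assms E2_ch by (simp add: ip_linear algebra_simps)

lemma Q_le: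
  assumes z: "E2 z" and w: "E2 w"
  shows "Q w \<le> Q z + 2 * nrm \<kappa> (padd z ch) * nrm \<kappa> (padd w (pneg z)) + (nrm \<kappa> (padd w (pneg z)))\<^sup>2"
proof -
  let ?d = "padd w (pneg z)"
  have d: "E2 ?d" using z w by (simp add: ip_linear)
  have "Q w = Q z + 2 * ip \<kappa> (padd z ch) ?d + ip \<kappa> ?d ?d"
    unfolding Q_def using z w E2_ch ip_sym[OF z w] by (simp add: ip_linear algebra_simps)
  also have "\<dots> \<le> Q z + 2 * (nrm \<kappa> (padd z ch) * nrm \<kappa> ?d) + (nrm \<kappa> ?d)\<^sup>2"
    using ip_cauchy_schwarz[of "padd z ch" ?d] d z E2_ch by (simp add: nrm_sq E2_padd)
  finally show ?thesis by simp
qed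

lemma Q_small_change:
  assumes z: "E2 z" and e: "e > 0"
  obtains d where "d > 0" "\<And>w. E2 w \<Longrightarrow> ip \<kappa> (padd w (pneg z)) (padd w (pneg z)) \<le> d \<Longrightarrow> Q w \<le> Q z + e"
proof -
  define N where "N = nrm \<kappa> (padd z ch)"
  have N: "N \<ge> 0" unfolding N_def by (intro nrm_nonneg E2_padd z E2_ch)
  \<comment> \<open>For \<open>0 \<le> n \<le> q\<close> this gives
    \<open>2 * N * n + n\<^sup>2 \<le> q * (2 * N + 1) \<le> e\<close>; the bound
    \<open>q \<le> 1\<close> absorbs one factor of the square.\<close>
  define q where "q = min 1 (e / (2 * N + 1))"
  have q: "q > 0" "q \<le> 1" using e N by (auto simp: q_def)
  have "q \<le> e / (2 * N + 1)" by (simp add: q_def)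
  then have qe: "q * (2 * N + 1) \<le> e" using N by (simp add: pos_le_divide_eq)
  have "Q w \<le> Q z + e" if w: "E2 w" "ip \<kappa> (padd w (pneg z)) (padd w (pneg z)) \<le> q\<^sup>2" for w
  proof -
    let ?n = "nrm \<kappa> (padd w (pneg z))"
    have n0: "?n \<ge> 0" by (intro nrm_nonneg E2_padd w E2_pneg z)
    have "?n \<le> sqrt (q\<^sup>2)" unfolding nrm_def using w by (intro real_sqrt_le_mono)
    then have n: "?n \<le> q" using q by simp
    have "2 * N * ?n + ?n\<^sup>2 = ?n * (2 * N + ?n)" by (simp add: power2_eq_square algebra_simps)
    also have "\<dots> \<le> q * (2 * N + 1)" using n n0 q N by (intro mult_mono) auto
    also have "\<dots> \<le> e" by (rule qe)
    finally show ?thesis using Q_le[OF z w(1)] unfolding N_def by linarith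
  qed
  then show ?thesis using that[of "q\<^sup>2"] q by simp
qed

lemma solves_iff: "minimizes J \<mu> \<longleftrightarrow>
    cls J \<mu> \<and> (\<forall>\<nu>. cls J \<nu> \<longrightarrow> Q (R \<mu>) \<le> Q (R \<nu>))"
proof -
  have G: "Gchi \<kappa> Ip In ch \<nu> = Q (R \<nu>)" if "cls J \<nu>" for \<nu>
    using that Gchi_eq by (simp add: EAag_def)
  show ?thesis
  proof
    assume s: "minimizes J \<mu>"
    then have \<mu>: "cls J \<mu>" by (simp add: solves_def)
    have "Q (R \<mu>) \<le> Q (R \<nu>)" if \<nu>: "cls J \<nu>" for \<nu>
    proof -
      have "ereal (Gchi \<kappa> Ip In ch \<mu>) \<le> ereal (Gchi \<kappa> Ip In ch \<nu>)"
        using s \<nu> unfolding solves_def Ginf_def by (auto intro!: INF_lower)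
      then show ?thesis using G \<mu> \<nu> by simp
    qed
    then show "cls J \<mu> \<and> (\<forall>\<nu>. cls J \<nu> \<longrightarrow> Q (R \<mu>) \<le> Q (R \<nu>))"
      using \<mu> by blast
  next
    assume *: "cls J \<mu> \<and> (\<forall>\<nu>. cls J \<nu> \<longrightarrow> Q (R \<mu>) \<le> Q (R \<nu>))"
    then have "ereal (Gchi \<kappa> Ip In ch \<mu>) = Ginf \<kappa> Ip In A a g ch J"
      unfolding Ginf_def by (intro antisym INF_greatest INF_lower) (auto simp: G)
    then show "minimizes J \<mu>" using * by (simp add: solves_def)
  qed
qed

section \<open>Convex combinations of vectors and replacement of the component on
  \<open>A l\<close>\<close>

lemma Rm_vcomb:
  assumes "good \<mu>" "good \<nu>"
  shows "R (vcomb t \<mu> \<nu>) = padd (pscale (1 - t) (R \<mu>)) (pscale t (R \<nu>))"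
  unfolding Rm_def padd_def pscale_def using assms good_sets
  by (simp add: msum_vcomb)

lemma EA_vcomb:
  assumes \<mu>: "vec \<mu>" and \<nu>: "vec \<nu>" and t: "0 \<le> t" "t \<le> 1"
  shows "vec (vcomb t \<mu> \<nu>)"
proof -
  have g: "good \<mu>" "good \<nu>" using \<mu> \<nu> by (auto simp: EA_iff)
  have "good (vcomb t \<mu> \<nu>)"
    using g t unfolding good_def vcomb_def
    by (auto intro!: radon_madd radon_scale simp: emeasure_madd radon_sets)
  moreover have "E2 (R (vcomb t \<mu> \<nu>))"
    unfolding Rm_vcomb[OF g] using t by (intro E2_padd E2_pscale E2_Rm \<mu> \<nu>) auto
  ultimately show ?thesis by (simp add: EA_iff E2_def Rm_def)
qed

lemma wint_vcomb:
  assumes "good \<mu>" "good \<nu>" "i \<in> I"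
  shows "wint i (vcomb t \<mu> \<nu> i) = ennreal (1 - t) * wint i (\<mu> i) + ennreal t * wint i (\<nu> i)"
proof -
  have s: "sets (\<mu> i) = sets borel" "sets (\<nu> i) = sets borel" using assms good_sets by auto
  show ?thesis
    unfolding vcomb_def using s wint_borel[OF assms(3)]
    by (simp add: nn_integral_madd nn_integral_scale_measure borel_measurable_cong_sets)
qed

lemma EAag_vcomb:
  assumes \<mu>: "cls J \<mu>" and \<nu>: "cls J \<nu>" and t: "0 \<le> t" "t \<le> 1" and J: "J \<subseteq> I"
  shows "cls J (vcomb t \<mu> \<nu>)"
  unfolding EAag_def
proof (intro conjI ballI)
  have E: "vec \<mu>" "vec \<nu>" using \<mu> \<nu> by (auto simp: EAag_def)
  then have g: "good \<mu>" "good \<nu>" by (auto simp: EA_iff)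
  show "vec (vcomb t \<mu> \<nu>)" by (rule EA_vcomb[OF E t])
  fix i assume i: "i \<in> J"
  have "wint i (vcomb t \<mu> \<nu> i) = ennreal (1 - t) * ennreal (a i) + ennreal t * ennreal (a i)"
    using wint_vcomb[OF g, of i t] i J \<mu> \<nu> by (auto simp: EAag_def)
  also have "\<dots> = ennreal ((1 - t) * a i + t * a i)"
    using t a_pos[of i] i J by (subst ennreal_plus) (auto simp: ennreal_mult less_imp_le)
  also have "(1 - t) * a i + t * a i = a i" by (simp add: algebra_simps)
  finally show "wint i (vcomb t \<mu> \<nu> i) = ennreal (a i)" .
qed

lemma minimizers_agree:
  assumes \<mu>: "minimizes J \<mu>" and \<nu>: "minimizes J \<nu>" and J: "J \<subseteq> I"
  shows "\<mu> l = \<nu> l"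
proof -
  have E: "cls J \<mu>" "cls J \<nu>" using \<mu> \<nu> by (auto simp: solves_iff)
  then have EA: "vec \<mu>" "vec \<nu>" by (auto simp: EAag_def)
  then have g: "good \<mu>" "good \<nu>" by (auto simp: EA_iff)
  let ?z = "R \<mu>" and ?w = "R \<nu>"
  have z: "E2 ?z" "E2 ?w" using EA E2_Rm by auto
  have eq: "Q ?z = Q ?w" using \<mu> \<nu> E by (auto simp: solves_iff intro: antisym)
  have half: "0 \<le> (1/2::real)" "(1/2::real) \<le> 1" by auto
  let ?d = "padd ?z (pneg ?w)"
  have dE: "E2 ?d" using z by (simp add: ip_linear)
  have "Q ?z \<le> Q (R (vcomb (1/2) \<mu> \<nu>))"
    using \<mu> EAag_vcomb[OF E half J] by (simp add: solves_iff)
  also have "\<dots> = Q ?z - 1/2 * (1 - 1/2) * ip \<kappa> ?d ?d"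
    unfolding Rm_vcomb[OF g] Q_convex[OF z half] using eq by simp
  finally have "ip \<kappa> ?d ?d = 0" using ip_nonneg[OF dE] by simp
  then have d0: "fst ?d = snd ?d" by (rule ip_zero_imp_eq[OF dE])
  \<comment> \<open>The equation \<open>fst ?d = snd ?d\<close> equates the positive part of
    \<open>R \<mu>\<close> plus the negative part of \<open>R \<nu>\<close> with the reverse sum. On
    subsets of \<open>A l\<close> the positive parts vanish, and of the negative parts only the
    components \<open>l\<close> remain.\<close>
  show ?thesis
  proof (rule measure_eqI)
    show "sets (\<mu> l) = sets (\<nu> l)" using g l_in by (simp add: good_sets)
    fix B assume "B \<in> sets (\<mu> l)"
    then have B: "B \<in> sets borel" using good_sets[OF g(1) l_in] by simp
    have "emeasure (fst ?d) (B \<inter> A l) = emeasure (snd ?d) (B \<inter> A l)" using d0 by simp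
    then show "emeasure (\<mu> l) B = emeasure (\<nu> l) B"
      using good_emeasure_l[OF g(1) _ B] good_emeasure_l[OF g(2) _ B] l_notin ell
      by (simp add: padd_def pneg_def Rm_def emeasure_madd)
  qed
qed

lemma msum_In_split:
  assumes "good \<mu>" shows "msum In \<mu> = madd (msum (In - {l}) \<mu>) (\<mu> l)"
  using assms ell good_sets by (intro msum_remove) auto

lemma EA_parts:
  assumes "vec \<mu>"
  shows "inEp \<kappa> (msum (In - {l}) \<mu>)" "inEp \<kappa> (\<mu> l)"
proof -
  have g: "good \<mu>" and E: "inEp \<kappa> (msum In \<mu>)" using assms by (auto simp: EA_iff)
  have r: "radon (msum (In - {l}) \<mu>)" "radon (\<mu> l)" using good_radon_msum[OF g, of "In - {l}"] g l_in by (auto simp: good_def)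
  show "inEp \<kappa> (msum (In - {l}) \<mu>)" "inEp \<kappa> (\<mu> l)" using inEp_maddD[OF r] E msum_In_split[OF g] by auto
qed

lemma
  assumes \<mu>: "vec \<mu>" and \<omega>: "inEp \<kappa> \<omega>" "emeasure \<omega> (UNIV - A l) = 0"
  shows EA_update: "vec (\<mu>(l := \<omega>))"
    and Rm_update: "R (\<mu>(l := \<omega>)) = (msum Ip \<mu>, madd (msum (In - {l}) \<mu>) \<omega>)"
proof -
  have g: "good \<mu>" using \<mu> by (simp add: EA_iff)
  have s: "sets \<omega> = sets borel" using \<omega> by (simp add: inEp_sets)
  have N: "msum In (\<mu>(l := \<omega>)) = madd (msum (In - {l}) \<mu>) \<omega>"
    using ell g s good_sets by (intro msum_update) auto
  have P: "msum Ip (\<mu>(l := \<omega>)) = msum Ip \<mu>" using l_notin by (intro msum_cong) auto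
  have "good (\<mu>(l := \<omega>))" using g \<omega> by (auto simp: good_def inEp_def)
  then show "vec (\<mu>(l := \<omega>))"
    using \<mu> \<omega> EA_parts[OF \<mu>] by (simp add: EA_iff N P inEp_madd)
  show "R (\<mu>(l := \<omega>)) = (msum Ip \<mu>, madd (msum (In - {l}) \<mu>) \<omega>)" by (simp add: Rm_def N P)
qed

lemma EAag_update:
  assumes "cls (I - {l}) \<mu>" "inEp \<kappa> \<omega>" "emeasure \<omega> (UNIV - A l) = 0"
  shows "cls (I - {l}) (\<mu>(l := \<omega>))"
  using assms EA_update unfolding EAag_def by auto

section \<open>Changing the weight on \<open>A l\<close> at small cost\<close>

lemma wint_restr_compact:
  assumes r: "inEp \<kappa> \<mu>" and K: "compact K"
  shows "wint l (restr K \<mu>) < \<infinity>"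
proof -
  have KB: "K \<in> sets borel" using K by (simp add: borel_closed compact_imp_closed)
  have s: "sets \<mu> = sets borel" using r by (rule inEp_sets)
  have "compact (g ` (K \<inter> A l))"
    using K closed_A[OF l_in] g_cont[OF l_in]
    by (intro compact_continuous_image compact_Int_closed) (auto intro: continuous_on_subset)
  then obtain m where m: "\<And>x. x \<in> K \<inter> A l \<Longrightarrow> g x \<le> m"
    using compact_imp_bounded bounded_iff by (metis abs_le_D1 image_eqI real_norm_def)
  have "wint l (restr K \<mu>) = (\<integral>\<^sup>+ x. indicator K x * (ennreal (g x) * indicator (A l) x) \<partial>\<mu>)"
    by (rule nn_integral_restr[OF s KB wint_borel[OF l_in]])
  also have "\<dots> \<le> (\<integral>\<^sup>+ x. ennreal m * indicator K x \<partial>\<mu>)"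
    using m by (intro nn_integral_mono) (auto simp: indicator_def intro!: ennreal_leI)
  also have "\<dots> = ennreal m * emeasure \<mu> K" using KB s by (simp add: nn_integral_cmult_indicator)
  also have "\<dots> < \<infinity>" using radon_compact[OF inEp_radon[OF r] K] by (simp add: ennreal_mult_less_top)
  finally show ?thesis .
qed

text \<open>This is where \<open>cap \<kappa> (A l) = \<infinity>\<close> enters: weight can be placed on \<open>A l\<close> at no cost.\<close>

lemma cheap_unit_weight:
  assumes d: "d > 0"
  obtains \<nu> where "inEp \<kappa> \<nu>" "emeasure \<nu> (UNIV - A l) = 0" "wint l \<nu> = 1" "energy \<nu> \<nu> \<le> d"
proof -
  \<comment> \<open>After the cut to a compact set the weight is at least \<open>c0 / 2\<close>, so
    normalizing it multiplies the energy by at most \<open>(2 / c0)\<^sup>2\<close>.\<close>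
  define e where "e = d * (c0 / 2)\<^sup>2"
  have e: "e > 0" using d c0_pos by (simp add: e_def)
  have "(INF \<nu>\<in>unit_measures (A l). kint \<kappa> \<nu> \<nu>) = 0"
    using cap_l unfolding cap_def unit_measures_def by simp
  then have "(INF \<nu>\<in>unit_measures (A l). kint \<kappa> \<nu> \<nu>) < ennreal e" using e by simp
  then obtain \<nu>0 where \<nu>0: "\<nu>0 \<in> unit_measures (A l)" "kint \<kappa> \<nu>0 \<nu>0 < ennreal e" by (auto simp: INF_less_iff)
  have E0: "inEp \<kappa> \<nu>0" "emeasure \<nu>0 UNIV = 1" and cc: "conc \<nu>0 (A l)" using \<nu>0 by (auto simp: unit_measures_def)
  have r: "radon \<nu>0" and s: "sets \<nu>0 = sets borel" using E0 by (auto simp: inEp_def radon_sets)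
  have z: "emeasure \<nu>0 (UNIV - A l) = 0" by (rule conc_null[OF cc closed_A[OF l_in] s])
  \<comment> \<open>The weight of \<open>\<nu>0\<close> may be infinite. It becomes finite on a
    compact set, where \<open>g\<close> is bounded on \<open>A l\<close>; more than half of the mass
    is kept so that the weight stays away from zero.\<close>
  have "ennreal (1/2) < emeasure \<nu>0 UNIV" unfolding E0 by (simp add: ennreal_less_one_iff del: ennreal_half)
  then obtain K where K: "compact K" "ennreal (1/2) < emeasure \<nu>0 K"
    unfolding radon_inner[OF r open_UNIV] by (auto simp: less_SUP_iff simp del: ennreal_half)
  have KB: "K \<in> sets borel" using K by (simp add: borel_closed compact_imp_closed)
  define \<nu>1 where "\<nu>1 = restr K \<nu>0"
  have E1: "inEp \<kappa> \<nu>1" unfolding \<nu>1_def by (rule inEp_restr[OF E0(1) KB])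
  have s1: "sets \<nu>1 = sets borel" using E1 by (rule inEp_sets)
  have z1: "emeasure \<nu>1 (UNIV - A l) = 0"
  proof -
    have cA: "UNIV - A l \<in> sets borel" using closed_A[OF l_in] by auto
    have "emeasure \<nu>1 (UNIV - A l) = emeasure \<nu>0 (K \<inter> (UNIV - A l))"
      unfolding \<nu>1_def by (rule emeasure_restr[OF s KB cA])
    also have "\<dots> \<le> emeasure \<nu>0 (UNIV - A l)" by (rule emeasure_mono) (use cA s in auto)
    finally show ?thesis using z by simp
  qed
  have "wint l \<nu>1 < \<infinity>" unfolding \<nu>1_def by (rule wint_restr_compact[OF E0(1) K(1)])
  then obtain w where w: "wint l \<nu>1 = ennreal w" "w \<ge> 0" by (cases "wint l \<nu>1") auto
  have "ennreal (c0 * (1/2)) = ennreal c0 * ennreal (1/2)" using c0_pos by (intro ennreal_mult) auto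
  also have "\<dots> \<le> ennreal c0 * emeasure \<nu>1 UNIV"
    using K(2) unfolding \<nu>1_def by (intro mult_left_mono) (auto simp: emeasure_restr[OF s KB] simp del: ennreal_half)
  also have "\<dots> \<le> ennreal w" unfolding w(1)[symmetric] by (rule mass_le_wint[OF l_in s1 z1])
  finally have wc: "c0 / 2 \<le> w" using w(2) by (simp add: ennreal_le_iff)
  then have w0: "w > 0" using c0_pos by simp
  define \<nu> where "\<nu> = scale_measure (ennreal (1/w)) \<nu>1"
  have "inEp \<kappa> \<nu>" unfolding \<nu>_def using w0 by (intro inEp_scale E1) simp
  moreover have "emeasure \<nu> (UNIV - A l) = 0" by (simp add: \<nu>_def z1)
  moreover have "wint l \<nu> = 1"
  proof -
    have "wint l \<nu> = ennreal (1/w) * wint l \<nu>1"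
      unfolding \<nu>_def by (rule nn_integral_scale_measure[OF borel_measurable_cong_sets[OF s1 wint_borel[OF l_in]]])
    also have "\<dots> = ennreal (1/w * w)" unfolding w(1) using w0 by (intro ennreal_mult[symmetric]) auto
    finally show ?thesis using w0 by simp
  qed
  moreover have "energy \<nu> \<nu> \<le> d"
  proof -
    have le: "kint \<kappa> \<nu>1 \<nu>1 \<le> kint \<kappa> \<nu>0 \<nu>0"
      unfolding \<nu>1_def using r KB E1 by (intro kint_restr_le) (auto simp: \<nu>1_def inEp_def)
    have "kint \<kappa> \<nu>1 \<nu>1 < ennreal e" using le \<nu>0(2) by (rule le_less_trans)
    then have "energy \<nu>1 \<nu>1 \<le> e" using e by (cases "kint \<kappa> \<nu>1 \<nu>1") (auto simp: ennreal_less_iff)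
    then have "(1/w)\<^sup>2 * energy \<nu>1 \<nu>1 \<le> (2/c0)\<^sup>2 * e"
      using wc w0 c0_pos e by (intro mult_mono power_mono) (auto simp: field_simps)
    also have "\<dots> = d" using c0_pos by (simp add: e_def field_simps power2_eq_square)
    finally show ?thesis
      unfolding \<nu>_def using E1 w0 by (simp add: energy_scale_left energy_scale_right inEp_scale power2_eq_square mult.assoc)
  qed
  ultimately show ?thesis using that by blast
qed

text \<open>The missing weight is supplied by a multiple of a measure from
  \<open>cheap_unit_weight\<close>, whose energy is chosen only after \<mu> and the missing amount
  are known.\<close>

lemma fill_up:
  assumes \<mu>: "cls (I - {l}) \<mu>" and b: "wint l (\<mu> l) \<le> ennreal (a l)" and e: "e > 0"
  obtains \<mu>' where "cls I \<mu>'" "Q (R \<mu>') \<le> Q (R \<mu>) + e"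
proof -
  have E: "vec \<mu>" using \<mu> by (simp add: EAag_def)
  then have g: "good \<mu>" by (simp add: EA_iff)
  have al: "a l > 0" using a_pos l_in by blast
  obtain w where w: "wint l (\<mu> l) = ennreal w" "w \<ge> 0" "w \<le> a l"
    using b al by (cases "wint l (\<mu> l)") (auto simp: ennreal_le_iff top_unique)
  define t where "t = a l - w"
  have t: "t \<ge> 0" using w by (simp add: t_def)
  let ?z = "R \<mu>"
  obtain d where d: "d > 0" "\<And>w. E2 w \<Longrightarrow> ip \<kappa> (padd w (pneg ?z)) (padd w (pneg ?z)) \<le> d \<Longrightarrow> Q w \<le> Q ?z + e"
    using Q_small_change[OF E2_Rm[OF E] e] by metis
  \<comment> \<open>Scaling by \<open>t\<close> multiplies the energy by \<open>t\<^sup>2\<close>;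
    the denominator \<open>t\<^sup>2 + 1\<close> makes the result at most \<open>d\<close> and also
    covers the case that nothing is missing.\<close>
  obtain \<nu> where \<nu>: "inEp \<kappa> \<nu>" "emeasure \<nu> (UNIV - A l) = 0" "wint l \<nu> = 1" "energy \<nu> \<nu> \<le> d / (t\<^sup>2 + 1)"
    using cheap_unit_weight[of "d / (t\<^sup>2 + 1)"] d by (metis add_nonneg_pos divide_pos_pos zero_le_power2 zero_less_one)
  define \<rho> where "\<rho> = scale_measure (ennreal t) \<nu>"
  have \<rho>: "inEp \<kappa> \<rho>" unfolding \<rho>_def by (rule inEp_scale[OF \<nu>(1) t])
  have s: "sets \<nu> = sets borel" "sets \<rho> = sets borel" "sets (\<mu> l) = sets borel"
    using \<nu>(1) \<rho> good_sets[OF g l_in] by (auto simp: inEp_sets)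
  have e\<rho>: "energy \<rho> \<rho> \<le> d"
  proof -
    have "energy \<rho> \<rho> = t\<^sup>2 * energy \<nu> \<nu>"
      unfolding \<rho>_def using \<nu>(1) t by (simp add: energy_scale_left energy_scale_right inEp_scale power2_eq_square)
    also have "\<dots> \<le> t\<^sup>2 * (d / (t\<^sup>2 + 1))" using \<nu>(4) by (intro mult_left_mono) auto
    also have "\<dots> \<le> d" using d(1) by (simp add: divide_le_eq add_pos_nonneg algebra_simps)
    finally show ?thesis .
  qed
  define \<mu>' where "\<mu>' = \<mu>(l := madd (\<mu> l) \<rho>)"
  have E': "inEp \<kappa> (madd (\<mu> l) \<rho>)" by (intro inEp_madd EA_parts(2)[OF E] \<rho>)
  have z': "emeasure (madd (\<mu> l) \<rho>) (UNIV - A l) = 0"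
    using g l_in \<nu>(2) s by (simp add: emeasure_madd good_def \<rho>_def)
  have "wint l (madd (\<mu> l) \<rho>) = wint l (\<mu> l) + ennreal t * wint l \<nu>"
    unfolding \<rho>_def using s wint_borel[OF l_in]
    by (simp add: nn_integral_madd nn_integral_scale_measure borel_measurable_cong_sets)
  also have "\<dots> = ennreal (a l)" using w t \<nu>(3) by (simp add: t_def flip: ennreal_plus)
  finally have wl: "wint l (madd (\<mu> l) \<rho>) = ennreal (a l)" .
  have "cls I \<mu>'"
    using \<mu> EA_update[OF E E' z'] wl unfolding EAag_def \<mu>'_def by auto
  moreover have "Q (R \<mu>') \<le> Q ?z + e"
  proof (rule d(2))
    show "E2 (R \<mu>')" unfolding \<mu>'_def by (rule E2_Rm[OF EA_update[OF E E' z']])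
    have "R \<mu>' = (msum Ip \<mu>, madd (msum In \<mu>) \<rho>)"
      unfolding \<mu>'_def Rm_update[OF E E' z'] msum_In_split[OF g] using s by (simp add: madd_assoc)
    moreover have "?z = (msum Ip \<mu>, msum In \<mu>)" by (simp add: Rm_def)
    ultimately show "ip \<kappa> (padd (R \<mu>') (pneg ?z)) (padd (R \<mu>') (pneg ?z)) \<le> d"
      using ip_diff_snd(1)[of "msum Ip \<mu>" "msum In \<mu>" \<rho>] E \<rho> e\<rho> by (simp add: EA_iff)
  qed
  ultimately show ?thesis using that by blast
qed

text \<open>A vector without constraint on \<open>A l\<close> may have infinite weight there, and
  mixing in any positive share of it would violate the bound \<open>a l\<close>. Restricting its
  component to a large compact set makes the weight finite.\<close>

lemma truncate:
  assumes \<mu>: "cls (I - {l}) \<mu>" and e: "e > 0"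
  obtains \<mu>' where "cls (I - {l}) \<mu>'" "wint l (\<mu>' l) < \<infinity>" "Q (R \<mu>') \<le> Q (R \<mu>) + e"
proof -
  have E: "vec \<mu>" using \<mu> by (simp add: EAag_def)
  then have g: "good \<mu>" by (simp add: EA_iff)
  let ?z = "R \<mu>"
  obtain d where d: "d > 0" "\<And>w. E2 w \<Longrightarrow> ip \<kappa> (padd w (pneg ?z)) (padd w (pneg ?z)) \<le> d \<Longrightarrow> Q w \<le> Q ?z + e"
    using Q_small_change[OF E2_Rm[OF E] e] by metis
  have El: "inEp \<kappa> (\<mu> l)" by (rule EA_parts(2)[OF E])
  have r: "radon (\<mu> l)" and s: "sets (\<mu> l) = sets borel" and fin: "kint \<kappa> (\<mu> l) (\<mu> l) < \<infinity>"
    using El by (auto simp: inEp_def radon_sets)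
  have "\<exists>K. compact K \<and> kint \<kappa> (\<mu> l) (\<mu> l) \<le> kint \<kappa> (restr K (\<mu> l)) (restr K (\<mu> l)) + ennreal d"
  proof (cases "kint \<kappa> (\<mu> l) (\<mu> l) \<le> ennreal d")
    case True
    then show ?thesis by (intro exI[of _ "{}"]) (simp add: add_increasing)
  next
    case False
    obtain k where k: "kint \<kappa> (\<mu> l) (\<mu> l) = ennreal k" "k \<ge> 0" using fin by (cases "kint \<kappa> (\<mu> l) (\<mu> l)") auto
    have "k > d" using False k d by (simp add: ennreal_le_iff2)
    then have "ennreal (k - d) < (SUP K\<in>{K. compact K}. kint \<kappa> (restr K (\<mu> l)) (restr K (\<mu> l)))"
      unfolding kint_compact_exhaustion[OF r, symmetric] k using d by (intro ennreal_lessI) auto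
    then obtain K where K: "compact K" "ennreal (k - d) < kint \<kappa> (restr K (\<mu> l)) (restr K (\<mu> l))" by (auto simp: less_SUP_iff)
    have "ennreal k = ennreal (k - d) + ennreal d" using \<open>k > d\<close> d by (simp flip: ennreal_plus)
    also have "\<dots> \<le> kint \<kappa> (restr K (\<mu> l)) (restr K (\<mu> l)) + ennreal d" using K by (intro add_right_mono) auto
    finally show ?thesis using K k by auto
  qed
  then obtain K where K: "compact K" "kint \<kappa> (\<mu> l) (\<mu> l) \<le> kint \<kappa> (restr K (\<mu> l)) (restr K (\<mu> l)) + ennreal d" by blast
  have KB: "K \<in> sets borel" using K by (simp add: borel_closed compact_imp_closed)
  define \<omega> where "\<omega> = restr K (\<mu> l)"
  define \<rho> where "\<rho> = restr (UNIV - K) (\<mu> l)"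
  have E\<omega>: "inEp \<kappa> \<omega>" "inEp \<kappa> \<rho>" unfolding \<omega>_def \<rho>_def using KB El by (auto intro!: inEp_restr)
  have s\<omega>: "sets \<omega> = sets borel" "sets \<rho> = sets borel" using E\<omega> inEp_sets by auto
  have split: "\<mu> l = madd \<omega> \<rho>"
  proof (rule measure_eqI)
    fix B assume "B \<in> sets (\<mu> l)"
    then have B: "B \<in> sets borel" using s by simp
    have "emeasure (\<mu> l) B = emeasure (\<mu> l) (K \<inter> B) + emeasure (\<mu> l) ((UNIV - K) \<inter> B)"
      using B KB s by (subst plus_emeasure) (auto intro!: arg_cong[where f="emeasure (\<mu> l)"])
    then show "emeasure (\<mu> l) B = emeasure (madd \<omega> \<rho>) B"
      using B KB s s\<omega> by (simp add: emeasure_madd \<omega>_def \<rho>_def emeasure_restr)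
  qed (use s in simp)
  \<comment> \<open>As \<kappa> is nonnegative, the energies of the two pieces add up to at most the
    total, of which \<open>K\<close> already captures all but \<open>d\<close>.\<close>
  have e\<rho>: "energy \<rho> \<rho> \<le> d"
  proof -
    have "kint \<kappa> \<omega> \<omega> + kint \<kappa> \<rho> \<rho> \<le> kint \<kappa> (\<mu> l) (\<mu> l)"
      using inEp_maddD(4)[of \<omega> \<rho>] E\<omega> El split by (simp add: inEp_radon)
    also have "\<dots> \<le> kint \<kappa> \<omega> \<omega> + ennreal d" using K by (simp add: \<omega>_def)
    finally have "kint \<kappa> \<rho> \<rho> \<le> ennreal d" using E\<omega>(1) by (auto simp: inEp_def ennreal_add_left_cancel_le)
    then show ?thesis using d by (simp add: enn2real_leI)
  qed
  have z\<omega>: "emeasure \<omega> (UNIV - A l) = 0"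
  proof -
    have "emeasure \<omega> (UNIV - A l) \<le> emeasure (\<mu> l) (UNIV - A l)"
      by (simp add: split emeasure_madd s\<omega>)
    then show ?thesis using g l_in by (simp add: good_def)
  qed
  show ?thesis
  proof (rule that[of "\<mu>(l := \<omega>)"])
    show "cls (I - {l}) (\<mu>(l := \<omega>))" by (rule EAag_update[OF \<mu> E\<omega>(1) z\<omega>])
    show "wint l ((\<mu>(l := \<omega>)) l) < \<infinity>" unfolding \<omega>_def using wint_restr_compact[OF El K(1)] by simp
    show "Q (R (\<mu>(l := \<omega>))) \<le> Q ?z + e"
    proof (rule d(2))
      show "E2 (R (\<mu>(l := \<omega>)))" by (rule E2_Rm[OF EA_update[OF E E\<omega>(1) z\<omega>]])
      let ?n = "madd (msum (In - {l}) \<mu>) \<omega>"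
      have R: "R (\<mu>(l := \<omega>)) = (msum Ip \<mu>, ?n)" by (rule Rm_update[OF E E\<omega>(1) z\<omega>])
      have zz: "?z = (msum Ip \<mu>, madd ?n \<rho>)"
        unfolding Rm_def msum_In_split[OF g] using s\<omega> by (subst split) (simp add: madd_assoc)
      have "inEp \<kappa> (msum Ip \<mu>)" "inEp \<kappa> ?n" using E EA_parts(1)[OF E] E\<omega> by (auto simp: EA_iff intro: inEp_madd)
      then show "ip \<kappa> (padd (R (\<mu>(l := \<omega>))) (pneg ?z)) (padd (R (\<mu>(l := \<omega>))) (pneg ?z)) \<le> d"
        unfolding R zz using ip_diff_snd(2)[of "msum Ip \<mu>" ?n \<rho>] E\<omega>(2) e\<rho> by simp
    qed
  qed
qed

text \<open>The segment from \<open>lam\<close> to a truncated competitor starts strictly below the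
  bound \<open>a l\<close>, so a short initial piece respects it. Points there are compared with
  \<open>cls I\<close> through \<open>fill_up\<close> at arbitrarily small loss, and convexity
  carries the comparison to the far end of the segment.\<close>

lemma slack_minimizer_solves:
  assumes lam: "cls (I - {l}) lam" and b: "wint l (lam l) < ennreal (a l)"
    and min: "\<And>\<nu>. cls I \<nu> \<Longrightarrow> Q (R lam) \<le> Q (R \<nu>)"
  shows "minimizes (I - {l}) lam"
  unfolding solves_iff
proof (intro conjI allI impI lam)
  fix \<mu> assume \<mu>: "cls (I - {l}) \<mu>"
  show "Q (R lam) \<le> Q (R \<mu>)"
  proof (rule field_le_epsilon)
    fix e :: real assume e: "e > 0"
    obtain \<nu> where \<nu>: "cls (I - {l}) \<nu>" "wint l (\<nu> l) < \<infinity>" "Q (R \<nu>) \<le> Q (R \<mu>) + e"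
      using truncate[OF \<mu> e] by metis
    have EA: "vec lam" "vec \<nu>" using lam \<nu> by (auto simp: EAag_def)
    then have g: "good lam" "good \<nu>" by (auto simp: EA_iff)
    have z: "E2 (R lam)" "E2 (R \<nu>)" using EA E2_Rm by auto
    obtain w where w: "wint l (lam l) = ennreal w" "w \<ge> 0" "w < a l"
      using b by (cases "wint l (lam l)") (auto simp: ennreal_less_iff)
    obtain w' where w': "wint l (\<nu> l) = ennreal w'" "w' \<ge> 0" using \<nu>(2) by (cases "wint l (\<nu> l)") auto
    \<comment> \<open>Small enough that the added weight \<open>t * w'\<close> fits into the slack
      \<open>a l - w\<close>.\<close>
    define t where "t = min 1 ((a l - w) / (w' + 1))"
    have t: "0 < t" "t \<le> 1" using w w' by (auto simp: t_def)
    have tw: "t * w' \<le> a l - w"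
    proof -
      have "t * w' \<le> (a l - w) / (w' + 1) * (w' + 1)" using w w' by (intro mult_mono) (auto simp: t_def)
      then show ?thesis using w' by simp
    qed
    let ?m = "vcomb t lam \<nu>"
    have m: "cls (I - {l}) ?m" using t by (intro EAag_vcomb lam \<nu>(1)) auto
    have wm: "wint l (?m l) \<le> ennreal (a l)"
    proof -
      have "wint l (?m l) = ennreal ((1 - t) * w + t * w')"
        using wint_vcomb[OF g l_in, of t] w w' t by (simp add: ennreal_mult ennreal_plus)
      moreover have "(1 - t) * w + t * w' \<le> a l"
        using tw t w mult_left_le_one_le[of w "1 - t"] by linarith
      ultimately show ?thesis by (simp add: ennreal_leI)
    qed
    have "Q (R lam) \<le> Q (R ?m)"
    proof (rule field_le_epsilon)
      fix e' :: real assume "e' > 0"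
      then obtain \<mu>' where "cls I \<mu>'" "Q (R \<mu>') \<le> Q (R ?m) + e'"
        using fill_up[OF m wm] by metis
      then show "Q (R lam) \<le> Q (R ?m) + e'" using min by (meson order_trans)
    qed
    also have "\<dots> = (1 - t) * Q (R lam) + t * Q (R \<nu>)
        - t * (1 - t) * ip \<kappa> (padd (R lam) (pneg (R \<nu>))) (padd (R lam) (pneg (R \<nu>)))"
      unfolding Rm_vcomb[OF g] using t by (intro Q_convex z) auto
    also have "\<dots> \<le> (1 - t) * Q (R lam) + t * Q (R \<nu>)"
      using t ip_nonneg[of "padd (R lam) (pneg (R \<nu>))"] z by (simp add: E2_padd E2_pneg)
    finally have "t * Q (R lam) \<le> t * Q (R \<nu>)" by (simp add: algebra_simps)
    then have "Q (R lam) \<le> Q (R \<nu>)" using t by simp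
    then show "Q (R lam) \<le> Q (R \<mu>) + e" using \<nu>(3) by simp
  qed
qed

text \<open>Up to the constant \<open>ip \<kappa> ch ch\<close>, the value
  \<open>Q (R (lam(l := \<omega>)))\<close> is the squared distance of \<omega> from the given pair.
  The uniqueness that \<open>THE\<close> demands comes from \<open>minimizers_agree\<close>: another
  nearest \<omega> would produce another minimizer with \<omega> as its component on
  \<open>A l\<close>.\<close>

lemma proj_eq:
  assumes sol: "minimizes (I - {l}) lam"
  shows "proj \<kappa> (A l) (madd (fst ch) (msum Ip lam), madd (snd ch) (msum (In - {l}) lam)) = lam l"
proof -
  let ?p = "madd (fst ch) (msum Ip lam)" and ?n = "madd (snd ch) (msum (In - {l}) lam)"
  have lam: "cls (I - {l}) lam" and min: "\<And>\<nu>. cls (I - {l}) \<nu> \<Longrightarrow> Q (R lam) \<le> Q (R \<nu>)"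
    using sol by (auto simp: solves_iff)
  have E: "vec lam" using lam by (simp add: EAag_def)
  then have g: "good lam" by (simp add: EA_iff)
  have Ech: "inEp \<kappa> (fst ch)" "inEp \<kappa> (snd ch)" using E2_ch by (auto simp: E2_def)
  have nz: "conc \<omega> (A l) \<longleftrightarrow> emeasure \<omega> (UNIV - A l) = 0" if "inEp \<kappa> \<omega>" for \<omega>
    using that closed_A[OF l_in] by (intro conc_closed_iff) (auto simp: inEp_sets)
  have val: "nrm \<kappa> (?p, madd ?n \<omega>) = sqrt (Q (R (lam(l := \<omega>))) + ip \<kappa> ch ch)"
    if \<omega>: "inEp \<kappa> \<omega>" "emeasure \<omega> (UNIV - A l) = 0" for \<omega>
  proof -
    let ?w = "R (lam(l := \<omega>))"
    have Ew: "E2 ?w" by (rule E2_Rm[OF EA_update[OF E \<omega>]])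
    have sw: "sets \<omega> = sets borel" "sets (snd ch) = sets borel" using \<omega> Ech by (auto simp: inEp_sets)
    have "padd ?w ch = (?p, madd ?n \<omega>)"
      unfolding Rm_update[OF E \<omega>] padd_def
      using madd_assoc[of "snd ch" "msum (In - {l}) lam" \<omega>] sw by (simp add: madd_commute)
    then have "(nrm \<kappa> (?p, madd ?n \<omega>))\<^sup>2 = Q ?w + ip \<kappa> ch ch" using Q_eq[OF Ew] by simp
    moreover have "0 \<le> nrm \<kappa> (?p, madd ?n \<omega>)"
      using \<open>padd ?w ch = (?p, madd ?n \<omega>)\<close> nrm_nonneg[OF E2_padd[OF Ew E2_ch]] by simp
    ultimately show ?thesis by (metis real_sqrt_unique)
  qed
  have ll: "lam(l := lam l) = lam" by simp
  have El: "inEp \<kappa> (lam l)" "emeasure (lam l) (UNIV - A l) = 0" using EA_parts(2)[OF E] g l_in by (auto simp: good_def)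
  show ?thesis
    unfolding proj_def fst_conv snd_conv
  proof (rule the_equality)
    show "inEp \<kappa> (lam l) \<and> conc (lam l) (A l) \<and>
        (\<forall>\<omega>'. inEp \<kappa> \<omega>' \<and> conc \<omega>' (A l) \<longrightarrow> nrm \<kappa> (?p, madd ?n (lam l)) \<le> nrm \<kappa> (?p, madd ?n \<omega>'))"
    proof (intro conjI allI impI)
      fix \<omega>' assume "inEp \<kappa> \<omega>' \<and> conc \<omega>' (A l)"
      then have \<omega>': "inEp \<kappa> \<omega>'" "emeasure \<omega>' (UNIV - A l) = 0" using nz by auto
      have "Q (R lam) \<le> Q (R (lam(l := \<omega>')))" by (intro min EAag_update[OF lam \<omega>'])
      then show "nrm \<kappa> (?p, madd ?n (lam l)) \<le> nrm \<kappa> (?p, madd ?n \<omega>')"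
        unfolding val[OF El] val[OF \<omega>'] ll by simp
    qed (use El nz in auto)
    fix \<omega> assume *: "inEp \<kappa> \<omega> \<and> conc \<omega> (A l) \<and>
        (\<forall>\<omega>'. inEp \<kappa> \<omega>' \<and> conc \<omega>' (A l) \<longrightarrow> nrm \<kappa> (?p, madd ?n \<omega>) \<le> nrm \<kappa> (?p, madd ?n \<omega>'))"
    then have \<omega>: "inEp \<kappa> \<omega>" "emeasure \<omega> (UNIV - A l) = 0" using nz by auto
    have "nrm \<kappa> (?p, madd ?n \<omega>) \<le> nrm \<kappa> (?p, madd ?n (lam l))" using * El nz by blast
    then have "Q (R (lam(l := \<omega>))) \<le> Q (R lam)" unfolding val[OF El] val[OF \<omega>] ll by simp
    then have "minimizes (I - {l}) (lam(l := \<omega>))"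
      unfolding solves_iff using EAag_update[OF lam \<omega>] min by (auto intro: order_trans)
    from minimizers_agree[OF this sol] show "\<omega> = lam l" by auto
  qed
qed

end

subsection \<open>Existence with a relaxed constraint on the plate of infinite capacity\<close>

text \<open>Consistency is available only for nonnegative measures, so a minimizing sequence is needed whose
  positive and negative parts are Cauchy separately. It is obtained by minimizing \<open>N\<close>, the sum of the
  energies of the two parts, within the sublevel sets of \<open>F\<close>.\<close>

lemma two_level_minimizing_sequence:
  fixes C :: "'v set" and F N :: "'v \<Rightarrow> real" and mid :: "'v \<Rightarrow> 'v \<Rightarrow> 'v" and D :: "'v \<Rightarrow> 'v \<Rightarrow> real"
  assumes ne: "C \<noteq> {}" and low: "\<And>x. x \<in> C \<Longrightarrow> f0 \<le> F x" and N0: "\<And>x. x \<in> C \<Longrightarrow> 0 \<le> N x"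
    and mid: "\<And>x y. x \<in> C \<Longrightarrow> y \<in> C \<Longrightarrow> mid x y \<in> C"
      "\<And>x y. x \<in> C \<Longrightarrow> y \<in> C \<Longrightarrow> F (mid x y) \<le> (F x + F y) / 2"
      "\<And>x y. x \<in> C \<Longrightarrow> y \<in> C \<Longrightarrow> N (mid x y) = (N x + N y) / 2 - D x y / 4"
    and Nb: "\<And>x. x \<in> C \<Longrightarrow> F x \<le> Inf (F ` C) + 1 \<Longrightarrow> N x \<le> B"
  obtains x :: "nat \<Rightarrow> 'v" where "\<And>n. x n \<in> C" "\<And>n. F (x n) \<le> Inf (F ` C) + 1 / (real n + 1)"
    "\<And>e. e > 0 \<Longrightarrow> \<exists>k. \<forall>n\<ge>k. \<forall>m\<ge>k. D (x n) (x m) < e"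
proof -
  define f where "f = Inf (F ` C)"
  define L where "L n = {x\<in>C. F x \<le> f + 1 / (real n + 1)}" for n :: nat
  \<comment> \<open>The level sets shrink, so the \<open>d n\<close> increase; they are bounded by
    \<open>B\<close> and converge. Hence near-minimizers of \<open>N\<close> at late levels have
    almost equal \<open>N\<close>, and their midpoint, which stays in the level set, cannot have a
    much smaller one.\<close>
  define d where "d n = Inf (N ` L n)" for n
  have Lne: "L n \<noteq> {}" for n
  proof -
    have "Inf (F ` C) < f + 1 / (real n + 1)" by (simp add: f_def)
    then obtain y where "y \<in> F ` C" "y < f + 1 / (real n + 1)" using cInf_lessD[of "F ` C"] ne by blast
    then show ?thesis by (auto simp: L_def intro: less_imp_le)
  qed
  have bN: "bdd_below (N ` L n)" for n using N0 by (intro bdd_belowI2[of _ 0]) (auto simp: L_def)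
  have Lmono: "L m \<subseteq> L n" if "n \<le> m" for n m
  proof -
    have "1 / (real m + 1) \<le> 1 / (real n + 1)" using that by (intro divide_left_mono) auto
    then show ?thesis by (auto simp: L_def)
  qed
  have dmono: "d n \<le> d m" if "n \<le> m" for n m
    unfolding d_def using Lmono[OF that] Lne bN by (intro cInf_superset_mono) auto
  have dB: "d n \<le> B" for n
  proof -
    obtain x where x: "x \<in> L n" using Lne by blast
    have "1 / (real n + 1) \<le> 1" by (simp add: divide_le_eq)
    moreover have xC: "x \<in> C" "F x \<le> f + 1 / (real n + 1)" using x by (auto simp: L_def)
    ultimately have "F x \<le> Inf (F ` C) + 1" unfolding f_def by linarith
    with xC(1) have "N x \<le> B" by (rule Nb)
    then show ?thesis unfolding d_def using x bN by (meson cINF_lower2)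
  qed
  have "\<exists>x\<in>L n. N x \<le> d n + 1 / (real n + 1)" for n
  proof -
    have lt: "Inf (N ` L n) < d n + 1 / (real n + 1)" by (simp add: d_def)
    have "N ` L n \<noteq> {}" using Lne by simp
    from cInf_lessD[OF this lt] show ?thesis by (force intro: less_imp_le)
  qed
  then obtain x where x: "\<And>n. x n \<in> L n" "\<And>n. N (x n) \<le> d n + 1 / (real n + 1)" by metis
  have xC: "x n \<in> C" for n using x by (auto simp: L_def)
  have bd: "bdd_above (range d)" by (rule bdd_aboveI2[OF dB])
  define s where "s = Sup (range d)"
  have ds: "d n \<le> s" for n unfolding s_def using bd by (intro cSup_upper) auto
  have "\<exists>k. \<forall>n\<ge>k. \<forall>m\<ge>k. D (x n) (x m) < e" if e: "e > 0" for e
  proof -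
    \<comment> \<open>The final estimate collects eight errors of size \<open>e / 16\<close>: four
      from \<open>s - d k\<close> and four from the terms \<open>1 / (n + 1)\<close> and
      \<open>1 / (m + 1)\<close>.\<close>
    have "s - e / 16 < Sup (range d)" using e by (simp add: s_def)
    then obtain k1 where k1: "s - e / 16 < d k1" using less_cSup_iff[of "range d"] bd by auto
    obtain k2 :: nat where k2: "1 / (real k2 + 1) < e / 16"
      using nat_approx_posE[of "e / 16"] e by (metis Suc_eq_plus1 of_nat_Suc add.commute divide_pos_pos zero_less_numeral)
    define k where "k = max k1 k2"
    have dk: "s - e / 16 < d k" using k1 dmono[of k1 k] by (simp add: k_def)
    have rk: "1 / (real n + 1) < e / 16" if "n \<ge> k" for n
    proof -
      have "1 / (real n + 1) \<le> 1 / (real k2 + 1)" using that by (intro divide_left_mono) (auto simp: k_def)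
      then show ?thesis using k2 by simp
    qed
    have "D (x n) (x m) < e" if nm: "n \<ge> k" "m \<ge> k" for n m
    proof -
      have in_k: "x n \<in> L k" "x m \<in> L k" using x(1) Lmono nm by auto
      have "mid (x n) (x m) \<in> L k"
        using mid(1,2)[OF xC[of n] xC[of m]] in_k by (auto simp: L_def)
      then have "d k \<le> N (mid (x n) (x m))" unfolding d_def using bN by (intro cInf_lower) auto
      then have "d k \<le> (N (x n) + N (x m)) / 2 - D (x n) (x m) / 4" using mid(3)[OF xC[of n] xC[of m]] by simp
      then have "D (x n) (x m) \<le> 2 * (N (x n) + N (x m)) - 4 * d k" by argo
      also have "\<dots> \<le> 2 * (d n + 1 / (real n + 1) + (d m + 1 / (real m + 1))) - 4 * d k" using x(2)[of n] x(2)[of m] by simp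
      also have "\<dots> < e" using ds[of n] ds[of m] rk[OF nm(1)] rk[OF nm(2)] dk e by argo
      finally show ?thesis .
    qed
    then show ?thesis by blast
  qed
  then show ?thesis using that[of x] xC x(1) by (auto simp: L_def f_def)
qed

section \<open>Uniform bounds, strong limits and the minimizer of the relaxed problem\<close>

context condenser_problem
begin

lemma total_mass_le:
  assumes \<mu>: "cls I \<mu>" and S: "S \<subseteq> I"
  shows "emeasure (msum S \<mu>) UNIV \<le> ennreal (infsum a I / c0)"
proof -
  have g: "good \<mu>" using \<mu> by (simp add: EAag_def EA_iff)
  have m: "emeasure (\<mu> i) UNIV \<le> ennreal (a i / c0)" if "i \<in> I" for i
  proof (rule mass_le[OF that good_sets[OF g that]])
    show "emeasure (\<mu> i) (UNIV - A i) = 0" using g that by (simp add: good_def)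
    show "wint i (\<mu> i) \<le> ennreal (a i)" using \<mu> that by (simp add: EAag_def)
    show "0 \<le> a i" using a_pos[OF that] by simp
  qed
  have ac: "(\<lambda>i. a i / c0) summable_on I"
    using summable_on_cmult_left[OF a_sum, of "1 / c0"] by simp
  have "emeasure (msum S \<mu>) UNIV = (\<Sum>\<^sub>\<infinity>i\<in>S. emeasure (\<mu> i) UNIV)"
    using g S good_sets by (intro emeasure_msum) auto
  also have "\<dots> \<le> (\<Sum>\<^sub>\<infinity>i\<in>I. emeasure (\<mu> i) UNIV)"
    using S by (intro infsum_mono_neutral nonneg_summable_on_complete) auto
  also have "\<dots> \<le> (\<Sum>\<^sub>\<infinity>i\<in>I. ennreal (a i / c0))"
    using m by (intro infsum_mono nonneg_summable_on_complete) auto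
  also have "\<dots> = ennreal (infsum (\<lambda>i. a i / c0) I)"
    using ac a_pos c0_pos
    by (subst infsum_nonneg_is_SUPREMUM_ennreal)
       (auto simp: infsum_ennreal_SUP less_imp_le intro!: SUP_cong sum_ennreal)
  also have "infsum (\<lambda>i. a i / c0) I = infsum a I / c0"
    using infsum_cmult_left'[of a "1 / c0" I] by simp
  finally show ?thesis .
qed

text \<open>\<kappa> is bounded between plates of opposite sign, and the total masses are bounded by
  \<open>total_mass_le\<close>. Consequently a bound on the energy of \<open>R \<mu>\<close> bounds
  the energies of its two parts separately.\<close>

lemma cross_energy_bound:
  obtains M where "\<And>\<mu>. cls I \<mu> \<Longrightarrow> energy (msum Ip \<mu>) (msum In \<mu>) \<le> M"
proof -
  have "\<exists>M::real. \<forall>x\<in>(\<Union>i\<in>Ip. A i). \<forall>y\<in>(\<Union>j\<in>In. A j). \<kappa> x y \<le> ennreal M"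
    using cond unfolding condenser_def by (elim conjE)
  then obtain M :: real where "\<forall>x\<in>(\<Union>i\<in>Ip. A i). \<forall>y\<in>(\<Union>j\<in>In. A j). \<kappa> x y \<le> ennreal M" ..
  then have M: "\<And>x y. x \<in> (\<Union>i\<in>Ip. A i) \<Longrightarrow> y \<in> (\<Union>j\<in>In. A j) \<Longrightarrow> \<kappa> x y \<le> ennreal M" by (meson bspec)
  define m where "m = infsum a I / c0"
  have "energy (msum Ip \<mu>) (msum In \<mu>) \<le> enn2real (ennreal M * ennreal m * ennreal m)"
    if \<mu>: "cls I \<mu>" for \<mu>
  proof (rule enn2real_mono)
    let ?P = "msum Ip \<mu>" and ?N = "msum In \<mu>"
    have g: "good \<mu>" using \<mu> by (simp add: EAag_def EA_iff)
    have ae: "AE x in msum S \<mu>. x \<in> (\<Union>i\<in>S. A i)" if S: "S \<subseteq> I" for S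
    proof (rule AE_I'[of "UNIV - (\<Union>i\<in>S. A i)"])
      have c: "closed (\<Union>i\<in>S. A i)" using closed_A S by (intro loc_finite_closed_UN[OF loc_finite_A_sub[OF S]]) auto
      have s: "\<And>i. i \<in> S \<Longrightarrow> sets (\<mu> i) = sets borel" using good_sets[OF g] S by blast
      have "emeasure (\<mu> i) (UNIV - (\<Union>i\<in>S. A i)) = 0" if "i \<in> S" for i
      proof -
        have "emeasure (\<mu> i) (UNIV - (\<Union>i\<in>S. A i)) \<le> emeasure (\<mu> i) (UNIV - A i)"
          using that closed_A[of i] s[OF that] S by (intro emeasure_mono) auto
        then show ?thesis using g that S by (auto simp: good_def)
      qed
      then have "emeasure (msum S \<mu>) (UNIV - (\<Union>i\<in>S. A i)) = 0"
        by (subst emeasure_msum[OF s]) (auto cong: infsum_cong)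
      then show "UNIV - (\<Union>i\<in>S. A i) \<in> null_sets (msum S \<mu>)" using c by (simp add: null_sets_def)
    qed auto
    have mN: "emeasure ?N UNIV \<le> ennreal m" "emeasure ?P UNIV \<le> ennreal m"
      unfolding m_def using total_mass_le[OF \<mu>] by auto
    have sp: "space ?N = UNIV" "space ?P = UNIV" by (auto simp: space_borel sets_eq_imp_space_eq[OF sets_msum])
    have "pot \<kappa> ?N x \<le> ennreal M * ennreal m" if x: "x \<in> (\<Union>i\<in>Ip. A i)" for x
    proof -
      have "AE y in ?N. y \<in> (\<Union>j\<in>In. A j)" by (rule ae) auto
      then have "AE y in ?N. \<kappa> x y \<le> ennreal M" by eventually_elim (rule M[OF x])
      then have "pot \<kappa> ?N x \<le> (\<integral>\<^sup>+ y. ennreal M \<partial>?N)" unfolding pot_def by (rule nn_integral_mono_AE)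
      also have "\<dots> = ennreal M * emeasure ?N UNIV" using sp by simp
      also have "\<dots> \<le> ennreal M * ennreal m" by (intro mult_left_mono mN) auto
      finally show ?thesis .
    qed
    moreover have "AE x in ?P. x \<in> (\<Union>i\<in>Ip. A i)" by (rule ae) auto
    ultimately have "AE x in ?P. pot \<kappa> ?N x \<le> ennreal M * ennreal m" by (auto elim: eventually_mono)
    then have "kint \<kappa> ?P ?N \<le> (\<integral>\<^sup>+ x. ennreal M * ennreal m \<partial>?P)" unfolding kint_def by (rule nn_integral_mono_AE)
    also have "\<dots> = ennreal M * ennreal m * emeasure ?P UNIV" using sp by simp
    also have "\<dots> \<le> ennreal M * ennreal m * ennreal m" by (intro mult_left_mono mN) auto
    finally show "kint \<kappa> ?P ?N \<le> ennreal M * ennreal m * ennreal m" .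
  qed (simp add: ennreal_mult_less_top)
  then show ?thesis using that by blast
qed

definition parts_energy :: "('i \<Rightarrow> 'a measure) \<Rightarrow> real" where
  "parts_energy \<mu> = energy (msum Ip \<mu>) (msum Ip \<mu>) + energy (msum In \<mu>) (msum In \<mu>)"

text \<open>The squared strong distance of the positive parts plus that of the negative parts.
  Unlike the distance of the differences \<open>R \<mu>\<close> and \<open>R \<nu>\<close>, it
  allows no compensation between the parts.\<close>

definition parts_dist :: "('i \<Rightarrow> 'a measure) \<Rightarrow> ('i \<Rightarrow> 'a measure) \<Rightarrow> real" where
  "parts_dist \<mu> \<nu> = ip \<kappa> (msum Ip \<mu>, msum Ip \<nu>) (msum Ip \<mu>, msum Ip \<nu>) + ip \<kappa> (msum In \<mu>, msum In \<nu>) (msum In \<mu>, msum In \<nu>)"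

lemma parts_energy_bound:
  obtains B where "\<And>\<mu>. cls I \<mu> \<Longrightarrow> Q (R \<mu>) \<le> c \<Longrightarrow> parts_energy \<mu> \<le> B"
proof -
  obtain M where M: "\<And>\<mu>. cls I \<mu> \<Longrightarrow> energy (msum Ip \<mu>) (msum In \<mu>) \<le> M"
    using cross_energy_bound by metis
  have "parts_energy \<mu> \<le> 2 * (c + ip \<kappa> ch ch) + 2 * ip \<kappa> ch ch + 2 * M"
    if \<mu>: "cls I \<mu>" "Q (R \<mu>) \<le> c" for \<mu>
  proof -
    let ?z = "R \<mu>"
    have E: "vec \<mu>" using \<mu> by (simp add: EAag_def)
    have z: "E2 ?z" by (rule E2_Rm[OF E])
    \<comment> \<open>Nonnegativity of the energy of \<open>z + 2 \<chi>\<close> bounds the energy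
      of \<open>z\<close> by \<open>2 * Q z + 4 * ip \<kappa> ch ch\<close>.\<close>
    have "0 \<le> ip \<kappa> (padd ?z (pscale 2 ch)) (padd ?z (pscale 2 ch))" by (intro ip_nonneg E2_padd z E2_pscale E2_ch) auto
    then have "0 \<le> ip \<kappa> ?z ?z + 4 * ip \<kappa> ch ?z + 4 * ip \<kappa> ch ch"
      using z E2_ch ip_sym[OF z E2_ch] by (simp add: ip_linear)
    then have "ip \<kappa> ?z ?z \<le> 2 * (c + ip \<kappa> ch ch) + 2 * ip \<kappa> ch ch" using \<mu>(2) unfolding Q_def by argo
    moreover have "ip \<kappa> ?z ?z = parts_energy \<mu> - 2 * energy (msum Ip \<mu>) (msum In \<mu>)"
      using E energy_sym[of "msum In \<mu>" "msum Ip \<mu>"] by (simp add: ip_def Rm_def parts_energy_def EA_iff)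
    ultimately show ?thesis using M[OF \<mu>(1)] by argo
  qed
  then show ?thesis using that by blast
qed

lemma parts_energy_midpoint:
  assumes "vec \<mu>" "vec \<nu>"
  shows "parts_energy (vcomb (1/2) \<mu> \<nu>) = (parts_energy \<mu> + parts_energy \<nu>) / 2 - parts_dist \<mu> \<nu> / 4"
proof -
  have half: "energy (madd (scale_measure (ennreal (1 - 1/2)) x) (scale_measure (ennreal (1/2)) y)) (madd (scale_measure (ennreal (1 - 1/2)) x) (scale_measure (ennreal (1/2)) y))
     = (energy x x + energy y y) / 2 - ip \<kappa> (x, y) (x, y) / 4" if "inEp \<kappa> x" "inEp \<kappa> y" for x y
  proof -
    have h: "(1 - 1/2 :: real) = 1/2" by simp
    show ?thesis unfolding h using that energy_sym[OF that]
      by (simp add: energy_scale_left energy_scale_right inEp_scale energy_madd_left energy_madd_right inEp_madd ip_def field_simps del: ennreal_half)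
  qed
  have g: "good \<mu>" "good \<nu>" using assms by (auto simp: EA_iff)
  have "msum S (vcomb (1/2) \<mu> \<nu>) = madd (scale_measure (ennreal (1 - 1/2)) (msum S \<mu>)) (scale_measure (ennreal (1/2)) (msum S \<nu>))" if "S \<subseteq> I" for S
    using good_sets[OF g(1)] good_sets[OF g(2)] that by (intro msum_vcomb) auto
  then show ?thesis
    unfolding parts_energy_def parts_dist_def
    using half[of "msum Ip \<mu>" "msum Ip \<nu>"] half[of "msum In \<mu>" "msum In \<nu>"] assms
    by (simp add: EA_iff field_simps del: ennreal_half)
qed

lemma integral_msum_Cc:
  assumes g: "good \<mu>" and S: "S \<subseteq> I" and \<phi>: "\<phi> \<in> Cc" and K: "compact K" "\<And>x. x \<notin> K \<Longrightarrow> \<phi> x = 0"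
  shows "integral\<^sup>L (msum S \<mu>) \<phi> = (\<Sum>i\<in>{i\<in>S. A i \<inter> K \<noteq> {}}. integral\<^sup>L (\<mu> i) \<phi>)"
proof -
  let ?F = "{i\<in>S. A i \<inter> K \<noteq> {}}"
  have fin: "finite ?F" by (rule loc_finite_compact[OF loc_finite_A_sub[OF S] K(1)])
  have r: "radon (msum S \<mu>)" by (rule good_radon_msum[OF g S])
  have ri: "i \<in> S \<Longrightarrow> radon (\<mu> i)" for i using g S by (auto simp: good_def)
  have pos: "integral\<^sup>L (msum S \<mu>) \<psi> = (\<Sum>i\<in>?F. integral\<^sup>L (\<mu> i) \<psi>)"
    if \<psi>: "\<psi> \<in> Cc" "\<And>x. 0 \<le> \<psi> x" "\<And>x. x \<notin> K \<Longrightarrow> \<psi> x = 0" for \<psi>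
  proof -
    have eq: "(\<integral>\<^sup>+ x. ennreal (\<psi> x) \<partial>\<nu>) = ennreal (integral\<^sup>L \<nu> \<psi>)" if "radon \<nu>" for \<nu>
      using \<psi> Cc_integrable[OF that \<psi>(1)] by (intro nn_integral_eq_integral) auto
    have zero: "(\<integral>\<^sup>+ x. ennreal (\<psi> x) \<partial>\<mu> i) = 0" if "i \<in> S - ?F" for i
    proof -
      have "AE x in \<mu> i. ennreal (\<psi> x) = 0"
      proof (rule AE_I'[of "UNIV - A i"])
        show "UNIV - A i \<in> null_sets (\<mu> i)"
          using g that S closed_A[of i] by (auto simp: good_def null_sets_def radon_sets)
        show "{x \<in> space (\<mu> i). ennreal (\<psi> x) \<noteq> 0} \<subseteq> UNIV - A i"
        proof
          fix y assume "y \<in> {x \<in> space (\<mu> i). ennreal (\<psi> x) \<noteq> 0}"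
          then have "\<psi> y \<noteq> 0" by auto
          then have "y \<in> K" using \<psi>(3) by blast
          then show "y \<in> UNIV - A i" using that by blast
        qed
      qed
      then have "(\<integral>\<^sup>+ x. ennreal (\<psi> x) \<partial>\<mu> i) = (\<integral>\<^sup>+ x. 0 \<partial>\<mu> i)" by (rule nn_integral_cong_AE)
      then show ?thesis by simp
    qed
    have "\<psi> \<in> borel_measurable borel" by (rule Cc_borel[OF \<psi>(1)])
    then have mb: "(\<lambda>x. ennreal (\<psi> x)) \<in> borel_measurable borel" by measurable
    have "ennreal (integral\<^sup>L (msum S \<mu>) \<psi>) = (\<Sum>\<^sub>\<infinity>i\<in>S. \<integral>\<^sup>+ x. ennreal (\<psi> x) \<partial>\<mu> i)"
      unfolding eq[OF r, symmetric] by (rule nn_integral_msum[OF radon_sets[OF ri] mb])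
    also have "\<dots> = (\<Sum>i\<in>?F. \<integral>\<^sup>+ x. ennreal (\<psi> x) \<partial>\<mu> i)"
      by (rule infsum_finite_support[OF fin _ zero]) auto
    also have "\<dots> = (\<Sum>i\<in>?F. ennreal (integral\<^sup>L (\<mu> i) \<psi>))" using ri eq by (intro sum.cong) auto
    also have "\<dots> = ennreal (\<Sum>i\<in>?F. integral\<^sup>L (\<mu> i) \<psi>)"
      using \<psi>(2) by (intro sum_ennreal integral_nonneg_AE) auto
    finally show ?thesis using \<psi>(2) by (subst (asm) ennreal_inj) (auto intro!: integral_nonneg_AE sum_nonneg)
  qed
  let ?p = "\<lambda>x. max (\<phi> x) 0" and ?n = "\<lambda>x. max (- 1 * \<phi> x) 0"
  have p: "?p \<in> Cc" and n: "?n \<in> Cc" using \<phi> Cc_zero by (intro Cc_max Cc_cmult; simp)+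
  have eq: "\<phi> = (\<lambda>x. ?p x - ?n x)" by (auto simp: max_def)
  have dif: "integral\<^sup>L \<nu> \<phi> = integral\<^sup>L \<nu> ?p - integral\<^sup>L \<nu> ?n" if "radon \<nu>" for \<nu>
    by (subst eq) (intro Bochner_Integration.integral_diff Cc_integrable[OF that] p n)
  have "integral\<^sup>L (msum S \<mu>) \<phi> = (\<Sum>i\<in>?F. integral\<^sup>L (\<mu> i) ?p) - (\<Sum>i\<in>?F. integral\<^sup>L (\<mu> i) ?n)"
    unfolding dif[OF r] using pos[OF p] pos[OF n] K(2) by simp
  also have "\<dots> = (\<Sum>i\<in>?F. integral\<^sup>L (\<mu> i) ?p - integral\<^sup>L (\<mu> i) ?n)" by (rule sum_subtractf[symmetric])
  also have "\<dots> = (\<Sum>i\<in>?F. integral\<^sup>L (\<mu> i) \<phi>)" using dif ri by (intro sum.cong) auto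
  finally show ?thesis .
qed

text \<open>Used once with \<open>S = Ip\<close> and once with \<open>S = In\<close>. The support of
  a test function meets only finitely many plates, so componentwise vague convergence passes to the
  sums, and consistency upgrades it to strong convergence.\<close>

lemma strong_limit:
  fixes x :: "nat \<Rightarrow> 'i \<Rightarrow> 'a measure"
  assumes S: "S \<subseteq> I" and x: "\<And>n. good (x n)" "\<And>n. inEp \<kappa> (msum S (x n))" and lam: "good lam"
    and cauchy: "\<And>e. e > 0 \<Longrightarrow> \<exists>k. \<forall>n\<ge>k. \<forall>m\<ge>k. ip \<kappa> (msum S (x n), msum S (x m)) (msum S (x n), msum S (x m)) < e"
    and G: "G \<le> sequentially" "G \<noteq> bot"
    and lim: "\<And>i \<phi>. i \<in> I \<Longrightarrow> \<phi> \<in> Cc \<Longrightarrow> ((\<lambda>n. integral\<^sup>L (x n i) \<phi>) \<longlongrightarrow> integral\<^sup>L (lam i) \<phi>) G"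
  shows "inEp \<kappa> (msum S lam)" "\<And>e. e > 0 \<Longrightarrow> \<forall>\<^sub>F n in G. nrm \<kappa> (msum S (x n), msum S lam) < e"
proof -
  let ?f = "\<lambda>n. msum S (x n)"
  let ?H = "filtermap ?f G"
  have Hne: "?H \<noteq> bot" using G(2) by (simp add: filtermap_bot_iff)
  have "\<forall>\<^sub>F \<mu> in ?H. inEp \<kappa> \<mu>" using x by (simp add: eventually_filtermap)
  moreover have "\<forall>\<^sub>F z in ?H \<times>\<^sub>F ?H. nrm \<kappa> (fst z, snd z) < e" if e: "e > 0" for e
  proof -
    obtain k where k: "\<And>n m. n \<ge> k \<Longrightarrow> m \<ge> k \<Longrightarrow> ip \<kappa> (?f n, ?f m) (?f n, ?f m) < e\<^sup>2"
      using cauchy[of "e\<^sup>2"] e by auto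
    let ?T = "\<lambda>\<mu>. \<exists>n\<ge>k. \<mu> = ?f n"
    have "\<forall>\<^sub>F n in G. n \<ge> k" by (rule filter_leD[OF G(1) eventually_ge_at_top])
    then have T: "eventually ?T ?H" unfolding eventually_filtermap by eventually_elim auto
    have "nrm \<kappa> (\<mu>, \<nu>) < e" if "?T \<mu>" "?T \<nu>" for \<mu> \<nu>
    proof -
      have "ip \<kappa> (\<mu>, \<nu>) (\<mu>, \<nu>) < e\<^sup>2" using that k by blast
      then have "sqrt (ip \<kappa> (\<mu>, \<nu>) (\<mu>, \<nu>)) < sqrt (e\<^sup>2)" by (rule real_sqrt_less_mono)
      then show ?thesis using e by (simp add: nrm_def)
    qed
    then show ?thesis unfolding eventually_prod_filter by (intro exI[of _ ?T] conjI T) auto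
  qed
  moreover have "vague_cluster ?H (msum S lam)"
    unfolding vague_cluster_def
  proof (intro allI impI)
    fix \<Phi> :: "('a \<Rightarrow> real) set" and e :: real assume H: "finite \<Phi> \<and> \<Phi> \<subseteq> Cc \<and> e > 0"
    have "\<forall>\<^sub>F n in G. \<bar>integral\<^sup>L (?f n) \<phi> - integral\<^sup>L (msum S lam) \<phi>\<bar> < e" if "\<phi> \<in> \<Phi>" for \<phi>
    proof -
      have \<phi>: "\<phi> \<in> Cc" using that H by blast
      obtain K where K: "compact K" "\<And>x. x \<notin> K \<Longrightarrow> \<phi> x = 0" using Cc_E[OF \<phi>] by metis
      have "((\<lambda>n. \<Sum>i\<in>{i\<in>S. A i \<inter> K \<noteq> {}}. integral\<^sup>L (x n i) \<phi>) \<longlongrightarrow> (\<Sum>i\<in>{i\<in>S. A i \<inter> K \<noteq> {}}. integral\<^sup>L (lam i) \<phi>)) G"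
        using S by (intro tendsto_sum lim \<phi>) auto
      then have "((\<lambda>n. integral\<^sup>L (?f n) \<phi>) \<longlongrightarrow> integral\<^sup>L (msum S lam) \<phi>) G"
        using integral_msum_Cc[OF x(1) S \<phi> K] integral_msum_Cc[OF lam S \<phi> K] by simp
      then have "\<forall>\<^sub>F n in G. dist (integral\<^sup>L (?f n) \<phi>) (integral\<^sup>L (msum S lam) \<phi>) < e"
        using H by (intro tendstoD) auto
      then show ?thesis by (simp add: dist_real_def)
    qed
    then have "\<forall>\<^sub>F n in G. \<forall>\<phi>\<in>\<Phi>. \<bar>integral\<^sup>L (?f n) \<phi> - integral\<^sup>L (msum S lam) \<phi>\<bar> < e"
      using H by (intro eventually_ball_finite) auto
    then have "\<forall>\<^sub>F \<mu> in ?H. \<forall>\<phi>\<in>\<Phi>. \<bar>integral\<^sup>L \<mu> \<phi> - integral\<^sup>L (msum S lam) \<phi>\<bar> < e"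
      by (simp add: eventually_filtermap)
    then show "\<exists>\<^sub>F \<mu> in ?H. \<forall>\<phi>\<in>\<Phi>. \<bar>integral\<^sup>L \<mu> \<phi> - integral\<^sup>L (msum S lam) \<phi>\<bar> < e"
      by (rule eventually_frequently[OF Hne])
  qed
  moreover have "radon (msum S lam)" by (rule good_radon_msum[OF lam S])
  ultimately have "inEp \<kappa> (msum S lam) \<and> (\<forall>e>0. \<forall>\<^sub>F \<mu> in ?H. nrm \<kappa> (\<mu>, msum S lam) < e)"
    using consistent unfolding kernel_consistent_def by blast
  then show "inEp \<kappa> (msum S lam)" "\<And>e. e > 0 \<Longrightarrow> \<forall>\<^sub>F n in G. nrm \<kappa> (msum S (x n), msum S lam) < e"
    by (auto simp: eventually_filtermap)
qed

text \<open>On \<open>A l\<close> weight may escape to infinity, so there the limit inherits only an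
  inequality and is known to lie in \<open>cls (I - {l})\<close>; on the other plates
  \<open>weighted_limit_ge\<close> recovers the equation. Minimality is stated against
  \<open>cls I\<close>, the class in which the minimizing sequence is taken.\<close>

lemma relaxed_minimizer:
  assumes ne: "\<exists>\<mu>. cls I \<mu>"
  obtains lam where "cls (I - {l}) lam" "wint l (lam l) \<le> ennreal (a l)"
    "\<And>\<nu>. cls I \<nu> \<Longrightarrow> Q (R lam) \<le> Q (R \<nu>)"
proof -
  define C where "C = {\<mu>. cls I \<mu>}"
  define F where "F \<mu> = Q (R \<mu>)" for \<mu>
  define f where "f = Inf (F ` C)"
  have CE: "vec \<mu>" "good \<mu>" "E2 (R \<mu>)" if "\<mu> \<in> C" for \<mu>
    using that E2_Rm by (auto simp: C_def EAag_def EA_iff)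
  have half: "0 \<le> (1/2::real)" "(1/2::real) \<le> 1" by auto
  have low: "- ip \<kappa> ch ch \<le> F \<mu>" if "\<mu> \<in> C" for \<mu> unfolding F_def by (rule Q_lower[OF CE(3)[OF that]])
  obtain B where B: "\<And>\<mu>. cls I \<mu> \<Longrightarrow> Q (R \<mu>) \<le> f + 1 \<Longrightarrow> parts_energy \<mu> \<le> B"
    using parts_energy_bound[of "f + 1"] by metis
  have Fmid: "F (vcomb (1/2) \<mu> \<nu>) \<le> (F \<mu> + F \<nu>) / 2" if "\<mu> \<in> C" "\<nu> \<in> C" for \<mu> \<nu>
  proof -
    let ?d = "padd (R \<mu>) (pneg (R \<nu>))"
    have "F (vcomb (1/2) \<mu> \<nu>) = (1 - 1/2) * F \<mu> + 1/2 * F \<nu> - 1/2 * (1 - 1/2) * ip \<kappa> ?d ?d"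
      unfolding F_def Rm_vcomb[OF CE(2)[OF that(1)] CE(2)[OF that(2)]] by (intro Q_convex CE half that)
    moreover have "0 \<le> ip \<kappa> ?d ?d" by (intro ip_nonneg E2_padd E2_pneg CE that)
    ultimately show ?thesis by (simp add: field_simps)
  qed
  obtain x :: "nat \<Rightarrow> 'i \<Rightarrow> 'a measure" where x: "\<And>n. x n \<in> C" "\<And>n. F (x n) \<le> f + 1 / (real n + 1)"
    "\<And>e. e > 0 \<Longrightarrow> \<exists>k. \<forall>n\<ge>k. \<forall>m\<ge>k. parts_dist (x n) (x m) < e"
  proof (rule two_level_minimizing_sequence[of C "- ip \<kappa> ch ch" F parts_energy "vcomb (1/2)" parts_dist B])
    show "C \<noteq> {}" using ne by (auto simp: C_def)
    show "0 \<le> parts_energy \<mu>" for \<mu> by (simp add: parts_energy_def)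
    show "vcomb (1/2) \<mu> \<nu> \<in> C" if "\<mu> \<in> C" "\<nu> \<in> C" for \<mu> \<nu>
      using that half EAag_vcomb[of I \<mu> \<nu> "1/2"] by (auto simp: C_def)
    show "parts_energy (vcomb (1/2) \<mu> \<nu>) = (parts_energy \<mu> + parts_energy \<nu>) / 2 - parts_dist \<mu> \<nu> / 4"
      if "\<mu> \<in> C" "\<nu> \<in> C" for \<mu> \<nu> by (intro parts_energy_midpoint CE that)
    show "parts_energy \<mu> \<le> B" if "\<mu> \<in> C" "F \<mu> \<le> Inf (F ` C) + 1" for \<mu>
      using that B by (simp add: C_def F_def f_def)
  qed (use low Fmid that f_def in auto)
  have xE: "cls I (x n)" "vec (x n)" "good (x n)" "E2 (R (x n))" for n
    using x(1) CE by (auto simp: C_def)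
  have xP: "inEp \<kappa> (msum Ip (x n))" "inEp \<kappa> (msum In (x n))" for n using xE(2) by (auto simp: EA_iff)
  have Fx: "F (x n) \<le> f + 1" for n
  proof -
    have "1 / (real n + 1) \<le> 1" by (simp add: divide_le_eq)
    then show ?thesis using x(2)[of n] by linarith
  qed
  have xB: "parts_energy (x n) \<le> B" for n using B[OF xE(1)] Fx by (simp add: F_def)
  have ev: "\<forall>\<^sub>F n in sequentially. \<forall>i\<in>I. radon (x n i) \<and> emeasure (x n i) UNIV \<le> ennreal (a i / c0)"
  proof (intro always_eventually allI ballI conjI)
    fix n i assume i: "i \<in> I"
    show "radon (x n i)" using xE(3) i by (simp add: good_def)
    show "emeasure (x n i) UNIV \<le> ennreal (a i / c0)"
      using xE(1)[of n] xE(3)[of n] i a_pos[OF i] good_sets[OF xE(3) i]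
      by (intro mass_le[OF i]) (auto simp: good_def EAag_def less_imp_le)
  qed
  obtain G lam where G: "G \<le> sequentially" "G \<noteq> bot" and rl: "\<And>i. i \<in> I \<Longrightarrow> radon (lam i)"
    and lim: "\<And>i \<phi>. i \<in> I \<Longrightarrow> \<phi> \<in> Cc \<Longrightarrow> ((\<lambda>n. integral\<^sup>L (x n i) \<phi>) \<longlongrightarrow> integral\<^sup>L (lam i) \<phi>) G"
    using vague_cluster_family[OF lc sequentially_bot ev] by metis
  have wl: "emeasure (lam i) (UNIV - A i) = 0" "wint i (lam i) \<le> ennreal (a i)" if i: "i \<in> I" for i
  proof -
    have "\<forall>\<^sub>F n in G. radon (x n i) \<and> emeasure (x n i) (UNIV - A i) = 0 \<and> wint i (x n i) \<le> ennreal (a i)"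
      using xE(1,3) i by (intro always_eventually allI) (auto simp: good_def EAag_def)
    from weighted_limit_le[OF rl[OF i] closed_A[OF i] g_cont[OF i] G(2) this lim[OF i]]
    show "emeasure (lam i) (UNIV - A i) = 0" "wint i (lam i) \<le> ennreal (a i)" by auto
  qed
  have gl: "good lam" using rl wl by (simp add: good_def)
  have ipP: "0 \<le> ip \<kappa> (msum Ip (x n), msum Ip (x m)) (msum Ip (x n), msum Ip (x m))"
    "0 \<le> ip \<kappa> (msum In (x n), msum In (x m)) (msum In (x n), msum In (x m))" for n m
    using xP by (auto intro!: ip_nonneg simp: E2_def)
  have cP: "\<exists>k. \<forall>n\<ge>k. \<forall>m\<ge>k. ip \<kappa> (msum Ip (x n), msum Ip (x m)) (msum Ip (x n), msum Ip (x m)) < e" if "e > 0" for e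
    using x(3)[OF that] ipP(2) unfolding parts_dist_def by (meson add_le_cancel_left le_add_same_cancel1 le_less_trans)
  have cN: "\<exists>k. \<forall>n\<ge>k. \<forall>m\<ge>k. ip \<kappa> (msum In (x n), msum In (x m)) (msum In (x n), msum In (x m)) < e" if "e > 0" for e
    using x(3)[OF that] ipP(1) unfolding parts_dist_def by (meson le_add_same_cancel2 le_less_trans)
  have sP: "inEp \<kappa> (msum Ip lam)" "\<And>e. e > 0 \<Longrightarrow> \<forall>\<^sub>F n in G. nrm \<kappa> (msum Ip (x n), msum Ip lam) < e"
    using strong_limit[OF _ xE(3) xP(1) gl cP G lim] by auto
  have sN: "inEp \<kappa> (msum In lam)" "\<And>e. e > 0 \<Longrightarrow> \<forall>\<^sub>F n in G. nrm \<kappa> (msum In (x n), msum In lam) < e"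
    using strong_limit[OF _ xE(3) xP(2) gl cN G lim] by auto
  have El: "vec lam" using gl sP sN by (simp add: EA_iff)
  have zl: "E2 (R lam)" by (rule E2_Rm[OF El])
  have "Q (R lam) \<le> f + e" if e: "e > 0" for e
  proof -
    \<comment> \<open>The norms of \<open>R (x n)\<close> plus \<chi> have a common bound, because
      their squares are \<open>F (x n) + ip \<kappa> ch ch\<close> and
      \<open>F (x n) \<le> f + 1\<close>.\<close>
    define N where "N = sqrt (f + 1 + ip \<kappa> ch ch)"
    have Nn: "nrm \<kappa> (padd (R (x n)) ch) \<le> N" for n
      unfolding N_def using Q_eq[OF xE(4)[of n]] Fx[of n] by (intro real_le_rsqrt) (simp add: F_def)
    have N0: "N \<ge> 0" using Nn[of 0] nrm_nonneg[OF E2_padd[OF xE(4)[of 0] E2_ch]] by simp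
    \<comment> \<open>One half of \<open>e\<close> pays for the passage from \<open>x n\<close> to
      \<open>lam\<close>, the other for the excess of \<open>F (x n)\<close> over
      \<open>f\<close>.\<close>
    define q where "q = min 1 (e / (2 * (2 * N + 1)))"
    have q: "q > 0" "q \<le> 1" using e N0 by (auto simp: q_def)
    have "q \<le> e / (2 * (2 * N + 1))" by (simp add: q_def)
    then have qe: "q * (2 * N + 1) \<le> e / 2" using N0 by (simp add: field_simps)
    obtain k where k: "1 / (real k + 1) < e / 2"
      using nat_approx_posE[of "e / 2"] e by (metis Suc_eq_plus1 of_nat_Suc add.commute half_gt_zero)
    have q2: "q / 2 > 0" using q by simp
    have "\<forall>\<^sub>F n in G. n \<ge> k" by (rule filter_leD[OF G(1) eventually_ge_at_top])
    then have "\<forall>\<^sub>F n in G. Q (R lam) \<le> f + e"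
      using sP(2)[OF q2] sN(2)[OF q2]
    proof eventually_elim
      case (elim n)
      let ?z = "R (x n)" and ?w = "R lam"
      let ?d = "padd ?w (pneg ?z)"
      \<comment> \<open>The difference is regrouped by sign into a difference of positive parts and
        one of negative parts, for each of which strong convergence is known.\<close>
      have dz: "?d = padd (pneg (msum Ip (x n), msum Ip lam)) (msum In (x n), msum In lam)"
        by (simp add: padd_def pneg_def Rm_def madd_commute)
      have E: "E2 (msum Ip (x n), msum Ip lam)" "E2 (msum In (x n), msum In lam)"
        using xP sP(1) sN(1) by (auto simp: E2_def)
      have nn: "nrm \<kappa> (pneg u) = nrm \<kappa> u" for u by (simp add: nrm_def ip_pneg_left ip_pneg_right)
      have "nrm \<kappa> ?d \<le> nrm \<kappa> (msum Ip (x n), msum Ip lam) + nrm \<kappa> (msum In (x n), msum In lam)"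
        unfolding dz using nrm_triangle[OF E2_pneg[OF E(1)] E(2)] by (simp add: nn)
      then have dq: "nrm \<kappa> ?d \<le> q" using elim by linarith
      have d0: "0 \<le> nrm \<kappa> ?d" by (intro nrm_nonneg E2_padd zl E2_pneg xE)
      have "2 * nrm \<kappa> (padd ?z ch) * nrm \<kappa> ?d + (nrm \<kappa> ?d)\<^sup>2 = nrm \<kappa> ?d * (2 * nrm \<kappa> (padd ?z ch) + nrm \<kappa> ?d)"
        by (simp add: power2_eq_square algebra_simps)
      also have "\<dots> \<le> q * (2 * N + 1)"
        using dq d0 q Nn[of n] nrm_nonneg[OF E2_padd[OF xE(4)[of n] E2_ch]] by (intro mult_mono) auto
      finally have "Q ?w \<le> Q ?z + e / 2" using Q_le[OF xE(4)[of n] zl] qe by linarith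
      moreover have "Q ?z \<le> f + e / 2"
      proof -
        have "1 / (real n + 1) \<le> 1 / (real k + 1)" using elim by (intro divide_left_mono) auto
        then show ?thesis using x(2)[of n] k by (simp add: F_def)
      qed
      ultimately show ?case by linarith
    qed
    then show ?thesis using eventually_happens'[OF G(2)] by blast
  qed
  then have Qf: "Q (R lam) \<le> f" by (rule field_le_epsilon)
  show ?thesis
  proof (rule that[of lam])
    show "wint l (lam l) \<le> ennreal (a l)" by (rule wl(2)[OF l_in])
    have "bdd_below (F ` C)" by (rule bdd_belowI2[OF low])
    then show "Q (R lam) \<le> Q (R \<nu>)" if "cls I \<nu>" for \<nu>
      using Qf that cInf_lower[of "F \<nu>" "F ` C"] by (auto simp: f_def C_def F_def)
    have "wint i (lam i) = ennreal (a i)" if i: "i \<in> I" "i \<noteq> l" for i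
    proof (rule antisym)
      show "wint i (lam i) \<le> ennreal (a i)" by (rule wl(2)[OF i(1)])
      have gb: "(\<exists>B. \<forall>x\<in>A i. g x \<le> B) \<or> (\<exists>r>1. \<exists>\<nu>. inE \<kappa> \<nu> \<and> nearly_everywhere \<kappa> (A i)
                (\<lambda>x. pot \<kappa> (snd \<nu>) x < \<infinity> \<and> ennreal (g x powr r) + pot \<kappa> (snd \<nu>) x \<le> pot \<kappa> (fst \<nu>) x))"
        using gok i unfolding g_ok_def by blast
      \<comment> \<open>\<kappa> being nonnegative, a component has no more energy than the sum to
        which it belongs; this gives a bound uniform in \<open>n\<close>.\<close>
      have part: "inEp \<kappa> (x n i) \<and> energy (x n i) (x n i) \<le> B" for n
      proof -
        have "\<exists>S\<subseteq>I. i \<in> S \<and> inEp \<kappa> (msum S (x n)) \<and> energy (msum S (x n)) (msum S (x n)) \<le> B"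
        proof (cases "i \<in> Ip")
          case True
          have "energy (msum Ip (x n)) (msum Ip (x n)) \<le> B"
            using xB[of n] enn2real_nonneg[of "kint \<kappa> (msum In (x n)) (msum In (x n))"] unfolding parts_energy_def by linarith
          then show ?thesis using True i xP(1) by (intro exI[of _ Ip]) auto
        next
          case False
          have "energy (msum In (x n)) (msum In (x n)) \<le> B"
            using xB[of n] enn2real_nonneg[of "kint \<kappa> (msum Ip (x n)) (msum Ip (x n))"] unfolding parts_energy_def by linarith
          then show ?thesis using False i xP(2) by (intro exI[of _ In]) auto
        qed
        then obtain S where S: "S \<subseteq> I" "i \<in> S" "inEp \<kappa> (msum S (x n))" "energy (msum S (x n)) (msum S (x n)) \<le> B" by blast
        have r: "radon (msum (S - {i}) (x n))" "radon (x n i)"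
          using good_radon_msum[OF xE(3), of "S - {i}"] S xE(3) i by (auto simp: good_def)
        have eq: "msum S (x n) = madd (msum (S - {i}) (x n)) (x n i)"
          using S good_sets[OF xE(3)] by (intro msum_remove) auto
        note D = inEp_maddD[OF r S(3)[unfolded eq]]
        have "energy (x n i) (x n i) \<le> energy (msum S (x n)) (msum S (x n))"
          unfolding eq using D(3) S(3)[unfolded eq] by (intro enn2real_mono) (auto simp: inEp_def)
        then show ?thesis using D(2) S(4) by auto
      qed
      have "\<forall>\<^sub>F n in G. inEp \<kappa> (x n i) \<and> emeasure (x n i) UNIV < \<infinity> \<and> energy (x n i) (x n i) \<le> B \<and>
          emeasure (x n i) (UNIV - A i) = 0 \<and> wint i (x n i) = ennreal (a i)"
        using filter_leD[OF G(1) ev]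
      proof eventually_elim
        case (elim n)
        then have "emeasure (x n i) UNIV < \<infinity>" using i by (auto intro: le_less_trans)
        then show ?case using part[of n] xE(1)[of n] xE(3)[of n] i by (auto simp: good_def EAag_def)
      qed
      from weighted_limit_ge[OF rl[OF i(1)] closed_A[OF i(1)] g_cont[OF i(1)] g_pos[OF i(1)] cap_fin[OF i] gb G(2) this _ lim[OF i(1)]]
      show "ennreal (a i) \<le> wint i (lam i)" using a_pos[OF i(1)] by simp
    qed
    then show "cls (I - {l}) lam" using El by (auto simp: EAag_def)
  qed
qed

text \<open>If \<open>lam\<close> had too little weight on \<open>A l\<close>,
  \<open>fill_up\<close> would produce members of \<open>cls I\<close> with values arbitrarily close
  to that of \<open>lam\<close>. A solution in \<open>cls I\<close> would then solve the problem
  without the constraint as well and share its component \<open>l\<close>, contrary to its weight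
  \<open>a l\<close>. Conversely, slack in the relaxed minimizer would give it the component of
  \<open>lam\<close>, whose weight is at least \<open>a l\<close>.\<close>

lemma solvable_iff:
  assumes ne: "\<exists>\<mu>. cls I \<mu>" and sol: "minimizes (I - {l}) lam"
  shows "(\<exists>\<mu>. minimizes I \<mu>) \<longleftrightarrow> ennreal (a l) \<le> wint l (lam l)"
proof
  assume "\<exists>\<mu>. minimizes I \<mu>"
  then obtain \<mu> where \<mu>: "cls I \<mu>" "\<And>\<nu>. cls I \<nu> \<Longrightarrow> Q (R \<mu>) \<le> Q (R \<nu>)"
    by (auto simp: solves_iff)
  show "ennreal (a l) \<le> wint l (lam l)"
  proof (rule ccontr)
    assume "\<not> ?thesis"
    then have lt: "wint l (lam l) < ennreal (a l)" by simp
    have lam: "cls (I - {l}) lam" and min: "\<And>\<nu>. cls (I - {l}) \<nu> \<Longrightarrow> Q (R lam) \<le> Q (R \<nu>)"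
      using sol by (auto simp: solves_iff)
    have \<mu>': "cls (I - {l}) \<mu>" using \<mu>(1) by (auto simp: EAag_def)
    have "Q (R \<mu>) \<le> Q (R lam)"
    proof (rule field_le_epsilon)
      fix e :: real assume e: "e > 0"
      obtain \<nu> where "cls I \<nu>" "Q (R \<nu>) \<le> Q (R lam) + e"
        using fill_up[OF lam less_imp_le[OF lt] e] by metis
      then show "Q (R \<mu>) \<le> Q (R lam) + e" using \<mu>(2) order_trans by blast
    qed
    then have "minimizes (I - {l}) \<mu>"
      unfolding solves_iff using \<mu>' min order_trans by blast
    then have "\<mu> l = lam l" by (rule minimizers_agree[OF _ sol]) auto
    moreover have "wint l (\<mu> l) = ennreal (a l)" using \<mu>(1) l_in unfolding EAag_def by blast
    ultimately show False using lt by simp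
  qed
next
  assume le: "ennreal (a l) \<le> wint l (lam l)"
  obtain \<mu> where \<mu>: "cls (I - {l}) \<mu>" "wint l (\<mu> l) \<le> ennreal (a l)"
    "\<And>\<nu>. cls I \<nu> \<Longrightarrow> Q (R \<mu>) \<le> Q (R \<nu>)"
    using relaxed_minimizer[OF ne] by metis
  have "wint l (\<mu> l) = ennreal (a l)"
  proof (rule ccontr)
    assume "wint l (\<mu> l) \<noteq> ennreal (a l)"
    then have lt: "wint l (\<mu> l) < ennreal (a l)" using \<mu>(2) by simp
    have "minimizes (I - {l}) \<mu>" by (rule slack_minimizer_solves[OF \<mu>(1) lt \<mu>(3)])
    then have "\<mu> l = lam l" by (rule minimizers_agree[OF _ sol]) auto
    then show False using lt le by simp
  qed
  then have "cls I \<mu>" using \<mu>(1) by (auto simp: EAag_def)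
  then show "\<exists>\<mu>. minimizes I \<mu>" using \<mu>(3) by (auto simp: solves_iff)
qed

end

theorem theorem7p3:
  fixes \<kappa> :: "'a::t2_space kernel" and h :: real
    and Ip In :: "'i set" and A :: "'i \<Rightarrow> 'a set"
    and ch :: "'a smeasure" and g :: "'a \<Rightarrow> real"
    and a :: "'i \<Rightarrow> real" and l :: 'i and lam :: "'i \<Rightarrow> 'a measure"
  assumes X: "locally_compact_space (euclidean :: 'a topology)" "\<not> compact (UNIV :: 'a set)"
    and K: "kernel_basic \<kappa>" "kernel_spd \<kappa>" "kernel_consistent \<kappa>" "kernel_offdiag \<kappa>"
       "kernel_vanishing \<kappa>" "h \<ge> 1" "kernel_gmp \<kappa> h"
    and cond: "condenser \<kappa> Ip In A"
    and chi: "ext_field \<kappa> Ip In A ch"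
    and g: "g_ok \<kappa> (Ip \<union> In) A g"
    and L: "{i\<in>Ip \<union> In. cap \<kappa> (A i) = \<infinity>} = {l}"
    and ell: "l \<in> In"
    and disj: "\<forall>i\<in>Ip \<union> In. i \<noteq> l \<longrightarrow> A i \<inter> A l = {}"
    and adm: "admissible \<kappa> Ip In A g ch a"
    and sol: "solves \<kappa> Ip In A a g ch (Ip \<union> In - {l}) lam"
  shows "((\<exists>\<mu>. solves \<kappa> Ip In A a g ch (Ip \<union> In) \<mu>) \<longleftrightarrow>
            ennreal (a l) \<le> (\<integral>\<^sup>+ x. ennreal (g x) * indicator (A l) x \<partial>(lam l)))
       \<and> ((\<exists>\<mu>. solves \<kappa> Ip In A a g ch (Ip \<union> In) \<mu>) \<longleftrightarrow>
            ennreal (a l) \<le> (\<integral>\<^sup>+ x. ennreal (g x) * indicator (A l) x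
               \<partial>(proj \<kappa> (A l) (madd (fst ch) (msum Ip lam), madd (snd ch) (msum (In - {l}) lam)))))"
proof -
  interpret condenser_problem \<kappa> Ip In A ch g a l
  proof
    show "cap \<kappa> (A l) = \<infinity>" using L by blast
    show "cap \<kappa> (A i) \<noteq> \<infinity>" if "i \<in> Ip \<union> In" "i \<noteq> l" for i using L that by blast
  qed (use X K cond chi g ell disj adm in \<open>auto simp: admissible_def\<close>)
  have "\<exists>\<mu>. EAag \<kappa> Ip In A a g (Ip \<union> In) \<mu>"
  proof (rule ccontr)
    assume "\<not> ?thesis"
    \<comment> \<open>The infimum over an empty class is infinite, which admissibility
      excludes.\<close>
    then have "Ginf \<kappa> Ip In A a g ch (Ip \<union> In) = \<infinity>" by (simp add: Ginf_def top_ereal_def)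
    then show False using adm by (simp add: admissible_def)
  qed
  from solvable_iff[OF this sol] show ?thesis by (simp only: proj_eq[OF sol] conj_absorb)
qed

end
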